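(* Let $\ell\geq 3$ be an odd integer, let $q=e^{2\pi i/\ell}$, and let $Y_m$, $V_m$, $W_n$ be the $A(SL_q(2))$-comodules defined in the context. Write $m=m_0+\ell m_1$ with integers $0\leq m_0\leq \ell-1$ and $m_1\geq 0$. (a) For $m_1=0$, the comodule $V_{m_0}:=Y_{m_0}$ is irreducible. (a$'$) For every $m_1>0$, the comodule $Y_{\ell-1+\ell m_1}$ (i.e. the case $m_0=\ell-1$) is irreducible as well, and it is isomorphic to $W_{m_1}\otimes V_{\ell-1}$. (b) When $0\leq m_0\leq \ell-2$ and $m_1\geq 1$, the comodule $Y_{m_0+\ell m_1}$ has a (maximal) subcomodule isomorphic to $W_{m_1}\otimes V_{m_0}$, and the quotient comodule of $Y_{m_0+\ell m_1}$ by this subcomodule is irreducible and isomorphic to $W_{m_1-1}\otimes V_{\ell-2-m_0}$.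
   Context: For $q\in\mathbb{C}$, $q\neq 0$, $A(SL_q(2))$ is the unital associative $\mathbb{C}$-algebra generated by $a,b,c,d$ subject to the relations $$ab=q\,ba,\quad ac=q\,ca,\quad bd=q\,db,\quad bc=cb,\quad cd=q\,dc,\quad ad-da=(q-q^{-1})bc,\quad ad-q\,bc=1.$$ It is a Hopf algebra with comultiplication, counit and antipode given on generators by $$\Delta a=a\otimes a+b\otimes c,\quad \Delta b=a\otimes b+b\otimes d,\quad \Delta c=c\otimes a+d\otimes c,\quad \Delta d=c\otimes b+d\otimes d,$$ $$\varepsilon(a)=\varepsilon(d)=1,\quad \varepsilon(b)=\varepsilon(c)=0,\quad S(a)=d,\quad S(b)=-q^{-1}b,\quad S(c)=-q\,c,\quad S(d)=a.$$ Here $q=e^{2\pi i/\ell}$ with $\ell\geq 3$ odd. Corepresentations are left comodules, i.e. vector spaces $U$ over $\mathbb{C}$ with a coaction $U\to A(SL_q(2))\otimes U$. For $m\in\mathbb{N}=\{0,1,2,\dots\}$, $Y_m$ is the linear span in $A(SL_q(2))$ of the monomials $a^m,a^{m-1}c,\dots,c^m$, with coaction the restriction of $\Delta$, $\Delta: Y_m\to A(SL_q(2))\otimes Y_m$. For $m\in\{0,1,\dots,\ell-1\}$ one writes $V_m:=Y_m$. For $n\in\mathbb{N}$, $W_n$ is the linear span of $\alpha^n,\alpha^{n-1}\gamma,\dots,\gamma^n$, where $\alpha=a^\ell$ and $\gamma=c^\ell$, with coaction the restriction of $\Delta$, $\Delta: W_n\to A(SL_q(2))\otimes W_n$. The tensor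 product of two comodules carries the usual coaction defined by means of the multiplication of $A(SL_q(2))$. A comodule is irreducible if it is nonzero and has no subcomodules other than $0$ and itself. *)

theory Defs
  imports Complex_Main "HOL-Algebra.Algebra" "HOL-Library.Poly_Mapping"
begin

text \<open>
  Complex vector spaces are modules over \<open>CC\<close> in the sense of HOL-Algebra, with explicit
  carriers.  The record type of modules extends that of rings, so the same records also serve as
  unital associative algebras; for spaces that are not algebras the fields for the multiplication
  and the unit carry no meaning and are never used.
\<close>

definition CC :: "(complex, complex) module" where
  "CC = \<lparr>carrier = UNIV, monoid.mult = (*), one = 1, ring.zero = 0, add = (+), smult = (*)\<rparr>"

definition linear_maps ::
  "(complex, 'u, 'x) module_scheme \<Rightarrow> (complex, 'v, 'y) module_scheme \<Rightarrow> ('u \<Rightarrow> 'v) set" where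
  "linear_maps U V = {f \<in> carrier U \<rightarrow> carrier V.
     (\<forall>x\<in>carrier U. \<forall>y\<in>carrier U. f (x \<oplus>\<^bsub>U\<^esub> y) = f x \<oplus>\<^bsub>V\<^esub> f y) \<and>
     (\<forall>z. \<forall>x\<in>carrier U. f (z \<odot>\<^bsub>U\<^esub> x) = z \<odot>\<^bsub>V\<^esub> f x)}"

definition lin_span :: "(complex, 'u, 'x) module_scheme \<Rightarrow> 'u set \<Rightarrow> 'u set" where
  "lin_span U S = \<Inter>{N. submodule N CC U \<and> S \<subseteq> N}"

text \<open>
  The quotient by a subspace \<open>N\<close>; if \<open>U\<close> is an algebra and \<open>N\<close> a two-sided ideal, this is the
  quotient algebra \<open>U Quot N\<close>.
\<close>

definition quot :: "(complex, 'u, 'x) module_scheme \<Rightarrow> 'u set \<Rightarrow> (complex, 'u set) module" where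
  "quot U N = ring.extend (U Quot N)
     (module.fields (\<lambda>z S. \<Union>x\<in>S. N +>\<^bsub>U\<^esub> (z \<odot>\<^bsub>U\<^esub> x)))"

text \<open>
  The vector space with basis \<open>carrier G\<close>, its elements being formal linear combinations, with the
  multiplication that extends the one of \<open>G\<close> bilinearly (the monoid algebra if \<open>G\<close> is a monoid).
\<close>

definition monoid_algebra :: "('s, 'x) monoid_scheme \<Rightarrow> (complex, 's \<Rightarrow>\<^sub>0 complex) module" where
  "monoid_algebra G =
    \<lparr>carrier = {f. Poly_Mapping.keys f \<subseteq> carrier G},
     monoid.mult = (\<lambda>f g. \<Sum>x\<in>Poly_Mapping.keys f. \<Sum>y\<in>Poly_Mapping.keys g.
               Poly_Mapping.single (x \<otimes>\<^bsub>G\<^esub> y) (Poly_Mapping.lookup f x * Poly_Mapping.lookup g y)),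
     one = Poly_Mapping.single \<one>\<^bsub>G\<^esub> 1,
     ring.zero = 0,
     add = (+),
     smult = (\<lambda>z. Poly_Mapping.map (\<lambda>w. z * w))\<rparr>"

text \<open>
  For a quotient of a space of formal linear combinations and a map \<open>h\<close> on the basis, the induced
  linear map to \<open>P\<close>.  The value on a class is the common value of the linear extension of \<open>h\<close> on
  all representatives, so this is meaningful only where the extension factors through the quotient.
\<close>

definition induced ::
  "(complex, 'p, 'x) module_scheme \<Rightarrow> ('s \<Rightarrow> 'p) \<Rightarrow> ('s \<Rightarrow>\<^sub>0 complex) set \<Rightarrow> 'p" where
  "induced P h S = (THE y. \<forall>f\<in>S.
     y = (\<Oplus>\<^bsub>P\<^esub>k\<in>Poly_Mapping.keys f. Poly_Mapping.lookup f k \<odot>\<^bsub>P\<^esub> h k))"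


section \<open>Tensor products\<close>

definition bilinear_rels ::
  "(complex, 'u, 'x) module_scheme \<Rightarrow> (complex, 'v, 'y) module_scheme
    \<Rightarrow> ('u \<times> 'v \<Rightarrow>\<^sub>0 complex) set" where
  "bilinear_rels U V =
     {Poly_Mapping.single (x \<oplus>\<^bsub>U\<^esub> x', y) 1 - Poly_Mapping.single (x, y) 1
        - Poly_Mapping.single (x', y) 1
      | x x' y. x \<in> carrier U \<and> x' \<in> carrier U \<and> y \<in> carrier V} \<union>
     {Poly_Mapping.single (x, y \<oplus>\<^bsub>V\<^esub> y') 1 - Poly_Mapping.single (x, y) 1
        - Poly_Mapping.single (x, y') 1
      | x y y'. x \<in> carrier U \<and> y \<in> carrier V \<and> y' \<in> carrier V} \<union>
     {Poly_Mapping.single (z \<odot>\<^bsub>U\<^esub> x, y) 1 - Poly_Mapping.single (x, y) z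
      | z x y. x \<in> carrier U \<and> y \<in> carrier V} \<union>
     {Poly_Mapping.single (x, z \<odot>\<^bsub>V\<^esub> y) 1 - Poly_Mapping.single (x, y) z
      | z x y. x \<in> carrier U \<and> y \<in> carrier V}"

definition tensor_null ::
  "(complex, 'u, 'x) module_scheme \<Rightarrow> (complex, 'v, 'y) module_scheme
    \<Rightarrow> ('u \<times> 'v \<Rightarrow>\<^sub>0 complex) set" where
  "tensor_null U V = lin_span (monoid_algebra (U \<times>\<times> V)) (bilinear_rels U V)"

text \<open>
  If \<open>U\<close> and \<open>V\<close> are algebras, the multiplication inherited from \<open>U \<times>\<times> V\<close> makes this the tensor
  product algebra.
\<close>

definition tensor ::
  "(complex, 'u, 'x) module_scheme \<Rightarrow> (complex, 'v, 'y) module_scheme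
    \<Rightarrow> (complex, ('u \<times> 'v \<Rightarrow>\<^sub>0 complex) set) module" where
  "tensor U V = quot (monoid_algebra (U \<times>\<times> V)) (tensor_null U V)"

definition pure ::
  "(complex, 'u, 'x) module_scheme \<Rightarrow> (complex, 'v, 'y) module_scheme
    \<Rightarrow> 'u \<Rightarrow> 'v \<Rightarrow> ('u \<times> 'v \<Rightarrow>\<^sub>0 complex) set" where
  "pure U V x y =
     tensor_null U V +>\<^bsub>monoid_algebra (U \<times>\<times> V)\<^esub> Poly_Mapping.single (x, y) 1"

text \<open>\<open>f \<otimes> g\<close> as a map into \<open>tensor U V\<close>; the source is determined by the argument.\<close>

definition tensor_map ::
  "(complex, 'u, 'x) module_scheme \<Rightarrow> (complex, 'v, 'y) module_scheme
    \<Rightarrow> ('s \<Rightarrow> 'u) \<Rightarrow> ('t \<Rightarrow> 'v) \<Rightarrow> ('s \<times> 't \<Rightarrow>\<^sub>0 complex) set \<Rightarrow> ('u \<times> 'v \<Rightarrow>\<^sub>0 complex) set" where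
  "tensor_map U V f g = induced (tensor U V) (\<lambda>(x, y). pure U V (f x) (g y))"

text \<open>The canonical map from \<open>(U \<otimes> V) \<otimes> W\<close> to \<open>U \<otimes> (V \<otimes> W)\<close>.\<close>

definition tensor_assoc ::
  "(complex, 'u, 'x) module_scheme \<Rightarrow> (complex, 'v, 'y) module_scheme
    \<Rightarrow> (complex, 'w, 'z) module_scheme
    \<Rightarrow> (('u \<times> 'v \<Rightarrow>\<^sub>0 complex) set \<times> 'w \<Rightarrow>\<^sub>0 complex) set
    \<Rightarrow> ('u \<times> ('v \<times> 'w \<Rightarrow>\<^sub>0 complex) set \<Rightarrow>\<^sub>0 complex) set" where
  "tensor_assoc U V W =
     induced (tensor U (tensor V W)) (\<lambda>(t, z).
       induced (tensor U (tensor V W)) (\<lambda>(x, y). pure U (tensor V W) x (pure V W y z)) t)"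


section \<open>Left comodules\<close>

record 'h bialgebra = "(complex, 'h) module" +
  comult :: "'h \<Rightarrow> ('h \<times> 'h \<Rightarrow>\<^sub>0 complex) set"
  counit :: "'h \<Rightarrow> complex"

record ('h, 'u) comodule = "(complex, 'u) module" +
  coact :: "'u \<Rightarrow> ('h \<times> 'u \<Rightarrow>\<^sub>0 complex) set"

definition left_comodule :: "'h bialgebra \<Rightarrow> ('h, 'u) comodule \<Rightarrow> bool" where
  "left_comodule H U \<longleftrightarrow>
     module CC U \<and>
     coact U \<in> linear_maps U (tensor H U) \<and>
     (\<forall>u\<in>carrier U.
        tensor_assoc H H U (tensor_map (tensor H H) U (comult H) id (coact U u)) =
        tensor_map H (tensor H U) id (coact U) (coact U u)) \<and>
     (\<forall>u\<in>carrier U. induced U (\<lambda>(x, v). counit H x \<odot>\<^bsub>U\<^esub> v) (coact U u) = u)"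

definition comodule_hom ::
  "'h bialgebra \<Rightarrow> ('h, 'u) comodule \<Rightarrow> ('h, 'v) comodule \<Rightarrow> ('u \<Rightarrow> 'v) \<Rightarrow> bool" where
  "comodule_hom H U V f \<longleftrightarrow>
     left_comodule H U \<and> left_comodule H V \<and> f \<in> linear_maps U V \<and>
     (\<forall>u\<in>carrier U. coact V (f u) = tensor_map H V id f (coact U u))"

definition comodule_iso ::
  "'h bialgebra \<Rightarrow> ('h, 'u) comodule \<Rightarrow> ('h, 'v) comodule \<Rightarrow> bool" where
  "comodule_iso H U V \<longleftrightarrow> (\<exists>f. comodule_hom H U V f \<and> bij_betw f (carrier U) (carrier V))"

text \<open>
  For a subspace \<open>N\<close> of \<open>U\<close>, the space \<open>H \<otimes> N\<close> consists of classes of formal combinations of pairs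
  from \<open>H \<times> N\<close> and is not literally a subset of \<open>H \<otimes> U\<close>; the two are related by the (injective)
  map induced by the inclusion, which is \<open>tensor_map H U id id\<close>.
\<close>

definition subcomodule :: "'h bialgebra \<Rightarrow> ('h, 'u) comodule \<Rightarrow> 'u set \<Rightarrow> bool" where
  "subcomodule H U N \<longleftrightarrow>
     left_comodule H U \<and> submodule N CC U \<and>
     coact U ` N \<subseteq> tensor_map H U id id ` carrier (tensor H (U\<lparr>carrier := N\<rparr>))"

definition restrict_comodule ::
  "'h bialgebra \<Rightarrow> ('h, 'u) comodule \<Rightarrow> 'u set \<Rightarrow> ('h, 'u) comodule" where
  "restrict_comodule H U N = U\<lparr>carrier := N,
     coact := (\<lambda>u. THE t. t \<in> carrier (tensor H (U\<lparr>carrier := N\<rparr>)) \<and>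
                          tensor_map H U id id t = coact U u)\<rparr>"

definition quotient_comodule ::
  "'h bialgebra \<Rightarrow> ('h, 'u) comodule \<Rightarrow> 'u set \<Rightarrow> ('h, 'u set) comodule" where
  "quotient_comodule H U N = module.extend (quot U N) (comodule.fields
     (\<lambda>S. THE t. \<forall>x\<in>S. t = tensor_map H (quot U N) id (\<lambda>u. N +>\<^bsub>U\<^esub> u) (coact U x)))"

definition maximal_subcomodule :: "'h bialgebra \<Rightarrow> ('h, 'u) comodule \<Rightarrow> 'u set \<Rightarrow> bool" where
  "maximal_subcomodule H U N \<longleftrightarrow>
     subcomodule H U N \<and> N \<noteq> carrier U \<and>
     (\<forall>M. subcomodule H U M \<and> N \<subseteq> M \<longrightarrow> M = N \<or> M = carrier U)"

definition irreducible_comodule :: "'h bialgebra \<Rightarrow> ('h, 'u) comodule \<Rightarrow> bool" where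
  "irreducible_comodule H U \<longleftrightarrow>
     left_comodule H U \<and> carrier U \<noteq> {\<zero>\<^bsub>U\<^esub>} \<and>
     (\<forall>N. subcomodule H U N \<longrightarrow> N = {\<zero>\<^bsub>U\<^esub>} \<or> N = carrier U)"

text \<open>
  The coaction of a tensor product sends \<open>u \<otimes> v\<close> to the sum of the \<open>x y \<otimes> (u' \<otimes> v')\<close> over the
  terms \<open>x \<otimes> u'\<close> of \<open>coact U u\<close> and \<open>y \<otimes> v'\<close> of \<open>coact V v\<close>.
\<close>

definition tensor_comodule ::
  "'h bialgebra \<Rightarrow> ('h, 'u) comodule \<Rightarrow> ('h, 'v) comodule
    \<Rightarrow> ('h, ('u \<times> 'v \<Rightarrow>\<^sub>0 complex) set) comodule" where
  "tensor_comodule H U V = module.extend (tensor U V) (comodule.fields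
     (induced (tensor H (tensor U V)) (\<lambda>(u, v).
        induced (tensor H (tensor U V)) (\<lambda>(x, u').
          induced (tensor H (tensor U V)) (\<lambda>(y, v').
            pure H (tensor U V) (x \<otimes>\<^bsub>H\<^esub> y) (pure U V u' v'))
          (coact V v)) (coact U u))))"

definition regular_comodule :: "'h bialgebra \<Rightarrow> ('h, 'h) comodule" where
  "regular_comodule H = module.extend (module.truncate H) (comodule.fields (comult H))"


section \<open>The quantum group $SL_q(2)$\<close>

datatype gen = GA | GB | GC | GD

definition free_algebra :: "(complex, gen list \<Rightarrow>\<^sub>0 complex) module" where
  "free_algebra = monoid_algebra \<lparr>carrier = UNIV, monoid.mult = (@), one = []\<rparr>"

definition slq2_rels :: "complex \<Rightarrow> (gen list \<Rightarrow>\<^sub>0 complex) set" where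
  "slq2_rels q =
    {Poly_Mapping.single [GA, GB] 1 - Poly_Mapping.single [GB, GA] q,
     Poly_Mapping.single [GA, GC] 1 - Poly_Mapping.single [GC, GA] q,
     Poly_Mapping.single [GB, GD] 1 - Poly_Mapping.single [GD, GB] q,
     Poly_Mapping.single [GB, GC] 1 - Poly_Mapping.single [GC, GB] 1,
     Poly_Mapping.single [GC, GD] 1 - Poly_Mapping.single [GD, GC] q,
     Poly_Mapping.single [GA, GD] 1 - Poly_Mapping.single [GD, GA] 1
       - Poly_Mapping.single [GB, GC] (q - inverse q),
     Poly_Mapping.single [GA, GD] 1 - Poly_Mapping.single [GB, GC] q
       - Poly_Mapping.single [] 1}"

definition slq2_ideal :: "complex \<Rightarrow> (gen list \<Rightarrow>\<^sub>0 complex) set" where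
  "slq2_ideal q = Idl\<^bsub>free_algebra\<^esub> (slq2_rels q)"

definition slq2_algebra :: "complex \<Rightarrow> (complex, (gen list \<Rightarrow>\<^sub>0 complex) set) module" where
  "slq2_algebra q = quot free_algebra (slq2_ideal q)"

definition slq2_gen :: "complex \<Rightarrow> gen \<Rightarrow> (gen list \<Rightarrow>\<^sub>0 complex) set" where
  "slq2_gen q g = slq2_ideal q +>\<^bsub>free_algebra\<^esub> Poly_Mapping.single [g] 1"

text \<open>
  The algebra homomorphism from an algebra presented by the generators \<open>gen\<close> to an algebra \<open>B\<close>
  with prescribed values on the generators.
\<close>

definition algebra_map ::
  "(complex, 'b, 'x) module_scheme \<Rightarrow> (gen \<Rightarrow> 'b) \<Rightarrow> (gen list \<Rightarrow>\<^sub>0 complex) set \<Rightarrow> 'b" where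
  "algebra_map B h = induced B (\<lambda>w. foldr (\<lambda>g t. h g \<otimes>\<^bsub>B\<^esub> t) w \<one>\<^bsub>B\<^esub>)"

definition slq2_comult_gen ::
  "complex \<Rightarrow> gen
    \<Rightarrow> ((gen list \<Rightarrow>\<^sub>0 complex) set \<times> (gen list \<Rightarrow>\<^sub>0 complex) set \<Rightarrow>\<^sub>0 complex) set" where
  "slq2_comult_gen q g =
    (let A = slq2_algebra q; T = tensor A A; p = pure A A;
         a = slq2_gen q GA; b = slq2_gen q GB; c = slq2_gen q GC; d = slq2_gen q GD
     in case g of
          GA \<Rightarrow> p a a \<oplus>\<^bsub>T\<^esub> p b c
        | GB \<Rightarrow> p a b \<oplus>\<^bsub>T\<^esub> p b d
        | GC \<Rightarrow> p c a \<oplus>\<^bsub>T\<^esub> p d c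
        | GD \<Rightarrow> p c b \<oplus>\<^bsub>T\<^esub> p d d)"

definition slq2_counit_gen :: "gen \<Rightarrow> complex" where
  "slq2_counit_gen g = (case g of GA \<Rightarrow> 1 | GB \<Rightarrow> 0 | GC \<Rightarrow> 0 | GD \<Rightarrow> 1)"

text \<open>The antipode plays no role for comodules and is omitted.\<close>

definition slq2 :: "complex \<Rightarrow> (gen list \<Rightarrow>\<^sub>0 complex) set bialgebra" where
  "slq2 q = module.extend (slq2_algebra q) (bialgebra.fields
     (algebra_map (tensor (slq2_algebra q) (slq2_algebra q)) (slq2_comult_gen q))
     (algebra_map CC slq2_counit_gen))"


section \<open>The comodules $Y_m$, $V_m$ and $W_n$\<close>

type_synonym slq2_comodule =
  "((gen list \<Rightarrow>\<^sub>0 complex) set, (gen list \<Rightarrow>\<^sub>0 complex) set) comodule"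

definition monomial_comodule ::
  "complex \<Rightarrow> (gen list \<Rightarrow>\<^sub>0 complex) set \<Rightarrow> (gen list \<Rightarrow>\<^sub>0 complex) set \<Rightarrow> nat \<Rightarrow> slq2_comodule" where
  "monomial_comodule q x y n =
     restrict_comodule (slq2 q) (regular_comodule (slq2 q))
       (lin_span (slq2 q)
         {(x [^]\<^bsub>slq2 q\<^esub> (n - k)) \<otimes>\<^bsub>slq2 q\<^esub> (y [^]\<^bsub>slq2 q\<^esub> k) | k. k \<le> n})"

definition comod_Y :: "complex \<Rightarrow> nat \<Rightarrow> slq2_comodule" where
  "comod_Y q m = monomial_comodule q (slq2_gen q GA) (slq2_gen q GC) m"

text \<open>\<open>comod_V q m\<close> is only used for \<open>m < l\<close>.\<close>

abbreviation (input) comod_V :: "complex \<Rightarrow> nat \<Rightarrow> slq2_comodule" where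
  "comod_V q m \<equiv> comod_Y q m"

definition comod_W :: "nat \<Rightarrow> complex \<Rightarrow> nat \<Rightarrow> slq2_comodule" where
  "comod_W l q n = monomial_comodule q
     (slq2_gen q GA [^]\<^bsub>slq2 q\<^esub> l) (slq2_gen q GC [^]\<^bsub>slq2 q\<^esub> l) n"

end

theory Submission
  imports Defs
begin

text \<open>
  A comodule is described by the matrix of its coaction in a basis; two comodules with the same
  matrix are isomorphic, and a block of zeros yields a subcomodule and a quotient whose matrices are
  diagonal blocks. By the \<open>q\<close>-binomial theorem (with \<open>q\<^bsup>-2\<^esup>\<close>, resp. \<open>1\<close>, as parameter) the
  matrices of \<open>Y\<^sub>m\<close> and \<open>W\<^sub>n\<close> are explicit, and the multiplicativity of \<open>\<Delta>\<close> applied to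
  \<open>a\<^bsup>ln+r-lj-k\<^esup> c\<^bsup>lj+k\<^esup> = (\<alpha>\<^bsup>n-j\<^esup> \<gamma>\<^bsup>j\<^esup>) (a\<^bsup>r-k\<^esup> c\<^bsup>k\<^esup>)\<close> factors the blocks
  of the matrix of \<open>Y\<close> with index \<open>ln + r\<close>. For \<open>r = m\<^sub>0 < l\<close> this gives the subcomodule \<open>W \<otimes> V\<close>. For
  the quotient take \<open>r = l + m\<^sub>0\<close>, which leaves the middle block, with indices \<open>m\<^sub>0 < i < l\<close>, of the
  matrix of \<open>Y\<close> with index \<open>l + m\<^sub>0\<close>: its first column is, up to nonzero scalars, the basis of the
  comodule \<open>V\<close> with index \<open>l - 2 - m\<^sub>0\<close>, because the remaining sum is the expansion of a power of the
  quantum determinant \<open>1\<close>, and coassociativity then determines the whole block.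

  For irreducibility two representations of the algebra on sequences are used, in which \<open>b\<close>, resp.
  \<open>c\<close>, acts by \<open>0\<close> and the other one by a shift. They yield functionals that send every nonzero vector
  to a multiple of the first basis vector and the first basis vector to any other one.
\<close>

section \<open>Complex vector spaces\<close>

text \<open>No basis of the algebra is constructed. Linear independence and nonvanishing come from
  degrees in the two shift representations: a word in a, d and the shifting generator sends a point
  mass to a nonzero multiple of one point mass, so nothing cancels, and different degrees are
  separated by matrix coefficients. The binomial parameter for Y is q^(-2), because each of the two
  tensor factors contributes one q^(-1). Since l is odd, its order is exactly l. The middle
  binomials of order l then vanish, so that l-th powers comultiply like classical matrix entries,
  while the binomials of order below l do not vanish, which is what irreducibility needs. Passing
  from l n + m0 to l (n - 1) + (l + m0) makes the pair (j, k) with index l j + k ambiguous, since k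
  may exceed l. For an index whose remainder mod l lies strictly between m0 and l the pair stays
  unique, and these are the indices of the quotient. The scalars of the first column of the middle
  block come from two identities: the reflection of a binomial with upper index l - 1 - k, where l
  counts as 0 in exponents, and trinomial revision.\<close>

abbreviation vspace :: "(complex, 'm, 'x) module_scheme \<Rightarrow> bool" where
  "vspace \<equiv> module CC"

lemma CC_simps [simp]:
  "carrier CC = UNIV" "x \<otimes>\<^bsub>CC\<^esub> y = x * y" "\<one>\<^bsub>CC\<^esub> = 1" "\<zero>\<^bsub>CC\<^esub> = 0"
  "x \<oplus>\<^bsub>CC\<^esub> y = x + y" "z \<odot>\<^bsub>CC\<^esub> x = z * x"
  by (simp_all add: CC_def)

lemma CC_cring: "cring CC"
proof (rule cringI)
  show "abelian_group CC"
  proof (rule abelian_groupI)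
    show "\<exists>y\<in>carrier CC. y \<oplus>\<^bsub>CC\<^esub> x = \<zero>\<^bsub>CC\<^esub>" for x
      by (rule bexI[of _ "- x"]) auto
  qed auto
  show "comm_monoid CC"
    by (rule comm_monoidI) auto
qed (auto simp: algebra_simps)

lemma vspace_CC [simp]: "vspace CC"
proof (rule moduleI)
  show "cring CC" by (rule CC_cring)
  then show "abelian_group CC" by (simp add: cring_def ring_def)
qed (auto simp: algebra_simps)

context
  fixes M :: "(complex, 'm, 'x) module_scheme" (structure)
  assumes M: "vspace M"
begin

interpretation module CC M by (rule M)

lemma vs_abelian_group: "abelian_group M" ..

lemma vs_closed [simp]:
  "\<zero> \<in> carrier M"
  "x \<in> carrier M \<Longrightarrow> y \<in> carrier M \<Longrightarrow> x \<oplus> y \<in> carrier M"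
  "x \<in> carrier M \<Longrightarrow> z \<odot> x \<in> carrier M"
  "x \<in> carrier M \<Longrightarrow> \<ominus> x \<in> carrier M"
  by auto

lemma vs_zero [simp]:
  "x \<in> carrier M \<Longrightarrow> \<zero> \<oplus> x = x"
  "x \<in> carrier M \<Longrightarrow> x \<oplus> \<zero> = x"
  "x \<in> carrier M \<Longrightarrow> 0 \<odot> x = \<zero>"
  "z \<odot> \<zero> = \<zero>"
  "x \<in> carrier M \<Longrightarrow> 1 \<odot> x = x"
  using smult_l_null smult_r_null smult_one by auto

lemma vs_ac:
  "x \<in> carrier M \<Longrightarrow> y \<in> carrier M \<Longrightarrow> z \<in> carrier M \<Longrightarrow> (x \<oplus> y) \<oplus> z = x \<oplus> (y \<oplus> z)"
  "x \<in> carrier M \<Longrightarrow> y \<in> carrier M \<Longrightarrow> x \<oplus> y = y \<oplus> x"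
  "x \<in> carrier M \<Longrightarrow> y \<in> carrier M \<Longrightarrow> z \<in> carrier M \<Longrightarrow> x \<oplus> (y \<oplus> z) = y \<oplus> (x \<oplus> z)"
  by (auto simp: a_ac)

lemma vs_add_smult: "x \<in> carrier M \<Longrightarrow> (z + w) \<odot> x = z \<odot> x \<oplus> w \<odot> x"
  using smult_l_distr[of z w x] by simp

lemma vs_smult_add: "x \<in> carrier M \<Longrightarrow> y \<in> carrier M \<Longrightarrow> z \<odot> (x \<oplus> y) = z \<odot> x \<oplus> z \<odot> y"
  using smult_r_distr[of z x y] by simp

lemma vs_smult_smult: "x \<in> carrier M \<Longrightarrow> z \<odot> (w \<odot> x) = (z * w) \<odot> x"
  using smult_assoc1[of z w x] by simp

lemma vs_uminus: "x \<in> carrier M \<Longrightarrow> \<ominus> x = (- 1) \<odot> x"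
proof -
  assume x: "x \<in> carrier M"
  have "(- 1) \<odot> x \<oplus> x = (- 1 + 1) \<odot> x"
    unfolding vs_add_smult[OF x] using x by simp
  then have "(- 1) \<odot> x \<oplus> x = \<zero>" using x by simp
  then show ?thesis
    using x by (metis minus_equality vs_closed(3))
qed

text \<open>Linear maps are only known to respect sums and scalars, so differences are written with
  the scalar -1.\<close>

lemma vs_diff_eq_zero: "x \<in> carrier M \<Longrightarrow> y \<in> carrier M \<Longrightarrow> x \<oplus> (- 1) \<odot> y = \<zero> \<longleftrightarrow> x = y"
  using vs_uminus[of y] r_neg[of y] by (metis add.inv_closed add.inv_equality minus_minus vs_ac(2))

lemma vs_finsum_closed [simp]: "(\<And>i. i \<in> A \<Longrightarrow> f i \<in> carrier M) \<Longrightarrow> finsum M f A \<in> carrier M"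
  by (rule finsum_closed) auto

lemma vs_finsum_cong:
  assumes "A = B" "\<And>i. i \<in> B \<Longrightarrow> f i = g i" "\<And>i. i \<in> B \<Longrightarrow> g i \<in> carrier M"
  shows "finsum M f A = finsum M g B"
  using assms by (intro finsum_cong') auto

lemma vs_finsum_empty [simp]: "finsum M f {} = \<zero>"
  by simp

lemma vs_finsum_insert [simp]:
  assumes "finite A" "a \<notin> A" "f a \<in> carrier M" "\<And>i. i \<in> A \<Longrightarrow> f i \<in> carrier M"
  shows "finsum M f (insert a A) = f a \<oplus> finsum M f A"
  using assms by (intro finsum_insert) auto

lemma vs_finsum_singleton [simp]: "f a \<in> carrier M \<Longrightarrow> finsum M f {a} = f a"
  using vs_finsum_insert[of "{}" a f] by simp

lemma vs_finsum_zero: "(\<And>i. i \<in> A \<Longrightarrow> f i = \<zero>) \<Longrightarrow> finsum M f A = \<zero>"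
  by (rule add.finprod_one_eqI) auto

lemma vs_finsum_add:
  assumes "\<And>i. i \<in> A \<Longrightarrow> f i \<in> carrier M" "\<And>i. i \<in> A \<Longrightarrow> g i \<in> carrier M"
  shows "finsum M (\<lambda>i. f i \<oplus> g i) A = finsum M f A \<oplus> finsum M g A"
  using assms by (intro finsum_addf) auto

lemma vs_finsum_smult:
  assumes "\<And>i. i \<in> A \<Longrightarrow> f i \<in> carrier M"
  shows "finsum M (\<lambda>i. z \<odot> f i) A = z \<odot> finsum M f A"
proof (cases "finite A")
  case True
  then show ?thesis
    using assms finsum_smult_ldistr[of A z f] by auto
next
  case False
  \<comment> \<open>Over an infinite index set both sums are zero by convention.\<close>
  then show ?thesis by (simp add: finsum_infinite)
qed

lemma vs_finsum_neutral:
  assumes "finite A" "B \<subseteq> A" "\<And>i. i \<in> A \<Longrightarrow> i \<notin> B \<Longrightarrow> f i = \<zero>" "\<And>i. i \<in> B \<Longrightarrow> f i \<in> carrier M"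
  shows "finsum M f A = finsum M f B"
proof (rule add.finprod_mono_neutral_cong_left[symmetric])
  show "f \<in> A \<rightarrow> carrier M"
    using assms(3,4) by (metis Pi_I vs_closed(1))
qed (use assms in auto)

lemma vs_finsum_single:
  assumes "finite A" "a \<in> A" "\<And>i. i \<in> A \<Longrightarrow> i \<noteq> a \<Longrightarrow> f i = \<zero>" "f a \<in> carrier M"
  shows "finsum M f A = f a"
  using vs_finsum_neutral[of A "{a}" f] assms by simp

lemma vs_finsum_swap:
  assumes "\<And>i j. i \<in> A \<Longrightarrow> j \<in> B \<Longrightarrow> f i j \<in> carrier M" "finite A" "finite B"
  shows "finsum M (\<lambda>i. finsum M (\<lambda>j. f i j) B) A = finsum M (\<lambda>j. finsum M (\<lambda>i. f i j) A) B"
  using \<open>finite A\<close> assms(1)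
proof (induction A)
  case empty
  then show ?case using assms by (simp add: vs_finsum_zero)
next
  case (insert a A)
  then have "finsum M (\<lambda>i. finsum M (\<lambda>j. f i j) B) (insert a A)
    = finsum M (\<lambda>j. f a j) B \<oplus> finsum M (\<lambda>j. finsum M (\<lambda>i. f i j) A) B"
    by simp
  also have "\<dots> = finsum M (\<lambda>j. f a j \<oplus> finsum M (\<lambda>i. f i j) A) B"
    using insert by (simp add: vs_finsum_add)
  also have "\<dots> = finsum M (\<lambda>j. finsum M (\<lambda>i. f i j) (insert a A)) B"
    using insert by (intro vs_finsum_cong) auto
  finally show ?case .
qed

lemma vs_finsum_Times:
  assumes "\<And>i j. i \<in> A \<Longrightarrow> j \<in> B \<Longrightarrow> f i j \<in> carrier M" "finite A" "finite B"
  shows "finsum M (\<lambda>i. finsum M (\<lambda>j. f i j) B) A = finsum M (\<lambda>(i, j). f i j) (A \<times> B)"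
  using \<open>finite A\<close> assms(1)
proof (induction A)
  case empty
  then show ?case by simp
next
  case (insert a A)
  have "insert a A \<times> B = (Pair a ` B) \<union> A \<times> B" by auto
  moreover have "finsum M (\<lambda>(i, j). f i j) ((Pair a ` B) \<union> A \<times> B)
    = finsum M (\<lambda>(i, j). f i j) (Pair a ` B) \<oplus> finsum M (\<lambda>(i, j). f i j) (A \<times> B)"
    by (intro finsum_Un_disjoint) (use insert assms in \<open>auto simp: Pi_iff\<close>)
  moreover have "finsum M (\<lambda>(i, j). f i j) (Pair a ` B) = finsum M (\<lambda>j. f a j) B"
    using finsum_reindex[of "\<lambda>(i, j). f i j" "Pair a" B] insert by (auto simp: inj_on_def Pi_iff)
  ultimately show ?case using insert by simp
qed

lemma vs_finsum_reindex:
  assumes "inj_on h A" "\<And>i. i \<in> A \<Longrightarrow> f (h i) \<in> carrier M"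
  shows "finsum M f (h ` A) = finsum M (\<lambda>i. f (h i)) A"
  using assms by (intro finsum_reindex) auto

lemma vs_finsum_Suc:
  assumes "\<And>i. i \<le> Suc n \<Longrightarrow> f i \<in> carrier M"
  shows "finsum M f {..Suc n} = finsum M f {..n} \<oplus> f (Suc n)"
    and "finsum M f {..Suc n} = finsum M (\<lambda>i. f (Suc i)) {..n} \<oplus> f 0"
proof -
  show "finsum M f {..Suc n} = finsum M f {..n} \<oplus> f (Suc n)"
    by (subst finsum_Suc) (use assms vs_ac in auto)
  show "finsum M f {..Suc n} = finsum M (\<lambda>i. f (Suc i)) {..n} \<oplus> f 0"
    by (rule finsum_Suc2) (use assms in auto)
qed

end

lemma finsum_CC [simp]: "finsum CC f A = sum f A"
proof (induction A rule: infinite_finite_induct)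
  case (infinite A)
  then show ?case
    using abelian_monoid.finsum_infinite[of CC A f] vspace_CC
    by (simp add: module_def abelian_group_def)
qed auto


subsection \<open>Linear maps\<close>

lemma linear_mapsI:
  assumes "\<And>x. x \<in> carrier U \<Longrightarrow> f x \<in> carrier V"
    "\<And>x y. x \<in> carrier U \<Longrightarrow> y \<in> carrier U \<Longrightarrow> f (x \<oplus>\<^bsub>U\<^esub> y) = f x \<oplus>\<^bsub>V\<^esub> f y"
    "\<And>z x. x \<in> carrier U \<Longrightarrow> f (z \<odot>\<^bsub>U\<^esub> x) = z \<odot>\<^bsub>V\<^esub> f x"
  shows "f \<in> linear_maps U V"
  using assms by (simp add: linear_maps_def)

lemma lin_closed: "f \<in> linear_maps U V \<Longrightarrow> x \<in> carrier U \<Longrightarrow> f x \<in> carrier V"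
  and lin_add: "f \<in> linear_maps U V \<Longrightarrow> x \<in> carrier U \<Longrightarrow> y \<in> carrier U \<Longrightarrow> f (x \<oplus>\<^bsub>U\<^esub> y) = f x \<oplus>\<^bsub>V\<^esub> f y"
  and lin_smult: "f \<in> linear_maps U V \<Longrightarrow> x \<in> carrier U \<Longrightarrow> f (z \<odot>\<^bsub>U\<^esub> x) = z \<odot>\<^bsub>V\<^esub> f x"
  by (auto simp: linear_maps_def)

lemma lin_zero: "f \<in> linear_maps U V \<Longrightarrow> vspace U \<Longrightarrow> vspace V \<Longrightarrow> f \<zero>\<^bsub>U\<^esub> = \<zero>\<^bsub>V\<^esub>"
  using lin_smult[of f U V "\<zero>\<^bsub>U\<^esub>" 0] lin_closed[of f U V "\<zero>\<^bsub>U\<^esub>"] by simp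

lemma lin_finsum:
  assumes "f \<in> linear_maps U V" "vspace U" "vspace V" "finite A" "\<And>i. i \<in> A \<Longrightarrow> g i \<in> carrier U"
  shows "f (finsum U g A) = finsum V (\<lambda>i. f (g i)) A"
  using assms(4,5)
  by (induction A) (use assms(1-3) in \<open>auto simp: lin_zero[OF assms(1)] lin_add[OF assms(1)] lin_closed[OF assms(1)]\<close>)

lemma lin_comp: "f \<in> linear_maps U V \<Longrightarrow> g \<in> linear_maps V W \<Longrightarrow> (\<lambda>x. g (f x)) \<in> linear_maps U W"
  by (auto simp: linear_maps_def Pi_iff)

lemma lin_id: "(\<lambda>x. x) \<in> linear_maps U U" "id \<in> linear_maps U U"
  by (auto simp: linear_maps_def)

lemma lin_add_fun:
  assumes "f \<in> linear_maps U V" "g \<in> linear_maps U V" "vspace V"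
  shows "(\<lambda>x. f x \<oplus>\<^bsub>V\<^esub> g x) \<in> linear_maps U V"
  using assms by (intro linear_mapsI) (auto simp: lin_closed[OF assms(1)] lin_closed[OF assms(2)] lin_add[OF assms(1)] lin_add[OF assms(2)] lin_smult[OF assms(1)] lin_smult[OF assms(2)] vs_smult_add vs_ac)

lemma lin_smult_fun:
  assumes "f \<in> linear_maps U V" "vspace V"
  shows "(\<lambda>x. z \<odot>\<^bsub>V\<^esub> f x) \<in> linear_maps U V"
  using assms
  by (intro linear_mapsI) (auto simp: lin_closed[OF assms(1)] lin_add[OF assms(1)] lin_smult[OF assms(1)] vs_smult_add vs_smult_smult mult.commute)

lemma lin_finsum_fun:
  assumes "\<And>i. i \<in> A \<Longrightarrow> f i \<in> linear_maps U V" "vspace V"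
  shows "(\<lambda>x. finsum V (\<lambda>i. f i x) A) \<in> linear_maps U V"
proof (rule linear_mapsI)
  fix x y assume xy: "x \<in> carrier U" "y \<in> carrier U"
  have "finsum V (\<lambda>i. f i (x \<oplus>\<^bsub>U\<^esub> y)) A = finsum V (\<lambda>i. f i x \<oplus>\<^bsub>V\<^esub> f i y) A"
    using assms xy by (intro vs_finsum_cong) (auto simp: lin_add lin_closed[OF assms(1)])
  then show "finsum V (\<lambda>i. f i (x \<oplus>\<^bsub>U\<^esub> y)) A = finsum V (\<lambda>i. f i x) A \<oplus>\<^bsub>V\<^esub> finsum V (\<lambda>i. f i y) A"
    using assms xy by (simp add: vs_finsum_add lin_closed[OF assms(1)])
next
  fix z x assume x: "x \<in> carrier U"
  have "finsum V (\<lambda>i. f i (z \<odot>\<^bsub>U\<^esub> x)) A = finsum V (\<lambda>i. z \<odot>\<^bsub>V\<^esub> f i x) A"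
    using assms x by (intro vs_finsum_cong) (auto simp: lin_smult lin_closed[OF assms(1)])
  then show "finsum V (\<lambda>i. f i (z \<odot>\<^bsub>U\<^esub> x)) A = z \<odot>\<^bsub>V\<^esub> finsum V (\<lambda>i. f i x) A"
    using assms x by (simp add: vs_finsum_smult lin_closed[OF assms(1)])
qed (use assms in \<open>auto simp: lin_closed[OF assms(1)]\<close>)

lemma lin_functional_smult:
  assumes "f \<in> linear_maps U CC" "vspace V" "v \<in> carrier V"
  shows "(\<lambda>x. f x \<odot>\<^bsub>V\<^esub> v) \<in> linear_maps U V"
  using assms by (intro linear_mapsI) (auto simp: lin_add[OF assms(1)] lin_smult[OF assms(1)] vs_add_smult vs_smult_smult)


subsection \<open>Spans\<close>

lemma submoduleI_vs:
  assumes "vspace U" "N \<subseteq> carrier U" "\<zero>\<^bsub>U\<^esub> \<in> N"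
    "\<And>x y. x \<in> N \<Longrightarrow> y \<in> N \<Longrightarrow> x \<oplus>\<^bsub>U\<^esub> y \<in> N" "\<And>z x. x \<in> N \<Longrightarrow> z \<odot>\<^bsub>U\<^esub> x \<in> N"
  shows "submodule N CC U"
  by (rule module.submoduleI[OF assms(1)])
    (use assms in \<open>auto simp: vs_uminus[OF assms(1)] subset_iff\<close>)

lemma submoduleD_vs:
  assumes "submodule N CC U" "vspace U"
  shows "N \<subseteq> carrier U" "\<zero>\<^bsub>U\<^esub> \<in> N" "\<And>x. x \<in> N \<Longrightarrow> x \<in> carrier U"
    "\<And>x y. x \<in> N \<Longrightarrow> y \<in> N \<Longrightarrow> x \<oplus>\<^bsub>U\<^esub> y \<in> N" "\<And>z x. x \<in> N \<Longrightarrow> z \<odot>\<^bsub>U\<^esub> x \<in> N"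
proof -
  show *: "N \<subseteq> carrier U" "\<And>x y. x \<in> N \<Longrightarrow> y \<in> N \<Longrightarrow> x \<oplus>\<^bsub>U\<^esub> y \<in> N" "\<And>z x. x \<in> N \<Longrightarrow> z \<odot>\<^bsub>U\<^esub> x \<in> N"
    using module.submoduleE[OF assms(2,1)] by auto
  then show "\<And>x. x \<in> N \<Longrightarrow> x \<in> carrier U" by auto
  obtain x where "x \<in> N" using module.submoduleE[OF assms(2,1)] by auto
  then show "\<zero>\<^bsub>U\<^esub> \<in> N" using *(1) *(3)[of x 0] assms(2) by auto
qed

lemma submodule_finsum:
  assumes "submodule N CC U" "vspace U" "finite A" "\<And>i. i \<in> A \<Longrightarrow> f i \<in> N"
  shows "finsum U f A \<in> N"
  using assms(3,4)
proof (induction A)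
  case empty
  then show ?case using submoduleD_vs[OF assms(1,2)] assms(2) by simp
next
  case (insert a A)
  then show ?case using submoduleD_vs[OF assms(1,2)] assms(2) by simp
qed

lemma vspace_carrier_update:
  "submodule N CC U \<Longrightarrow> vspace U \<Longrightarrow> vspace (U\<lparr>carrier := N\<rparr>)"
  by (rule submodule.submodule_is_module)

text \<open>A sum refers to the carrier of its record, so a sum taken in a subspace has to be
  identified with the same sum in the ambient space.\<close>

lemma finsum_carrier_update:
  assumes "submodule N CC U" "vspace U" "finite A" "\<And>i. i \<in> A \<Longrightarrow> f i \<in> N"
  shows "finsum (U\<lparr>carrier := N\<rparr>) f A = finsum U f A"
  using assms(3,4)
proof (induction A)
  case empty
  then show ?case using vspace_carrier_update[OF assms(1,2)] assms(2) by simp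
next
  case (insert a A)
  then show ?case
    using vspace_carrier_update[OF assms(1,2)] submoduleD_vs[OF assms(1,2)] assms(2) by simp
qed

lemma lin_span_submodule:
  assumes "vspace U" "S \<subseteq> carrier U"
  shows "submodule (lin_span U S) CC U"
proof (rule submoduleI_vs[OF assms(1)])
  show "lin_span U S \<subseteq> carrier U"
    using module.carrier_is_submodule[OF assms(1)] assms(2) by (auto simp: lin_span_def)
qed (auto simp: lin_span_def intro: submoduleD_vs[OF _ assms(1)])

lemma lin_span_superset: "S \<subseteq> lin_span U S"
  by (auto simp: lin_span_def)

lemma lin_span_minimal: "submodule N CC U \<Longrightarrow> S \<subseteq> N \<Longrightarrow> lin_span U S \<subseteq> N"
  by (auto simp: lin_span_def)

lemma lin_kernel_submodule:
  assumes "f \<in> linear_maps U V" "vspace U" "vspace V"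
  shows "submodule {x \<in> carrier U. f x = \<zero>\<^bsub>V\<^esub>} CC U"
  using assms by (intro submoduleI_vs) (auto simp: lin_zero[OF assms(1)] lin_add[OF assms(1)] lin_smult[OF assms(1)])

lemma lin_image_submodule:
  assumes "f \<in> linear_maps U V" "vspace U" "vspace V" "submodule N CC U"
  shows "submodule (f ` N) CC V"
proof (rule submoduleI_vs[OF assms(3)])
  note N = submoduleD_vs[OF assms(4,2)]
  show "f ` N \<subseteq> carrier V" using assms N by (auto simp: lin_closed[OF assms(1)])
  show "\<zero>\<^bsub>V\<^esub> \<in> f ` N" using N(2) lin_zero[OF assms(1-3)] by (metis image_eqI)
  show "x \<oplus>\<^bsub>V\<^esub> y \<in> f ` N" if "x \<in> f ` N" "y \<in> f ` N" for x y
    using that N lin_add[OF assms(1)] by (auto simp: image_iff) metis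
  show "z \<odot>\<^bsub>V\<^esub> x \<in> f ` N" if "x \<in> f ` N" for z x
    using that N lin_smult[OF assms(1)] by (auto simp: image_iff) metis
qed

text \<open>The vectors on which two linear maps agree form a subspace, so agreement spreads from
  generators to their span.\<close>

lemma lin_span_eq:
  assumes "f \<in> linear_maps U V" "g \<in> linear_maps U V" "vspace U" "vspace V" "S \<subseteq> carrier U"
    "\<And>x. x \<in> S \<Longrightarrow> f x = g x" "x \<in> lin_span U S"
  shows "f x = g x"
proof -
  have "submodule {x \<in> carrier U. f x = g x} CC U"
    using assms by (intro submoduleI_vs) (auto simp: lin_zero[OF assms(1)] lin_zero[OF assms(2)] lin_add[OF assms(1)] lin_add[OF assms(2)] lin_smult[OF assms(1)] lin_smult[OF assms(2)])
  then have "lin_span U S \<subseteq> {x \<in> carrier U. f x = g x}"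
    using assms(5,6) by (intro lin_span_minimal) auto
  then show ?thesis using assms(7) by auto
qed


subsection \<open>Quotient spaces\<close>

lemma submodule_abelian_subgroup:
  assumes "submodule N CC U" "vspace U"
  shows "abelian_subgroup N U"
  using assms(1) vs_abelian_group[OF assms(2)]
  by (intro abelian_subgroupI3 additive_subgroup.intro) (auto simp: submodule_def)

lemma quot_simps:
  "carrier (quot U N) = (\<lambda>x. N +>\<^bsub>U\<^esub> x) ` carrier U"
  "\<zero>\<^bsub>quot U N\<^esub> = N"
  "\<one>\<^bsub>quot U N\<^esub> = N +>\<^bsub>U\<^esub> \<one>\<^bsub>U\<^esub>"
  "S \<oplus>\<^bsub>quot U N\<^esub> Y = set_add U S Y"
  "S \<otimes>\<^bsub>quot U N\<^esub> Y = rcoset_mult U N S Y"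
  "z \<odot>\<^bsub>quot U N\<^esub> S = (\<Union>x\<in>S. N +>\<^bsub>U\<^esub> (z \<odot>\<^bsub>U\<^esub> x))"
  by (auto simp: quot_def FactRing_def A_RCOSETS_def' ring.defs module.defs)

context
  fixes U :: "(complex, 'u, 'x) module_scheme" and N
  assumes N: "submodule N CC U" and U: "vspace U"
begin

interpretation abelian_subgroup N U
  by (rule submodule_abelian_subgroup[OF N U])

lemma coset_eq_iff:
  assumes "x \<in> carrier U" "y \<in> carrier U"
  shows "N +>\<^bsub>U\<^esub> x = N +>\<^bsub>U\<^esub> y \<longleftrightarrow> x \<oplus>\<^bsub>U\<^esub> (- 1) \<odot>\<^bsub>U\<^esub> y \<in> N"
proof -
  have "N +>\<^bsub>U\<^esub> x = N +>\<^bsub>U\<^esub> y \<longleftrightarrow> x \<in> N +>\<^bsub>U\<^esub> y"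
    using assms a_rcos_self a_repr_independence'
    by (metis a_subgroup a_repr_independence)
  also have "\<dots> \<longleftrightarrow> x \<oplus>\<^bsub>U\<^esub> \<ominus>\<^bsub>U\<^esub> y \<in> N"
    using assms by (intro a_rcos_module)
  finally show ?thesis by (simp add: vs_uminus[OF U] assms)
qed

lemma mem_coset_iff:
  assumes "x \<in> carrier U"
  shows "y \<in> N +>\<^bsub>U\<^esub> x \<longleftrightarrow> y \<in> carrier U \<and> N +>\<^bsub>U\<^esub> y = N +>\<^bsub>U\<^esub> x"
proof
  assume "y \<in> N +>\<^bsub>U\<^esub> x"
  then show "y \<in> carrier U \<and> N +>\<^bsub>U\<^esub> y = N +>\<^bsub>U\<^esub> x"
    using a_r_coset_subset_G[OF a_subset assms] a_repr_independence[OF _ assms a_subgroup, of y] by blast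
next
  assume "y \<in> carrier U \<and> N +>\<^bsub>U\<^esub> y = N +>\<^bsub>U\<^esub> x"
  then show "y \<in> N +>\<^bsub>U\<^esub> x"
    using a_rcos_self[of y] by simp
qed

lemma coset_eq_self_iff:
  assumes "x \<in> carrier U"
  shows "N +>\<^bsub>U\<^esub> x = N \<longleftrightarrow> x \<in> N"
  using a_coset_join1[OF _ assms a_subgroup] a_coset_join2[OF assms a_subgroup] by blast

lemma coset_add:
  assumes "x \<in> carrier U" "y \<in> carrier U"
  shows "(N +>\<^bsub>U\<^esub> x) \<oplus>\<^bsub>quot U N\<^esub> (N +>\<^bsub>U\<^esub> y) = N +>\<^bsub>U\<^esub> (x \<oplus>\<^bsub>U\<^esub> y)"
  using assms by (simp add: quot_simps a_rcos_sum)

text \<open>The scalar action on classes is a union over all representatives. Because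
  \<open>N\<close> is closed under scalars, all cosets in this union coincide.\<close>

lemma coset_smult:
  assumes "x \<in> carrier U"
  shows "z \<odot>\<^bsub>quot U N\<^esub> (N +>\<^bsub>U\<^esub> x) = N +>\<^bsub>U\<^esub> (z \<odot>\<^bsub>U\<^esub> x)"
proof -
  have "N +>\<^bsub>U\<^esub> (z \<odot>\<^bsub>U\<^esub> y) = N +>\<^bsub>U\<^esub> (z \<odot>\<^bsub>U\<^esub> x)" if "y \<in> N +>\<^bsub>U\<^esub> x" for y
  proof -
    have y: "y \<in> carrier U" "y \<oplus>\<^bsub>U\<^esub> (- 1) \<odot>\<^bsub>U\<^esub> x \<in> N"
      using that assms by (auto simp: mem_coset_iff coset_eq_iff)
    have "z \<odot>\<^bsub>U\<^esub> (y \<oplus>\<^bsub>U\<^esub> (- 1) \<odot>\<^bsub>U\<^esub> x) \<in> N"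
      using y(2) submoduleD_vs[OF N U] by simp
    then show ?thesis
      using y(1) assms U by (simp add: coset_eq_iff vs_smult_add vs_smult_smult)
  qed
  then have "(\<Union>y\<in>N +>\<^bsub>U\<^esub> x. N +>\<^bsub>U\<^esub> (z \<odot>\<^bsub>U\<^esub> y)) = (\<Union>y\<in>N +>\<^bsub>U\<^esub> x. N +>\<^bsub>U\<^esub> (z \<odot>\<^bsub>U\<^esub> x))"
    by (rule SUP_cong[OF refl])
  also have "\<dots> = N +>\<^bsub>U\<^esub> (z \<odot>\<^bsub>U\<^esub> x)"
    using mem_coset_iff[OF assms, of x] assms by auto
  finally show ?thesis unfolding quot_simps(6) .
qed

lemma coset_closed: "x \<in> carrier U \<Longrightarrow> N +>\<^bsub>U\<^esub> x \<in> carrier (quot U N)"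
  unfolding quot_simps(1) by (rule imageI)

lemma coset_lin: "(\<lambda>x. N +>\<^bsub>U\<^esub> x) \<in> linear_maps U (quot U N)"
  by (rule linear_mapsI) (simp_all only: coset_closed coset_add coset_smult)

lemma coset_zero: "N +>\<^bsub>U\<^esub> \<zero>\<^bsub>U\<^esub> = \<zero>\<^bsub>quot U N\<^esub>"
  using coset_eq_self_iff[of "\<zero>\<^bsub>U\<^esub>"] submoduleD_vs(2)[OF N U] vs_closed(1)[OF U] by (simp add: quot_simps(2))

lemma coset_cases:
  assumes "S \<in> carrier (quot U N)"
  obtains x where "x \<in> carrier U" "S = N +>\<^bsub>U\<^esub> x"
  using assms that unfolding quot_simps(1) by (elim imageE)

lemma vspace_quot: "vspace (quot U N)"
proof -
  note closed = vs_closed[OF U]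
  have *: "abelian_group (quot U N)"
  proof (rule abelian_groupI)
    show "S \<oplus>\<^bsub>quot U N\<^esub> S' \<in> carrier (quot U N)"
      if "S \<in> carrier (quot U N)" "S' \<in> carrier (quot U N)" for S S'
      using that by (elim coset_cases) (simp add: coset_add coset_closed closed)
    show "\<zero>\<^bsub>quot U N\<^esub> \<in> carrier (quot U N)"
      using coset_closed[OF closed(1)] by (simp add: coset_zero)
    show "S \<oplus>\<^bsub>quot U N\<^esub> S' \<oplus>\<^bsub>quot U N\<^esub> S'' = S \<oplus>\<^bsub>quot U N\<^esub> (S' \<oplus>\<^bsub>quot U N\<^esub> S'')"
      if "S \<in> carrier (quot U N)" "S' \<in> carrier (quot U N)" "S'' \<in> carrier (quot U N)" for S S' S''
      using that by (elim coset_cases) (simp add: coset_add closed vs_ac[OF U])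
    show "S \<oplus>\<^bsub>quot U N\<^esub> S' = S' \<oplus>\<^bsub>quot U N\<^esub> S"
      if "S \<in> carrier (quot U N)" "S' \<in> carrier (quot U N)" for S S'
      using that by (elim coset_cases) (simp add: coset_add vs_ac(2)[OF U])
    show "\<zero>\<^bsub>quot U N\<^esub> \<oplus>\<^bsub>quot U N\<^esub> S = S" if "S \<in> carrier (quot U N)" for S
      using that by (elim coset_cases) (simp add: coset_add coset_zero[symmetric] closed vs_zero[OF U])
    show "\<exists>S'\<in>carrier (quot U N). S' \<oplus>\<^bsub>quot U N\<^esub> S = \<zero>\<^bsub>quot U N\<^esub>" if "S \<in> carrier (quot U N)" for S
      using that
    proof (elim coset_cases)
      fix x assume x: "x \<in> carrier U" "S = N +>\<^bsub>U\<^esub> x"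
      have "(N +>\<^bsub>U\<^esub> ((- 1) \<odot>\<^bsub>U\<^esub> x)) \<oplus>\<^bsub>quot U N\<^esub> S = N +>\<^bsub>U\<^esub> ((- 1 + 1) \<odot>\<^bsub>U\<^esub> x)"
        using x closed vs_zero(5)[OF U] vs_add_smult[OF U, of x "- 1" 1] by (simp only: coset_add)
      then show ?thesis
        using coset_closed[of "(- 1) \<odot>\<^bsub>U\<^esub> x"] x closed vs_zero(3)[OF U] by (auto simp: coset_zero)
    qed
  qed
  show ?thesis
  proof (rule moduleI[OF CC_cring *])
    show "z \<odot>\<^bsub>quot U N\<^esub> S \<in> carrier (quot U N)" if "S \<in> carrier (quot U N)" for z S
      using that by (elim coset_cases) (simp add: coset_smult coset_closed closed)
    show "(z \<oplus>\<^bsub>CC\<^esub> w) \<odot>\<^bsub>quot U N\<^esub> S = z \<odot>\<^bsub>quot U N\<^esub> S \<oplus>\<^bsub>quot U N\<^esub> w \<odot>\<^bsub>quot U N\<^esub> S"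
      if "S \<in> carrier (quot U N)" for z w S
      using that by (elim coset_cases) (simp add: coset_smult coset_add closed vs_add_smult[OF U])
    show "z \<odot>\<^bsub>quot U N\<^esub> (S \<oplus>\<^bsub>quot U N\<^esub> S') = z \<odot>\<^bsub>quot U N\<^esub> S \<oplus>\<^bsub>quot U N\<^esub> z \<odot>\<^bsub>quot U N\<^esub> S'"
      if "S \<in> carrier (quot U N)" "S' \<in> carrier (quot U N)" for z S S'
      using that by (elim coset_cases) (simp add: coset_smult coset_add closed vs_smult_add[OF U])
    show "(z \<otimes>\<^bsub>CC\<^esub> w) \<odot>\<^bsub>quot U N\<^esub> S = z \<odot>\<^bsub>quot U N\<^esub> (w \<odot>\<^bsub>quot U N\<^esub> S)"
      if "S \<in> carrier (quot U N)" for z w S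
      using that by (elim coset_cases) (simp add: coset_smult closed vs_smult_smult[OF U])
    show "\<one>\<^bsub>CC\<^esub> \<odot>\<^bsub>quot U N\<^esub> S = S" if "S \<in> carrier (quot U N)" for S
      using that by (elim coset_cases) (simp add: coset_smult vs_zero(5)[OF U])
  qed
qed

text \<open>The map on classes is specified only by its values, because the candidates used later,
  \<open>induced\<close>, \<open>coset_fun\<close> and \<open>algebra_map\<close>, are definite
  descriptions.\<close>

lemma quot_lin_lift:
  assumes f: "f \<in> linear_maps U V" and V: "vspace V" and N0: "\<And>x. x \<in> N \<Longrightarrow> f x = \<zero>\<^bsub>V\<^esub>"
    and g: "\<And>x. x \<in> carrier U \<Longrightarrow> g (N +>\<^bsub>U\<^esub> x) = f x"
  shows "g \<in> linear_maps (quot U N) V"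
proof (rule linear_mapsI)
  note closed = vs_closed[OF U]
  show "g S \<in> carrier V" if "S \<in> carrier (quot U N)" for S
    using that by (elim coset_cases) (simp add: g lin_closed[OF f])
  show "g (S \<oplus>\<^bsub>quot U N\<^esub> S') = g S \<oplus>\<^bsub>V\<^esub> g S'"
    if "S \<in> carrier (quot U N)" "S' \<in> carrier (quot U N)" for S S'
    using that by (elim coset_cases) (simp add: g closed coset_add lin_add[OF f])
  show "g (z \<odot>\<^bsub>quot U N\<^esub> S) = z \<odot>\<^bsub>V\<^esub> g S" if "S \<in> carrier (quot U N)" for z S
    using that by (elim coset_cases) (simp add: g closed coset_smult lin_smult[OF f])
qed

lemma lin_eq_on_coset:
  assumes f: "f \<in> linear_maps U V" and V: "vspace V" and N0: "\<And>x. x \<in> N \<Longrightarrow> f x = \<zero>\<^bsub>V\<^esub>"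
    and x: "x \<in> carrier U" and y: "y \<in> N +>\<^bsub>U\<^esub> x"
  shows "f y = f x"
proof -
  have y': "y \<in> carrier U" "y \<oplus>\<^bsub>U\<^esub> (- 1) \<odot>\<^bsub>U\<^esub> x \<in> N"
    using y x by (auto simp: mem_coset_iff coset_eq_iff)
  have "f y \<oplus>\<^bsub>V\<^esub> (- 1) \<odot>\<^bsub>V\<^esub> f x = \<zero>\<^bsub>V\<^esub>"
    using N0[OF y'(2)] y'(1) x vs_closed[OF U] by (simp add: lin_add[OF f] lin_smult[OF f])
  then show ?thesis
    using vs_diff_eq_zero[OF V] x y' by (simp add: lin_closed[OF f])
qed

end

section \<open>Formal linear combinations\<close>

definition pm_scale :: "complex \<Rightarrow> ('a \<Rightarrow>\<^sub>0 complex) \<Rightarrow> 'a \<Rightarrow>\<^sub>0 complex" where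
  "pm_scale z = Poly_Mapping.map (\<lambda>w. z * w)"

lemma monoid_algebra_simps [simp]:
  "f \<in> carrier (monoid_algebra G) \<longleftrightarrow> Poly_Mapping.keys f \<subseteq> carrier G"
  "\<zero>\<^bsub>monoid_algebra G\<^esub> = 0"
  "f \<oplus>\<^bsub>monoid_algebra G\<^esub> g = f + g"
  "z \<odot>\<^bsub>monoid_algebra G\<^esub> f = pm_scale z f"
  "\<one>\<^bsub>monoid_algebra G\<^esub> = Poly_Mapping.single \<one>\<^bsub>G\<^esub> 1"
  by (simp_all add: monoid_algebra_def pm_scale_def)

lemma lookup_pm_scale [simp]: "Poly_Mapping.lookup (pm_scale z f) k = z * Poly_Mapping.lookup f k"
  by (simp add: pm_scale_def Poly_Mapping.map.rep_eq when_def)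

lemma keys_pm_scale: "Poly_Mapping.keys (pm_scale z f) \<subseteq> Poly_Mapping.keys f"
  by (auto simp: in_keys_iff)

lemma pm_scale_minus_one [simp]: "pm_scale (- 1) f = - f"
  by (rule poly_mapping_eqI) simp

lemma pm_scale_single [simp]: "pm_scale z (Poly_Mapping.single k w) = Poly_Mapping.single k (z * w)"
  by (rule poly_mapping_eqI) (simp add: lookup_single when_def)

lemma keys_plus_subset:
  "Poly_Mapping.keys f \<subseteq> A \<Longrightarrow> Poly_Mapping.keys g \<subseteq> A \<Longrightarrow> Poly_Mapping.keys (f + g) \<subseteq> A"
  using Poly_Mapping.keys_add[of f g] by blast

lemma vspace_monoid_algebra [simp]: "vspace (monoid_algebra G)"
proof (rule moduleI[OF CC_cring])
  show "abelian_group (monoid_algebra G)"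
  proof (rule abelian_groupI)
    show "\<exists>y\<in>carrier (monoid_algebra G). y \<oplus>\<^bsub>monoid_algebra G\<^esub> x = \<zero>\<^bsub>monoid_algebra G\<^esub>"
      if "x \<in> carrier (monoid_algebra G)" for x
      using that by (intro bexI[of _ "- x"]) simp_all
  qed (simp_all add: keys_plus_subset ac_simps)
next
  show "z \<odot>\<^bsub>monoid_algebra G\<^esub> x \<in> carrier (monoid_algebra G)" if "x \<in> carrier (monoid_algebra G)" for z x
    using that keys_pm_scale[of z x] by simp
  show "\<one>\<^bsub>CC\<^esub> \<odot>\<^bsub>monoid_algebra G\<^esub> x = x" for x
    by (rule poly_mapping_eqI) simp
qed (simp_all add: poly_mapping_eq_iff fun_eq_iff lookup_add algebra_simps)

text \<open>One term is split off at a time. The induction runs over the finite set of keys, since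
  the remainder has exactly the other keys.\<close>

lemma poly_mapping_induct_on [consumes 1, case_names zero add]:
  fixes f :: "'a \<Rightarrow>\<^sub>0 'b :: ab_group_add"
  assumes "Poly_Mapping.keys f \<subseteq> A" "P 0"
    "\<And>k z f. k \<in> A \<Longrightarrow> Poly_Mapping.keys f \<subseteq> A \<Longrightarrow> P f \<Longrightarrow> P (Poly_Mapping.single k z + f)"
  shows "P f"
proof -
  have "P g" if "finite B" "Poly_Mapping.keys g = B" "B \<subseteq> A" for B g
    using that
  proof (induction B arbitrary: g)
    case empty
    then show ?case using assms(2) by simp
  next
    case (insert k B)
    define h where "h = g - Poly_Mapping.single k (Poly_Mapping.lookup g k)"
    have "Poly_Mapping.lookup h x = (if x = k then 0 else Poly_Mapping.lookup g x)" for x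
      by (cases "x = k") (simp_all add: h_def lookup_minus lookup_single)
    then have "Poly_Mapping.keys h = Poly_Mapping.keys g - {k}"
      by (auto simp: in_keys_iff split: if_splits)
    then have "Poly_Mapping.keys h = B"
      using insert.hyps insert.prems(1) by simp
    then have "P (Poly_Mapping.single k (Poly_Mapping.lookup g k) + h)"
      using insert.prems(2) insert.IH[of h] by (intro assms(3)) simp_all
    moreover have "Poly_Mapping.single k (Poly_Mapping.lookup g k) + h = g"
      by (simp add: h_def)
    ultimately show ?case by (simp only:)
  qed
  from this[OF finite_keys refl assms(1)] show ?thesis .
qed

lemma monoid_algebra_lin_eq:
  assumes "F \<in> linear_maps (monoid_algebra G) P" "F' \<in> linear_maps (monoid_algebra G) P" "vspace P"
    "\<And>k. k \<in> carrier G \<Longrightarrow> F (Poly_Mapping.single k 1) = F' (Poly_Mapping.single k 1)"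
    "Poly_Mapping.keys f \<subseteq> carrier G"
  shows "F f = F' f"
  using assms(5)
proof (induction rule: poly_mapping_induct_on)
  case zero
  show ?case
    using lin_zero[OF assms(1) _ assms(3)] lin_zero[OF assms(2) _ assms(3)] by simp
next
  case (add k z f)
  have "F (Poly_Mapping.single k z) = F' (Poly_Mapping.single k z)"
    using lin_smult[OF assms(1), of "Poly_Mapping.single k 1" z]
      lin_smult[OF assms(2), of "Poly_Mapping.single k 1" z] add(1) assms(4)[of k]
    by (simp add: pm_scale_single)
  then show ?case
    using lin_add[OF assms(1), of "Poly_Mapping.single k z" f]
      lin_add[OF assms(2), of "Poly_Mapping.single k z" f] add by auto
qed

section \<open>Linear extension from basis elements and its descent to classes\<close>

definition lin_ext :: "(complex, 'p, 'x) module_scheme \<Rightarrow> ('s \<Rightarrow> 'p) \<Rightarrow> ('s \<Rightarrow>\<^sub>0 complex) \<Rightarrow> 'p" where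
  "lin_ext P h f = (\<Oplus>\<^bsub>P\<^esub>k\<in>Poly_Mapping.keys f. Poly_Mapping.lookup f k \<odot>\<^bsub>P\<^esub> h k)"

text \<open>The support changes under addition and scaling. A common larger index set makes the sums
  comparable, the additional coefficients being zero.\<close>

lemma lin_ext_superset:
  assumes "vspace P" "\<And>k. k \<in> A \<Longrightarrow> h k \<in> carrier P" "finite A" "Poly_Mapping.keys f \<subseteq> A"
  shows "lin_ext P h f = (\<Oplus>\<^bsub>P\<^esub>k\<in>A. Poly_Mapping.lookup f k \<odot>\<^bsub>P\<^esub> h k)"
  unfolding lin_ext_def
  by (rule vs_finsum_neutral[symmetric]) (use assms in \<open>auto simp: in_keys_iff\<close>)

lemma lin_ext_single:
  assumes "vspace P" "h k \<in> carrier P"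
  shows "lin_ext P h (Poly_Mapping.single k z) = z \<odot>\<^bsub>P\<^esub> h k"
proof -
  have "Poly_Mapping.keys (Poly_Mapping.single k z) \<subseteq> {k}" by simp
  then show ?thesis
    using lin_ext_superset[OF assms(1), of "{k}" h "Poly_Mapping.single k z"] assms by simp
qed

lemma lin_ext_linear:
  assumes P: "vspace P" and h: "\<And>k. k \<in> carrier G \<Longrightarrow> h k \<in> carrier P"
  shows "lin_ext P h \<in> linear_maps (monoid_algebra G) P"
proof (rule linear_mapsI)
  fix f assume f: "f \<in> carrier (monoid_algebra G)"
  then show "lin_ext P h f \<in> carrier P"
    unfolding lin_ext_def using assms by (intro vs_finsum_closed) auto
  show "lin_ext P h (z \<odot>\<^bsub>monoid_algebra G\<^esub> f) = z \<odot>\<^bsub>P\<^esub> lin_ext P h f" for z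
  proof -
    have "lin_ext P h (z \<odot>\<^bsub>monoid_algebra G\<^esub> f)
      = (\<Oplus>\<^bsub>P\<^esub>k\<in>Poly_Mapping.keys f. z \<odot>\<^bsub>P\<^esub> (Poly_Mapping.lookup f k \<odot>\<^bsub>P\<^esub> h k))"
      using assms f keys_pm_scale[of z f]
      by (subst lin_ext_superset[of _ "Poly_Mapping.keys f"])
        (auto simp: vs_smult_smult subset_iff intro!: vs_finsum_cong)
    then show ?thesis
      using assms f by (simp add: lin_ext_def vs_finsum_smult subset_iff)
  qed
next
  fix f g assume fg: "f \<in> carrier (monoid_algebra G)" "g \<in> carrier (monoid_algebra G)"
  define A where "A = Poly_Mapping.keys f \<union> Poly_Mapping.keys g"
  have A: "finite A" "Poly_Mapping.keys f \<subseteq> A" "Poly_Mapping.keys g \<subseteq> A"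
    "Poly_Mapping.keys (f + g) \<subseteq> A" "\<And>k. k \<in> A \<Longrightarrow> h k \<in> carrier P"
    using fg assms Poly_Mapping.keys_add[of f g] by (auto simp: A_def)
  show "lin_ext P h (f \<oplus>\<^bsub>monoid_algebra G\<^esub> g) = lin_ext P h f \<oplus>\<^bsub>P\<^esub> lin_ext P h g"
  proof -
    have ext: "lin_ext P h f' = (\<Oplus>\<^bsub>P\<^esub>k\<in>A. Poly_Mapping.lookup f' k \<odot>\<^bsub>P\<^esub> h k)"
      if "Poly_Mapping.keys f' \<subseteq> A" for f'
      using lin_ext_superset[of P A h f'] P A(1,5) that by simp
    have "lin_ext P h (f \<oplus>\<^bsub>monoid_algebra G\<^esub> g) = (\<Oplus>\<^bsub>P\<^esub>k\<in>A. Poly_Mapping.lookup (f + g) k \<odot>\<^bsub>P\<^esub> h k)"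
      using ext[OF A(4)] by simp
    also have "\<dots> = (\<Oplus>\<^bsub>P\<^esub>k\<in>A. Poly_Mapping.lookup f k \<odot>\<^bsub>P\<^esub> h k \<oplus>\<^bsub>P\<^esub> Poly_Mapping.lookup g k \<odot>\<^bsub>P\<^esub> h k)"
      by (rule vs_finsum_cong[OF P refl]) (use A(5) P in \<open>simp_all add: lookup_add vs_add_smult\<close>)
    also have "\<dots> = lin_ext P h f \<oplus>\<^bsub>P\<^esub> lin_ext P h g"
      using A(5) P by (simp add: vs_finsum_add ext[OF A(2)] ext[OF A(3)])
    finally show ?thesis .
  qed
qed

lemma induced_eq_lin_ext: "induced P h S = (THE y. \<forall>f\<in>S. y = lin_ext P h f)"
  by (simp add: induced_def lin_ext_def)

text \<open>An extension that kills \<open>N\<close> is constant on each class, so the definite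
  description in \<open>induced\<close> has exactly one candidate.\<close>

lemma induced_coset:
  assumes "vspace P" "\<And>k. k \<in> carrier G \<Longrightarrow> h k \<in> carrier P" "submodule N CC (monoid_algebra G)"
    "\<And>f. f \<in> N \<Longrightarrow> lin_ext P h f = \<zero>\<^bsub>P\<^esub>" "Poly_Mapping.keys f \<subseteq> carrier G"
  shows "induced P h (N +>\<^bsub>monoid_algebra G\<^esub> f) = lin_ext P h f"
  unfolding induced_eq_lin_ext
proof (rule the_equality)
  show "\<forall>g\<in>N +>\<^bsub>monoid_algebra G\<^esub> f. lin_ext P h f = lin_ext P h g"
    using lin_eq_on_coset[OF assms(3) _ lin_ext_linear[OF assms(1,2)] assms(1,4)] assms(5) by auto
  show "y = lin_ext P h f" if "\<forall>g\<in>N +>\<^bsub>monoid_algebra G\<^esub> f. y = lin_ext P h g" for y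
    using that mem_coset_iff[OF assms(3), of f f] assms(5) by auto
qed

lemma induced_linear:
  assumes "vspace P" "\<And>k. k \<in> carrier G \<Longrightarrow> h k \<in> carrier P" "submodule N CC (monoid_algebra G)"
    "\<And>f. f \<in> N \<Longrightarrow> lin_ext P h f = \<zero>\<^bsub>P\<^esub>"
  shows "induced P h \<in> linear_maps (quot (monoid_algebra G) N) P"
  by (rule quot_lin_lift[OF assms(3) _ lin_ext_linear[OF assms(1,2)] assms(1,4)])
    (use assms in \<open>auto intro!: induced_coset\<close>)


section \<open>Tensor products\<close>

context
  fixes U :: "(complex, 'u, 'x) module_scheme" and V :: "(complex, 'v, 'y) module_scheme"
  assumes U: "vspace U" and V: "vspace V"
begin

lemma bilinear_rels_subset: "bilinear_rels U V \<subseteq> carrier (monoid_algebra (U \<times>\<times> V))"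
proof -
  have *: "Poly_Mapping.keys (f - g) \<subseteq> A"
    if "Poly_Mapping.keys f \<subseteq> A" "Poly_Mapping.keys g \<subseteq> A" for f g :: "'u \<times> 'v \<Rightarrow>\<^sub>0 complex" and A
    using that keys_diff[of f g] by blast
  have **: "Poly_Mapping.keys (Poly_Mapping.single k z) \<subseteq> carrier U \<times> carrier V"
    if "k \<in> carrier U \<times> carrier V" for k and z :: complex
    using that by simp
  show ?thesis
    unfolding bilinear_rels_def
    by (rule subsetI, elim UnE CollectE exE conjE; simp only: monoid_algebra_simps carrier_DirProd;
        intro * **; simp add: vs_closed[OF U] vs_closed[OF V])
qed

lemma tensor_null_submodule: "submodule (tensor_null U V) CC (monoid_algebra (U \<times>\<times> V))"
  unfolding tensor_null_def by (rule lin_span_submodule[OF _ bilinear_rels_subset]) simp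

lemma vspace_tensor [simp]: "vspace (tensor U V)"
  unfolding tensor_def by (rule vspace_quot[OF tensor_null_submodule]) simp

lemma pure_closed [simp]: "x \<in> carrier U \<Longrightarrow> y \<in> carrier V \<Longrightarrow> pure U V x y \<in> carrier (tensor U V)"
  unfolding tensor_def pure_def by (rule coset_closed[OF tensor_null_submodule]) auto

lemma coset_rel_eq:
  assumes "f - g \<in> bilinear_rels U V" "Poly_Mapping.keys f \<subseteq> carrier U \<times> carrier V"
    "Poly_Mapping.keys g \<subseteq> carrier U \<times> carrier V"
  shows "tensor_null U V +>\<^bsub>monoid_algebra (U \<times>\<times> V)\<^esub> f = tensor_null U V +>\<^bsub>monoid_algebra (U \<times>\<times> V)\<^esub> g"
proof -
  have "f - g \<in> tensor_null U V"
    unfolding tensor_null_def by (rule subsetD[OF lin_span_superset assms(1)])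
  then show ?thesis
    using coset_eq_iff[OF tensor_null_submodule, of f g] assms(2,3) by simp
qed

lemma pure_smult_coset:
  assumes "x \<in> carrier U" "y \<in> carrier V"
  shows "z \<odot>\<^bsub>tensor U V\<^esub> pure U V x y
    = tensor_null U V +>\<^bsub>monoid_algebra (U \<times>\<times> V)\<^esub> Poly_Mapping.single (x, y) z"
  unfolding tensor_def pure_def
  by (subst coset_smult[OF tensor_null_submodule]) (use assms in \<open>auto simp: pm_scale_single\<close>)

lemma pure_add_coset:
  assumes "x \<in> carrier U" "y \<in> carrier V" "x' \<in> carrier U" "y' \<in> carrier V"
  shows "pure U V x y \<oplus>\<^bsub>tensor U V\<^esub> pure U V x' y'
    = tensor_null U V +>\<^bsub>monoid_algebra (U \<times>\<times> V)\<^esub> (Poly_Mapping.single (x, y) 1 + Poly_Mapping.single (x', y') 1)"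
  unfolding tensor_def pure_def
  by (subst coset_add[OF tensor_null_submodule]) (use assms in auto)

lemma pure_add_left:
  assumes "x \<in> carrier U" "x' \<in> carrier U" "y \<in> carrier V"
  shows "pure U V (x \<oplus>\<^bsub>U\<^esub> x') y = pure U V x y \<oplus>\<^bsub>tensor U V\<^esub> pure U V x' y"
proof -
  have "Poly_Mapping.single (x \<oplus>\<^bsub>U\<^esub> x', y) 1 - (Poly_Mapping.single (x, y) 1 + Poly_Mapping.single (x', y) 1)
     \<in> bilinear_rels U V"
    unfolding bilinear_rels_def diff_diff_add[symmetric] using assms by blast
  from coset_rel_eq[OF this] show ?thesis
    using assms U keys_plus_subset[of "Poly_Mapping.single (x, y) (1 :: complex)" "carrier U \<times> carrier V" "Poly_Mapping.single (x', y) 1"]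
    by (simp add: pure_add_coset) (simp add: pure_def)
qed

lemma pure_add_right:
  assumes "x \<in> carrier U" "y \<in> carrier V" "y' \<in> carrier V"
  shows "pure U V x (y \<oplus>\<^bsub>V\<^esub> y') = pure U V x y \<oplus>\<^bsub>tensor U V\<^esub> pure U V x y'"
proof -
  have "Poly_Mapping.single (x, y \<oplus>\<^bsub>V\<^esub> y') 1 - (Poly_Mapping.single (x, y) 1 + Poly_Mapping.single (x, y') 1)
     \<in> bilinear_rels U V"
    unfolding bilinear_rels_def diff_diff_add[symmetric] using assms by blast
  from coset_rel_eq[OF this] show ?thesis
    using assms V keys_plus_subset[of "Poly_Mapping.single (x, y) (1 :: complex)" "carrier U \<times> carrier V" "Poly_Mapping.single (x, y') 1"]
    by (simp add: pure_add_coset) (simp add: pure_def)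
qed

lemma pure_smult_left:
  assumes "x \<in> carrier U" "y \<in> carrier V"
  shows "pure U V (z \<odot>\<^bsub>U\<^esub> x) y = z \<odot>\<^bsub>tensor U V\<^esub> pure U V x y"
proof -
  have "Poly_Mapping.single (z \<odot>\<^bsub>U\<^esub> x, y) 1 - Poly_Mapping.single (x, y) z \<in> bilinear_rels U V"
    unfolding bilinear_rels_def using assms by blast
  from coset_rel_eq[OF this] show ?thesis
    using assms U by (simp add: pure_smult_coset) (simp add: pure_def)
qed

lemma pure_smult_right:
  assumes "x \<in> carrier U" "y \<in> carrier V"
  shows "pure U V x (z \<odot>\<^bsub>V\<^esub> y) = z \<odot>\<^bsub>tensor U V\<^esub> pure U V x y"
proof -
  have "Poly_Mapping.single (x, z \<odot>\<^bsub>V\<^esub> y) 1 - Poly_Mapping.single (x, y) z \<in> bilinear_rels U V"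
    unfolding bilinear_rels_def using assms by blast
  from coset_rel_eq[OF this] show ?thesis
    using assms V by (simp add: pure_smult_coset) (simp add: pure_def)
qed

lemma pure_lin_left: "y \<in> carrier V \<Longrightarrow> (\<lambda>x. pure U V x y) \<in> linear_maps U (tensor U V)"
  by (rule linear_mapsI) (auto simp: pure_add_left pure_smult_left)

lemma pure_lin_right: "x \<in> carrier U \<Longrightarrow> pure U V x \<in> linear_maps V (tensor U V)"
  by (rule linear_mapsI) (auto simp: pure_add_right pure_smult_right)

lemma pure_zero_left: "y \<in> carrier V \<Longrightarrow> pure U V \<zero>\<^bsub>U\<^esub> y = \<zero>\<^bsub>tensor U V\<^esub>"
  using lin_zero[OF pure_lin_left] U V by auto

lemma pure_zero_right: "x \<in> carrier U \<Longrightarrow> pure U V x \<zero>\<^bsub>V\<^esub> = \<zero>\<^bsub>tensor U V\<^esub>"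
  using lin_zero[OF pure_lin_right] U V by auto

text \<open>A scalar can be absorbed into the first factor of a pure tensor, so the induction needs
  no case for scalar multiples.\<close>

lemma tensor_induct [consumes 1, case_names zero pure add]:
  assumes "t \<in> carrier (tensor U V)" "Q \<zero>\<^bsub>tensor U V\<^esub>"
    "\<And>x y. x \<in> carrier U \<Longrightarrow> y \<in> carrier V \<Longrightarrow> Q (pure U V x y)"
    "\<And>s t. s \<in> carrier (tensor U V) \<Longrightarrow> t \<in> carrier (tensor U V) \<Longrightarrow> Q s \<Longrightarrow> Q t \<Longrightarrow> Q (s \<oplus>\<^bsub>tensor U V\<^esub> t)"
  shows "Q t"
proof -
  let ?F = "monoid_algebra (U \<times>\<times> V)" and ?N = "tensor_null U V"
  have "Q (?N +>\<^bsub>?F\<^esub> f)" if "Poly_Mapping.keys f \<subseteq> carrier (U \<times>\<times> V)" for f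
    using that
  proof (induction rule: poly_mapping_induct_on)
    case zero
    then show ?case
      using coset_zero[OF tensor_null_submodule vspace_monoid_algebra] assms(2) by (simp add: tensor_def)
  next
    case (add k z f)
    obtain x y where k: "k = (x, y)" "x \<in> carrier U" "y \<in> carrier V" using add(1) by auto
    have "?N +>\<^bsub>?F\<^esub> (Poly_Mapping.single k z + f)
      = (?N +>\<^bsub>?F\<^esub> Poly_Mapping.single k z) \<oplus>\<^bsub>tensor U V\<^esub> (?N +>\<^bsub>?F\<^esub> f)"
      unfolding tensor_def
      using add k by (subst coset_add[OF tensor_null_submodule]) auto
    also have "?N +>\<^bsub>?F\<^esub> Poly_Mapping.single k z = pure U V (z \<odot>\<^bsub>U\<^esub> x) y"
      using k U by (simp add: pure_smult_left pure_smult_coset)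
    finally have eq: "?N +>\<^bsub>?F\<^esub> (Poly_Mapping.single k z + f)
      = pure U V (z \<odot>\<^bsub>U\<^esub> x) y \<oplus>\<^bsub>tensor U V\<^esub> (?N +>\<^bsub>?F\<^esub> f)" .
    have "?N +>\<^bsub>?F\<^esub> f \<in> carrier (tensor U V)"
      unfolding tensor_def using coset_closed[OF tensor_null_submodule, of f] add by simp
    then show ?case
      unfolding eq using add k vs_closed(3)[OF U] by (intro assms(3,4) pure_closed) simp_all
  qed
  then show ?thesis using assms(1) by (auto simp: tensor_def quot_simps(1))
qed

lemma tensor_lin_eq:
  assumes "F \<in> linear_maps (tensor U V) P" "G \<in> linear_maps (tensor U V) P" "vspace P"
    "\<And>x y. x \<in> carrier U \<Longrightarrow> y \<in> carrier V \<Longrightarrow> F (pure U V x y) = G (pure U V x y)"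
    "t \<in> carrier (tensor U V)"
  shows "F t = G t"
  using assms(5)
  by (induction rule: tensor_induct)
    (use assms in \<open>auto simp: lin_zero[OF assms(1)] lin_zero[OF assms(2)] lin_add[OF assms(1)] lin_add[OF assms(2)]\<close>)

end

section \<open>Bilinear maps and the universal property of the tensor product\<close>

definition bilin ::
  "(complex, 'u, 'x) module_scheme \<Rightarrow> (complex, 'v, 'y) module_scheme \<Rightarrow> (complex, 'p, 'z) module_scheme
    \<Rightarrow> ('u \<Rightarrow> 'v \<Rightarrow> 'p) \<Rightarrow> bool" where
  "bilin U V P h \<longleftrightarrow> (\<forall>x\<in>carrier U. h x \<in> linear_maps V P) \<and> (\<forall>y\<in>carrier V. (\<lambda>x. h x y) \<in> linear_maps U P)"

lemma bilinI:
  assumes "\<And>x. x \<in> carrier U \<Longrightarrow> h x \<in> linear_maps V P" "\<And>y. y \<in> carrier V \<Longrightarrow> (\<lambda>x. h x y) \<in> linear_maps U P"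
  shows "bilin U V P h"
  using assms by (simp add: bilin_def)

lemma bilinD:
  assumes "bilin U V P h"
  shows "x \<in> carrier U \<Longrightarrow> h x \<in> linear_maps V P" "y \<in> carrier V \<Longrightarrow> (\<lambda>x. h x y) \<in> linear_maps U P"
    "x \<in> carrier U \<Longrightarrow> y \<in> carrier V \<Longrightarrow> h x y \<in> carrier P"
  using assms by (auto simp: bilin_def intro: lin_closed)

context
  fixes U :: "(complex, 'u, 'x) module_scheme" and V :: "(complex, 'v, 'y) module_scheme"
    and P :: "(complex, 'p, 'z) module_scheme" and h
  assumes U: "vspace U" and V: "vspace V" and P: "vspace P" and h: "bilin U V P h"
begin

text \<open>The four families that span \<open>tensor_null\<close> encode the four bilinearity laws,
  so the linear extension of a bilinear map vanishes on each of them. Its kernel is a subspace and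
  therefore contains the span.\<close>

lemma lin_ext_tensor_null:
  assumes "f \<in> tensor_null U V"
  shows "lin_ext P (case_prod h) f = \<zero>\<^bsub>P\<^esub>"
proof -
  let ?L = "lin_ext P (case_prod h)" and ?F = "monoid_algebra (U \<times>\<times> V)"
  note hc = bilinD(3)[OF h]
  have L: "?L \<in> linear_maps ?F P"
    by (rule lin_ext_linear[OF P]) (auto intro: hc)
  have single: "?L (Poly_Mapping.single (x, y) z) = z \<odot>\<^bsub>P\<^esub> h x y"
    if "x \<in> carrier U" "y \<in> carrier V" for x y z
    using lin_ext_single[OF P, of "case_prod h" "(x, y)"] hc[OF that] by simp
  have diff: "?L (f - g) = ?L f \<oplus>\<^bsub>P\<^esub> (- 1) \<odot>\<^bsub>P\<^esub> ?L g"
    if "f \<in> carrier ?F" "g \<in> carrier ?F" for f g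
    using lin_add[OF L that(1), of "- g"] lin_smult[OF L that(2), of "- 1"] that
    by (auto simp: pm_scale_minus_one)
  have "?L f = \<zero>\<^bsub>P\<^esub>" if "f \<in> bilinear_rels U V" for f
  proof -
    have K: "Poly_Mapping.single k z - Poly_Mapping.single k' z' \<in> carrier ?F"
      if "k \<in> carrier (U \<times>\<times> V)" "k' \<in> carrier (U \<times>\<times> V)" for k k' z z'
      using keys_diff[of "Poly_Mapping.single k z" "Poly_Mapping.single k' z'"] that by (auto split: if_splits)
    have Z: "a \<oplus>\<^bsub>P\<^esub> (- 1) \<odot>\<^bsub>P\<^esub> a = \<zero>\<^bsub>P\<^esub>" if "a \<in> carrier P" for a
      using vs_diff_eq_zero[OF P that that] by simp
    have Z': "(a \<oplus>\<^bsub>P\<^esub> b \<oplus>\<^bsub>P\<^esub> (- 1) \<odot>\<^bsub>P\<^esub> a) \<oplus>\<^bsub>P\<^esub> (- 1) \<odot>\<^bsub>P\<^esub> b = \<zero>\<^bsub>P\<^esub>"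
      if "a \<in> carrier P" "b \<in> carrier P" for a b
    proof -
      have "(a \<oplus>\<^bsub>P\<^esub> b \<oplus>\<^bsub>P\<^esub> (- 1) \<odot>\<^bsub>P\<^esub> a) \<oplus>\<^bsub>P\<^esub> (- 1) \<odot>\<^bsub>P\<^esub> b
        = (a \<oplus>\<^bsub>P\<^esub> (- 1) \<odot>\<^bsub>P\<^esub> a) \<oplus>\<^bsub>P\<^esub> (b \<oplus>\<^bsub>P\<^esub> (- 1) \<odot>\<^bsub>P\<^esub> b)"
        using that P by (simp add: vs_ac[OF P])
      then show ?thesis using Z that P by simp
    qed
    note hl = lin_add[OF bilinD(1)[OF h]] lin_smult[OF bilinD(1)[OF h]]
      lin_add[OF bilinD(2)[OF h]] lin_smult[OF bilinD(2)[OF h]]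
    show ?thesis
      using that U V P hc unfolding bilinear_rels_def
      by (auto simp: diff K[simplified] single hl Z Z')
  qed
  then have "tensor_null U V \<subseteq> {f \<in> carrier ?F. ?L f = \<zero>\<^bsub>P\<^esub>}"
    unfolding tensor_null_def
    by (intro lin_span_minimal lin_kernel_submodule[OF L _ P] vspace_monoid_algebra)
      (use bilinear_rels_subset[OF U V] in blast)
  then show ?thesis using assms by auto
qed

lemma tensor_lift_linear: "induced P (case_prod h) \<in> linear_maps (tensor U V) P"
  unfolding tensor_def
  by (rule induced_linear[OF P _ tensor_null_submodule[OF U V] lin_ext_tensor_null])
    (auto intro: bilinD(3)[OF h])

lemma tensor_lift_pure:
  assumes "x \<in> carrier U" "y \<in> carrier V"
  shows "induced P (case_prod h) (pure U V x y) = h x y"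
proof -
  have "induced P (case_prod h) (pure U V x y) = lin_ext P (case_prod h) (Poly_Mapping.single (x, y) 1)"
    unfolding pure_def
    by (rule induced_coset[OF P _ tensor_null_submodule[OF U V] lin_ext_tensor_null])
      (use assms in \<open>auto intro: bilinD(3)[OF h]\<close>)
  also have "\<dots> = h x y"
    using assms P bilinD(3)[OF h] by (simp add: lin_ext_single)
  finally show ?thesis .
qed

end

lemma bilin_pure: "vspace U \<Longrightarrow> vspace V \<Longrightarrow> bilin U V (tensor U V) (pure U V)"
  by (intro bilinI pure_lin_left pure_lin_right)

lemma bilin_comp:
  assumes "bilin U V P h" "f \<in> linear_maps S U" "g \<in> linear_maps T V" "k \<in> linear_maps P Q"
  shows "bilin S T Q (\<lambda>x y. k (h (f x) (g y)))"
  using assms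
  by (intro bilinI lin_comp[OF lin_comp[OF assms(3) bilinD(1)[OF assms(1)]] assms(4)]
      lin_comp[OF lin_comp[OF assms(2) bilinD(2)[OF assms(1)]] assms(4)])
    (auto intro: lin_closed[OF assms(2)] lin_closed[OF assms(3)])

lemma bilin_pure_comp:
  assumes "f \<in> linear_maps S U" "g \<in> linear_maps T V" "vspace U" "vspace V"
  shows "bilin S T (tensor U V) (\<lambda>x y. pure U V (f x) (g y))"
  using bilin_comp[OF bilin_pure assms(1,2) lin_id(1)] assms by simp

context
  fixes S :: "(complex, 's, 'x) module_scheme" and T :: "(complex, 't, 'y) module_scheme"
    and U :: "(complex, 'u, 'z) module_scheme" and V :: "(complex, 'v, 'w) module_scheme" and f g
  assumes S: "vspace S" and T: "vspace T" and U: "vspace U" and V: "vspace V"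
    and f: "f \<in> linear_maps S U" and g: "g \<in> linear_maps T V"
begin

lemma tensor_map_linear: "tensor_map U V f g \<in> linear_maps (tensor S T) (tensor U V)"
  unfolding tensor_map_def
  by (rule tensor_lift_linear[OF S T vspace_tensor[OF U V] bilin_pure_comp[OF f g U V]])

lemma tensor_map_pure:
  "x \<in> carrier S \<Longrightarrow> y \<in> carrier T \<Longrightarrow> tensor_map U V f g (pure S T x y) = pure U V (f x) (g y)"
  unfolding tensor_map_def
  by (rule tensor_lift_pure[OF S T vspace_tensor[OF U V] bilin_pure_comp[OF f g U V]])

end

context
  fixes U :: "(complex, 'u, 'x) module_scheme" and V :: "(complex, 'v, 'y) module_scheme"
    and W :: "(complex, 'w, 'z) module_scheme"
  assumes U: "vspace U" and V: "vspace V" and W: "vspace W"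
begin

lemma tensor_assoc_inner:
  assumes z: "z \<in> carrier W"
  shows "bilin U V (tensor U (tensor V W)) (\<lambda>x y. pure U (tensor V W) x (pure V W y z))"
  using bilin_pure_comp[OF lin_id(1) pure_lin_left[OF V W z] U vspace_tensor[OF V W]] .

text \<open>The universal property is used twice: for fixed \<open>z\<close> it produces the inner
  map, whose linear dependence on \<open>z\<close> is then verified on pure tensors.\<close>

lemma tensor_assoc_bilin:
  "bilin (tensor U V) W (tensor U (tensor V W)) (\<lambda>t z. induced (tensor U (tensor V W))
     (\<lambda>(x, y). pure U (tensor V W) x (pure V W y z)) t)"
proof (rule bilinI)
  let ?P = "tensor U (tensor V W)"
  let ?I = "\<lambda>z. induced ?P (\<lambda>(x, y). pure U (tensor V W) x (pure V W y z))"
  have P: "vspace ?P" and VW: "vspace (tensor V W)" and UV: "vspace (tensor U V)" using U V W by auto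
  note lin = tensor_lift_linear[OF U V P tensor_assoc_inner]
    and val = tensor_lift_pure[OF U V P tensor_assoc_inner]
  show "?I z \<in> linear_maps (tensor U V) ?P" if "z \<in> carrier W" for z
    by (rule lin[OF that])
  show "(\<lambda>z. ?I z t) \<in> linear_maps W ?P" if t: "t \<in> carrier (tensor U V)" for t
  proof (rule linear_mapsI)
    fix z w assume zw: "z \<in> carrier W" "w \<in> carrier W"
    show "?I (z \<oplus>\<^bsub>W\<^esub> w) t = ?I z t \<oplus>\<^bsub>?P\<^esub> ?I w t"
      by (rule tensor_lin_eq[OF U V lin lin_add_fun[OF lin lin P] P _ t])
        (use zw U V W VW P in \<open>auto simp: val pure_add_right\<close>)
  next
    fix c w assume w: "w \<in> carrier W"
    show "?I (c \<odot>\<^bsub>W\<^esub> w) t = c \<odot>\<^bsub>?P\<^esub> ?I w t"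
      by (rule tensor_lin_eq[OF U V lin lin_smult_fun[OF lin P] P _ t])
        (use w U V W VW P in \<open>auto simp: val pure_smult_right\<close>)
  qed (use lin_closed[OF lin t] in auto)
qed

lemma tensor_assoc_linear:
  "tensor_assoc U V W \<in> linear_maps (tensor (tensor U V) W) (tensor U (tensor V W))"
  unfolding tensor_assoc_def
  by (rule tensor_lift_linear[OF _ W _ tensor_assoc_bilin]) (use U V W in auto)

lemma tensor_assoc_pure:
  assumes "x \<in> carrier U" "y \<in> carrier V" "z \<in> carrier W"
  shows "tensor_assoc U V W (pure (tensor U V) W (pure U V x y) z) = pure U (tensor V W) x (pure V W y z)"
proof -
  have "vspace (tensor U V)" "vspace (tensor U (tensor V W))" using U V W by auto
  then show ?thesis
    unfolding tensor_assoc_def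
    using tensor_lift_pure[OF _ W _ tensor_assoc_bilin, of "pure U V x y" z]
      tensor_lift_pure[OF U V _ tensor_assoc_inner[OF assms(3)], of x y] assms U V by simp
qed

end

text \<open>This is id \<otimes> \<psi> followed by the identification of H \<otimes> C with H. With
  a coordinate functional for \<psi> it extracts one coefficient of a tensor.\<close>

definition slice_right :: "(complex, 'h, 'x) module_scheme \<Rightarrow> ('u \<Rightarrow> complex) \<Rightarrow> ('h \<times> 'u \<Rightarrow>\<^sub>0 complex) set \<Rightarrow> 'h" where
  "slice_right H \<psi> = induced H (\<lambda>(x, u). \<psi> u \<odot>\<^bsub>H\<^esub> x)"

text \<open>This is \<chi> \<otimes> id. Composed with a coaction it lets a functional on the
  coalgebra act on the comodule.\<close>

definition slice_left :: "(complex, 'u, 'x) module_scheme \<Rightarrow> ('h \<Rightarrow> complex) \<Rightarrow> ('h \<times> 'u \<Rightarrow>\<^sub>0 complex) set \<Rightarrow> 'u" where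
  "slice_left U \<chi> = induced U (\<lambda>(x, u). \<chi> x \<odot>\<^bsub>U\<^esub> u)"

context
  fixes H :: "(complex, 'h, 'x) module_scheme" and U :: "(complex, 'u, 'y) module_scheme"
  assumes H: "vspace H" and U: "vspace U"
begin

lemma slice_right_bilin:
  assumes "\<psi> \<in> linear_maps U CC"
  shows "bilin H U H (\<lambda>x u. \<psi> u \<odot>\<^bsub>H\<^esub> x)"
  using assms H by (intro bilinI lin_functional_smult lin_smult_fun[OF lin_id(1)])

lemma slice_left_bilin:
  assumes "\<chi> \<in> linear_maps H CC"
  shows "bilin H U U (\<lambda>x u. \<chi> x \<odot>\<^bsub>U\<^esub> u)"
  using assms U by (intro bilinI lin_functional_smult lin_smult_fun[OF lin_id(1)])

lemma slice_right_linear: "\<psi> \<in> linear_maps U CC \<Longrightarrow> slice_right H \<psi> \<in> linear_maps (tensor H U) H"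
  unfolding slice_right_def by (rule tensor_lift_linear[OF H U H slice_right_bilin])

lemma slice_right_pure:
  "\<psi> \<in> linear_maps U CC \<Longrightarrow> x \<in> carrier H \<Longrightarrow> u \<in> carrier U \<Longrightarrow> slice_right H \<psi> (pure H U x u) = \<psi> u \<odot>\<^bsub>H\<^esub> x"
  unfolding slice_right_def by (rule tensor_lift_pure[OF H U H slice_right_bilin])

lemma slice_left_linear: "\<chi> \<in> linear_maps H CC \<Longrightarrow> slice_left U \<chi> \<in> linear_maps (tensor H U) U"
  unfolding slice_left_def by (rule tensor_lift_linear[OF H U U slice_left_bilin])

lemma slice_left_pure:
  "\<chi> \<in> linear_maps H CC \<Longrightarrow> x \<in> carrier H \<Longrightarrow> u \<in> carrier U \<Longrightarrow> slice_left U \<chi> (pure H U x u) = \<chi> x \<odot>\<^bsub>U\<^esub> u"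
  unfolding slice_left_def by (rule tensor_lift_pure[OF H U U slice_left_bilin])

end

section \<open>Associative algebras\<close>

definition calgebra :: "(complex, 'b, 'x) module_scheme \<Rightarrow> bool" where
  "calgebra B \<longleftrightarrow> vspace B \<and> monoid B \<and> bilin B B B (\<otimes>\<^bsub>B\<^esub>)"

definition algebra_hom ::
  "(complex, 'a, 'x) module_scheme \<Rightarrow> (complex, 'b, 'y) module_scheme \<Rightarrow> ('a \<Rightarrow> 'b) \<Rightarrow> bool" where
  "algebra_hom A B f \<longleftrightarrow> f \<in> linear_maps A B \<and> f \<one>\<^bsub>A\<^esub> = \<one>\<^bsub>B\<^esub> \<and>
     (\<forall>x\<in>carrier A. \<forall>y\<in>carrier A. f (x \<otimes>\<^bsub>A\<^esub> y) = f x \<otimes>\<^bsub>B\<^esub> f y)"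

context
  fixes B :: "(complex, 'b, 'x) module_scheme" (structure)
  assumes B: "calgebra B"
begin

lemma alg_vspace [simp]: "vspace B"
  and alg_monoid: "monoid B"
  and alg_bilin: "bilin B B B (\<otimes>\<^bsub>B\<^esub>)"
  using B by (auto simp: calgebra_def)

lemma alg_closed [simp]:
  "x \<in> carrier B \<Longrightarrow> y \<in> carrier B \<Longrightarrow> x \<otimes> y \<in> carrier B" "\<one> \<in> carrier B"
  "x \<in> carrier B \<Longrightarrow> x [^] (n :: nat) \<in> carrier B"
  by (rule monoid.m_closed[OF alg_monoid] monoid.one_closed[OF alg_monoid] monoid.nat_pow_closed[OF alg_monoid]; assumption)+

lemma alg_one [simp]: "x \<in> carrier B \<Longrightarrow> \<one> \<otimes> x = x" "x \<in> carrier B \<Longrightarrow> x \<otimes> \<one> = x"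
  by (rule monoid.l_one[OF alg_monoid] monoid.r_one[OF alg_monoid]; assumption)+

lemma alg_assoc:
  "x \<in> carrier B \<Longrightarrow> y \<in> carrier B \<Longrightarrow> z \<in> carrier B \<Longrightarrow> (x \<otimes> y) \<otimes> z = x \<otimes> (y \<otimes> z)"
  by (rule monoid.m_assoc[OF alg_monoid])

lemma alg_lin:
  "x \<in> carrier B \<Longrightarrow> (\<lambda>y. x \<otimes> y) \<in> linear_maps B B" "y \<in> carrier B \<Longrightarrow> (\<lambda>x. x \<otimes> y) \<in> linear_maps B B"
  by (rule bilinD(1)[OF alg_bilin] bilinD(2)[OF alg_bilin]; assumption)+

lemma alg_distrib:
  assumes "x \<in> carrier B" "y \<in> carrier B" "z \<in> carrier B"
  shows "x \<otimes> (y \<oplus> z) = x \<otimes> y \<oplus> x \<otimes> z" "(x \<oplus> y) \<otimes> z = x \<otimes> z \<oplus> y \<otimes> z"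
  using lin_add[OF alg_lin(1)[OF assms(1)] assms(2,3)] lin_add[OF alg_lin(2)[OF assms(3)] assms(1,2)] .

lemma alg_smult:
  assumes "x \<in> carrier B" "y \<in> carrier B"
  shows "x \<otimes> (c \<odot> y) = c \<odot> (x \<otimes> y)" "(c \<odot> x) \<otimes> y = c \<odot> (x \<otimes> y)"
  using lin_smult[OF alg_lin(1)[OF assms(1)] assms(2)] lin_smult[OF alg_lin(2)[OF assms(2)] assms(1)] .

lemma alg_zero [simp]: "x \<in> carrier B \<Longrightarrow> x \<otimes> \<zero> = \<zero>" "x \<in> carrier B \<Longrightarrow> \<zero> \<otimes> x = \<zero>"
  using lin_zero[OF alg_lin(1) alg_vspace alg_vspace] lin_zero[OF alg_lin(2) alg_vspace alg_vspace] by blast+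

lemma alg_finsum:
  assumes "finite I" "\<And>i. i \<in> I \<Longrightarrow> f i \<in> carrier B" "x \<in> carrier B"
  shows "x \<otimes> finsum B f I = finsum B (\<lambda>i. x \<otimes> f i) I" "finsum B f I \<otimes> x = finsum B (\<lambda>i. f i \<otimes> x) I"
  by (rule lin_finsum[OF alg_lin(1)[OF assms(3)] alg_vspace alg_vspace assms(1,2)]
      lin_finsum[OF alg_lin(2)[OF assms(3)] alg_vspace alg_vspace assms(1,2)]; assumption)+

lemma alg_pow [simp]: "x [^] (0 :: nat) = \<one>" "x \<in> carrier B \<Longrightarrow> x [^] (1 :: nat) = x"
  by (simp, rule monoid.nat_pow_eone[OF alg_monoid])

lemma alg_pow_Suc:
  assumes "x \<in> carrier B"
  shows "x [^] Suc n = x [^] n \<otimes> x" "x [^] Suc n = x \<otimes> x [^] n"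
  by (simp, rule monoid.nat_pow_Suc2[OF alg_monoid assms])

lemma alg_pow_add: "x \<in> carrier B \<Longrightarrow> x [^] (m + n :: nat) = x [^] m \<otimes> x [^] n"
  by (rule monoid.nat_pow_mult[OF alg_monoid, symmetric])

lemma alg_pow_pow: "x \<in> carrier B \<Longrightarrow> (x [^] m) [^] n = x [^] (m * n :: nat)"
  by (rule monoid.nat_pow_pow[OF alg_monoid])

lemma alg_ring: "ring B"
  by (rule ringI) (auto simp: vs_abelian_group alg_monoid alg_distrib)

end

lemma calgebraI:
  assumes "vspace B" "bilin B B B (\<otimes>\<^bsub>B\<^esub>)" "\<one>\<^bsub>B\<^esub> \<in> carrier B"
    "\<And>x. x \<in> carrier B \<Longrightarrow> \<one>\<^bsub>B\<^esub> \<otimes>\<^bsub>B\<^esub> x = x" "\<And>x. x \<in> carrier B \<Longrightarrow> x \<otimes>\<^bsub>B\<^esub> \<one>\<^bsub>B\<^esub> = x"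
    "\<And>x y z. x \<in> carrier B \<Longrightarrow> y \<in> carrier B \<Longrightarrow> z \<in> carrier B \<Longrightarrow> (x \<otimes>\<^bsub>B\<^esub> y) \<otimes>\<^bsub>B\<^esub> z = x \<otimes>\<^bsub>B\<^esub> (y \<otimes>\<^bsub>B\<^esub> z)"
  shows "calgebra B"
  unfolding calgebra_def
proof (intro conjI)
  show "monoid B"
    by (rule monoidI) (use assms bilinD(3)[OF assms(2)] in auto)
qed (use assms in auto)

lemma calgebra_CC [simp]: "calgebra CC"
  by (rule calgebraI) (auto intro!: bilinI linear_mapsI simp: algebra_simps)

lemma algebra_homD:
  assumes "algebra_hom A B f"
  shows "f \<in> linear_maps A B" "f \<one>\<^bsub>A\<^esub> = \<one>\<^bsub>B\<^esub>"
    "x \<in> carrier A \<Longrightarrow> y \<in> carrier A \<Longrightarrow> f (x \<otimes>\<^bsub>A\<^esub> y) = f x \<otimes>\<^bsub>B\<^esub> f y"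
  using assms by (auto simp: algebra_hom_def)

lemma algebra_hom_pow:
  assumes "algebra_hom A B f" "calgebra A" "calgebra B" "x \<in> carrier A"
  shows "f (x [^]\<^bsub>A\<^esub> n) = f x [^]\<^bsub>B\<^esub> (n :: nat)"
  using assms(2-4) lin_closed[OF algebra_homD(1)[OF assms(1)]]
  by (induction n) (simp_all add: algebra_homD[OF assms(1)] alg_pow_Suc)


subsection \<open>Monoid algebras\<close>

text \<open>The product of formal combinations sums over supports. Enlarging the index sets allows
  products whose factors have different supports to be added.\<close>

lemma lookup_sum_double:
  "(\<Sum>x\<in>Poly_Mapping.keys f. \<Sum>y\<in>Poly_Mapping.keys g. Poly_Mapping.single (m x y) (Poly_Mapping.lookup f x * Poly_Mapping.lookup g y))
   = (\<Sum>x\<in>X1. \<Sum>y\<in>Y1. Poly_Mapping.single (m x y) (Poly_Mapping.lookup f x * Poly_Mapping.lookup g y))"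
  if "finite X1" "finite Y1" "Poly_Mapping.keys f \<subseteq> X1" "Poly_Mapping.keys g \<subseteq> Y1"
  for f :: "'a \<Rightarrow>\<^sub>0 complex" and g :: "'b \<Rightarrow>\<^sub>0 complex"
proof -
  have "(\<Sum>y\<in>Poly_Mapping.keys g. Poly_Mapping.single (m x y) (Poly_Mapping.lookup f x * Poly_Mapping.lookup g y))
    = (\<Sum>y\<in>Y1. Poly_Mapping.single (m x y) (Poly_Mapping.lookup f x * Poly_Mapping.lookup g y))" for x
    using that by (intro sum.mono_neutral_left) (auto simp: in_keys_iff)
  moreover have "(\<Sum>x\<in>Poly_Mapping.keys f. \<Sum>y\<in>Y1. Poly_Mapping.single (m x y) (Poly_Mapping.lookup f x * Poly_Mapping.lookup g y))
    = (\<Sum>x\<in>X1. \<Sum>y\<in>Y1. Poly_Mapping.single (m x y) (Poly_Mapping.lookup f x * Poly_Mapping.lookup g y))"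
    using that by (intro sum.mono_neutral_left) (auto simp: in_keys_iff)
  ultimately show ?thesis by simp
qed

context
  fixes G :: "('s, 'x) monoid_scheme"
  assumes G: "monoid G"
begin

lemma monoid_algebra_mult:
  assumes "finite A" "finite A'" "Poly_Mapping.keys f \<subseteq> A" "Poly_Mapping.keys g \<subseteq> A'"
  shows "f \<otimes>\<^bsub>monoid_algebra G\<^esub> g = (\<Sum>x\<in>A. \<Sum>y\<in>A'.
     Poly_Mapping.single (x \<otimes>\<^bsub>G\<^esub> y) (Poly_Mapping.lookup f x * Poly_Mapping.lookup g y))"
  using lookup_sum_double[OF assms] by (simp add: monoid_algebra_def)

lemma monoid_algebra_mult_single:
  "Poly_Mapping.single x z \<otimes>\<^bsub>monoid_algebra G\<^esub> Poly_Mapping.single y w = Poly_Mapping.single (x \<otimes>\<^bsub>G\<^esub> y) (z * w)"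
  using monoid_algebra_mult[of "{x}" "{y}" "Poly_Mapping.single x z" "Poly_Mapping.single y w"] by simp

lemma monoid_algebra_mult_closed:
  assumes "Poly_Mapping.keys f \<subseteq> carrier G" "Poly_Mapping.keys g \<subseteq> carrier G"
  shows "Poly_Mapping.keys (f \<otimes>\<^bsub>monoid_algebra G\<^esub> g) \<subseteq> carrier G"
proof -
  have "Poly_Mapping.keys (\<Sum>x\<in>A. F x) \<subseteq> carrier G"
    if "\<And>x. x \<in> A \<Longrightarrow> Poly_Mapping.keys (F x) \<subseteq> carrier G" for A and F :: "'s \<Rightarrow> 's \<Rightarrow>\<^sub>0 complex"
    using keys_sum[of F A] that by blast
  note sum = this
  have "Poly_Mapping.keys (Poly_Mapping.single (x \<otimes>\<^bsub>G\<^esub> y) z) \<subseteq> carrier G"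
    if "x \<in> Poly_Mapping.keys f" "y \<in> Poly_Mapping.keys g" for x y and z :: complex
    using that assms monoid.m_closed[OF G, of x y] by auto
  then show ?thesis
    unfolding monoid_algebra_def by (simp only: monoid.simps) (intro sum)
qed

lemma monoid_algebra_mult_bilin:
  "bilin (monoid_algebra G) (monoid_algebra G) (monoid_algebra G) (\<otimes>\<^bsub>monoid_algebra G\<^esub>)"
proof -
  let ?F = "monoid_algebra G" and ?K = Poly_Mapping.keys
  have add1: "f \<otimes>\<^bsub>?F\<^esub> (g + h) = f \<otimes>\<^bsub>?F\<^esub> g + f \<otimes>\<^bsub>?F\<^esub> h" for f g h
  proof -
    let ?A = "?K g \<union> ?K h"
    have *: "finite ?A" "?K g \<subseteq> ?A" "?K h \<subseteq> ?A" "?K (g + h) \<subseteq> ?A" "finite (?K f)" "?K f \<subseteq> ?K f"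
      using Poly_Mapping.keys_add[of g h] by auto
    show ?thesis
      unfolding monoid_algebra_mult[OF *(5,1,6,2)] monoid_algebra_mult[OF *(5,1,6,3)] monoid_algebra_mult[OF *(5,1,6,4)]
      by (simp add: lookup_add algebra_simps single_add sum.distrib)
  qed
  have add2: "(g + h) \<otimes>\<^bsub>?F\<^esub> f = g \<otimes>\<^bsub>?F\<^esub> f + h \<otimes>\<^bsub>?F\<^esub> f" for f g h
  proof -
    let ?A = "?K g \<union> ?K h"
    have *: "finite ?A" "?K g \<subseteq> ?A" "?K h \<subseteq> ?A" "?K (g + h) \<subseteq> ?A" "finite (?K f)" "?K f \<subseteq> ?K f"
      using Poly_Mapping.keys_add[of g h] by auto
    show ?thesis
      unfolding monoid_algebra_mult[OF *(1,5,2,6)] monoid_algebra_mult[OF *(1,5,3,6)] monoid_algebra_mult[OF *(1,5,4,6)]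
      by (simp add: lookup_add algebra_simps single_add sum.distrib)
  qed
  have scale_sum: "pm_scale z (sum F A) = (\<Sum>x\<in>A. pm_scale z (F x))" for z and F :: "'s \<Rightarrow> 's \<Rightarrow>\<^sub>0 complex" and A
    by (rule poly_mapping_eqI) (simp add: lookup_sum sum_distrib_left)
  have scale1: "f \<otimes>\<^bsub>?F\<^esub> pm_scale z g = pm_scale z (f \<otimes>\<^bsub>?F\<^esub> g)" for f g z
    unfolding monoid_algebra_mult[OF finite_keys finite_keys subset_refl subset_refl, of f g]
      monoid_algebra_mult[OF finite_keys finite_keys subset_refl keys_pm_scale]
    by (simp add: scale_sum mult.left_commute)
  have scale2: "pm_scale z f \<otimes>\<^bsub>?F\<^esub> g = pm_scale z (f \<otimes>\<^bsub>?F\<^esub> g)" for f g z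
    unfolding monoid_algebra_mult[OF finite_keys finite_keys subset_refl subset_refl, of f g]
      monoid_algebra_mult[OF finite_keys finite_keys keys_pm_scale subset_refl]
    by (simp add: scale_sum mult.assoc)
  show ?thesis
    by (intro bilinI linear_mapsI)
      (simp_all add: add1 add2 scale1 scale2 monoid_algebra_mult_closed)
qed

text \<open>Associativity holds on basis elements by the monoid law and is extended by linearity in
  one factor after the other.\<close>

lemma calgebra_monoid_algebra: "calgebra (monoid_algebra G)"
proof (rule calgebraI[OF vspace_monoid_algebra monoid_algebra_mult_bilin])
  let ?F = "monoid_algebra G"
  note lin = bilinD(1)[OF monoid_algebra_mult_bilin] bilinD(2)[OF monoid_algebra_mult_bilin]
  have s: "Poly_Mapping.single k 1 \<in> carrier ?F" if "k \<in> carrier G" for k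
    using that by simp
  show one: "\<one>\<^bsub>?F\<^esub> \<in> carrier ?F" using monoid.one_closed[OF G] by simp
  show "\<one>\<^bsub>?F\<^esub> \<otimes>\<^bsub>?F\<^esub> f = f" if "f \<in> carrier ?F" for f
    by (rule monoid_algebra_lin_eq[OF lin(1)[OF one] lin_id(1) vspace_monoid_algebra])
      (use that monoid.l_one[OF G] in \<open>simp_all add: monoid_algebra_mult_single\<close>)
  show "f \<otimes>\<^bsub>?F\<^esub> \<one>\<^bsub>?F\<^esub> = f" if "f \<in> carrier ?F" for f
    by (rule monoid_algebra_lin_eq[OF lin(2)[OF one] lin_id(1) vspace_monoid_algebra])
      (use that monoid.r_one[OF G] in \<open>simp_all add: monoid_algebra_mult_single\<close>)
  have a1: "(Poly_Mapping.single k 1 \<otimes>\<^bsub>?F\<^esub> Poly_Mapping.single k' 1) \<otimes>\<^bsub>?F\<^esub> f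
     = Poly_Mapping.single k 1 \<otimes>\<^bsub>?F\<^esub> (Poly_Mapping.single k' 1 \<otimes>\<^bsub>?F\<^esub> f)"
    if "k \<in> carrier G" "k' \<in> carrier G" "f \<in> carrier ?F" for k k' f
  proof (rule monoid_algebra_lin_eq[OF lin(1) lin_comp[OF lin(1) lin(1)] vspace_monoid_algebra])
    show "(Poly_Mapping.single k 1 \<otimes>\<^bsub>?F\<^esub> Poly_Mapping.single k' 1) \<in> carrier ?F"
      using that monoid.m_closed[OF G, of k k'] by (simp add: monoid_algebra_mult_single)
  qed (use that s monoid.m_assoc[OF G] in \<open>simp_all add: monoid_algebra_mult_single\<close>)
  have a2: "(Poly_Mapping.single k 1 \<otimes>\<^bsub>?F\<^esub> g) \<otimes>\<^bsub>?F\<^esub> f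
     = Poly_Mapping.single k 1 \<otimes>\<^bsub>?F\<^esub> (g \<otimes>\<^bsub>?F\<^esub> f)"
    if "k \<in> carrier G" "g \<in> carrier ?F" "f \<in> carrier ?F" for k g f
    by (rule monoid_algebra_lin_eq[OF lin_comp[OF lin(1) lin(2)] lin_comp[OF lin(2) lin(1)] vspace_monoid_algebra])
      (use that s a1 in simp_all)
  show "(h \<otimes>\<^bsub>?F\<^esub> g) \<otimes>\<^bsub>?F\<^esub> f = h \<otimes>\<^bsub>?F\<^esub> (g \<otimes>\<^bsub>?F\<^esub> f)"
    if "h \<in> carrier ?F" "g \<in> carrier ?F" "f \<in> carrier ?F" for h g f
    by (rule monoid_algebra_lin_eq[OF lin_comp[OF lin(2) lin(2)] lin(2) vspace_monoid_algebra])
      (use that a2 monoid_algebra_mult_closed in simp_all)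
qed

end


subsection \<open>Quotient algebras\<close>

definition two_sided :: "(complex, 'b, 'x) module_scheme \<Rightarrow> 'b set \<Rightarrow> bool" where
  "two_sided B N \<longleftrightarrow> submodule N CC B \<and>
     (\<forall>x\<in>carrier B. \<forall>y\<in>N. x \<otimes>\<^bsub>B\<^esub> y \<in> N \<and> y \<otimes>\<^bsub>B\<^esub> x \<in> N)"

lemma two_sided_ideal:
  assumes "calgebra B" "two_sided B N"
  shows "ideal N B"
  using assms submodule_abelian_subgroup[of N B] alg_ring[of B]
  by (auto simp: two_sided_def ideal_def ideal_axioms_def abelian_subgroup_def)

context
  fixes B :: "(complex, 'b, 'x) module_scheme" and N
  assumes B: "calgebra B" and N: "two_sided B N"
begin

lemma two_sidedD: "submodule N CC B" "x \<in> carrier B \<Longrightarrow> y \<in> N \<Longrightarrow> x \<otimes>\<^bsub>B\<^esub> y \<in> N"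
  "x \<in> carrier B \<Longrightarrow> y \<in> N \<Longrightarrow> y \<otimes>\<^bsub>B\<^esub> x \<in> N"
  using N by (auto simp: two_sided_def)

lemma coset_mult:
  assumes "x \<in> carrier B" "y \<in> carrier B"
  shows "(N +>\<^bsub>B\<^esub> x) \<otimes>\<^bsub>quot B N\<^esub> (N +>\<^bsub>B\<^esub> y) = N +>\<^bsub>B\<^esub> (x \<otimes>\<^bsub>B\<^esub> y)"
  using ideal.rcoset_mult_add[OF two_sided_ideal[OF B N] assms] by (simp only: quot_simps(5))

lemma calgebra_quot: "calgebra (quot B N)"
proof -
  note sub = two_sidedD(1)
  have V: "vspace B" using B by simp
  note closed = vs_closed[OF V] alg_closed[OF B]
  note C = coset_cases[OF sub V]
  have mc: "S \<otimes>\<^bsub>quot B N\<^esub> S' \<in> carrier (quot B N)"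
    if "S \<in> carrier (quot B N)" "S' \<in> carrier (quot B N)" for S S'
    using that by (elim C) (simp add: coset_mult coset_closed[OF sub V] closed)
  show ?thesis
  proof (rule calgebraI)
    show "vspace (quot B N)" by (rule vspace_quot[OF sub V])
    show "bilin (quot B N) (quot B N) (quot B N) (\<otimes>\<^bsub>quot B N\<^esub>)"
    proof (intro bilinI linear_mapsI mc)
      fix S S' S'' z assume S: "S \<in> carrier (quot B N)" "S' \<in> carrier (quot B N)"
      show "S \<otimes>\<^bsub>quot B N\<^esub> (z \<odot>\<^bsub>quot B N\<^esub> S') = z \<odot>\<^bsub>quot B N\<^esub> (S \<otimes>\<^bsub>quot B N\<^esub> S')"
        "(z \<odot>\<^bsub>quot B N\<^esub> S') \<otimes>\<^bsub>quot B N\<^esub> S = z \<odot>\<^bsub>quot B N\<^esub> (S' \<otimes>\<^bsub>quot B N\<^esub> S)"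
        using S by (elim C; simp add: coset_mult coset_smult[OF sub V] closed alg_smult[OF B])+
      assume S'': "S'' \<in> carrier (quot B N)"
      show "S \<otimes>\<^bsub>quot B N\<^esub> (S' \<oplus>\<^bsub>quot B N\<^esub> S'') = S \<otimes>\<^bsub>quot B N\<^esub> S' \<oplus>\<^bsub>quot B N\<^esub> S \<otimes>\<^bsub>quot B N\<^esub> S''"
        "(S' \<oplus>\<^bsub>quot B N\<^esub> S'') \<otimes>\<^bsub>quot B N\<^esub> S = S' \<otimes>\<^bsub>quot B N\<^esub> S \<oplus>\<^bsub>quot B N\<^esub> S'' \<otimes>\<^bsub>quot B N\<^esub> S"
        using S S'' by (elim C; simp add: coset_mult coset_add[OF sub V] closed alg_distrib[OF B])+
    qed
    show "\<one>\<^bsub>quot B N\<^esub> \<in> carrier (quot B N)"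
      unfolding quot_simps(3) by (rule coset_closed[OF sub V]) (simp add: closed)
    show "\<one>\<^bsub>quot B N\<^esub> \<otimes>\<^bsub>quot B N\<^esub> S = S" "S \<otimes>\<^bsub>quot B N\<^esub> \<one>\<^bsub>quot B N\<^esub> = S" if "S \<in> carrier (quot B N)" for S
      using that by (elim C; simp add: quot_simps(3) coset_mult closed alg_one[OF B])+
    show "(S \<otimes>\<^bsub>quot B N\<^esub> S') \<otimes>\<^bsub>quot B N\<^esub> S'' = S \<otimes>\<^bsub>quot B N\<^esub> (S' \<otimes>\<^bsub>quot B N\<^esub> S'')"
      if "S \<in> carrier (quot B N)" "S' \<in> carrier (quot B N)" "S'' \<in> carrier (quot B N)" for S S' S''
      using that by (elim C; simp add: coset_mult closed alg_assoc[OF B])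
  qed
qed

end


subsection \<open>Tensor products of algebras\<close>

context
  fixes A :: "(complex, 'a, 'x) module_scheme" and B :: "(complex, 'b, 'y) module_scheme"
  assumes A: "calgebra A" and B: "calgebra B"
begin

lemma monoid_DirProd: "monoid (A \<times>\<times> B)"
  by (rule DirProd_monoid[OF alg_monoid[OF A] alg_monoid[OF B]])

lemma DirProd_simps: "(x, y) \<otimes>\<^bsub>A \<times>\<times> B\<^esub> (x', y') = (x \<otimes>\<^bsub>A\<^esub> x', y \<otimes>\<^bsub>B\<^esub> y')" "\<one>\<^bsub>A \<times>\<times> B\<^esub> = (\<one>\<^bsub>A\<^esub>, \<one>\<^bsub>B\<^esub>)"
  by (simp_all add: DirProd_def)

text \<open>A basis element acts on each component of a pair separately, so it carries a bilinearity
  relation to another relation of the same family.\<close>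

lemma tensor_null_mult_rel:
  assumes x: "x \<in> carrier A" and y: "y \<in> carrier B" and f: "f \<in> bilinear_rels A B"
  shows "Poly_Mapping.single (x, y) 1 \<otimes>\<^bsub>monoid_algebra (A \<times>\<times> B)\<^esub> f \<in> bilinear_rels A B" (is "?L f \<in> _")
    and "f \<otimes>\<^bsub>monoid_algebra (A \<times>\<times> B)\<^esub> Poly_Mapping.single (x, y) 1 \<in> bilinear_rels A B" (is "?R f \<in> _")
proof -
  let ?F = "monoid_algebra (A \<times>\<times> B)"
  note C = calgebra_monoid_algebra[OF monoid_DirProd]
  have s: "Poly_Mapping.single (u, v) z \<in> carrier ?F" if "u \<in> carrier A" "v \<in> carrier B" for u v z
    using that by simp
  note VA = vs_closed[OF alg_vspace[OF A]] alg_closed[OF A] and VB = vs_closed[OF alg_vspace[OF B]] alg_closed[OF B]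
  have K: "f - g \<in> carrier ?F" if "f \<in> carrier ?F" "g \<in> carrier ?F" for f g
    using that keys_diff[of f g] by (simp only: monoid_algebra_simps) blast
  \<comment> \<open>Additivity is available only for sums, hence the detour through (f - g) +
    g.\<close>
  have L: "?L (f - g) = ?L f - ?L g" and R: "?R (f - g) = ?R f - ?R g" if "f \<in> carrier ?F" "g \<in> carrier ?F" for f g
  proof -
    have "?L ((f - g) + g) = ?L (f - g) + ?L g" "?R ((f - g) + g) = ?R (f - g) + ?R g"
      using lin_add[OF alg_lin(1)[OF C s[OF x y]] K[OF that] that(2)]
        lin_add[OF alg_lin(2)[OF C s[OF x y]] K[OF that] that(2)] by simp_all
    then show "?L (f - g) = ?L f - ?L g" "?R (f - g) = ?R f - ?R g" by (simp_all add: algebra_simps)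
  qed
  note M = monoid_algebra_mult_single[OF monoid_DirProd] DirProd_simps
  note D = alg_distrib[OF A] alg_distrib[OF B] alg_smult[OF A] alg_smult[OF B]
  have "(?L f \<in> bilinear_rels A B) \<and> (?R f \<in> bilinear_rels A B)"
    using f unfolding bilinear_rels_def
  proof (elim UnE CollectE exE conjE, goal_cases)
    case (1 u u' v)
    then have "?L f = Poly_Mapping.single (x \<otimes>\<^bsub>A\<^esub> u \<oplus>\<^bsub>A\<^esub> x \<otimes>\<^bsub>A\<^esub> u', y \<otimes>\<^bsub>B\<^esub> v) 1
        - Poly_Mapping.single (x \<otimes>\<^bsub>A\<^esub> u, y \<otimes>\<^bsub>B\<^esub> v) 1 - Poly_Mapping.single (x \<otimes>\<^bsub>A\<^esub> u', y \<otimes>\<^bsub>B\<^esub> v) 1"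
      "?R f = Poly_Mapping.single (u \<otimes>\<^bsub>A\<^esub> x \<oplus>\<^bsub>A\<^esub> u' \<otimes>\<^bsub>A\<^esub> x, v \<otimes>\<^bsub>B\<^esub> y) 1
        - Poly_Mapping.single (u \<otimes>\<^bsub>A\<^esub> x, v \<otimes>\<^bsub>B\<^esub> y) 1 - Poly_Mapping.single (u' \<otimes>\<^bsub>A\<^esub> x, v \<otimes>\<^bsub>B\<^esub> y) 1"
      using x y by (simp_all only: L R K s VA VB M D mult_1)
    moreover have "x \<otimes>\<^bsub>A\<^esub> u \<in> carrier A" "x \<otimes>\<^bsub>A\<^esub> u' \<in> carrier A" "y \<otimes>\<^bsub>B\<^esub> v \<in> carrier B"
      "u \<otimes>\<^bsub>A\<^esub> x \<in> carrier A" "u' \<otimes>\<^bsub>A\<^esub> x \<in> carrier A" "v \<otimes>\<^bsub>B\<^esub> y \<in> carrier B"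
      using 1 x y VA VB by auto
    ultimately show ?case by blast
  next
    case (2 u v v')
    then have "?L f = Poly_Mapping.single (x \<otimes>\<^bsub>A\<^esub> u, y \<otimes>\<^bsub>B\<^esub> v \<oplus>\<^bsub>B\<^esub> y \<otimes>\<^bsub>B\<^esub> v') 1
        - Poly_Mapping.single (x \<otimes>\<^bsub>A\<^esub> u, y \<otimes>\<^bsub>B\<^esub> v) 1 - Poly_Mapping.single (x \<otimes>\<^bsub>A\<^esub> u, y \<otimes>\<^bsub>B\<^esub> v') 1"
      "?R f = Poly_Mapping.single (u \<otimes>\<^bsub>A\<^esub> x, v \<otimes>\<^bsub>B\<^esub> y \<oplus>\<^bsub>B\<^esub> v' \<otimes>\<^bsub>B\<^esub> y) 1
        - Poly_Mapping.single (u \<otimes>\<^bsub>A\<^esub> x, v \<otimes>\<^bsub>B\<^esub> y) 1 - Poly_Mapping.single (u \<otimes>\<^bsub>A\<^esub> x, v' \<otimes>\<^bsub>B\<^esub> y) 1"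
      using x y by (simp_all only: L R K s VA VB M D mult_1)
    moreover have "x \<otimes>\<^bsub>A\<^esub> u \<in> carrier A" "y \<otimes>\<^bsub>B\<^esub> v \<in> carrier B" "y \<otimes>\<^bsub>B\<^esub> v' \<in> carrier B"
      "u \<otimes>\<^bsub>A\<^esub> x \<in> carrier A" "v \<otimes>\<^bsub>B\<^esub> y \<in> carrier B" "v' \<otimes>\<^bsub>B\<^esub> y \<in> carrier B"
      using 2 x y VA VB by auto
    ultimately show ?case by blast
  next
    case (3 z u v)
    then have "?L f = Poly_Mapping.single (z \<odot>\<^bsub>A\<^esub> (x \<otimes>\<^bsub>A\<^esub> u), y \<otimes>\<^bsub>B\<^esub> v) 1 - Poly_Mapping.single (x \<otimes>\<^bsub>A\<^esub> u, y \<otimes>\<^bsub>B\<^esub> v) z"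
      "?R f = Poly_Mapping.single (z \<odot>\<^bsub>A\<^esub> (u \<otimes>\<^bsub>A\<^esub> x), v \<otimes>\<^bsub>B\<^esub> y) 1 - Poly_Mapping.single (u \<otimes>\<^bsub>A\<^esub> x, v \<otimes>\<^bsub>B\<^esub> y) z"
      using x y by (simp_all only: L R K s VA VB M D mult_1 mult_1_right)
    moreover have "x \<otimes>\<^bsub>A\<^esub> u \<in> carrier A" "y \<otimes>\<^bsub>B\<^esub> v \<in> carrier B" "u \<otimes>\<^bsub>A\<^esub> x \<in> carrier A" "v \<otimes>\<^bsub>B\<^esub> y \<in> carrier B"
      using 3 x y VA VB by auto
    ultimately show ?case by blast
  next
    case (4 z u v)
    then have "?L f = Poly_Mapping.single (x \<otimes>\<^bsub>A\<^esub> u, z \<odot>\<^bsub>B\<^esub> (y \<otimes>\<^bsub>B\<^esub> v)) 1 - Poly_Mapping.single (x \<otimes>\<^bsub>A\<^esub> u, y \<otimes>\<^bsub>B\<^esub> v) z"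
      "?R f = Poly_Mapping.single (u \<otimes>\<^bsub>A\<^esub> x, z \<odot>\<^bsub>B\<^esub> (v \<otimes>\<^bsub>B\<^esub> y)) 1 - Poly_Mapping.single (u \<otimes>\<^bsub>A\<^esub> x, v \<otimes>\<^bsub>B\<^esub> y) z"
      using x y by (simp_all only: L R K s VA VB M D mult_1 mult_1_right)
    moreover have "x \<otimes>\<^bsub>A\<^esub> u \<in> carrier A" "y \<otimes>\<^bsub>B\<^esub> v \<in> carrier B" "u \<otimes>\<^bsub>A\<^esub> x \<in> carrier A" "v \<otimes>\<^bsub>B\<^esub> y \<in> carrier B"
      using 4 x y VA VB by auto
    ultimately show ?case by blast
  qed
  then show "?L f \<in> bilinear_rels A B" "?R f \<in> bilinear_rels A B" by auto
qed

text \<open>The ideal property is first obtained for multiplication by basis elements, where it can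
  be tested on the generators of the span, and then for arbitrary combinations.\<close>

lemma tensor_null_two_sided: "two_sided (monoid_algebra (A \<times>\<times> B)) (tensor_null A B)"
proof -
  let ?F = "monoid_algebra (A \<times>\<times> B)" and ?N = "tensor_null A B"
  note C = calgebra_monoid_algebra[OF monoid_DirProd]
  note VA = alg_vspace[OF A] and VB = alg_vspace[OF B]
  note N = tensor_null_submodule[OF VA VB]
  note ND = submoduleD_vs[OF N vspace_monoid_algebra]
  \<comment> \<open>The preimage of a subspace under a linear map is a subspace, so it contains the
    span as soon as it contains the generators.\<close>
  have pull: "submodule {n \<in> carrier ?F. \<phi> n \<in> ?N} CC ?F" if "\<phi> \<in> linear_maps ?F ?F" for \<phi>
    using ND lin_zero[OF that] lin_add[OF that] lin_smult[OF that] vs_closed[OF vspace_monoid_algebra[of "A \<times>\<times> B"]]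
    by (intro submoduleI_vs) auto
  have rel: "bilinear_rels A B \<subseteq> ?N" unfolding tensor_null_def by (rule lin_span_superset)
  have basis: "Poly_Mapping.single k 1 \<otimes>\<^bsub>?F\<^esub> n \<in> ?N \<and> n \<otimes>\<^bsub>?F\<^esub> Poly_Mapping.single k 1 \<in> ?N"
    if k: "k \<in> carrier (A \<times>\<times> B)" and n: "n \<in> ?N" for k n
  proof -
    obtain x y where xy: "k = (x, y)" "x \<in> carrier A" "y \<in> carrier B" using k by auto
    have s: "Poly_Mapping.single k 1 \<in> carrier ?F" using k by simp
    have "?N \<subseteq> {n \<in> carrier ?F. Poly_Mapping.single k 1 \<otimes>\<^bsub>?F\<^esub> n \<in> ?N}"
      unfolding tensor_null_def[of A B]
      by (intro lin_span_minimal pull[unfolded tensor_null_def] alg_lin(1)[OF C s])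
        (use tensor_null_mult_rel(1)[OF xy(2,3)] rel[unfolded tensor_null_def] bilinear_rels_subset[OF VA VB] xy in blast)
    moreover have "?N \<subseteq> {n \<in> carrier ?F. n \<otimes>\<^bsub>?F\<^esub> Poly_Mapping.single k 1 \<in> ?N}"
      unfolding tensor_null_def[of A B]
      by (intro lin_span_minimal pull[unfolded tensor_null_def] alg_lin(2)[OF C s])
        (use tensor_null_mult_rel(2)[OF xy(2,3)] rel[unfolded tensor_null_def] bilinear_rels_subset[OF VA VB] xy in blast)
    ultimately show ?thesis using n by blast
  qed
  have "f \<otimes>\<^bsub>?F\<^esub> n \<in> ?N \<and> n \<otimes>\<^bsub>?F\<^esub> f \<in> ?N" if f: "Poly_Mapping.keys f \<subseteq> carrier (A \<times>\<times> B)" and n: "n \<in> ?N" for f n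
    using f
  proof (induction rule: poly_mapping_induct_on)
    case zero
    then show ?case using alg_zero[OF C, of n] ND(2,3) n by auto
  next
    case (add k z f)
    have nc: "n \<in> carrier ?F" and fc: "f \<in> carrier ?F" and kc: "Poly_Mapping.single k z \<in> carrier ?F"
      and k1: "Poly_Mapping.single k 1 \<in> carrier ?F"
      using ND(3)[OF n] add by auto
    have "Poly_Mapping.single k z = z \<odot>\<^bsub>?F\<^esub> Poly_Mapping.single k 1" by simp
    then have "Poly_Mapping.single k z \<otimes>\<^bsub>?F\<^esub> n = z \<odot>\<^bsub>?F\<^esub> (Poly_Mapping.single k 1 \<otimes>\<^bsub>?F\<^esub> n)"
      "n \<otimes>\<^bsub>?F\<^esub> Poly_Mapping.single k z = z \<odot>\<^bsub>?F\<^esub> (n \<otimes>\<^bsub>?F\<^esub> Poly_Mapping.single k 1)"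
      using alg_smult(2)[OF C k1 nc, of z] alg_smult(1)[OF C nc k1, of z] by (simp_all only:)
    then have "Poly_Mapping.single k z \<otimes>\<^bsub>?F\<^esub> n \<in> ?N" "n \<otimes>\<^bsub>?F\<^esub> Poly_Mapping.single k z \<in> ?N"
      using ND(5) basis[OF add(1) n] by (simp_all only:)
    then have "(Poly_Mapping.single k z \<oplus>\<^bsub>?F\<^esub> f) \<otimes>\<^bsub>?F\<^esub> n \<in> ?N \<and> n \<otimes>\<^bsub>?F\<^esub> (Poly_Mapping.single k z \<oplus>\<^bsub>?F\<^esub> f) \<in> ?N"
      using alg_distrib(2)[OF C kc fc nc] alg_distrib(1)[OF C nc kc fc] ND(4) add by (simp only:)
    then show ?case by simp
  qed
  then show ?thesis using N by (simp add: two_sided_def)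
qed

lemma calgebra_tensor: "calgebra (tensor A B)"
  unfolding tensor_def by (rule calgebra_quot[OF calgebra_monoid_algebra[OF monoid_DirProd] tensor_null_two_sided])

lemma tensor_mult_pure:
  assumes "x \<in> carrier A" "x' \<in> carrier A" "y \<in> carrier B" "y' \<in> carrier B"
  shows "pure A B x y \<otimes>\<^bsub>tensor A B\<^esub> pure A B x' y' = pure A B (x \<otimes>\<^bsub>A\<^esub> x') (y \<otimes>\<^bsub>B\<^esub> y')"
  unfolding tensor_def pure_def
  using coset_mult[OF calgebra_monoid_algebra[OF monoid_DirProd] tensor_null_two_sided,
      of "Poly_Mapping.single (x, y) 1" "Poly_Mapping.single (x', y') 1"] assms
  by (simp add: monoid_algebra_mult_single[OF monoid_DirProd] DirProd_simps)

lemma tensor_one: "\<one>\<^bsub>tensor A B\<^esub> = pure A B \<one>\<^bsub>A\<^esub> \<one>\<^bsub>B\<^esub>"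
  by (simp add: tensor_def pure_def quot_simps(3) DirProd_simps)

end

section \<open>Change of record scheme\<close>

text \<open>Extending a record by a coaction or a comultiplication changes its type, so the extended
  and the plain record cannot be equated. Tensor products, linear maps and sums depend on these six
  fields only and can be transferred.\<close>

definition same_module :: "(complex, 'u, 'x) module_scheme \<Rightarrow> (complex, 'u, 'y) module_scheme \<Rightarrow> bool" where
  "same_module U U' \<longleftrightarrow> carrier U' = carrier U \<and> (\<otimes>\<^bsub>U'\<^esub>) = (\<otimes>\<^bsub>U\<^esub>) \<and> \<one>\<^bsub>U'\<^esub> = \<one>\<^bsub>U\<^esub> \<and> \<zero>\<^bsub>U'\<^esub> = \<zero>\<^bsub>U\<^esub> \<and>
     (\<oplus>\<^bsub>U'\<^esub>) = (\<oplus>\<^bsub>U\<^esub>) \<and> (\<odot>\<^bsub>U'\<^esub>) = (\<odot>\<^bsub>U\<^esub>)"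

context
  fixes U :: "(complex, 'u, 'x) module_scheme" and U' :: "(complex, 'u, 'y) module_scheme"
  assumes same: "same_module U U'"
begin

lemma same_simps:
  "carrier U' = carrier U" "(\<otimes>\<^bsub>U'\<^esub>) = (\<otimes>\<^bsub>U\<^esub>)" "\<one>\<^bsub>U'\<^esub> = \<one>\<^bsub>U\<^esub>" "\<zero>\<^bsub>U'\<^esub> = \<zero>\<^bsub>U\<^esub>"
  "(\<oplus>\<^bsub>U'\<^esub>) = (\<oplus>\<^bsub>U\<^esub>)" "(\<odot>\<^bsub>U'\<^esub>) = (\<odot>\<^bsub>U\<^esub>)"
  using same by (simp_all add: same_module_def)

lemma same_vspace:
  assumes U: "vspace U"
  shows "vspace U'"
proof (rule moduleI[OF CC_cring])
  show "abelian_group U'"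
  proof (rule abelian_groupI)
    show "\<exists>y\<in>carrier U'. y \<oplus>\<^bsub>U'\<^esub> x = \<zero>\<^bsub>U'\<^esub>" if "x \<in> carrier U'" for x
      using that abelian_group.l_neg[OF vs_abelian_group[OF U], of x] vs_closed(4)[OF U]
      unfolding same_simps by blast
  qed (simp_all add: same_simps vs_closed[OF U] vs_zero[OF U] vs_ac[OF U])
qed (simp_all add: same_simps vs_closed[OF U] vs_zero[OF U] vs_add_smult[OF U] vs_smult_add[OF U] vs_smult_smult[OF U])

lemma same_linear_maps:
  "linear_maps U' W = linear_maps U W" "linear_maps V U' = linear_maps V U"
  by (simp_all add: linear_maps_def same_simps)

lemma same_bilin: "bilin U' U' U' h = bilin U U U h"
  by (simp add: bilin_def same_linear_maps same_simps(1))

lemma same_calgebra: "calgebra U \<Longrightarrow> calgebra U'"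
  by (rule calgebraI)
    (simp_all add: same_vspace same_bilin same_simps alg_bilin alg_assoc)

lemma same_algebra_hom: "algebra_hom U' W f = algebra_hom U W f"
  by (simp add: algebra_hom_def same_linear_maps same_simps)

lemma same_DirProd: "U' \<times>\<times> V = U \<times>\<times> V" "V \<times>\<times> U' = V \<times>\<times> U"
  by (simp_all add: DirProd_def same_simps)

lemma same_tensor:
  "tensor U' V = tensor U V" "tensor V U' = tensor V U" "pure U' V = pure U V" "pure V U' = pure V U"
proof -
  have 1: "tensor_null U' V = tensor_null U V" "tensor_null V U' = tensor_null V U"
    unfolding tensor_null_def bilinear_rels_def same_DirProd same_simps by simp_all
  show "tensor U' V = tensor U V" "tensor V U' = tensor V U"
    unfolding tensor_def same_DirProd 1 by simp_all
  show "pure U' V = pure U V" "pure V U' = pure V U"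
    unfolding pure_def[abs_def] same_DirProd 1 by simp_all
qed

lemma same_finsum: "finsum U' = finsum U"
  by (intro ext) (simp add: finsum_def finprod_def same_simps)

lemma same_tensor_map: "tensor_map U' V = tensor_map U V" "tensor_map V U' = tensor_map V U"
  by (intro ext; simp add: tensor_map_def same_tensor)+

end

section \<open>The presented algebra\<close>

abbreviation word_monoid :: "gen list monoid" where
  "word_monoid \<equiv> \<lparr>carrier = UNIV, monoid.mult = (@), one = []\<rparr>"

lemma monoid_words: "monoid word_monoid"
  by (rule monoidI) auto

lemma calgebra_free: "calgebra free_algebra"
  unfolding free_algebra_def by (rule calgebra_monoid_algebra[OF monoid_words])

lemma carrier_free [simp]: "f \<in> carrier free_algebra"
  by (simp add: free_algebra_def)

lemma free_simps:
  "\<one>\<^bsub>free_algebra\<^esub> = Poly_Mapping.single [] 1" "\<zero>\<^bsub>free_algebra\<^esub> = 0"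
  "f \<oplus>\<^bsub>free_algebra\<^esub> g = f + g" "z \<odot>\<^bsub>free_algebra\<^esub> f = pm_scale z f"
  "Poly_Mapping.single v z \<otimes>\<^bsub>free_algebra\<^esub> Poly_Mapping.single w z' = Poly_Mapping.single (v @ w) (z * z')"
  by (simp_all add: free_algebra_def monoid_algebra_mult_single[OF monoid_words])

text \<open>A ring ideal is closed under multiplication by \<open>z \<odot> 1\<close>, which
  supplies the missing closure under scalars.\<close>

lemma slq2_ideal_two_sided: "two_sided free_algebra (slq2_ideal q)"
proof -
  let ?F = free_algebra
  have "ideal (slq2_ideal q) ?F"
    unfolding slq2_ideal_def by (rule ring.genideal_ideal[OF alg_ring[OF calgebra_free]]) auto
  then interpret ideal "slq2_ideal q" ?F .
  have V: "vspace ?F" using calgebra_free by simp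
  have "submodule (slq2_ideal q) CC ?F"
  proof (rule submoduleI_vs[OF V a_subset additive_subgroup.zero_closed[OF additive_subgroup_axioms]])
    show "x \<oplus>\<^bsub>?F\<^esub> y \<in> slq2_ideal q" if "x \<in> slq2_ideal q" "y \<in> slq2_ideal q" for x y
      using that by (rule additive_subgroup.a_closed[OF additive_subgroup_axioms])
    show "z \<odot>\<^bsub>?F\<^esub> x \<in> slq2_ideal q" if "x \<in> slq2_ideal q" for z x
      using I_l_closed[OF that, of "z \<odot>\<^bsub>?F\<^esub> \<one>\<^bsub>?F\<^esub>"] alg_smult(2)[OF calgebra_free, of "\<one>\<^bsub>?F\<^esub>" x z]
      by (simp add: alg_one[OF calgebra_free])
  qed
  then show ?thesis
    unfolding two_sided_def by (auto intro: I_l_closed I_r_closed)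
qed

lemma slq2_ideal_minimal:
  assumes "two_sided free_algebra K" "slq2_rels q \<subseteq> K"
  shows "slq2_ideal q \<subseteq> K"
  unfolding slq2_ideal_def
  by (rule ring.genideal_minimal[OF alg_ring[OF calgebra_free] two_sided_ideal[OF calgebra_free assms(1)] assms(2)])

lemma slq2_rels_in_ideal: "slq2_rels q \<subseteq> slq2_ideal q"
  unfolding slq2_ideal_def by (rule ring.genideal_self[OF alg_ring[OF calgebra_free]]) auto

section \<open>The universal property of the algebra given by generators and relations\<close>

definition word_val :: "(complex, 'b, 'x) module_scheme \<Rightarrow> (gen \<Rightarrow> 'b) \<Rightarrow> gen list \<Rightarrow> 'b" where
  "word_val B h w = foldr (\<lambda>g t. h g \<otimes>\<^bsub>B\<^esub> t) w \<one>\<^bsub>B\<^esub>"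

lemma word_val_simps [simp]:
  "word_val B h [] = \<one>\<^bsub>B\<^esub>" "word_val B h (g # w) = h g \<otimes>\<^bsub>B\<^esub> word_val B h w"
  by (simp_all add: word_val_def)

text \<open>The last two defining relations are solved for a d and d a, so that both products can be
  rewritten in terms of 1 and b c.\<close>

definition slq2_relations :: "(complex, 'b, 'x) module_scheme \<Rightarrow> complex \<Rightarrow> 'b \<Rightarrow> 'b \<Rightarrow> 'b \<Rightarrow> 'b \<Rightarrow> bool" where
  "slq2_relations B q a b c d \<longleftrightarrow>
     a \<otimes>\<^bsub>B\<^esub> b = q \<odot>\<^bsub>B\<^esub> (b \<otimes>\<^bsub>B\<^esub> a) \<and> a \<otimes>\<^bsub>B\<^esub> c = q \<odot>\<^bsub>B\<^esub> (c \<otimes>\<^bsub>B\<^esub> a) \<and>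
     b \<otimes>\<^bsub>B\<^esub> d = q \<odot>\<^bsub>B\<^esub> (d \<otimes>\<^bsub>B\<^esub> b) \<and> b \<otimes>\<^bsub>B\<^esub> c = c \<otimes>\<^bsub>B\<^esub> b \<and> c \<otimes>\<^bsub>B\<^esub> d = q \<odot>\<^bsub>B\<^esub> (d \<otimes>\<^bsub>B\<^esub> c) \<and>
     a \<otimes>\<^bsub>B\<^esub> d = \<one>\<^bsub>B\<^esub> \<oplus>\<^bsub>B\<^esub> q \<odot>\<^bsub>B\<^esub> (b \<otimes>\<^bsub>B\<^esub> c) \<and> d \<otimes>\<^bsub>B\<^esub> a = \<one>\<^bsub>B\<^esub> \<oplus>\<^bsub>B\<^esub> inverse q \<odot>\<^bsub>B\<^esub> (b \<otimes>\<^bsub>B\<^esub> c)"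

context
  fixes B :: "(complex, 'b, 'x) module_scheme" and h :: "gen \<Rightarrow> 'b"
  assumes B: "calgebra B" and h: "\<And>g. h g \<in> carrier B"
begin

lemma word_val_closed: "word_val B h w \<in> carrier B"
  by (induction w) (simp_all add: alg_closed[OF B] h)

lemma word_val_append: "word_val B h (v @ w) = word_val B h v \<otimes>\<^bsub>B\<^esub> word_val B h w"
  by (induction v) (simp_all add: alg_one[OF B] alg_assoc[OF B] h word_val_closed)

lemma word_val_hom: "algebra_hom free_algebra B (lin_ext B (word_val B h))"
proof -
  let ?L = "lin_ext B (word_val B h)" and ?F = free_algebra
  note V = alg_vspace[OF B]
  have L: "?L \<in> linear_maps ?F B"
    unfolding free_algebra_def by (rule lin_ext_linear[OF V word_val_closed])
  have single: "?L (Poly_Mapping.single w 1) = word_val B h w" for w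
    using lin_ext_single[of B "word_val B h" w 1] V word_val_closed vs_zero(5)[OF V] by simp
  have eq: "F f = F' f" if "F \<in> linear_maps ?F B" "F' \<in> linear_maps ?F B"
    "\<And>k. F (Poly_Mapping.single k 1) = F' (Poly_Mapping.single k 1)" for F F' f
    by (rule monoid_algebra_lin_eq[OF that(1,2)[unfolded free_algebra_def] V]) (simp_all add: that(3))
  have 1: "?L (Poly_Mapping.single v 1 \<otimes>\<^bsub>?F\<^esub> g) = word_val B h v \<otimes>\<^bsub>B\<^esub> ?L g" for v g
    by (rule eq[OF lin_comp[OF alg_lin(1)[OF calgebra_free] L] lin_comp[OF L alg_lin(1)[OF B]]])
      (simp_all add: free_simps single word_val_append word_val_closed)
  have "?L (f \<otimes>\<^bsub>?F\<^esub> g) = ?L f \<otimes>\<^bsub>B\<^esub> ?L g" for f g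
    by (rule eq[OF lin_comp[OF alg_lin(2)[OF calgebra_free] L] lin_comp[OF L alg_lin(2)[OF B]]])
      (simp_all add: 1 single lin_closed[OF L])
  then show ?thesis
    unfolding algebra_hom_def using L by (simp add: free_simps(1) single)
qed

text \<open>The kernel of an algebra homomorphism is a two-sided ideal, so it contains the generated
  ideal once it contains the seven relations.\<close>

lemma word_val_kernel:
  assumes rels: "slq2_relations B q (h GA) (h GB) (h GC) (h GD)" and f: "f \<in> slq2_ideal q"
  shows "lin_ext B (word_val B h) f = \<zero>\<^bsub>B\<^esub>"
proof -
  let ?L = "lin_ext B (word_val B h)" and ?F = free_algebra
  note V = alg_vspace[OF B] and VF = alg_vspace[OF calgebra_free]
  note L = algebra_homD[OF word_val_hom]
  let ?K = "{f \<in> carrier ?F. ?L f = \<zero>\<^bsub>B\<^esub>}"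
  have "two_sided ?F ?K"
    unfolding two_sided_def
    using lin_kernel_submodule[OF L(1) VF V] by (simp add: L(3) lin_closed[OF L(1)] alg_zero[OF B])
  moreover have "slq2_rels q \<subseteq> ?K"
  proof -
    have diff: "?L (f - g) = ?L f \<oplus>\<^bsub>B\<^esub> (- 1) \<odot>\<^bsub>B\<^esub> ?L g" for f g
      using lin_add[OF L(1), of f "- g"] lin_smult[OF L(1), of g "- 1"] by (simp add: free_simps)
    have single: "?L (Poly_Mapping.single w z) = z \<odot>\<^bsub>B\<^esub> word_val B h w" for w z
      by (rule lin_ext_single[OF V]) (rule word_val_closed)
    note closed = vs_closed[OF V] alg_closed[OF B] h
    have Z: "x \<oplus>\<^bsub>B\<^esub> (- 1) \<odot>\<^bsub>B\<^esub> x = \<zero>\<^bsub>B\<^esub>" if "x \<in> carrier B" for x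
      using vs_diff_eq_zero[OF V that that] by simp
    \<comment> \<open>With y = b c, the relations for a d - d a and for the determinant become the
      two identities that follow.\<close>
    have bc: "h GB \<otimes>\<^bsub>B\<^esub> h GC \<in> carrier B" by (simp add: closed)
    have "((\<one>\<^bsub>B\<^esub> \<oplus>\<^bsub>B\<^esub> q \<odot>\<^bsub>B\<^esub> y) \<oplus>\<^bsub>B\<^esub> (- 1) \<odot>\<^bsub>B\<^esub> (\<one>\<^bsub>B\<^esub> \<oplus>\<^bsub>B\<^esub> inverse q \<odot>\<^bsub>B\<^esub> y)) \<oplus>\<^bsub>B\<^esub> (- 1) \<odot>\<^bsub>B\<^esub> ((q - inverse q) \<odot>\<^bsub>B\<^esub> y) = \<zero>\<^bsub>B\<^esub>"
      and "((\<one>\<^bsub>B\<^esub> \<oplus>\<^bsub>B\<^esub> q \<odot>\<^bsub>B\<^esub> y) \<oplus>\<^bsub>B\<^esub> (- 1) \<odot>\<^bsub>B\<^esub> (q \<odot>\<^bsub>B\<^esub> y)) \<oplus>\<^bsub>B\<^esub> (- 1) \<odot>\<^bsub>B\<^esub> \<one>\<^bsub>B\<^esub> = \<zero>\<^bsub>B\<^esub>"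
      if y: "y \<in> carrier B" for y
    proof -
      have "((\<one>\<^bsub>B\<^esub> \<oplus>\<^bsub>B\<^esub> q \<odot>\<^bsub>B\<^esub> y) \<oplus>\<^bsub>B\<^esub> (- 1) \<odot>\<^bsub>B\<^esub> (\<one>\<^bsub>B\<^esub> \<oplus>\<^bsub>B\<^esub> inverse q \<odot>\<^bsub>B\<^esub> y)) \<oplus>\<^bsub>B\<^esub> (- 1) \<odot>\<^bsub>B\<^esub> ((q - inverse q) \<odot>\<^bsub>B\<^esub> y)
        = (\<one>\<^bsub>B\<^esub> \<oplus>\<^bsub>B\<^esub> (- 1) \<odot>\<^bsub>B\<^esub> \<one>\<^bsub>B\<^esub>) \<oplus>\<^bsub>B\<^esub> (q \<odot>\<^bsub>B\<^esub> y \<oplus>\<^bsub>B\<^esub> (- inverse q) \<odot>\<^bsub>B\<^esub> y \<oplus>\<^bsub>B\<^esub> (- (q - inverse q)) \<odot>\<^bsub>B\<^esub> y)"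
        using y closed by (simp add: vs_smult_add[OF V] vs_smult_smult[OF V] vs_ac[OF V])
      also have "q \<odot>\<^bsub>B\<^esub> y \<oplus>\<^bsub>B\<^esub> (- inverse q) \<odot>\<^bsub>B\<^esub> y \<oplus>\<^bsub>B\<^esub> (- (q - inverse q)) \<odot>\<^bsub>B\<^esub> y = (q + (- inverse q) + (- (q - inverse q))) \<odot>\<^bsub>B\<^esub> y"
        using y by (simp only: vs_add_smult[OF V])
      finally show "((\<one>\<^bsub>B\<^esub> \<oplus>\<^bsub>B\<^esub> q \<odot>\<^bsub>B\<^esub> y) \<oplus>\<^bsub>B\<^esub> (- 1) \<odot>\<^bsub>B\<^esub> (\<one>\<^bsub>B\<^esub> \<oplus>\<^bsub>B\<^esub> inverse q \<odot>\<^bsub>B\<^esub> y)) \<oplus>\<^bsub>B\<^esub> (- 1) \<odot>\<^bsub>B\<^esub> ((q - inverse q) \<odot>\<^bsub>B\<^esub> y) = \<zero>\<^bsub>B\<^esub>"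
        using y Z[of "\<one>\<^bsub>B\<^esub>"] closed vs_zero[OF V] by simp
      have "((\<one>\<^bsub>B\<^esub> \<oplus>\<^bsub>B\<^esub> q \<odot>\<^bsub>B\<^esub> y) \<oplus>\<^bsub>B\<^esub> (- 1) \<odot>\<^bsub>B\<^esub> (q \<odot>\<^bsub>B\<^esub> y)) \<oplus>\<^bsub>B\<^esub> (- 1) \<odot>\<^bsub>B\<^esub> \<one>\<^bsub>B\<^esub>
        = (\<one>\<^bsub>B\<^esub> \<oplus>\<^bsub>B\<^esub> (- 1) \<odot>\<^bsub>B\<^esub> \<one>\<^bsub>B\<^esub>) \<oplus>\<^bsub>B\<^esub> (q \<odot>\<^bsub>B\<^esub> y \<oplus>\<^bsub>B\<^esub> (- 1) \<odot>\<^bsub>B\<^esub> (q \<odot>\<^bsub>B\<^esub> y))"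
        using y closed by (simp add: vs_ac[OF V])
      then show "((\<one>\<^bsub>B\<^esub> \<oplus>\<^bsub>B\<^esub> q \<odot>\<^bsub>B\<^esub> y) \<oplus>\<^bsub>B\<^esub> (- 1) \<odot>\<^bsub>B\<^esub> (q \<odot>\<^bsub>B\<^esub> y)) \<oplus>\<^bsub>B\<^esub> (- 1) \<odot>\<^bsub>B\<^esub> \<one>\<^bsub>B\<^esub> = \<zero>\<^bsub>B\<^esub>"
        using y Z[of "\<one>\<^bsub>B\<^esub>"] Z[of "q \<odot>\<^bsub>B\<^esub> y"] closed vs_zero[OF V] by simp
    qed
    note Y = this[OF bc]
    have R: "h GA \<otimes>\<^bsub>B\<^esub> h GB = q \<odot>\<^bsub>B\<^esub> (h GB \<otimes>\<^bsub>B\<^esub> h GA)" "h GA \<otimes>\<^bsub>B\<^esub> h GC = q \<odot>\<^bsub>B\<^esub> (h GC \<otimes>\<^bsub>B\<^esub> h GA)"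
      "h GB \<otimes>\<^bsub>B\<^esub> h GD = q \<odot>\<^bsub>B\<^esub> (h GD \<otimes>\<^bsub>B\<^esub> h GB)" "h GB \<otimes>\<^bsub>B\<^esub> h GC = h GC \<otimes>\<^bsub>B\<^esub> h GB"
      "h GC \<otimes>\<^bsub>B\<^esub> h GD = q \<odot>\<^bsub>B\<^esub> (h GD \<otimes>\<^bsub>B\<^esub> h GC)"
      "h GA \<otimes>\<^bsub>B\<^esub> h GD = \<one>\<^bsub>B\<^esub> \<oplus>\<^bsub>B\<^esub> q \<odot>\<^bsub>B\<^esub> (h GB \<otimes>\<^bsub>B\<^esub> h GC)" "h GD \<otimes>\<^bsub>B\<^esub> h GA = \<one>\<^bsub>B\<^esub> \<oplus>\<^bsub>B\<^esub> inverse q \<odot>\<^bsub>B\<^esub> (h GB \<otimes>\<^bsub>B\<^esub> h GC)"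
      using rels by (simp_all add: slq2_relations_def)
    note S = diff single word_val_simps alg_one[OF B] vs_zero(5)[OF V] closed
    have "?L r = \<zero>\<^bsub>B\<^esub>" if "r \<in> slq2_rels q" for r
      using that unfolding slq2_rels_def insert_iff empty_iff
    proof (elim disjE FalseE, goal_cases)
      case 1 then show ?case by (simp only: S R(1) Z)
    next
      case 2 then show ?case by (simp only: S R(2) Z)
    next
      case 3 then show ?case by (simp only: S R(3) Z)
    next
      case 4 then show ?case by (simp only: S R(4) Z)
    next
      case 5 then show ?case by (simp only: S R(5) Z)
    next
      case 6 then show ?case by (simp only: S R(6,7) Y)
    next
      case 7 then show ?case by (simp only: S R(6,7) Y)
    qed
    then show ?thesis by auto
  qed
  ultimately show ?thesis using slq2_ideal_minimal f by blast
qed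

context
  fixes q
  assumes rels: "slq2_relations B q (h GA) (h GB) (h GC) (h GD)"
begin

lemma algebra_map_coset:
  "algebra_map B h (slq2_ideal q +>\<^bsub>free_algebra\<^esub> f) = lin_ext B (word_val B h) f"
proof -
  have "algebra_map B h = induced B (word_val B h)"
    by (simp add: algebra_map_def word_val_def[abs_def])
  then show ?thesis
    using induced_coset[OF alg_vspace[OF B], of word_monoid "word_val B h" "slq2_ideal q" f]
      word_val_kernel[OF rels] word_val_closed two_sidedD(1)[OF calgebra_free slq2_ideal_two_sided]
    by (simp add: free_algebra_def)
qed

lemma algebra_map_hom: "algebra_hom (slq2_algebra q) B (algebra_map B h)"
proof -
  note N = slq2_ideal_two_sided[of q]
  note sub = two_sidedD(1)[OF calgebra_free N] and VF = alg_vspace[OF calgebra_free]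
  note L = algebra_homD[OF word_val_hom]
  have "algebra_map B h \<in> linear_maps (quot free_algebra (slq2_ideal q)) B"
    by (rule quot_lin_lift[OF sub VF L(1) alg_vspace[OF B] word_val_kernel[OF rels] algebra_map_coset])
  moreover have "algebra_map B h (S \<otimes>\<^bsub>quot free_algebra (slq2_ideal q)\<^esub> S') = algebra_map B h S \<otimes>\<^bsub>B\<^esub> algebra_map B h S'"
    if "S \<in> carrier (quot free_algebra (slq2_ideal q))" "S' \<in> carrier (quot free_algebra (slq2_ideal q))" for S S'
    using that by (elim coset_cases[OF sub VF]) (simp add: coset_mult[OF calgebra_free N] algebra_map_coset L(3))
  ultimately show ?thesis
    unfolding algebra_hom_def slq2_algebra_def by (simp add: quot_simps(3) algebra_map_coset L(2))
qed

lemma algebra_map_gen: "algebra_map B h (slq2_gen q g) = h g"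
proof -
  have "lin_ext B (word_val B h) (Poly_Mapping.single [g] 1) = h g"
    using lin_ext_single[of B "word_val B h" "[g]" 1] word_val_closed alg_vspace[OF B] h
    by (simp add: alg_one[OF B] vs_zero(5)[OF alg_vspace[OF B]])
  then show ?thesis
    unfolding slq2_gen_def algebra_map_coset .
qed

end

end

lemma calgebra_slq2_algebra: "calgebra (slq2_algebra q)"
  unfolding slq2_algebra_def by (rule calgebra_quot[OF calgebra_free slq2_ideal_two_sided])

lemma slq2_gen_closed: "slq2_gen q g \<in> carrier (slq2_algebra q)"
  unfolding slq2_algebra_def slq2_gen_def
  by (rule coset_closed[OF two_sidedD(1)[OF calgebra_free slq2_ideal_two_sided] alg_vspace[OF calgebra_free] carrier_free])

lemma slq2_algebra_relations:
  "slq2_relations (slq2_algebra q) q (slq2_gen q GA) (slq2_gen q GB) (slq2_gen q GC) (slq2_gen q GD)"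
proof -
  let ?F = free_algebra and ?N = "slq2_ideal q"
  note N = slq2_ideal_two_sided[of q]
  note sub = two_sidedD(1)[OF calgebra_free N] and VF = alg_vspace[OF calgebra_free]
  note mult = coset_mult[OF calgebra_free N carrier_free carrier_free]
    and add = coset_add[OF sub VF carrier_free carrier_free] and smult = coset_smult[OF sub VF carrier_free]
  have sumI: "f - g \<in> ?N \<Longrightarrow> ?N +>\<^bsub>?F\<^esub> f = ?N +>\<^bsub>?F\<^esub> g" for f g
    using coset_eq_iff[OF sub VF carrier_free carrier_free, of f g] by (simp add: free_simps)
  have in_rel: "f \<in> slq2_rels q \<Longrightarrow> f \<in> ?N" for f
    using slq2_rels_in_ideal by blast
  let ?s = "Poly_Mapping.single :: gen list \<Rightarrow> complex \<Rightarrow> _"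
  \<comment> \<open>Subtracting the commutator relation from the determinant relation cancels a d
    and leaves d a - 1 - q^(-1) b c.\<close>
  have da: "?s [GD, GA] 1 - (?s [] 1 + ?s [GB, GC] (inverse q)) \<in> ?N"
  proof -
    have 1: "?s [GA, GD] 1 - ?s [GD, GA] 1 - ?s [GB, GC] (q - inverse q) \<in> ?N"
      and 2: "?s [GA, GD] 1 - ?s [GB, GC] q - ?s [] 1 \<in> ?N"
      by (rule in_rel; simp add: slq2_rels_def)+
    have "(?s [GA, GD] 1 - ?s [GB, GC] q - ?s [] 1) \<oplus>\<^bsub>?F\<^esub> ((- 1) \<odot>\<^bsub>?F\<^esub> (?s [GA, GD] 1 - ?s [GD, GA] 1 - ?s [GB, GC] (q - inverse q))) \<in> ?N"
      by (intro submoduleD_vs(4,5)[OF sub VF] 1 2)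
    moreover have "(?s [GA, GD] 1 - ?s [GB, GC] q - ?s [] 1) \<oplus>\<^bsub>?F\<^esub> ((- 1) \<odot>\<^bsub>?F\<^esub> (?s [GA, GD] 1 - ?s [GD, GA] 1 - ?s [GB, GC] (q - inverse q)))
      = ?s [GD, GA] 1 - (?s [] 1 + ?s [GB, GC] (inverse q))"
      by (simp add: free_simps single_diff)
    ultimately show ?thesis by simp
  qed
  have R: "?s [GA, GB] 1 - ?s [GB, GA] q \<in> ?N" "?s [GA, GC] 1 - ?s [GC, GA] q \<in> ?N"
    "?s [GB, GD] 1 - ?s [GD, GB] q \<in> ?N" "?s [GB, GC] 1 - ?s [GC, GB] 1 \<in> ?N" "?s [GC, GD] 1 - ?s [GD, GC] q \<in> ?N"
    "?s [GA, GD] 1 - ?s [GB, GC] q - ?s [] 1 \<in> ?N"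
    by (rule in_rel; simp add: slq2_rels_def)+
  have ad: "?s [GA, GD] 1 - (?s [] 1 + ?s [GB, GC] q) \<in> ?N"
    using R(6) by (simp add: algebra_simps)
  show ?thesis
    unfolding slq2_relations_def slq2_algebra_def slq2_gen_def
    by (simp add: mult smult add free_simps quot_simps(3))
      (intro conjI sumI R ad da)
qed

lemma same_slq2: "same_module (slq2_algebra q) (slq2 q)"
  by (simp add: same_module_def slq2_def module.defs bialgebra.defs)

lemma calgebra_slq2: "calgebra (slq2 q)"
  by (rule same_calgebra[OF same_slq2 calgebra_slq2_algebra])

lemma slq2_gen_closed' [simp]: "slq2_gen q g \<in> carrier (slq2 q)"
  using slq2_gen_closed by (simp add: same_simps[OF same_slq2])

lemma slq2_relations: "slq2_relations (slq2 q) q (slq2_gen q GA) (slq2_gen q GB) (slq2_gen q GC) (slq2_gen q GD)"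
  using slq2_algebra_relations by (simp add: slq2_relations_def same_simps[OF same_slq2])

text \<open>Words span the algebra and are built by left multiplication with generators. This is the
  form in which homomorphisms out of the algebra are easiest to compare.\<close>

lemma slq2_induct [consumes 1, case_names zero one gen add smult]:
  assumes "x \<in> carrier (slq2 q)" "P \<zero>\<^bsub>slq2 q\<^esub>" "P \<one>\<^bsub>slq2 q\<^esub>"
    "\<And>g x. x \<in> carrier (slq2 q) \<Longrightarrow> P x \<Longrightarrow> P (slq2_gen q g \<otimes>\<^bsub>slq2 q\<^esub> x)"
    "\<And>x y. x \<in> carrier (slq2 q) \<Longrightarrow> y \<in> carrier (slq2 q) \<Longrightarrow> P x \<Longrightarrow> P y \<Longrightarrow> P (x \<oplus>\<^bsub>slq2 q\<^esub> y)"
    "\<And>z x. x \<in> carrier (slq2 q) \<Longrightarrow> P x \<Longrightarrow> P (z \<odot>\<^bsub>slq2 q\<^esub> x)"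
  shows "P x"
proof -
  let ?F = free_algebra and ?N = "slq2_ideal q" and ?A = "slq2_algebra q"
  note A = assms(2-6)[unfolded same_simps[OF same_slq2]]
  note N = slq2_ideal_two_sided[of q]
  note sub = two_sidedD(1)[OF calgebra_free N] and VF = alg_vspace[OF calgebra_free]
  have C: "?N +>\<^bsub>?F\<^esub> f \<in> carrier ?A" for f
    unfolding slq2_algebra_def by (rule coset_closed[OF sub VF carrier_free])
  have word: "P (?N +>\<^bsub>?F\<^esub> Poly_Mapping.single w 1)" for w
  proof (induction w)
    case Nil
    then show ?case using A(2) by (simp add: slq2_algebra_def quot_simps(3) free_simps)
  next
    case (Cons g w)
    have "?N +>\<^bsub>?F\<^esub> Poly_Mapping.single (g # w) 1 = slq2_gen q g \<otimes>\<^bsub>?A\<^esub> (?N +>\<^bsub>?F\<^esub> Poly_Mapping.single w 1)"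
      unfolding slq2_gen_def slq2_algebra_def
      by (simp add: coset_mult[OF calgebra_free N] free_simps)
    then show ?case using A(3)[OF C Cons] by simp
  qed
  have "P (?N +>\<^bsub>?F\<^esub> f)" for f
    using subset_UNIV[of "Poly_Mapping.keys f"]
  proof (induction rule: poly_mapping_induct_on)
    case zero
    then show ?case using A(1) coset_zero[OF sub VF] by (simp add: slq2_algebra_def free_simps)
  next
    case (add k z f)
    have "?N +>\<^bsub>?F\<^esub> (Poly_Mapping.single k z + f)
      = (z \<odot>\<^bsub>?A\<^esub> (?N +>\<^bsub>?F\<^esub> Poly_Mapping.single k 1)) \<oplus>\<^bsub>?A\<^esub> (?N +>\<^bsub>?F\<^esub> f)"
      unfolding slq2_algebra_def
      by (simp add: coset_smult[OF sub VF] coset_add[OF sub VF] free_simps)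
    then show ?case
      using A(4)[OF _ C A(5)[OF C word] add(3)] C vs_closed(3)[OF alg_vspace[OF calgebra_slq2_algebra]] by simp
  qed
  moreover have "x \<in> carrier (quot ?F ?N)"
    using assms(1) by (simp add: same_simps[OF same_slq2] slq2_algebra_def)
  ultimately show ?thesis by (elim coset_cases[OF sub VF]) simp
qed

section \<open>Comodules given by matrices\<close>

text \<open>Only multiplicativity is recorded here. Coassociativity and the counit law enter
  separately, through the matrices in \<open>comatrix\<close>.\<close>

definition prebialgebra :: "'h bialgebra \<Rightarrow> bool" where
  "prebialgebra H \<longleftrightarrow> calgebra H \<and> algebra_hom H (tensor H H) (comult H) \<and> algebra_hom H CC (counit H)"

text \<open>The coordinate functionals are kept next to the basis because slicing by them extracts
  coefficients from tensors. The index type is free so that pairs can label a basis of a tensor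
  product.\<close>

definition dual_basis ::
  "(complex, 'u, 'x) module_scheme \<Rightarrow> 'i set \<Rightarrow> ('i \<Rightarrow> 'u) \<Rightarrow> ('i \<Rightarrow> 'u \<Rightarrow> complex) \<Rightarrow> bool" where
  "dual_basis U I e \<phi> \<longleftrightarrow> finite I \<and> (\<forall>i\<in>I. e i \<in> carrier U \<and> \<phi> i \<in> linear_maps U CC) \<and>
     (\<forall>i\<in>I. \<forall>j\<in>I. \<phi> i (e j) = (if i = j then 1 else 0)) \<and>
     (\<forall>u\<in>carrier U. u = (\<Oplus>\<^bsub>U\<^esub>i\<in>I. \<phi> i u \<odot>\<^bsub>U\<^esub> e i))"

text \<open>These are the laws of matrix coefficients of a comodule: comultiplication is matrix
  multiplication and the counit is the identity matrix.\<close>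

definition comatrix :: "'h bialgebra \<Rightarrow> 'i set \<Rightarrow> ('i \<Rightarrow> 'i \<Rightarrow> 'h) \<Rightarrow> bool" where
  "comatrix H I T \<longleftrightarrow> finite I \<and> (\<forall>i\<in>I. \<forall>j\<in>I. T i j \<in> carrier H \<and>
     comult H (T i j) = (\<Oplus>\<^bsub>tensor H H\<^esub>k\<in>I. pure H H (T i k) (T k j)) \<and>
     counit H (T i j) = (if i = j then 1 else 0))"

definition has_matrix :: "'h bialgebra \<Rightarrow> ('h, 'u) comodule \<Rightarrow> 'i set \<Rightarrow> ('i \<Rightarrow> 'u) \<Rightarrow> ('i \<Rightarrow> 'i \<Rightarrow> 'h) \<Rightarrow> bool" where
  "has_matrix H U I e T \<longleftrightarrow> vspace U \<and> (\<exists>\<phi>. dual_basis U I e \<phi>) \<and> comatrix H I T \<and>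
     coact U \<in> linear_maps U (tensor H U) \<and>
     (\<forall>i\<in>I. coact U (e i) = (\<Oplus>\<^bsub>tensor H U\<^esub>j\<in>I. pure H U (T i j) (e j)))"

lemma prebialgebraD:
  assumes "prebialgebra H"
  shows "calgebra H" "vspace H" "algebra_hom H (tensor H H) (comult H)" "algebra_hom H CC (counit H)"
    "comult H \<in> linear_maps H (tensor H H)" "counit H \<in> linear_maps H CC" "vspace (tensor H H)"
  using assms by (auto simp: prebialgebra_def algebra_hom_def alg_vspace)

lemma dual_basisD:
  assumes "dual_basis U I e \<phi>"
  shows "finite I" "\<And>i. i \<in> I \<Longrightarrow> e i \<in> carrier U" "\<And>i. i \<in> I \<Longrightarrow> \<phi> i \<in> linear_maps U CC"
    "\<And>i j. i \<in> I \<Longrightarrow> j \<in> I \<Longrightarrow> \<phi> i (e j) = (if i = j then 1 else 0)"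
    "\<And>u. u \<in> carrier U \<Longrightarrow> u = (\<Oplus>\<^bsub>U\<^esub>i\<in>I. \<phi> i u \<odot>\<^bsub>U\<^esub> e i)"
  using assms unfolding dual_basis_def by blast+

lemma comatrixD:
  assumes "comatrix H I T"
  shows "finite I" "\<And>i j. i \<in> I \<Longrightarrow> j \<in> I \<Longrightarrow> T i j \<in> carrier H"
    "\<And>i j. i \<in> I \<Longrightarrow> j \<in> I \<Longrightarrow> comult H (T i j) = (\<Oplus>\<^bsub>tensor H H\<^esub>k\<in>I. pure H H (T i k) (T k j))"
    "\<And>i j. i \<in> I \<Longrightarrow> j \<in> I \<Longrightarrow> counit H (T i j) = (if i = j then 1 else 0)"
  using assms unfolding comatrix_def by blast+

lemma has_matrixD:
  assumes "has_matrix H U I e T"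
  shows "vspace U" "comatrix H I T" "coact U \<in> linear_maps U (tensor H U)"
    "\<And>i. i \<in> I \<Longrightarrow> coact U (e i) = (\<Oplus>\<^bsub>tensor H U\<^esub>j\<in>I. pure H U (T i j) (e j))"
  using assms unfolding has_matrix_def by blast+

lemma has_matrixE:
  assumes "has_matrix H U I e T"
  obtains \<phi> where "dual_basis U I e \<phi>"
  using assms unfolding has_matrix_def by blast

lemma basis_lin_eq:
  assumes b: "dual_basis U I e \<phi>" and U: "vspace U" and V: "vspace V"
    and F: "F \<in> linear_maps U V" and G: "G \<in> linear_maps U V"
    and eq: "\<And>i. i \<in> I \<Longrightarrow> F (e i) = G (e i)" and u: "u \<in> carrier U"
  shows "F u = G u"
proof -
  note D = dual_basisD[OF b]
  have *: "L u = (\<Oplus>\<^bsub>V\<^esub>i\<in>I. \<phi> i u \<odot>\<^bsub>V\<^esub> L (e i))" if L: "L \<in> linear_maps U V" for L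
  proof -
    have "L u = L (\<Oplus>\<^bsub>U\<^esub>i\<in>I. \<phi> i u \<odot>\<^bsub>U\<^esub> e i)" using D(5)[OF u] by (rule arg_cong)
    also have "\<dots> = (\<Oplus>\<^bsub>V\<^esub>i\<in>I. L (\<phi> i u \<odot>\<^bsub>U\<^esub> e i))"
      by (rule lin_finsum[OF L U V D(1)]) (simp add: D(2) U)
    also have "\<dots> = (\<Oplus>\<^bsub>V\<^esub>i\<in>I. \<phi> i u \<odot>\<^bsub>V\<^esub> L (e i))"
      by (rule vs_finsum_cong[OF V refl]) (simp_all add: D(2) V lin_smult[OF L] lin_closed[OF L])
    finally show ?thesis .
  qed
  have "(\<Oplus>\<^bsub>V\<^esub>i\<in>I. \<phi> i u \<odot>\<^bsub>V\<^esub> F (e i)) = (\<Oplus>\<^bsub>V\<^esub>i\<in>I. \<phi> i u \<odot>\<^bsub>V\<^esub> G (e i))"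
    by (rule vs_finsum_cong[OF V refl]) (simp_all add: eq D(2) V lin_closed[OF G])
  then show ?thesis using *[OF F] *[OF G] by simp
qed

lemma finsum_delta_smult:
  assumes "vspace V" "finite I" "j \<in> I" "\<And>i. i \<in> I \<Longrightarrow> f i \<in> carrier V"
  shows "(\<Oplus>\<^bsub>V\<^esub>i\<in>I. (if i = j then 1 else 0) \<odot>\<^bsub>V\<^esub> f i) = f j"
proof -
  have "(\<Oplus>\<^bsub>V\<^esub>i\<in>I. (if i = j then 1 else 0) \<odot>\<^bsub>V\<^esub> f i) = (if j = j then 1 else 0) \<odot>\<^bsub>V\<^esub> f j"
    by (rule vs_finsum_single[OF assms(1-3)]) (use assms in auto)
  then show ?thesis using assms by simp
qed

text \<open>Expanding the second factor of a pure tensor in the basis gives the formula, and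
  linearity does the rest. It shows that a tensor is determined by its slices.\<close>

lemma tensor_expand:
  assumes b: "dual_basis U I e \<phi>" and H: "vspace H" and U: "vspace U" and t: "t \<in> carrier (tensor H U)"
  shows "t = (\<Oplus>\<^bsub>tensor H U\<^esub>i\<in>I. pure H U (slice_right H (\<phi> i) t) (e i))"
proof (rule tensor_lin_eq[OF H U lin_id(1) _ vspace_tensor[OF H U] _ t])
  note D = dual_basisD[OF b]
  note P = vspace_tensor[OF H U]
  show "(\<lambda>t. \<Oplus>\<^bsub>tensor H U\<^esub>i\<in>I. pure H U (slice_right H (\<phi> i) t) (e i)) \<in> linear_maps (tensor H U) (tensor H U)"
    by (intro lin_finsum_fun[OF _ P] lin_comp[OF slice_right_linear[OF H U] pure_lin_left[OF H U]] D(2,3))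
  fix x u assume xu: "x \<in> carrier H" "u \<in> carrier U"
  have "pure H U x u = pure H U x (\<Oplus>\<^bsub>U\<^esub>i\<in>I. \<phi> i u \<odot>\<^bsub>U\<^esub> e i)" using D(5)[OF xu(2)] by (rule arg_cong)
  also have "\<dots> = (\<Oplus>\<^bsub>tensor H U\<^esub>i\<in>I. pure H U x (\<phi> i u \<odot>\<^bsub>U\<^esub> e i))"
    by (rule lin_finsum[OF pure_lin_right[OF H U xu(1)] U P D(1)]) (simp add: D(2) U)
  also have "\<dots> = (\<Oplus>\<^bsub>tensor H U\<^esub>i\<in>I. pure H U (slice_right H (\<phi> i) (pure H U x u)) (e i))"
    by (rule vs_finsum_cong[OF P refl])
      (simp_all add: slice_right_pure[OF H U D(3)] xu D(2) H U pure_smult_left pure_smult_right)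
  finally show "pure H U x u = (\<Oplus>\<^bsub>tensor H U\<^esub>i\<in>I. pure H U (slice_right H (\<phi> i) (pure H U x u)) (e i))" .
qed

lemma slice_right_sum:
  assumes b: "finite I" "\<And>i. i \<in> I \<Longrightarrow> e i \<in> carrier U" "\<phi> \<in> linear_maps U CC"
    "\<And>i. i \<in> I \<Longrightarrow> \<phi> (e i) = (if i = j then 1 else 0)" and H: "vspace H" and U: "vspace U"
    and x: "\<And>i. i \<in> I \<Longrightarrow> x i \<in> carrier H" and j: "j \<in> I"
  shows "slice_right H \<phi> (\<Oplus>\<^bsub>tensor H U\<^esub>i\<in>I. pure H U (x i) (e i)) = x j"
proof -
  have "slice_right H \<phi> (\<Oplus>\<^bsub>tensor H U\<^esub>i\<in>I. pure H U (x i) (e i))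
    = (\<Oplus>\<^bsub>H\<^esub>i\<in>I. slice_right H \<phi> (pure H U (x i) (e i)))"
    by (rule lin_finsum[OF slice_right_linear[OF H U b(3)] vspace_tensor[OF H U] H b(1)]) (simp add: x b(2) H U)
  also have "\<dots> = (\<Oplus>\<^bsub>H\<^esub>i\<in>I. (if i = j then 1 else 0) \<odot>\<^bsub>H\<^esub> x i)"
    by (rule vs_finsum_cong[OF H refl]) (simp_all add: slice_right_pure[OF H U b(3)] x b(2,4) H)
  also have "\<dots> = x j" by (rule finsum_delta_smult[OF H b(1) j x])
  finally show ?thesis .
qed

lemma bilin_finsum:
  assumes h: "bilin U V P h" and U: "vspace U" and V: "vspace V" and P: "vspace P" and I: "finite I" and J: "finite J"
    and f: "\<And>i. i \<in> I \<Longrightarrow> f i \<in> carrier U" and g: "\<And>j. j \<in> J \<Longrightarrow> g j \<in> carrier V"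
  shows "h (finsum U f I) (finsum V g J) = (\<Oplus>\<^bsub>P\<^esub>i\<in>I. \<Oplus>\<^bsub>P\<^esub>j\<in>J. h (f i) (g j))"
proof -
  have "h (finsum U f I) (finsum V g J) = (\<Oplus>\<^bsub>P\<^esub>i\<in>I. h (f i) (finsum V g J))"
    by (rule lin_finsum[OF bilinD(2)[OF h] U P I f]) (simp add: V g)
  also have "\<dots> = (\<Oplus>\<^bsub>P\<^esub>i\<in>I. \<Oplus>\<^bsub>P\<^esub>j\<in>J. h (f i) (g j))"
    by (rule vs_finsum_cong[OF P refl lin_finsum[OF bilinD(1)[OF h] V P J]])
      (auto intro!: vs_finsum_closed[OF P] simp: f g bilinD(3)[OF h])
  finally show ?thesis .
qed

text \<open>On \<open>e i\<close> both sides of coassociativity become the sum of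
  \<open>T i k\<close> \<otimes> (\<open>T k j\<close> \<otimes> \<open>e j\<close>) over j and
  k.\<close>

lemma has_matrix_left_comodule:
  assumes H: "prebialgebra H" and m: "has_matrix H U I e T"
  shows "left_comodule H U"
proof -
  obtain \<phi> where b: "dual_basis U I e \<phi>" by (rule has_matrixE[OF m])
  note D = dual_basisD[OF b] and M = has_matrixD[OF m] and B = prebialgebraD[OF H]
  note T = comatrixD[OF M(2)]
  note U = M(1) and VH = B(2) and VHH = B(7)
  note VHU = vspace_tensor[OF VH U]
  note P = vspace_tensor[OF VH VHU]
  note VHHU = vspace_tensor[OF VHH U]
  let ?P = "tensor H (tensor H U)"
  have coassoc: "tensor_assoc H H U (tensor_map (tensor H H) U (comult H) id (coact U u)) =
        tensor_map H (tensor H U) id (coact U) (coact U u)" if u: "u \<in> carrier U" for u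
  proof (rule basis_lin_eq[OF b U P _ _ _ u])
    note L1 = tensor_map_linear[OF VH U VHH U B(5) lin_id(2)] and L2 = tensor_assoc_linear[OF VH VH U]
    note L3 = tensor_map_linear[OF VH U VH VHU lin_id(2) M(3)]
    show "(\<lambda>u. tensor_assoc H H U (tensor_map (tensor H H) U (comult H) id (coact U u))) \<in> linear_maps U ?P"
      by (rule lin_comp[OF lin_comp[OF M(3) L1] L2])
    show "(\<lambda>u. tensor_map H (tensor H U) id (coact U) (coact U u)) \<in> linear_maps U ?P"
      by (rule lin_comp[OF M(3) L3])
    fix i assume i: "i \<in> I"
    have "tensor_assoc H H U (tensor_map (tensor H H) U (comult H) id (coact U (e i)))
      = (\<Oplus>\<^bsub>?P\<^esub>j\<in>I. tensor_assoc H H U (tensor_map (tensor H H) U (comult H) id (pure H U (T i j) (e j))))"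
      unfolding M(4)[OF i]
      by (rule lin_finsum[OF lin_comp[OF L1 L2] VHU P D(1)]) (simp add: T(2) i D(2) VH U)
    also have "\<dots> = (\<Oplus>\<^bsub>?P\<^esub>j\<in>I. \<Oplus>\<^bsub>?P\<^esub>k\<in>I. pure H (tensor H U) (T i k) (pure H U (T k j) (e j)))"
    proof (rule vs_finsum_cong[OF P refl])
      fix j assume j: "j \<in> I"
      have "tensor_assoc H H U (tensor_map (tensor H H) U (comult H) id (pure H U (T i j) (e j)))
        = tensor_assoc H H U (pure (tensor H H) U (\<Oplus>\<^bsub>tensor H H\<^esub>k\<in>I. pure H H (T i k) (T k j)) (e j))"
        using tensor_map_pure[OF VH U VHH U B(5) lin_id(2) T(2)[OF i j] D(2)[OF j]] T(3)[OF i j] by simp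
      also have "\<dots> = (\<Oplus>\<^bsub>?P\<^esub>k\<in>I. tensor_assoc H H U (pure (tensor H H) U (pure H H (T i k) (T k j)) (e j)))"
        by (rule lin_finsum[OF lin_comp[OF pure_lin_left[OF VHH U D(2)[OF j]] L2] VHH P D(1)])
          (simp add: T(2) i j VH)
      also have "\<dots> = (\<Oplus>\<^bsub>?P\<^esub>k\<in>I. pure H (tensor H U) (T i k) (pure H U (T k j) (e j)))"
        by (rule vs_finsum_cong[OF P refl])
          (simp_all add: tensor_assoc_pure[OF VH VH U] T(2) D(2) i j VH U VHU)
      finally show "tensor_assoc H H U (tensor_map (tensor H H) U (comult H) id (pure H U (T i j) (e j)))
        = (\<Oplus>\<^bsub>?P\<^esub>k\<in>I. pure H (tensor H U) (T i k) (pure H U (T k j) (e j)))" .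
      show "(\<Oplus>\<^bsub>?P\<^esub>k\<in>I. pure H (tensor H U) (T i k) (pure H U (T k j) (e j))) \<in> carrier ?P"
        by (rule vs_finsum_closed[OF P]) (simp add: T(2) D(2) i j VH U VHU)
    qed
    \<comment> \<open>After the exchange the inner sum over \<open>j\<close> is the coaction on
      \<open>e k\<close>.\<close>
    also have "\<dots> = (\<Oplus>\<^bsub>?P\<^esub>k\<in>I. \<Oplus>\<^bsub>?P\<^esub>j\<in>I. pure H (tensor H U) (T i k) (pure H U (T k j) (e j)))"
      by (rule vs_finsum_swap[OF P _ D(1) D(1)]) (simp add: T(2) D(2) i VH U VHU)
    also have "\<dots> = (\<Oplus>\<^bsub>?P\<^esub>k\<in>I. tensor_map H (tensor H U) id (coact U) (pure H U (T i k) (e k)))"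
    proof (rule vs_finsum_cong[OF P refl])
      fix k assume k: "k \<in> I"
      show "(\<Oplus>\<^bsub>?P\<^esub>j\<in>I. pure H (tensor H U) (T i k) (pure H U (T k j) (e j)))
        = tensor_map H (tensor H U) id (coact U) (pure H U (T i k) (e k))"
        unfolding tensor_map_pure[OF VH U VH VHU lin_id(2) M(3) T(2)[OF i k] D(2)[OF k]] M(4)[OF k] id_apply
        by (rule lin_finsum[OF pure_lin_right[OF VH VHU T(2)[OF i k]] VHU P D(1), symmetric])
          (simp add: T(2) D(2) k VH U)
      show "tensor_map H (tensor H U) id (coact U) (pure H U (T i k) (e k)) \<in> carrier ?P"
        by (rule lin_closed[OF L3]) (simp add: T(2) D(2) i k VH U)
    qed
    also have "\<dots> = tensor_map H (tensor H U) id (coact U) (coact U (e i))"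
      unfolding M(4)[OF i]
      by (rule lin_finsum[OF L3 VHU P D(1), symmetric]) (simp add: T(2) i D(2) VH U)
    finally show "tensor_assoc H H U (tensor_map (tensor H H) U (comult H) id (coact U (e i))) =
        tensor_map H (tensor H U) id (coact U) (coact U (e i))" .
  qed
  have counit: "slice_left U (counit H) (coact U u) = u" if u: "u \<in> carrier U" for u
  proof (rule basis_lin_eq[OF b U U _ lin_id(1) _ u])
    note L = slice_left_linear[OF VH U B(6)]
    show "(\<lambda>u. slice_left U (counit H) (coact U u)) \<in> linear_maps U U"
      by (rule lin_comp[OF M(3) L])
    fix i assume i: "i \<in> I"
    have "slice_left U (counit H) (coact U (e i)) = (\<Oplus>\<^bsub>U\<^esub>j\<in>I. slice_left U (counit H) (pure H U (T i j) (e j)))"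
      unfolding M(4)[OF i]
      by (rule lin_finsum[OF L VHU U D(1)]) (simp add: T(2) i D(2) VH U)
    also have "\<dots> = (\<Oplus>\<^bsub>U\<^esub>j\<in>I. (if j = i then 1 else 0) \<odot>\<^bsub>U\<^esub> e j)"
      by (rule vs_finsum_cong[OF U refl]) (auto simp: slice_left_pure[OF VH U B(6)] T(2,4) i D(2) U)
    also have "\<dots> = e i" by (rule finsum_delta_smult[OF U D(1) i D(2)])
    finally show "slice_left U (counit H) (coact U (e i)) = e i" .
  qed
  show ?thesis
    unfolding left_comodule_def using U M(3) coassoc counit by (simp add: slice_left_def)
qed

lemma linear_maps_cong:
  assumes "f \<in> linear_maps U V" "vspace U" "\<And>x. x \<in> carrier U \<Longrightarrow> g x = f x"
  shows "g \<in> linear_maps U V"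
  by (rule linear_mapsI)
    (simp_all add: assms(3) vs_closed[OF assms(2)] lin_closed[OF assms(1)] lin_add[OF assms(1)] lin_smult[OF assms(1)])

lemma dual_basis_same:
  assumes "same_module U U'" "dual_basis U I e \<phi>"
  shows "dual_basis U' I e \<phi>"
  using assms(2) unfolding dual_basis_def same_simps[OF assms(1)] same_linear_maps[OF assms(1)] same_finsum[OF assms(1)] .

lemma has_matrix_same:
  assumes s: "same_module U U'" and U: "vspace U" and b: "dual_basis U I e \<phi>" and T: "comatrix H I T"
    and c: "c \<in> linear_maps U (tensor H U)" "\<And>u. u \<in> carrier U \<Longrightarrow> coact U' u = c u"
    "\<And>i. i \<in> I \<Longrightarrow> c (e i) = (\<Oplus>\<^bsub>tensor H U\<^esub>j\<in>I. pure H U (T i j) (e j))"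
  shows "has_matrix H U' I e T"
proof -
  have "coact U' \<in> linear_maps U (tensor H U)"
    by (rule linear_maps_cong[OF c(1) U c(2)])
  then show ?thesis
    unfolding has_matrix_def same_tensor[OF s] same_linear_maps[OF s]
    using same_vspace[OF s U] dual_basis_same[OF s b] T c(2,3) dual_basisD(2)[OF b] by auto
qed

text \<open>The functionals are defined on the whole of \<open>X1\<close> and are dual to the chosen
  vectors, which yields both independence and coordinates on the span.\<close>

lemma has_matrix_restrict:
  fixes X1 :: "('h, 'u) comodule"
  assumes VH: "vspace H" and V: "vspace X1" and c: "coact X1 \<in> linear_maps X1 (tensor H X1)"
    and I: "finite I" and e: "\<And>i. i \<in> I \<Longrightarrow> e i \<in> carrier X1"
    and \<phi>: "\<And>i. i \<in> I \<Longrightarrow> \<phi> i \<in> linear_maps X1 CC"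
    and dual: "\<And>i j. i \<in> I \<Longrightarrow> j \<in> I \<Longrightarrow> \<phi> i (e j) = (if i = j then 1 else 0)"
    and T: "comatrix H I T"
    and ce: "\<And>i. i \<in> I \<Longrightarrow> coact X1 (e i) = (\<Oplus>\<^bsub>tensor H X1\<^esub>j\<in>I. pure H X1 (T i j) (e j))"
  defines "N \<equiv> lin_span X1 (e ` I)"
  shows "has_matrix H (restrict_comodule H X1 N) I e T"
    and "submodule N CC X1"
    and "coact X1 ` N \<subseteq> tensor_map H X1 id id ` carrier (tensor H (X1\<lparr>carrier := N\<rparr>))"
proof -
  let ?N = "X1\<lparr>carrier := N\<rparr>"
  have eI: "e ` I \<subseteq> carrier X1" using e by auto
  show sub: "submodule N CC X1" unfolding N_def by (rule lin_span_submodule[OF V eI])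
  note ND = submoduleD_vs[OF sub V]
  have VN: "vspace ?N" by (rule vspace_carrier_update[OF sub V])
  have eN: "e i \<in> N" if "i \<in> I" for i
    using lin_span_superset[of "e ` I" X1] that unfolding N_def by blast
  have sl: "linear_maps X1 W \<subseteq> linear_maps ?N W" for W :: "(complex, 'w, 'z) module_scheme"
    using ND(3) by (auto simp: linear_maps_def Pi_iff)
  have idN: "id \<in> linear_maps ?N X1" using ND(1) by (auto simp: linear_maps_def)
  have b: "dual_basis ?N I e \<phi>"
    unfolding dual_basis_def
  proof (intro conjI ballI)
    show "finite I" by (rule I)
    show "e i \<in> carrier ?N" "\<phi> i \<in> linear_maps ?N CC" if "i \<in> I" for i
      using eN[OF that] \<phi>[OF that] sl[of CC] by auto
    show "\<phi> i (e j) = (if i = j then 1 else 0)" if "i \<in> I" "j \<in> I" for i j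
      by (rule dual[OF that])
    fix u assume "u \<in> carrier ?N"
    then have u: "u \<in> N" by simp
    have "u = (\<Oplus>\<^bsub>X1\<^esub>i\<in>I. \<phi> i u \<odot>\<^bsub>X1\<^esub> e i)"
    proof (rule lin_span_eq[OF lin_id(1) lin_finsum_fun[OF lin_functional_smult[OF \<phi> V e] V] V V eI _ u[unfolded N_def]])
      fix x assume "x \<in> e ` I"
      then obtain j where j: "j \<in> I" "x = e j" by auto
      have "(\<Oplus>\<^bsub>X1\<^esub>i\<in>I. \<phi> i x \<odot>\<^bsub>X1\<^esub> e i) = (\<Oplus>\<^bsub>X1\<^esub>i\<in>I. (if i = j then 1 else 0) \<odot>\<^bsub>X1\<^esub> e i)"
        by (rule vs_finsum_cong[OF V refl]) (use j dual e V in auto)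
      also have "\<dots> = e j" by (rule finsum_delta_smult[OF V I j(1) e])
      finally show "x = (\<Oplus>\<^bsub>X1\<^esub>i\<in>I. \<phi> i x \<odot>\<^bsub>X1\<^esub> e i)" using j(2) by simp
    qed
    also have "\<dots> = (\<Oplus>\<^bsub>?N\<^esub>i\<in>I. \<phi> i u \<odot>\<^bsub>X1\<^esub> e i)"
      by (rule finsum_carrier_update[OF sub V I, symmetric]) (rule ND(5)[OF eN])
    finally show "u = (\<Oplus>\<^bsub>?N\<^esub>i\<in>I. \<phi> i u \<odot>\<^bsub>?N\<^esub> e i)" by simp
  qed
  note D = dual_basisD[OF b]
  let ?\<iota> = "tensor_map H X1 id id"
  note VT = vspace_tensor[OF VH VN] and VX = vspace_tensor[OF VH V]
  have \<iota>: "?\<iota> \<in> linear_maps (tensor H ?N) (tensor H X1)"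
    by (rule tensor_map_linear[OF VH VN VH V lin_id(2) idN])
  have \<iota>_pure: "?\<iota> (pure H ?N x u) = pure H X1 x u" if "x \<in> carrier H" "u \<in> N" for x u
    using tensor_map_pure[OF VH VN VH V lin_id(2) idN, of x u] that by simp
  \<comment> \<open>Slicing commutes with the inclusion of H \<otimes> N into H \<otimes>
    X1.\<close>
  have slice: "slice_right H (\<phi> i) (?\<iota> t) = slice_right H (\<phi> i) t" if i: "i \<in> I" and t: "t \<in> carrier (tensor H ?N)" for i t
    by (rule tensor_lin_eq[OF VH VN lin_comp[OF \<iota> slice_right_linear[OF VH V \<phi>[OF i]]] slice_right_linear[OF VH VN D(3)[OF i]] VH _ t])
      (use ND(3) in \<open>simp add: \<iota>_pure slice_right_pure[OF VH V \<phi>[OF i]] slice_right_pure[OF VH VN D(3)[OF i]]\<close>)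
  \<comment> \<open>Slices determine a tensor over \<open>N\<close> and can be computed after the
    inclusion. So the inclusion is injective, and the definite description of the restricted
    coaction is unique.\<close>
  have inj: "t = t'" if t: "t \<in> carrier (tensor H ?N)" "t' \<in> carrier (tensor H ?N)" "?\<iota> t = ?\<iota> t'" for t t'
  proof -
    have "(\<Oplus>\<^bsub>tensor H ?N\<^esub>i\<in>I. pure H ?N (slice_right H (\<phi> i) t) (e i))
      = (\<Oplus>\<^bsub>tensor H ?N\<^esub>i\<in>I. pure H ?N (slice_right H (\<phi> i) t') (e i))"
    proof (rule vs_finsum_cong[OF VT refl])
      fix i assume i: "i \<in> I"
      show "pure H ?N (slice_right H (\<phi> i) t) (e i) = pure H ?N (slice_right H (\<phi> i) t') (e i)"
        using slice[OF i t(1)] slice[OF i t(2)] t(3) by simp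
      show "pure H ?N (slice_right H (\<phi> i) t') (e i) \<in> carrier (tensor H ?N)"
        by (rule pure_closed[OF VH VN lin_closed[OF slice_right_linear[OF VH VN D(3)[OF i]] t(2)] D(2)[OF i]])
    qed
    then show ?thesis using tensor_expand[OF b VH VN t(1)] tensor_expand[OF b VH VN t(2)] by simp
  qed
  \<comment> \<open>The candidate for the restricted coaction: \<open>s i\<close> lifts the coaction
    on \<open>e i\<close> to H \<otimes> N, and \<open>c'\<close> extends these lifts by
    coordinates.\<close>
  define s where "s i = (\<Oplus>\<^bsub>tensor H ?N\<^esub>j\<in>I. pure H ?N (T i j) (e j))" for i
  define c' where "c' u = (\<Oplus>\<^bsub>tensor H ?N\<^esub>i\<in>I. \<phi> i u \<odot>\<^bsub>tensor H ?N\<^esub> s i)" for u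
  have s: "s i \<in> carrier (tensor H ?N)" if "i \<in> I" for i
    unfolding s_def by (rule vs_finsum_closed[OF VT pure_closed[OF VH VN comatrixD(2)[OF T that] D(2)]])
  have \<iota>s: "?\<iota> (s i) = coact X1 (e i)" if i: "i \<in> I" for i
  proof -
    have "?\<iota> (s i) = (\<Oplus>\<^bsub>tensor H X1\<^esub>j\<in>I. ?\<iota> (pure H ?N (T i j) (e j)))"
      unfolding s_def by (rule lin_finsum[OF \<iota> VT VX I pure_closed[OF VH VN comatrixD(2)[OF T i] D(2)]])
    also have "\<dots> = (\<Oplus>\<^bsub>tensor H X1\<^esub>j\<in>I. pure H X1 (T i j) (e j))"
      by (rule vs_finsum_cong[OF VX refl]) (simp_all add: \<iota>_pure comatrixD(2)[OF T i] eN e VH V)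
    finally show ?thesis by (simp add: ce[OF i])
  qed
  have c'_lin: "c' \<in> linear_maps ?N (tensor H ?N)"
    unfolding c'_def by (rule lin_finsum_fun[OF lin_functional_smult[OF D(3) VT s] VT])
  have c'e: "c' (e j) = s j" if j: "j \<in> I" for j
  proof -
    have "c' (e j) = (\<Oplus>\<^bsub>tensor H ?N\<^esub>i\<in>I. (if i = j then 1 else 0) \<odot>\<^bsub>tensor H ?N\<^esub> s i)"
      unfolding c'_def by (rule vs_finsum_cong[OF VT refl]) (use j D(4) s VT in auto)
    also have "\<dots> = s j" by (rule finsum_delta_smult[OF VT I j s])
    finally show ?thesis .
  qed
  have \<iota>c': "?\<iota> (c' u) = coact X1 u" if u: "u \<in> N" for u
    by (rule basis_lin_eq[OF b VN VX lin_comp[OF c'_lin \<iota>]]) (use u c sl[of "tensor H X1"] in \<open>auto simp: c'e \<iota>s\<close>)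
  have c'N: "c' u \<in> carrier (tensor H ?N)" if "u \<in> N" for u
    using lin_closed[OF c'_lin] that by simp
  show "coact X1 ` N \<subseteq> ?\<iota> ` carrier (tensor H ?N)"
  proof
    fix t assume "t \<in> coact X1 ` N"
    then obtain u where u: "u \<in> N" "t = coact X1 u" by auto
    show "t \<in> ?\<iota> ` carrier (tensor H ?N)"
      by (rule image_eqI[of _ _ "c' u"]) (simp_all add: u \<iota>c' c'N)
  qed
  have coact: "coact (restrict_comodule H X1 N) u = c' u" if u: "u \<in> carrier ?N" for u
  proof -
    have "(THE t. t \<in> carrier (tensor H ?N) \<and> ?\<iota> t = coact X1 u) = c' u"
    proof (rule the_equality)
      show *: "c' u \<in> carrier (tensor H ?N) \<and> ?\<iota> (c' u) = coact X1 u"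
        using u c'N[of u] \<iota>c'[of u] by simp
      show "t = c' u" if "t \<in> carrier (tensor H ?N) \<and> ?\<iota> t = coact X1 u" for t
        by (rule inj) (use that * in auto)
    qed
    then show ?thesis by (simp add: restrict_comodule_def)
  qed
  have same: "same_module ?N (restrict_comodule H X1 N)"
    by (simp add: same_module_def restrict_comodule_def)
  show "has_matrix H (restrict_comodule H X1 N) I e T"
    by (rule has_matrix_same[OF same VN b T c'_lin coact]) (simp_all add: c'e s_def)
qed

text \<open>The zeros keep the coaction on the vectors indexed by \<open>J\<close> inside their
  span. In the comultiplication of such an entry they remove every term through an index outside
  \<open>J\<close>, since its first factor is zero.\<close>

lemma subcomodule_span:
  assumes H: "prebialgebra H" and m: "has_matrix H U I e T" and J: "J \<subseteq> I"
    and T0: "\<And>i j. i \<in> J \<Longrightarrow> j \<in> I - J \<Longrightarrow> T i j = \<zero>\<^bsub>H\<^esub>"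
  shows "has_matrix H (restrict_comodule H U (lin_span U (e ` J))) J e T"
    and "subcomodule H U (lin_span U (e ` J))"
proof -
  obtain \<phi> where b: "dual_basis U I e \<phi>" by (rule has_matrixE[OF m])
  note D = dual_basisD[OF b] and M = has_matrixD[OF m] and B = prebialgebraD[OF H]
  note T = comatrixD[OF M(2)]
  note U = M(1) and VH = B(2) and VHH = B(7)
  note VHU = vspace_tensor[OF VH U]
  have finJ: "finite J" using J D(1) finite_subset by blast
  have restrict_sum: "finsum P f I = finsum P f J"
    if P: "vspace P" and "\<And>k. k \<in> I - J \<Longrightarrow> f k = \<zero>\<^bsub>P\<^esub>" "\<And>k. k \<in> J \<Longrightarrow> f k \<in> carrier P"
    for P :: "(complex, 'p, 'z) module_scheme" and f
    by (rule vs_finsum_neutral[OF P D(1) J]) (use that in auto)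
  have TJ: "comatrix H J T"
    unfolding comatrix_def
  proof (intro conjI ballI finJ)
    fix i j assume ij: "i \<in> J" "j \<in> J"
    then have ij': "i \<in> I" "j \<in> I" using J by auto
    show "T i j \<in> carrier H" "counit H (T i j) = (if i = j then 1 else 0)"
      by (rule T(2)[OF ij'] T(4)[OF ij'])+
    show "comult H (T i j) = (\<Oplus>\<^bsub>tensor H H\<^esub>k\<in>J. pure H H (T i k) (T k j))"
      unfolding T(3)[OF ij']
    proof (rule vs_finsum_neutral[OF VHH D(1) J])
      show "pure H H (T i k) (T k j) = \<zero>\<^bsub>tensor H H\<^esub>" if "k \<in> I" "k \<notin> J" for k
        using that T0[OF ij(1), of k] pure_zero_left[OF VH VH T(2)[OF that(1) ij'(2)]] by simp
      show "pure H H (T i k) (T k j) \<in> carrier (tensor H H)" if "k \<in> J" for k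
        by (rule pure_closed[OF VH VH T(2) T(2)]) (use that ij' J in auto)
    qed
  qed
  have ce: "coact U (e i) = (\<Oplus>\<^bsub>tensor H U\<^esub>j\<in>J. pure H U (T i j) (e j))" if i: "i \<in> J" for i
    unfolding M(4)[OF subsetD[OF J i]]
  proof (rule vs_finsum_neutral[OF VHU D(1) J])
    show "pure H U (T i k) (e k) = \<zero>\<^bsub>tensor H U\<^esub>" if "k \<in> I" "k \<notin> J" for k
      using that T0[OF i, of k] pure_zero_left[OF VH U D(2)[OF that(1)]] by simp
    show "pure H U (T i k) (e k) \<in> carrier (tensor H U)" if "k \<in> J" for k
      by (rule pure_closed[OF VH U T(2) D(2)]) (use that i J in auto)
  qed
  have r: "has_matrix H (restrict_comodule H U (lin_span U (e ` J))) J e T"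
    "submodule (lin_span U (e ` J)) CC U"
    "coact U ` lin_span U (e ` J) \<subseteq> tensor_map H U id id ` carrier (tensor H (U\<lparr>carrier := lin_span U (e ` J)\<rparr>))"
    by (rule has_matrix_restrict[where \<phi> = \<phi>, OF VH U M(3) finJ D(2) D(3) D(4) TJ ce];
        use J in auto)+
  show "has_matrix H (restrict_comodule H U (lin_span U (e ` J))) J e T" by (rule r(1))
  show "subcomodule H U (lin_span U (e ` J))"
    unfolding subcomodule_def using has_matrix_left_comodule[OF H m] r(2,3) by simp
qed

subsection \<open>Quotients\<close>

text \<open>The common value of a map on a class. The definite description is chosen to match the
  coaction in \<open>quotient_comodule\<close>.\<close>

definition coset_fun :: "('u \<Rightarrow> 'v) \<Rightarrow> 'u set \<Rightarrow> 'v" where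
  "coset_fun f S = (THE y. \<forall>x\<in>S. y = f x)"

lemma coset_fun:
  assumes N: "submodule N CC U" and U: "vspace U" and f: "f \<in> linear_maps U V" and V: "vspace V"
    and N0: "\<And>x. x \<in> N \<Longrightarrow> f x = \<zero>\<^bsub>V\<^esub>"
  shows "x \<in> carrier U \<Longrightarrow> coset_fun f (N +>\<^bsub>U\<^esub> x) = f x"
    and "coset_fun f \<in> linear_maps (quot U N) V"
proof -
  show *: "coset_fun f (N +>\<^bsub>U\<^esub> x) = f x" if x: "x \<in> carrier U" for x
    unfolding coset_fun_def
  proof (rule the_equality)
    show "\<forall>y\<in>N +>\<^bsub>U\<^esub> x. f x = f y"
      using lin_eq_on_coset[OF N U f V N0 x] by auto
    show "z = f x" if "\<forall>y\<in>N +>\<^bsub>U\<^esub> x. z = f y" for z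
      using that mem_coset_iff[OF N U x, of x] x by auto
  qed
  show "coset_fun f \<in> linear_maps (quot U N) V"
    by (rule quot_lin_lift[OF N U f V N0 *])
qed

text \<open>The same zeros seen from the other side: for indices outside \<open>J\<close>, a term of
  the comultiplication through an index in \<open>J\<close> dies because its second factor is
  zero.\<close>

lemma has_matrix_quotient:
  assumes H: "prebialgebra H" and m: "has_matrix H U I e T" and J: "J \<subseteq> I"
    and T0: "\<And>i j. i \<in> J \<Longrightarrow> j \<in> I - J \<Longrightarrow> T i j = \<zero>\<^bsub>H\<^esub>"
  defines "N \<equiv> lin_span U (e ` J)"
  shows "has_matrix H (quotient_comodule H U N) (I - J) (\<lambda>i. N +>\<^bsub>U\<^esub> e i) T"
    and "u \<in> carrier U \<Longrightarrow> coact (quotient_comodule H U N) (N +>\<^bsub>U\<^esub> u) = tensor_map H (quot U N) id (\<lambda>u. N +>\<^bsub>U\<^esub> u) (coact U u)"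
    and "same_module (quot U N) (quotient_comodule H U N)"
    and "submodule N CC U"
proof -
  obtain \<phi> where b: "dual_basis U I e \<phi>" by (rule has_matrixE[OF m])
  note D = dual_basisD[OF b] and M = has_matrixD[OF m] and B = prebialgebraD[OF H]
  note T = comatrixD[OF M(2)]
  note U = M(1) and VH = B(2) and VHH = B(7)
  note VHU = vspace_tensor[OF VH U]
  let ?Q = "quot U N" and ?\<pi> = "\<lambda>u. N +>\<^bsub>U\<^esub> u"
  have eJ: "e ` J \<subseteq> carrier U" using D(2) J by auto
  show sub: "submodule N CC U" unfolding N_def by (rule lin_span_submodule[OF U eJ])
  note Q = vspace_quot[OF sub U]
  note VHQ = vspace_tensor[OF VH Q]
  have \<pi>: "?\<pi> \<in> linear_maps U ?Q" by (rule coset_lin[OF sub U])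
  have eN: "e j \<in> N" if "j \<in> J" for j
    using lin_span_superset[of "e ` J" U] that unfolding N_def by blast
  have \<pi>0: "?\<pi> (e j) = \<zero>\<^bsub>?Q\<^esub>" if "j \<in> J" for j
    using coset_eq_self_iff[OF sub U D(2)] eN[OF that] that J by (auto simp: quot_simps(2))
  \<comment> \<open>To vanish on the span \<open>N\<close>, a linear map only has to vanish on the
    vectors indexed by \<open>J\<close>.\<close>
  have vanish: "f x = \<zero>\<^bsub>V\<^esub>" if V: "vspace V" and f: "f \<in> linear_maps U V" and z: "\<And>j. j \<in> J \<Longrightarrow> f (e j) = \<zero>\<^bsub>V\<^esub>" and x: "x \<in> N"
    for f x and V :: "(complex, 'v, 'z) module_scheme"
  proof (rule lin_span_eq[OF f _ U V eJ _ x[unfolded N_def]])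
    show "(\<lambda>x. \<zero>\<^bsub>V\<^esub>) \<in> linear_maps U V" using V by (intro linear_mapsI) auto
  qed (use z in auto)
  have \<phi>0: "\<phi> i x = \<zero>\<^bsub>CC\<^esub>" if "i \<in> I - J" "x \<in> N" for i x
    by (rule vanish[OF vspace_CC D(3) _ that(2)]) (use that D(4) J in auto)
  have V': "finite (I - J)" using D(1) by simp
  note sum_cut = vs_finsum_neutral[OF _ D(1) Diff_subset[of I J]]
  have bQ: "dual_basis ?Q (I - J) (\<lambda>i. ?\<pi> (e i)) (\<lambda>i. coset_fun (\<phi> i))"
    unfolding dual_basis_def
  proof (intro conjI ballI V')
    fix i assume i: "i \<in> I - J"
    have cf: "coset_fun (\<phi> i) (?\<pi> x) = \<phi> i x" if "x \<in> carrier U" for x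
      by (rule coset_fun(1)[OF sub U D(3) vspace_CC \<phi>0[OF i] that]) (use i in auto)
    show "?\<pi> (e i) \<in> carrier ?Q" by (rule lin_closed[OF \<pi> D(2)]) (use i in auto)
    show "coset_fun (\<phi> i) \<in> linear_maps ?Q CC" 
      by (rule coset_fun(2)[OF sub U D(3) vspace_CC \<phi>0[OF i]]) (use i in auto)
    show "coset_fun (\<phi> i) (?\<pi> (e j)) = (if i = j then 1 else 0)" if "j \<in> I - J" for j
      using cf[of "e j"] i that D(2,4) by auto
  next
    fix S assume "S \<in> carrier ?Q"
    then obtain u where u: "u \<in> carrier U" "S = ?\<pi> u" by (rule coset_cases[OF sub U])
    have "?\<pi> u = ?\<pi> (\<Oplus>\<^bsub>U\<^esub>i\<in>I. \<phi> i u \<odot>\<^bsub>U\<^esub> e i)" using D(5)[OF u(1)] by (rule arg_cong)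
    also have "\<dots> = (\<Oplus>\<^bsub>?Q\<^esub>i\<in>I. ?\<pi> (\<phi> i u \<odot>\<^bsub>U\<^esub> e i))"
      by (rule lin_finsum[OF \<pi> U Q D(1)]) (simp add: D(2) U)
    also have "\<dots> = (\<Oplus>\<^bsub>?Q\<^esub>i\<in>I. \<phi> i u \<odot>\<^bsub>?Q\<^esub> ?\<pi> (e i))"
      by (rule vs_finsum_cong[OF Q refl]) (simp_all add: D(2) lin_smult[OF \<pi>] lin_closed[OF \<pi>] Q)
    also have "\<dots> = (\<Oplus>\<^bsub>?Q\<^esub>i\<in>I - J. \<phi> i u \<odot>\<^bsub>?Q\<^esub> ?\<pi> (e i))"
    proof (rule sum_cut[OF Q])
      show "\<phi> i u \<odot>\<^bsub>?Q\<^esub> ?\<pi> (e i) = \<zero>\<^bsub>?Q\<^esub>" if "i \<in> I" "i \<notin> I - J" for i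
        using that \<pi>0[of i] vs_zero(4)[OF Q] by simp
    qed (simp add: D(2) lin_closed[OF \<pi>] Q)
    also have "\<dots> = (\<Oplus>\<^bsub>?Q\<^esub>i\<in>I - J. coset_fun (\<phi> i) S \<odot>\<^bsub>?Q\<^esub> ?\<pi> (e i))"
    proof (rule vs_finsum_cong[OF Q refl])
      fix i assume i: "i \<in> I - J"
      have "coset_fun (\<phi> i) S = \<phi> i u"
        unfolding u(2) by (rule coset_fun(1)[OF sub U D(3) vspace_CC \<phi>0[OF i] u(1)]) (use i in auto)
      then show "\<phi> i u \<odot>\<^bsub>?Q\<^esub> ?\<pi> (e i) = coset_fun (\<phi> i) S \<odot>\<^bsub>?Q\<^esub> ?\<pi> (e i)" by simp
      show "coset_fun (\<phi> i) S \<odot>\<^bsub>?Q\<^esub> ?\<pi> (e i) \<in> carrier ?Q"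
        using i by (simp add: D(2) lin_closed[OF \<pi>] Q)
    qed
    finally show "S = (\<Oplus>\<^bsub>?Q\<^esub>i\<in>I - J. coset_fun (\<phi> i) S \<odot>\<^bsub>?Q\<^esub> ?\<pi> (e i))" using u(2) by simp
  qed
  have TQ: "comatrix H (I - J) T"
    unfolding comatrix_def
  proof (intro conjI ballI V')
    fix i j assume ij: "i \<in> I - J" "j \<in> I - J"
    then have ij': "i \<in> I" "j \<in> I" by auto
    show "T i j \<in> carrier H" "counit H (T i j) = (if i = j then 1 else 0)"
      by (rule T(2)[OF ij'] T(4)[OF ij'])+
    show "comult H (T i j) = (\<Oplus>\<^bsub>tensor H H\<^esub>k\<in>I - J. pure H H (T i k) (T k j))"
      unfolding T(3)[OF ij']
    proof (rule sum_cut[OF VHH])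
      show "pure H H (T i k) (T k j) = \<zero>\<^bsub>tensor H H\<^esub>" if "k \<in> I" "k \<notin> I - J" for k
        using that T0[OF _ ij(2), of k] pure_zero_right[OF VH VH T(2)[OF ij'(1) that(1)]] by simp
      show "pure H H (T i k) (T k j) \<in> carrier (tensor H H)" if "k \<in> I - J" for k
        by (rule pure_closed[OF VH VH T(2) T(2)]) (use that ij' in auto)
    qed
  qed
  define c where "c u = tensor_map H ?Q id ?\<pi> (coact U u)" for u
  note tm = tensor_map_linear[OF VH U VH Q lin_id(2) \<pi>]
  have c: "c \<in> linear_maps U (tensor H ?Q)"
    unfolding c_def by (rule lin_comp[OF M(3) tm])
  have ce: "c (e i) = (\<Oplus>\<^bsub>tensor H ?Q\<^esub>j\<in>I. pure H ?Q (T i j) (?\<pi> (e j)))" if i: "i \<in> I" for i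
  proof -
    have "c (e i) = (\<Oplus>\<^bsub>tensor H ?Q\<^esub>j\<in>I. tensor_map H ?Q id ?\<pi> (pure H U (T i j) (e j)))"
      unfolding c_def M(4)[OF i] by (rule lin_finsum[OF tm VHU VHQ D(1)]) (simp add: T(2) i D(2) VH U)
    also have "\<dots> = (\<Oplus>\<^bsub>tensor H ?Q\<^esub>j\<in>I. pure H ?Q (T i j) (?\<pi> (e j)))"
      by (rule vs_finsum_cong[OF VHQ refl])
        (simp_all add: tensor_map_pure[OF VH U VH Q lin_id(2) \<pi>] T(2) i D(2) VH Q lin_closed[OF \<pi>])
    finally show ?thesis .
  qed
  \<comment> \<open>In the coaction on a vector of \<open>J\<close> each term dies, either because
    its vector becomes zero in the quotient or because its coefficient lies in the block of
    zeros.\<close>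
  have c0: "c x = \<zero>\<^bsub>tensor H ?Q\<^esub>" if "x \<in> N" for x
  proof (rule vanish[OF VHQ c _ that])
    fix i assume i: "i \<in> J"
    show "c (e i) = \<zero>\<^bsub>tensor H ?Q\<^esub>"
      unfolding ce[OF subsetD[OF J i]]
    proof (rule vs_finsum_zero[OF VHQ])
      fix j assume j: "j \<in> I"
      show "pure H ?Q (T i j) (?\<pi> (e j)) = \<zero>\<^bsub>tensor H ?Q\<^esub>"
      proof (cases "j \<in> J")
        case True
        then show ?thesis using \<pi>0[OF True] pure_zero_right[OF VH Q T(2)[OF subsetD[OF J i] j]] by simp
      next
        case False
        then show ?thesis using T0[OF i, of j] j pure_zero_left[OF VH Q lin_closed[OF \<pi> D(2)[OF j]]] by simp
      qed
    qed
  qed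
  have cf: "coset_fun c (?\<pi> x) = c x" if "x \<in> carrier U" for x
    by (rule coset_fun(1)[OF sub U c VHQ c0 that])
  have cf_lin: "coset_fun c \<in> linear_maps ?Q (tensor H ?Q)"
    by (rule coset_fun(2)[OF sub U c VHQ c0])
  have coact: "coact (quotient_comodule H U N) = coset_fun c"
    by (rule ext) (simp add: quotient_comodule_def module.defs comodule.defs coset_fun_def c_def)
  show same: "same_module ?Q (quotient_comodule H U N)"
    by (simp add: same_module_def quotient_comodule_def module.defs comodule.defs)
  show "coact (quotient_comodule H U N) (N +>\<^bsub>U\<^esub> u) = tensor_map H ?Q id ?\<pi> (coact U u)" if "u \<in> carrier U"
    unfolding coact cf[OF that] by (simp add: c_def)
  show "has_matrix H (quotient_comodule H U N) (I - J) (\<lambda>i. N +>\<^bsub>U\<^esub> e i) T"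
  proof (rule has_matrix_same[OF same Q bQ TQ cf_lin])
    show "coact (quotient_comodule H U N) u = coset_fun c u" for u by (simp add: coact)
    fix i assume i: "i \<in> I - J"
    then have i': "i \<in> I" by simp
    show "coset_fun c (?\<pi> (e i)) = (\<Oplus>\<^bsub>tensor H ?Q\<^esub>j\<in>I - J. pure H ?Q (T i j) (?\<pi> (e j)))"
      unfolding cf[OF D(2)[OF i']] ce[OF i']
    proof (rule sum_cut[OF VHQ])
      show "pure H ?Q (T i j) (?\<pi> (e j)) = \<zero>\<^bsub>tensor H ?Q\<^esub>" if "j \<in> I" "j \<notin> I - J" for j
        using that \<pi>0[of j] pure_zero_right[OF VH Q T(2)[OF i' that(1)]] by simp
      show "pure H ?Q (T i j) (?\<pi> (e j)) \<in> carrier (tensor H ?Q)" if "j \<in> I - J" for j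
        by (rule pure_closed[OF VH Q T(2)[OF i'] lin_closed[OF \<pi> D(2)]]) (use that in auto)
    qed
  qed
qed

text \<open>The image of an intermediate subcomodule is a subcomodule of the irreducible quotient.
  If it is zero, the subcomodule is \<open>N\<close>; if it is everything, the subcomodule is the
  whole space, because it contains \<open>N\<close>.\<close>

lemma maximal_subcomodule_quotient:
  assumes H: "prebialgebra H" and m: "has_matrix H U I e T" and J: "J \<subset> I"
    and T0: "\<And>i j. i \<in> J \<Longrightarrow> j \<in> I - J \<Longrightarrow> T i j = \<zero>\<^bsub>H\<^esub>"
  defines "N \<equiv> lin_span U (e ` J)"
  assumes irr: "irreducible_comodule H (quotient_comodule H U N)"
  shows "maximal_subcomodule H U N"
proof -
  have J': "J \<subseteq> I" using J by auto
  let ?Q = "quot U N" and ?QC = "quotient_comodule H U N" and ?\<pi> = "\<lambda>u. N +>\<^bsub>U\<^esub> u"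
  have q1: "has_matrix H ?QC (I - J) (\<lambda>i. N +>\<^bsub>U\<^esub> e i) T"
    unfolding N_def by (rule has_matrix_quotient(1)[OF H m J' T0])
  have q2: "coact ?QC (N +>\<^bsub>U\<^esub> u) = tensor_map H ?Q id ?\<pi> (coact U u)" if "u \<in> carrier U" for u
    unfolding N_def by (rule has_matrix_quotient(2)[OF H m J' T0 that])
  have same: "same_module ?Q ?QC"
    unfolding N_def by (rule has_matrix_quotient(3)[OF H m J' T0])
  have sub: "submodule N CC U"
    unfolding N_def by (rule has_matrix_quotient(4)[OF H m J' T0])
  have subc: "subcomodule H U N" unfolding N_def by (rule subcomodule_span(2)[OF H m J' T0])
  note M = has_matrixD[OF m] and B = prebialgebraD[OF H]
  note U = M(1) and VH = B(2)
  note Q = vspace_quot[OF sub U]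
  have \<pi>: "?\<pi> \<in> linear_maps U ?Q" by (rule coset_lin[OF sub U])
  have main: "K = N \<or> K = carrier U" if K: "subcomodule H U K" "N \<subseteq> K" for K
  proof -
    have subK: "submodule K CC U" using K by (simp add: subcomodule_def)
    note KD = submoduleD_vs[OF subK U]
    let ?K = "U\<lparr>carrier := K\<rparr>" and ?L = "?\<pi> ` K"
    let ?QL = "?QC\<lparr>carrier := ?L\<rparr>"
    have VK: "vspace ?K" by (rule vspace_carrier_update[OF subK U])
    have subL: "submodule ?L CC ?Q" by (rule lin_image_submodule[OF \<pi> U Q subK])
    have VQC: "vspace ?QC" by (rule same_vspace[OF same Q])
    have subL': "submodule ?L CC ?QC"
      using submoduleD_vs[OF subL Q] by (intro submoduleI_vs[OF VQC]) (simp_all add: same_simps[OF same])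
    have VL: "vspace ?QL" by (rule vspace_carrier_update[OF subL' VQC])
    have \<pi>K: "?\<pi> \<in> linear_maps ?K ?QL"
    proof (rule linear_mapsI)
      show "?\<pi> (x \<oplus>\<^bsub>?K\<^esub> y) = ?\<pi> x \<oplus>\<^bsub>?QL\<^esub> ?\<pi> y" if "x \<in> carrier ?K" "y \<in> carrier ?K" for x y
        using that lin_add[OF \<pi> KD(3) KD(3), of x y] by (simp add: same_simps[OF same])
      show "?\<pi> (z \<odot>\<^bsub>?K\<^esub> x) = z \<odot>\<^bsub>?QL\<^esub> ?\<pi> x" if "x \<in> carrier ?K" for z x
        using that lin_smult[OF \<pi> KD(3), of x z] by (simp add: same_simps[OF same])
    qed simp
    have idL: "id \<in> linear_maps ?QL ?Q"
      by (rule linear_mapsI) (use submoduleD_vs(3)[OF subL Q] in \<open>simp_all add: same_simps[OF same]\<close>)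
    have idK: "id \<in> linear_maps ?K U"
      by (rule linear_mapsI) (use KD(3) in simp_all)
    have "coact ?QC ` ?L \<subseteq> tensor_map H ?QC id id ` carrier (tensor H ?QL)"
    proof (rule subsetI, elim imageE)
      fix s S u assume s: "s = coact ?QC S" "S = ?\<pi> u" and u: "u \<in> K"
      obtain t where t: "t \<in> carrier (tensor H ?K)" "coact U u = tensor_map H U id id t"
        using subsetD[OF _ imageI[OF u], of "coact U" "tensor_map H U id id ` carrier (tensor H ?K)"] K(1)
        by (auto simp: subcomodule_def)
      \<comment> \<open>Including \<open>K\<close> and then projecting equals projecting onto the
        image of \<open>K\<close> and then including. This places the coaction on the image in the
        required tensor product.\<close>
      have "tensor_map H ?Q id ?\<pi> (tensor_map H U id id t) = tensor_map H ?Q id id (tensor_map H ?QL id ?\<pi> t)"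
        by (rule tensor_lin_eq[OF VH VK
              lin_comp[OF tensor_map_linear[OF VH VK VH U lin_id(2) idK] tensor_map_linear[OF VH U VH Q lin_id(2) \<pi>]]
              lin_comp[OF tensor_map_linear[OF VH VK VH VL lin_id(2) \<pi>K] tensor_map_linear[OF VH VL VH Q lin_id(2) idL]]
              vspace_tensor[OF VH Q] _ t(1)])
          (simp add: KD(3) tensor_map_pure[OF VH VK VH U lin_id(2) idK] tensor_map_pure[OF VH U VH Q lin_id(2) \<pi>]
            tensor_map_pure[OF VH VK VH VL lin_id(2) \<pi>K] tensor_map_pure[OF VH VL VH Q lin_id(2) idL])
      then have "s = tensor_map H ?QC id id (tensor_map H ?QL id ?\<pi> t)"
        using s q2[OF KD(3)[OF u]] t(2) by (simp add: same_tensor_map[OF same])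
      then show "s \<in> tensor_map H ?QC id id ` carrier (tensor H ?QL)"
        using lin_closed[OF tensor_map_linear[OF VH VK VH VL lin_id(2) \<pi>K] t(1)] by (rule image_eqI)
    qed
    then have "subcomodule H ?QC ?L"
      using subL' has_matrix_left_comodule[OF H q1] by (simp add: subcomodule_def)
    then have cases: "?L = {\<zero>\<^bsub>?QC\<^esub>} \<or> ?L = carrier ?QC"
      using irr by (simp add: irreducible_comodule_def)
    show ?thesis
      using cases
    proof
      assume L: "?L = {\<zero>\<^bsub>?QC\<^esub>}"
      have "u \<in> N" if "u \<in> K" for u
      proof -
        have "?\<pi> u \<in> ?L" using that by (rule imageI)
        then have "?\<pi> u = N" unfolding L same_simps[OF same] quot_simps(2) by simp
        then show ?thesis using iffD1[OF coset_eq_self_iff[OF sub U KD(3)[OF that]]] by simp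
      qed
      then have "K = N" using K(2) by blast
      then show ?thesis ..
    next
      assume L: "?L = carrier ?QC"
      have "u \<in> K" if u: "u \<in> carrier U" for u
      proof -
        have "?\<pi> u \<in> ?L" unfolding L same_simps[OF same] by (rule lin_closed[OF \<pi> u])
        then obtain v where v: "v \<in> K" "?\<pi> u = ?\<pi> v" by (elim imageE)
        \<comment> \<open>The difference of two vectors with the same class lies in \<open>N\<close>
          and thus in \<open>K\<close>, so \<open>u\<close> is recovered from \<open>v\<close>
          inside \<open>K\<close>.\<close>
        have "u \<oplus>\<^bsub>U\<^esub> (- 1) \<odot>\<^bsub>U\<^esub> v \<in> N" by (rule iffD1[OF coset_eq_iff[OF sub U u KD(3)[OF v(1)]] v(2)])
        then have "(u \<oplus>\<^bsub>U\<^esub> (- 1) \<odot>\<^bsub>U\<^esub> v) \<oplus>\<^bsub>U\<^esub> v \<in> K" using K(2) v(1) by (intro KD(4)[OF subsetD]) auto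
        moreover have "(- 1) \<odot>\<^bsub>U\<^esub> v \<oplus>\<^bsub>U\<^esub> v = \<zero>\<^bsub>U\<^esub>"
          using vs_diff_eq_zero[OF U KD(3)[OF v(1)] KD(3)[OF v(1)]]
            vs_ac(2)[OF U KD(3)[OF v(1)] vs_closed(3)[OF U KD(3)[OF v(1)]], of "- 1"] by simp
        ultimately show ?thesis
          using vs_ac(1)[OF U u vs_closed(3)[OF U KD(3)[OF v(1)]] KD(3)[OF v(1)], of "- 1"] vs_zero(2)[OF U u] by simp
      qed
      then have "K = carrier U" using KD(1) by blast
      then show ?thesis ..
    qed
  qed
  have "carrier ?QC \<noteq> {\<zero>\<^bsub>?QC\<^esub>}" using irr by (simp add: irreducible_comodule_def)
  have "N \<noteq> carrier U"
  proof
    assume N: "N = carrier U"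
    have "S = \<zero>\<^bsub>?Q\<^esub>" if "S \<in> carrier ?Q" for S
    proof -
      obtain u where u: "u \<in> carrier U" "S = ?\<pi> u"
        using \<open>S \<in> carrier ?Q\<close> by (rule coset_cases[OF sub U])
      have "u \<in> N" using u(1) N by simp
      then have "?\<pi> u = N" by (rule iffD2[OF coset_eq_self_iff[OF sub U u(1)]])
      then show ?thesis using u(2) by (simp only: quot_simps(2))
    qed
    then have "carrier ?Q = {\<zero>\<^bsub>?Q\<^esub>}" using vs_closed(1)[OF Q] by blast
    then show False using \<open>carrier ?QC \<noteq> {\<zero>\<^bsub>?QC\<^esub>}\<close> by (simp add: same_simps[OF same])
  qed
  then show ?thesis unfolding maximal_subcomodule_def using subc main by blast
qed


subsection \<open>Change of basis and isomorphisms\<close>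

text \<open>Relabelling by \<open>h\<close> together with conjugation by the diagonal matrix of the
  scalars \<open>s\<close>. The relation between the matrices is cross-multiplied, so that no
  quotient of scalars occurs in it.\<close>

lemma has_matrix_change:
  assumes H: "prebialgebra H" and m: "has_matrix H U I e T" and h: "bij_betw h K I"
    and s: "\<And>k. k \<in> K \<Longrightarrow> s k \<noteq> 0"
    and S: "\<And>i j. i \<in> K \<Longrightarrow> j \<in> K \<Longrightarrow> s i \<odot>\<^bsub>H\<^esub> T (h i) (h j) = s j \<odot>\<^bsub>H\<^esub> S i j"
    and Sc: "\<And>i j. i \<in> K \<Longrightarrow> j \<in> K \<Longrightarrow> S i j \<in> carrier H"
  shows "has_matrix H U K (\<lambda>k. s k \<odot>\<^bsub>U\<^esub> e (h k)) S"
proof -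
  obtain \<phi> where b: "dual_basis U I e \<phi>" by (rule has_matrixE[OF m])
  note D = dual_basisD[OF b] and M = has_matrixD[OF m] and B = prebialgebraD[OF H]
  note T = comatrixD[OF M(2)]
  note U = M(1) and VH = B(2) and VHH = B(7)
  note VHU = vspace_tensor[OF VH U]
  have hK: "h k \<in> I" if "k \<in> K" for k using that h by (auto simp: bij_betw_def)
  have inj: "inj_on h K" and im: "I = h ` K" using h by (auto simp: bij_betw_def)
  have finK: "finite K" using bij_betw_finite[OF h] D(1) by simp
  have reindex: "finsum P f I = finsum P (\<lambda>k. f (h k)) K" if "vspace P" "\<And>i. i \<in> I \<Longrightarrow> f i \<in> carrier P"
    for P :: "(complex, 'p, 'z) module_scheme" and f
    unfolding im by (rule vs_finsum_reindex[OF that(1) inj]) (use that(2) hK in auto)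
  have Seq: "S i j = (s i / s j) \<odot>\<^bsub>H\<^esub> T (h i) (h j)" if "i \<in> K" "j \<in> K" for i j
  proof -
    have "(1 / s j) \<odot>\<^bsub>H\<^esub> (s i \<odot>\<^bsub>H\<^esub> T (h i) (h j)) = (1 / s j) \<odot>\<^bsub>H\<^esub> (s j \<odot>\<^bsub>H\<^esub> S i j)"
      using S[OF that] by simp
    then show ?thesis
      using s[OF that(2)] by (simp add: vs_smult_smult[OF VH] T(2)[OF hK hK] Sc that vs_zero(5)[OF VH])
  qed
  have b': "dual_basis U K (\<lambda>k. s k \<odot>\<^bsub>U\<^esub> e (h k)) (\<lambda>k u. (1 / s k) * \<phi> (h k) u)"
    unfolding dual_basis_def
  proof (intro conjI ballI finK)
    fix k assume k: "k \<in> K"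
    show "s k \<odot>\<^bsub>U\<^esub> e (h k) \<in> carrier U" by (simp add: U D(2) hK k)
    show "(\<lambda>u. (1 / s k) * \<phi> (h k) u) \<in> linear_maps U CC"
      using lin_smult_fun[OF D(3)[OF hK[OF k]] vspace_CC, of "1 / s k"] by simp
    show "(1 / s k) * \<phi> (h k) (s j \<odot>\<^bsub>U\<^esub> e (h j)) = (if k = j then 1 else 0)" if j: "j \<in> K" for j
      using lin_smult[OF D(3)[OF hK[OF k]] D(2)[OF hK[OF j]], of "s j"] D(4)[OF hK[OF k] hK[OF j]] s[OF k]
        inj_on_eq_iff[OF inj k j] by auto
  next
    fix u assume u: "u \<in> carrier U"
    have "u = (\<Oplus>\<^bsub>U\<^esub>i\<in>I. \<phi> i u \<odot>\<^bsub>U\<^esub> e i)" by (rule D(5)[OF u])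
    also have "\<dots> = (\<Oplus>\<^bsub>U\<^esub>k\<in>K. \<phi> (h k) u \<odot>\<^bsub>U\<^esub> e (h k))"
      by (rule reindex[OF U]) (simp add: U D(2))
    also have "\<dots> = (\<Oplus>\<^bsub>U\<^esub>k\<in>K. ((1 / s k) * \<phi> (h k) u) \<odot>\<^bsub>U\<^esub> (s k \<odot>\<^bsub>U\<^esub> e (h k)))"
      by (rule vs_finsum_cong[OF U refl]) (simp_all add: U D(2) hK vs_smult_smult[OF U] s)
    finally show "u = (\<Oplus>\<^bsub>U\<^esub>k\<in>K. ((1 / s k) * \<phi> (h k) u) \<odot>\<^bsub>U\<^esub> (s k \<odot>\<^bsub>U\<^esub> e (h k)))" .
  qed
  have S': "comatrix H K S"
    unfolding comatrix_def
  proof (intro conjI ballI finK Sc)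
    fix i j assume ij: "i \<in> K" "j \<in> K"
    note ij' = hK[OF ij(1)] hK[OF ij(2)]
    have "comult H (S i j) = (s i / s j) \<odot>\<^bsub>tensor H H\<^esub> (\<Oplus>\<^bsub>tensor H H\<^esub>k\<in>I. pure H H (T (h i) k) (T k (h j)))"
      unfolding Seq[OF ij] lin_smult[OF B(5) T(2)[OF ij']] T(3)[OF ij'] ..
    also have "(\<Oplus>\<^bsub>tensor H H\<^esub>k\<in>I. pure H H (T (h i) k) (T k (h j))) = (\<Oplus>\<^bsub>tensor H H\<^esub>k\<in>K. pure H H (T (h i) (h k)) (T (h k) (h j)))"
      by (rule reindex[OF VHH]) (simp add: VH T(2) ij')
    also have "(s i / s j) \<odot>\<^bsub>tensor H H\<^esub> \<dots> = (\<Oplus>\<^bsub>tensor H H\<^esub>k\<in>K. (s i / s j) \<odot>\<^bsub>tensor H H\<^esub> pure H H (T (h i) (h k)) (T (h k) (h j)))"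
      by (rule vs_finsum_smult[OF VHH, symmetric]) (simp add: VH T(2) ij' hK)
    also have "\<dots> = (\<Oplus>\<^bsub>tensor H H\<^esub>k\<in>K. pure H H (S i k) (S k j))"
      by (rule vs_finsum_cong[OF VHH refl])
        (simp_all add: Seq ij VH T(2) ij' hK pure_smult_left pure_smult_right vs_smult_smult[OF VHH] s)
    finally show "comult H (S i j) = (\<Oplus>\<^bsub>tensor H H\<^esub>k\<in>K. pure H H (S i k) (S k j))" .
    show "counit H (S i j) = (if i = j then 1 else 0)"
      unfolding Seq[OF ij] lin_smult[OF B(6) T(2)[OF ij']] T(4)[OF ij']
      using s[OF ij(1)] inj_on_eq_iff[OF inj ij] by auto
  qed
  have c: "coact U (s i \<odot>\<^bsub>U\<^esub> e (h i)) = (\<Oplus>\<^bsub>tensor H U\<^esub>k\<in>K. pure H U (S i k) (s k \<odot>\<^bsub>U\<^esub> e (h k)))" if i: "i \<in> K" for i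
  proof -
    have "coact U (s i \<odot>\<^bsub>U\<^esub> e (h i)) = s i \<odot>\<^bsub>tensor H U\<^esub> (\<Oplus>\<^bsub>tensor H U\<^esub>k\<in>I. pure H U (T (h i) k) (e k))"
      unfolding lin_smult[OF M(3) D(2)[OF hK[OF i]]] M(4)[OF hK[OF i]] ..
    also have "(\<Oplus>\<^bsub>tensor H U\<^esub>k\<in>I. pure H U (T (h i) k) (e k)) = (\<Oplus>\<^bsub>tensor H U\<^esub>k\<in>K. pure H U (T (h i) (h k)) (e (h k)))"
      by (rule reindex[OF VHU]) (simp add: VH U T(2) D(2) hK i)
    also have "s i \<odot>\<^bsub>tensor H U\<^esub> \<dots> = (\<Oplus>\<^bsub>tensor H U\<^esub>k\<in>K. s i \<odot>\<^bsub>tensor H U\<^esub> pure H U (T (h i) (h k)) (e (h k)))"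
      by (rule vs_finsum_smult[OF VHU, symmetric]) (simp add: VH U T(2) D(2) hK i)
    also have "\<dots> = (\<Oplus>\<^bsub>tensor H U\<^esub>k\<in>K. pure H U (S i k) (s k \<odot>\<^bsub>U\<^esub> e (h k)))"
      by (rule vs_finsum_cong[OF VHU refl])
        (simp_all add: Seq i VH U T(2) D(2) hK pure_smult_left pure_smult_right vs_smult_smult[OF VHU] s)
    finally show ?thesis .
  qed
  show ?thesis
    unfolding has_matrix_def using U b' S' M(3) c by blast
qed

text \<open>The map sends \<open>e i\<close> to \<open>f i\<close>, and its inverse is built
  symmetrically. Compatibility with the coactions is checked on the basis, where both sides have the
  same coefficients.\<close>

lemma has_matrix_iso:
  assumes H: "prebialgebra H" and mU: "has_matrix H U I e T" and mV: "has_matrix H V I f T"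
  shows "comodule_iso H U V"
proof -
  obtain \<phi> where bU: "dual_basis U I e \<phi>" by (rule has_matrixE[OF mU])
  obtain \<psi> where bV: "dual_basis V I f \<psi>" by (rule has_matrixE[OF mV])
  note D = dual_basisD[OF bU] and M = has_matrixD[OF mU] and B = prebialgebraD[OF H]
  note D' = dual_basisD[OF bV] and M' = has_matrixD[OF mV]
  note T = comatrixD[OF M(2)]
  note U = M(1) and V = M'(1) and VH = B(2)
  note VHU = vspace_tensor[OF VH U] and VHV = vspace_tensor[OF VH V]
  define F where "F u = (\<Oplus>\<^bsub>V\<^esub>i\<in>I. \<phi> i u \<odot>\<^bsub>V\<^esub> f i)" for u
  define G where "G u = (\<Oplus>\<^bsub>U\<^esub>i\<in>I. \<psi> i u \<odot>\<^bsub>U\<^esub> e i)" for u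
  have F: "F \<in> linear_maps U V"
    unfolding F_def by (rule lin_finsum_fun[OF lin_functional_smult[OF D(3) V D'(2)] V])
  have G: "G \<in> linear_maps V U"
    unfolding G_def by (rule lin_finsum_fun[OF lin_functional_smult[OF D'(3) U D(2)] U])
  have Fe: "F (e j) = f j" if j: "j \<in> I" for j
  proof -
    have "F (e j) = (\<Oplus>\<^bsub>V\<^esub>i\<in>I. (if i = j then 1 else 0) \<odot>\<^bsub>V\<^esub> f i)"
      unfolding F_def by (rule vs_finsum_cong[OF V refl]) (use j D(4) D'(2) V in auto)
    also have "\<dots> = f j" by (rule finsum_delta_smult[OF V D(1) j D'(2)])
    finally show ?thesis .
  qed
  have Gf: "G (f j) = e j" if j: "j \<in> I" for j
  proof -
    have "G (f j) = (\<Oplus>\<^bsub>U\<^esub>i\<in>I. (if i = j then 1 else 0) \<odot>\<^bsub>U\<^esub> e i)"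
      unfolding G_def by (rule vs_finsum_cong[OF U refl]) (use j D'(4) D(2) U in auto)
    also have "\<dots> = e j" by (rule finsum_delta_smult[OF U D(1) j D(2)])
    finally show ?thesis .
  qed
  have GF: "G (F u) = u" if "u \<in> carrier U" for u
    by (rule basis_lin_eq[OF bU U U lin_comp[OF F G] lin_id(1) _ that]) (simp add: Fe Gf)
  have FG: "F (G v) = v" if "v \<in> carrier V" for v
    by (rule basis_lin_eq[OF bV V V lin_comp[OF G F] lin_id(1) _ that]) (simp add: Fe Gf)
  note tm = tensor_map_linear[OF VH U VH V lin_id(2) F]
  have "coact V (F u) = tensor_map H V id F (coact U u)" if "u \<in> carrier U" for u
  proof (rule basis_lin_eq[OF bU U VHV lin_comp[OF F M'(3)] lin_comp[OF M(3) tm] _ that])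
    fix i assume i: "i \<in> I"
    have "tensor_map H V id F (coact U (e i)) = (\<Oplus>\<^bsub>tensor H V\<^esub>j\<in>I. tensor_map H V id F (pure H U (T i j) (e j)))"
      unfolding M(4)[OF i] by (rule lin_finsum[OF tm VHU VHV D(1)]) (simp add: T(2) D(2) i VH U)
    also have "\<dots> = (\<Oplus>\<^bsub>tensor H V\<^esub>j\<in>I. pure H V (T i j) (f j))"
      by (rule vs_finsum_cong[OF VHV refl])
        (simp_all add: tensor_map_pure[OF VH U VH V lin_id(2) F] T(2) D(2) D'(2) i VH V Fe)
    finally show "coact V (F (e i)) = tensor_map H V id F (coact U (e i))"
      by (simp add: Fe[OF i] M'(4)[OF i])
  qed
  then have "comodule_hom H U V F"
    unfolding comodule_hom_def using has_matrix_left_comodule[OF H mU] has_matrix_left_comodule[OF H mV] F by simp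
  moreover have "bij_betw F (carrier U) (carrier V)"
    by (rule bij_betw_byWitness[where f' = G])
      (use GF FG lin_closed[OF F] lin_closed[OF G] in auto)
  ultimately show ?thesis unfolding comodule_iso_def by blast
qed

subsection \<open>Tensor products of comodules\<close>

context
  fixes H :: "'h bialgebra" and U :: "(complex, 'u, 'x) module_scheme" and V :: "(complex, 'v, 'y) module_scheme"
  assumes H: "calgebra H" and U: "vspace U" and V: "vspace V"
begin

text \<open>The coaction in \<open>tensor_comodule\<close> nests two definite descriptions.
  \<open>shuffle1\<close> is the inner one and \<open>shuffle\<close> the outer one, so that
  bilinearity can be proved one level at a time.\<close>

definition shuffle1 :: "'h \<Rightarrow> 'u \<Rightarrow> ('h \<times> 'v \<Rightarrow>\<^sub>0 complex) set \<Rightarrow> ('h \<times> ('u \<times> 'v \<Rightarrow>\<^sub>0 complex) set \<Rightarrow>\<^sub>0 complex) set" where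
  "shuffle1 x u = induced (tensor H (tensor U V)) (\<lambda>(y, v). pure H (tensor U V) (x \<otimes>\<^bsub>H\<^esub> y) (pure U V u v))"

definition shuffle :: "('h \<times> 'u \<Rightarrow>\<^sub>0 complex) set \<Rightarrow> ('h \<times> 'v \<Rightarrow>\<^sub>0 complex) set \<Rightarrow> ('h \<times> ('u \<times> 'v \<Rightarrow>\<^sub>0 complex) set \<Rightarrow>\<^sub>0 complex) set" where
  "shuffle s t = induced (tensor H (tensor U V)) (\<lambda>(x, u). shuffle1 x u t) s"

lemma shuffle_vspaces: "vspace H" "vspace (tensor U V)" "vspace (tensor H (tensor U V))" "vspace (tensor H U)" "vspace (tensor H V)"
  using alg_vspace[OF H] U V by simp_all

lemma shuffle1_inner:
  assumes "x \<in> carrier H" "u \<in> carrier U"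
  shows "bilin H V (tensor H (tensor U V)) (\<lambda>y v. pure H (tensor U V) (x \<otimes>\<^bsub>H\<^esub> y) (pure U V u v))"
  by (rule bilin_pure_comp[OF alg_lin(1)[OF H assms(1)] pure_lin_right[OF U V assms(2)] shuffle_vspaces(1) shuffle_vspaces(2)])

lemma shuffle1_linear: "x \<in> carrier H \<Longrightarrow> u \<in> carrier U \<Longrightarrow> shuffle1 x u \<in> linear_maps (tensor H V) (tensor H (tensor U V))"
  unfolding shuffle1_def by (rule tensor_lift_linear[OF shuffle_vspaces(1) V shuffle_vspaces(3) shuffle1_inner])

lemma shuffle1_pure:
  "x \<in> carrier H \<Longrightarrow> u \<in> carrier U \<Longrightarrow> y \<in> carrier H \<Longrightarrow> v \<in> carrier V \<Longrightarrow>
     shuffle1 x u (pure H V y v) = pure H (tensor U V) (x \<otimes>\<^bsub>H\<^esub> y) (pure U V u v)"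
  unfolding shuffle1_def by (rule tensor_lift_pure[OF shuffle_vspaces(1) V shuffle_vspaces(3) shuffle1_inner])

lemma shuffle1_bilin:
  assumes t: "t \<in> carrier (tensor H V)"
  shows "bilin H U (tensor H (tensor U V)) (\<lambda>x u. shuffle1 x u t)"
proof (intro bilinI linear_mapsI)
  note closed = vs_closed[OF shuffle_vspaces(1)] vs_closed[OF U] alg_closed[OF H] pure_closed[OF U V]
  note eq = tensor_lin_eq[OF shuffle_vspaces(1) V _ _ shuffle_vspaces(3) _ t]
  note ops = alg_distrib[OF H] alg_smult[OF H] pure_add_left[OF shuffle_vspaces(1) shuffle_vspaces(2)] pure_add_right[OF shuffle_vspaces(1) shuffle_vspaces(2)]
    pure_smult_left[OF shuffle_vspaces(1) shuffle_vspaces(2)] pure_smult_right[OF shuffle_vspaces(1) shuffle_vspaces(2)] pure_add_left[OF U V] pure_smult_left[OF U V]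
  fix x y u w z assume x: "x \<in> carrier H" and u: "u \<in> carrier U"
  \<comment> \<open>The closure goal appears once for each of the two variables.\<close>
  show "shuffle1 x u t \<in> carrier (tensor H (tensor U V))" "shuffle1 x u t \<in> carrier (tensor H (tensor U V))" by (rule lin_closed[OF shuffle1_linear[OF x u] t])+
  show "shuffle1 x (z \<odot>\<^bsub>U\<^esub> u) t = z \<odot>\<^bsub>(tensor H (tensor U V))\<^esub> shuffle1 x u t"
    by (rule eq[OF shuffle1_linear lin_smult_fun[OF shuffle1_linear shuffle_vspaces(3)]])
      (use x u in \<open>simp_all add: closed shuffle1_pure ops\<close>)
  show "shuffle1 (z \<odot>\<^bsub>H\<^esub> x) u t = z \<odot>\<^bsub>(tensor H (tensor U V))\<^esub> shuffle1 x u t"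
    by (rule eq[OF shuffle1_linear lin_smult_fun[OF shuffle1_linear shuffle_vspaces(3)]])
      (use x u in \<open>simp_all add: closed shuffle1_pure ops\<close>)
  show "shuffle1 x (u \<oplus>\<^bsub>U\<^esub> w) t = shuffle1 x u t \<oplus>\<^bsub>(tensor H (tensor U V))\<^esub> shuffle1 x w t" if w: "w \<in> carrier U"
    by (rule eq[OF shuffle1_linear lin_add_fun[OF shuffle1_linear shuffle1_linear shuffle_vspaces(3)]])
      (use x u w in \<open>simp_all add: closed shuffle1_pure ops\<close>)
  show "shuffle1 (x \<oplus>\<^bsub>H\<^esub> y) u t = shuffle1 x u t \<oplus>\<^bsub>(tensor H (tensor U V))\<^esub> shuffle1 y u t" if y: "y \<in> carrier H"
    by (rule eq[OF shuffle1_linear lin_add_fun[OF shuffle1_linear shuffle1_linear shuffle_vspaces(3)]])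
      (use x u y in \<open>simp_all add: closed shuffle1_pure ops\<close>)
qed

lemma shuffle_left: "t \<in> carrier (tensor H V) \<Longrightarrow> (\<lambda>s. shuffle s t) \<in> linear_maps (tensor H U) (tensor H (tensor U V))"
  unfolding shuffle_def by (rule tensor_lift_linear[OF shuffle_vspaces(1) U shuffle_vspaces(3) shuffle1_bilin])

lemma shuffle_pure1:
  "t \<in> carrier (tensor H V) \<Longrightarrow> x \<in> carrier H \<Longrightarrow> u \<in> carrier U \<Longrightarrow> shuffle (pure H U x u) t = shuffle1 x u t"
  unfolding shuffle_def by (rule tensor_lift_pure[OF shuffle_vspaces(1) U shuffle_vspaces(3) shuffle1_bilin])

lemma shuffle_bilin: "bilin (tensor H U) (tensor H V) (tensor H (tensor U V)) shuffle"
proof (intro bilinI linear_mapsI)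
  note L = shuffle_left and C = vs_closed[OF shuffle_vspaces(5)]
  fix s t t' z assume s: "s \<in> carrier (tensor H U)" and t: "t \<in> carrier (tensor H V)"
  note eq = tensor_lin_eq[OF shuffle_vspaces(1) U _ _ shuffle_vspaces(3) _ s]
  show "shuffle s t \<in> carrier (tensor H (tensor U V))" "shuffle s t \<in> carrier (tensor H (tensor U V))" by (rule lin_closed[OF L[OF t] s])+
  show "shuffle s (z \<odot>\<^bsub>tensor H V\<^esub> t) = z \<odot>\<^bsub>(tensor H (tensor U V))\<^esub> shuffle s t"
    by (rule eq[OF L lin_smult_fun[OF L shuffle_vspaces(3)]])
      (use t in \<open>simp_all add: C shuffle_pure1 lin_smult[OF shuffle1_linear]\<close>)
  show "shuffle s (t \<oplus>\<^bsub>tensor H V\<^esub> t') = shuffle s t \<oplus>\<^bsub>(tensor H (tensor U V))\<^esub> shuffle s t'" if t': "t' \<in> carrier (tensor H V)"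
    by (rule eq[OF L lin_add_fun[OF L L shuffle_vspaces(3)]])
      (use t t' in \<open>simp_all add: C shuffle_pure1 lin_add[OF shuffle1_linear]\<close>)
next
  fix s s' t z assume s: "s \<in> carrier (tensor H U)" and t: "t \<in> carrier (tensor H V)"
  show "shuffle (z \<odot>\<^bsub>tensor H U\<^esub> s) t = z \<odot>\<^bsub>(tensor H (tensor U V))\<^esub> shuffle s t" by (rule lin_smult[OF shuffle_left[OF t] s])
  show "shuffle (s \<oplus>\<^bsub>tensor H U\<^esub> s') t = shuffle s t \<oplus>\<^bsub>(tensor H (tensor U V))\<^esub> shuffle s' t" if "s' \<in> carrier (tensor H U)"
    by (rule lin_add[OF shuffle_left[OF t] s that])
qed

lemma shuffle_pure:
  "x \<in> carrier H \<Longrightarrow> u \<in> carrier U \<Longrightarrow> y \<in> carrier H \<Longrightarrow> v \<in> carrier V \<Longrightarrow>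
     shuffle (pure H U x u) (pure H V y v) = pure H (tensor U V) (x \<otimes>\<^bsub>H\<^esub> y) (pure U V u v)"
  by (simp add: shuffle_pure1 shuffle1_pure pure_closed[OF shuffle_vspaces(1) V])

end

text \<open>The dual functionals are \<phi> \<otimes> \<psi>, computed by slicing with the first and
  applying the second to the result.\<close>

lemma dual_basis_tensor:
  assumes b: "dual_basis U I e \<phi>" and b': "dual_basis V K f \<psi>" and U: "vspace U" and V: "vspace V"
  shows "\<exists>\<theta>. dual_basis (tensor U V) (I \<times> K) (\<lambda>(i, k). pure U V (e i) (f k)) \<theta>"
proof -
  note D = dual_basisD[OF b] and D' = dual_basisD[OF b']
  note P = vspace_tensor[OF U V]
  define \<theta> where "\<theta> = (\<lambda>(i, k) t. \<psi> k (slice_left V (\<phi> i) t))"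
  have \<theta>: "\<theta> (i, k) \<in> linear_maps (tensor U V) CC" if "i \<in> I" "k \<in> K" for i k
    unfolding \<theta>_def prod.case by (rule lin_comp[OF slice_left_linear[OF U V D(3)[OF that(1)]] D'(3)[OF that(2)]])
  have \<theta>_pure: "\<theta> (i, k) (pure U V u v) = \<phi> i u * \<psi> k v" if "i \<in> I" "k \<in> K" "u \<in> carrier U" "v \<in> carrier V" for i k u v
    using slice_left_pure[OF U V D(3)[OF that(1)] that(3,4)] lin_smult[OF D'(3)[OF that(2)] that(4)] by (simp add: \<theta>_def)
  have fin: "finite (I \<times> K)" using D(1) D'(1) by simp
  have "dual_basis (tensor U V) (I \<times> K) (\<lambda>(i, k). pure U V (e i) (f k)) \<theta>"
    unfolding dual_basis_def
  proof (intro conjI ballI fin)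
    fix p assume p: "p \<in> I \<times> K"
    then obtain i k where ik: "p = (i, k)" "i \<in> I" "k \<in> K" by auto
    show "(case p of (i, k) \<Rightarrow> pure U V (e i) (f k)) \<in> carrier (tensor U V)"
      using ik by (simp add: pure_closed[OF U V] D(2) D'(2))
    show "\<theta> p \<in> linear_maps (tensor U V) CC" using \<theta> ik by simp
    fix p' assume p': "p' \<in> I \<times> K"
    then obtain i' k' where ik': "p' = (i', k')" "i' \<in> I" "k' \<in> K" by auto
    show "\<theta> p (case p' of (i, k) \<Rightarrow> pure U V (e i) (f k)) = (if p = p' then 1 else 0)"
      using ik ik' by (simp add: \<theta>_pure D(2,4) D'(2,4))
  next
    fix t assume t: "t \<in> carrier (tensor U V)"
    have L: "(\<lambda>t. \<Oplus>\<^bsub>tensor U V\<^esub>p\<in>I \<times> K. \<theta> p t \<odot>\<^bsub>tensor U V\<^esub> (case p of (i, k) \<Rightarrow> pure U V (e i) (f k))) \<in> linear_maps (tensor U V) (tensor U V)"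
      by (rule lin_finsum_fun[OF lin_functional_smult[OF _ P] P])
        (auto simp: \<theta> pure_closed[OF U V] D(2) D'(2))
    show "t = (\<Oplus>\<^bsub>tensor U V\<^esub>p\<in>I \<times> K. \<theta> p t \<odot>\<^bsub>tensor U V\<^esub> (case p of (i, k) \<Rightarrow> pure U V (e i) (f k)))"
    proof (rule tensor_lin_eq[OF U V lin_id(1) L P _ t])
      fix u v assume uv: "u \<in> carrier U" "v \<in> carrier V"
      have "pure U V u v = pure U V (\<Oplus>\<^bsub>U\<^esub>i\<in>I. \<phi> i u \<odot>\<^bsub>U\<^esub> e i) (\<Oplus>\<^bsub>V\<^esub>k\<in>K. \<psi> k v \<odot>\<^bsub>V\<^esub> f k)"
        using D(5)[OF uv(1)] D'(5)[OF uv(2)] by (rule arg_cong2)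
      also have "\<dots> = (\<Oplus>\<^bsub>tensor U V\<^esub>i\<in>I. \<Oplus>\<^bsub>tensor U V\<^esub>k\<in>K. pure U V (\<phi> i u \<odot>\<^bsub>U\<^esub> e i) (\<psi> k v \<odot>\<^bsub>V\<^esub> f k))"
        by (rule bilin_finsum[OF bilin_pure[OF U V] U V P D(1) D'(1)]) (simp_all add: U V D(2) D'(2))
      also have "\<dots> = finsum (tensor U V) (\<lambda>(i, k). pure U V (\<phi> i u \<odot>\<^bsub>U\<^esub> e i) (\<psi> k v \<odot>\<^bsub>V\<^esub> f k)) (I \<times> K)"
        by (rule vs_finsum_Times[OF P _ D(1) D'(1)]) (simp add: U V D(2) D'(2))
      also have "\<dots> = (\<Oplus>\<^bsub>tensor U V\<^esub>p\<in>I \<times> K. \<theta> p (pure U V u v) \<odot>\<^bsub>tensor U V\<^esub> (case p of (i, k) \<Rightarrow> pure U V (e i) (f k)))"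
        by (rule vs_finsum_cong[OF P refl])
          (auto simp: \<theta>_pure uv D(2) D'(2) U V P pure_smult_left[OF U V] pure_smult_right[OF U V] vs_smult_smult[OF P] mult.commute)
      finally show "pure U V u v = (\<Oplus>\<^bsub>tensor U V\<^esub>p\<in>I \<times> K. \<theta> p (pure U V u v) \<odot>\<^bsub>tensor U V\<^esub> (case p of (i, k) \<Rightarrow> pure U V (e i) (f k)))" .
    qed
  qed
  then show ?thesis by (rule exI[of _ \<theta>])
qed

text \<open>Multiplicativity of the comultiplication turns the product of the two matrix sums into
  one sum over pairs. The result is the Kronecker product with entries multiplied in the
  algebra.\<close>

lemma comatrix_mult:
  assumes H: "prebialgebra H" and TI: "comatrix H I T" and SK: "comatrix H K S"
  shows "comatrix H (I \<times> K) (\<lambda>(i, k) (j, l). T i j \<otimes>\<^bsub>H\<^esub> S k l)"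
  unfolding comatrix_def
proof (intro conjI ballI)
  note B = prebialgebraD[OF H] and T = comatrixD[OF TI] and S = comatrixD[OF SK]
  note VH = B(2) and VHH = B(7) and A = B(1)
  note AHH = calgebra_tensor[OF A A]
  show "finite (I \<times> K)" using T(1) S(1) by simp
  fix p p' assume "p \<in> I \<times> K" "p' \<in> I \<times> K"
  then obtain i k j l where p: "p = (i, k)" "p' = (j, l)" and i: "i \<in> I" and k: "k \<in> K" and j: "j \<in> I" and l: "l \<in> K"
    by auto
  note c = T(2)[OF i j] S(2)[OF k l]
  have "comult H (T i j \<otimes>\<^bsub>H\<^esub> S k l)
    = (\<Oplus>\<^bsub>tensor H H\<^esub>m\<in>I. pure H H (T i m) (T m j)) \<otimes>\<^bsub>tensor H H\<^esub> (\<Oplus>\<^bsub>tensor H H\<^esub>n\<in>K. pure H H (S k n) (S n l))"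
    unfolding algebra_homD(3)[OF B(3) c] T(3)[OF i j] S(3)[OF k l] ..
  also have "\<dots> = (\<Oplus>\<^bsub>tensor H H\<^esub>m\<in>I. \<Oplus>\<^bsub>tensor H H\<^esub>n\<in>K. pure H H (T i m) (T m j) \<otimes>\<^bsub>tensor H H\<^esub> pure H H (S k n) (S n l))"
    by (rule bilin_finsum[OF alg_bilin[OF AHH] VHH VHH VHH T(1) S(1)]) (simp_all add: VH T(2) S(2) i j k l)
  also have "\<dots> = finsum (tensor H H) (\<lambda>(m, n). pure H H (T i m) (T m j) \<otimes>\<^bsub>tensor H H\<^esub> pure H H (S k n) (S n l)) (I \<times> K)"
    by (rule vs_finsum_Times[OF VHH _ T(1) S(1)]) (simp add: VH T(2) S(2) i j k l alg_closed[OF AHH])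
  also have "\<dots> = (\<Oplus>\<^bsub>tensor H H\<^esub>q\<in>I \<times> K. pure H H (case q of (m, n) \<Rightarrow> T i m \<otimes>\<^bsub>H\<^esub> S k n) (case q of (m, n) \<Rightarrow> T m j \<otimes>\<^bsub>H\<^esub> S n l))"
    by (rule vs_finsum_cong[OF VHH refl])
      (auto simp: tensor_mult_pure[OF A A] VH T(2) S(2) i j k l alg_closed[OF A])
  finally show "comult H ((\<lambda>(i, k) (j, l). T i j \<otimes>\<^bsub>H\<^esub> S k l) p p')
    = (\<Oplus>\<^bsub>tensor H H\<^esub>q\<in>I \<times> K. pure H H ((\<lambda>(i, k) (j, l). T i j \<otimes>\<^bsub>H\<^esub> S k l) p q) ((\<lambda>(i, k) (j, l). T i j \<otimes>\<^bsub>H\<^esub> S k l) q p'))"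
    unfolding p by (simp add: case_prod_unfold)
  show "(\<lambda>(i, k) (j, l). T i j \<otimes>\<^bsub>H\<^esub> S k l) p p' \<in> carrier H"
    unfolding p using c by (simp add: alg_closed[OF A])
  show "counit H ((\<lambda>(i, k) (j, l). T i j \<otimes>\<^bsub>H\<^esub> S k l) p p') = (if p = p' then 1 else 0)"
    unfolding p using algebra_homD(3)[OF B(4) c] T(4)[OF i j] S(4)[OF k l] by simp
qed

text \<open>The coaction is \<open>shuffle\<close> applied to the coactions of the factors, so on
  pure tensors of basis vectors the matrix entries multiply.\<close>

lemma has_matrix_tensor:
  assumes H: "prebialgebra H" and mU: "has_matrix H U I e T" and mV: "has_matrix H V K f S"
  shows "has_matrix H (tensor_comodule H U V) (I \<times> K) (\<lambda>(i, k). pure U V (e i) (f k))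
    (\<lambda>(i, k) (j, l). T i j \<otimes>\<^bsub>H\<^esub> S k l)"
proof -
  obtain \<phi> where bU: "dual_basis U I e \<phi>" by (rule has_matrixE[OF mU])
  obtain \<psi> where bV: "dual_basis V K f \<psi>" by (rule has_matrixE[OF mV])
  note D = dual_basisD[OF bU] and M = has_matrixD[OF mU] and B = prebialgebraD[OF H]
  note D' = dual_basisD[OF bV] and M' = has_matrixD[OF mV]
  note T = comatrixD[OF M(2)] and S = comatrixD[OF M'(2)]
  note U = M(1) and V = M'(1) and A = B(1) and VH = B(2)
  note V' = shuffle_vspaces(2,3,4,5)[OF A U V]
  let ?UV = "tensor U V" and ?P = "tensor H (tensor U V)"
  let ?sh = "shuffle H U V"
  have hb: "bilin U V ?P (\<lambda>u v. ?sh (coact U u) (coact V v))"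
    using bilin_comp[OF shuffle_bilin[OF A U V] M(3) M'(3) lin_id(1)] .
  let ?c = "induced ?P (case_prod (\<lambda>u v. ?sh (coact U u) (coact V v)))"
  have c: "?c \<in> linear_maps ?UV ?P" by (rule tensor_lift_linear[OF U V V'(2) hb])
  have same: "same_module ?UV (tensor_comodule H U V)"
    by (simp add: same_module_def tensor_comodule_def module.defs comodule.defs)
  have coact: "coact (tensor_comodule H U V) = ?c"
    by (simp add: tensor_comodule_def module.defs comodule.defs shuffle_def[OF A U V] shuffle1_def[OF A U V])
  obtain \<theta> where b: "dual_basis ?UV (I \<times> K) (\<lambda>(i, k). pure U V (e i) (f k)) \<theta>"
    using dual_basis_tensor[OF bU bV U V] by blast
  show ?thesis
  proof (rule has_matrix_same[OF same V'(1) b comatrix_mult[OF H M(2) M'(2)] c])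
    show "coact (tensor_comodule H U V) u = ?c u" for u by (simp add: coact)
    fix p assume "p \<in> I \<times> K"
    then obtain i k where p: "p = (i, k)" and i: "i \<in> I" and k: "k \<in> K" by auto
    have "?c (pure U V (e i) (f k)) = ?sh (coact U (e i)) (coact V (f k))"
      by (rule tensor_lift_pure[OF U V V'(2) hb D(2)[OF i] D'(2)[OF k]])
    also have "\<dots> = (\<Oplus>\<^bsub>?P\<^esub>j\<in>I. \<Oplus>\<^bsub>?P\<^esub>l\<in>K. ?sh (pure H U (T i j) (e j)) (pure H V (S k l) (f l)))"
      unfolding M(4)[OF i] M'(4)[OF k]
      by (rule bilin_finsum[OF shuffle_bilin[OF A U V] V'(3,4,2) D(1) D'(1)])
        (simp_all add: VH U V T(2) S(2) D(2) D'(2) i k)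
    also have "\<dots> = finsum ?P (\<lambda>(j, l). ?sh (pure H U (T i j) (e j)) (pure H V (S k l) (f l))) (I \<times> K)"
      by (rule vs_finsum_Times[OF V'(2) bilinD(3)[OF shuffle_bilin[OF A U V]] D(1) D'(1)])
        (simp_all add: VH U V T(2) S(2) D(2) D'(2) i k)
    also have "\<dots> = (\<Oplus>\<^bsub>?P\<^esub>q\<in>I \<times> K. pure H ?UV ((\<lambda>(i, k) (j, l). T i j \<otimes>\<^bsub>H\<^esub> S k l) p q) (case q of (j, l) \<Rightarrow> pure U V (e j) (f l)))"
      by (rule vs_finsum_cong[OF V'(2) refl])
        (auto simp: p shuffle_pure[OF A U V] VH U V V' T(2) S(2) D(2) D'(2) i k alg_closed[OF A])
    finally show "?c (case p of (i, k) \<Rightarrow> pure U V (e i) (f k))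
      = (\<Oplus>\<^bsub>?P\<^esub>q\<in>I \<times> K. pure H ?UV ((\<lambda>(i, k) (j, l). T i j \<otimes>\<^bsub>H\<^esub> S k l) p q) (case q of (j, l) \<Rightarrow> pure U V (e j) (f l)))"
      by (simp add: p)
  qed
qed


subsection \<open>An irreducibility criterion\<close>

text \<open>The coaction of \<open>u\<close> comes from H \<otimes> N, and a slice by a functional
  on \<open>H\<close> can be taken there already.\<close>

lemma subcomodule_slice:
  assumes H: "vspace H" and N: "subcomodule H U N" and \<chi>: "\<chi> \<in> linear_maps H CC" and u: "u \<in> N"
  shows "slice_left U \<chi> (coact U u) \<in> N"
proof -
  have U: "vspace U" and sub: "submodule N CC U"
    using N by (simp_all add: subcomodule_def left_comodule_def)
  let ?N = "U\<lparr>carrier := N\<rparr>"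
  note ND = submoduleD_vs[OF sub U]
  have VN: "vspace ?N" by (rule vspace_carrier_update[OF sub U])
  have idN: "id \<in> linear_maps ?N U" by (rule linear_mapsI) (use ND(3) in simp_all)
  obtain t where t: "t \<in> carrier (tensor H ?N)" "coact U u = tensor_map H U id id t"
    using subsetD[OF _ imageI[OF u], of "coact U" "tensor_map H U id id ` carrier (tensor H ?N)"] N
    by (auto simp: subcomodule_def)
  have "slice_left U \<chi> (tensor_map H U id id t) = id (slice_left ?N \<chi> t)"
    by (rule tensor_lin_eq[OF H VN lin_comp[OF tensor_map_linear[OF H VN H U lin_id(2) idN] slice_left_linear[OF H U \<chi>]]
          lin_comp[OF slice_left_linear[OF H VN \<chi>] idN] U _ t(1)])
      (simp add: ND(3) tensor_map_pure[OF H VN H U lin_id(2) idN] slice_left_pure[OF H U \<chi>] slice_left_pure[OF H VN \<chi>])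
  then show ?thesis
    using t(2) lin_closed[OF slice_left_linear[OF H VN \<chi>] t(1)] by simp
qed

text \<open>A functional \<chi> acts on coordinate rows through the scalar matrix \<chi>(T i j) and
  preserves subcomodules. By \<open>down\<close> a nonzero subcomodule contains \<open>e i0\<close>,
  and by \<open>up\<close> it then contains every basis vector.\<close>

lemma has_matrix_irreducible:
  assumes H: "prebialgebra H" and m: "has_matrix H U I e T" and i0: "i0 \<in> I"
    and down: "\<And>x. \<exists>i\<in>I. x i \<noteq> 0 \<Longrightarrow> \<exists>\<chi>\<in>linear_maps H CC. (\<Sum>i\<in>I. x i * \<chi> (T i i0)) \<noteq> 0 \<and>
        (\<forall>j\<in>I. j \<noteq> i0 \<longrightarrow> (\<Sum>i\<in>I. x i * \<chi> (T i j)) = 0)"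
    and up: "\<And>i. i \<in> I \<Longrightarrow> \<exists>\<chi>\<in>linear_maps H CC. \<chi> (T i0 i) \<noteq> 0 \<and> (\<forall>j\<in>I. j \<noteq> i \<longrightarrow> \<chi> (T i0 j) = 0)"
  shows "irreducible_comodule H U"
proof -
  obtain \<phi> where b: "dual_basis U I e \<phi>" by (rule has_matrixE[OF m])
  note D = dual_basisD[OF b] and M = has_matrixD[OF m] and B = prebialgebraD[OF H]
  note T = comatrixD[OF M(2)]
  note U = M(1) and VH = B(2)
  note VHU = vspace_tensor[OF VH U]
  \<comment> \<open>In coordinates the action of \<chi> multiplies the row of coordinates of
    \<open>u\<close> by the matrix \<chi>(T i j) from the right.\<close>
  have slice: "slice_left U \<chi> (coact U u) = (\<Oplus>\<^bsub>U\<^esub>j\<in>I. (\<Sum>i\<in>I. \<phi> i u * \<chi> (T i j)) \<odot>\<^bsub>U\<^esub> e j)"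
    if \<chi>: "\<chi> \<in> linear_maps H CC" and u: "u \<in> carrier U" for \<chi> u
  proof (rule basis_lin_eq[OF b U U lin_comp[OF M(3) slice_left_linear[OF VH U \<chi>]] _ _ u])
    have *: "(\<lambda>u. \<Sum>i\<in>I. \<phi> i u * \<chi> (T i j)) \<in> linear_maps U CC" for j
      using lin_finsum_fun[of I "\<lambda>i u. \<phi> i u \<odot>\<^bsub>CC\<^esub> \<chi> (T i j)" U CC] lin_functional_smult[OF D(3) vspace_CC] by simp
    show "(\<lambda>u. \<Oplus>\<^bsub>U\<^esub>j\<in>I. (\<Sum>i\<in>I. \<phi> i u * \<chi> (T i j)) \<odot>\<^bsub>U\<^esub> e j) \<in> linear_maps U U"
      by (rule lin_finsum_fun[OF lin_functional_smult[OF * U D(2)] U])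
    fix k assume k: "k \<in> I"
    have "slice_left U \<chi> (coact U (e k)) = (\<Oplus>\<^bsub>U\<^esub>j\<in>I. slice_left U \<chi> (pure H U (T k j) (e j)))"
      unfolding M(4)[OF k] by (rule lin_finsum[OF slice_left_linear[OF VH U \<chi>] VHU U D(1)]) (simp add: T(2) D(2) k VH U)
    also have "\<dots> = (\<Oplus>\<^bsub>U\<^esub>j\<in>I. (\<Sum>i\<in>I. \<phi> i (e k) * \<chi> (T i j)) \<odot>\<^bsub>U\<^esub> e j)"
    proof (rule vs_finsum_cong[OF U refl])
      fix j assume j: "j \<in> I"
      have "(\<Sum>i\<in>I. \<phi> i (e k) * \<chi> (T i j)) = (\<Sum>i\<in>I. if i = k then \<chi> (T i j) else 0)"
        by (rule sum.cong) (use k D(4) in auto)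
      then have "(\<Sum>i\<in>I. \<phi> i (e k) * \<chi> (T i j)) = \<chi> (T k j)" using D(1) k by simp
      then show "slice_left U \<chi> (pure H U (T k j) (e j)) = (\<Sum>i\<in>I. \<phi> i (e k) * \<chi> (T i j)) \<odot>\<^bsub>U\<^esub> e j"
        by (simp add: slice_left_pure[OF VH U \<chi>] T(2) D(2) k j)
      show "(\<Sum>i\<in>I. \<phi> i (e k) * \<chi> (T i j)) \<odot>\<^bsub>U\<^esub> e j \<in> carrier U" by (simp add: U D(2) j)
    qed
    finally show "slice_left U \<chi> (coact U (e k)) = (\<Oplus>\<^bsub>U\<^esub>j\<in>I. (\<Sum>i\<in>I. \<phi> i (e k) * \<chi> (T i j)) \<odot>\<^bsub>U\<^esub> e j)" .
  qed
  have "N = {\<zero>\<^bsub>U\<^esub>} \<or> N = carrier U" if N: "subcomodule H U N" for N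
  proof (cases "N = {\<zero>\<^bsub>U\<^esub>}")
    case False
    have sub: "submodule N CC U" using N by (simp add: subcomodule_def)
    note ND = submoduleD_vs[OF sub U]
    have pick: "e k \<in> N" if u: "u \<in> N" and k: "k \<in> I" and \<chi>: "\<chi> \<in> linear_maps H CC"
      and nz: "(\<Sum>i\<in>I. \<phi> i u * \<chi> (T i k)) \<noteq> 0"
      and z: "\<forall>j\<in>I. j \<noteq> k \<longrightarrow> (\<Sum>i\<in>I. \<phi> i u * \<chi> (T i j)) = 0" for u k \<chi>
    proof -
      let ?z = "\<Sum>i\<in>I. \<phi> i u * \<chi> (T i k)"
      have "slice_left U \<chi> (coact U u) = ?z \<odot>\<^bsub>U\<^esub> e k"
        unfolding slice[OF \<chi> ND(3)[OF u]]
        by (rule vs_finsum_single[OF U D(1) k]) (use z k D(2) U in auto)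
      then have "?z \<odot>\<^bsub>U\<^esub> e k \<in> N" using subcomodule_slice[OF VH N \<chi> u] by simp
      then have "(1 / ?z) \<odot>\<^bsub>U\<^esub> (?z \<odot>\<^bsub>U\<^esub> e k) \<in> N" by (rule ND(5))
      then show ?thesis using nz by (simp add: vs_smult_smult[OF U D(2)[OF k]] vs_zero(5)[OF U D(2)[OF k]])
    qed
    obtain u where u: "u \<in> N" "u \<noteq> \<zero>\<^bsub>U\<^esub>" using False ND(2) by blast
    have "\<exists>i\<in>I. \<phi> i u \<noteq> 0"
    proof (rule ccontr)
      assume "\<not> (\<exists>i\<in>I. \<phi> i u \<noteq> 0)"
      then have "(\<Oplus>\<^bsub>U\<^esub>i\<in>I. \<phi> i u \<odot>\<^bsub>U\<^esub> e i) = \<zero>\<^bsub>U\<^esub>"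
        by (intro vs_finsum_zero[OF U]) (simp add: U D(2))
      then show False using D(5)[OF ND(3)[OF u(1)]] u(2) by simp
    qed
    from down[OF this] have e0: "e i0 \<in> N"
      using pick[OF u(1) i0] by blast
    have "e k \<in> N" if k: "k \<in> I" for k
    proof -
      obtain \<chi> where \<chi>: "\<chi> \<in> linear_maps H CC" "\<chi> (T i0 k) \<noteq> 0" "\<forall>j\<in>I. j \<noteq> k \<longrightarrow> \<chi> (T i0 j) = 0"
        using up[OF k] by blast
      have s: "(\<Sum>i\<in>I. \<phi> i (e i0) * \<chi> (T i j)) = \<chi> (T i0 j)" for j
      proof -
        have "(\<Sum>i\<in>I. \<phi> i (e i0) * \<chi> (T i j)) = (\<Sum>i\<in>I. if i = i0 then \<chi> (T i j) else 0)"
          by (rule sum.cong) (use i0 D(4) in auto)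
        then show ?thesis using D(1) i0 by simp
      qed
      show ?thesis by (rule pick[OF e0 k \<chi>(1)]) (simp_all add: s \<chi>(2,3))
    qed
    then have "u \<in> N" if "u \<in> carrier U" for u
      using submodule_finsum[OF sub U D(1), of "\<lambda>i. \<phi> i u \<odot>\<^bsub>U\<^esub> e i"] ND(5) D(5)[OF that] by simp
    then show ?thesis using ND(1) by blast
  qed simp
  moreover have "carrier U \<noteq> {\<zero>\<^bsub>U\<^esub>}"
  proof
    assume "carrier U = {\<zero>\<^bsub>U\<^esub>}"
    then have "e i0 = \<zero>\<^bsub>U\<^esub>" using D(2)[OF i0] by simp
    then show False using D(4)[OF i0 i0] lin_zero[OF D(3)[OF i0] U vspace_CC] by simp
  qed
  ultimately show ?thesis
    unfolding irreducible_comodule_def using has_matrix_left_comodule[OF H m] by blast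
qed

subsection \<open>Linear identities\<close>

text \<open>
  An identity between linear combinations in a module is proved by comparing the coefficients of
  the formal linear combinations that represent its two sides.
\<close>

definition represents :: "(complex, 'm, 'x) module_scheme \<Rightarrow> 'm \<Rightarrow> ('m \<Rightarrow>\<^sub>0 complex) \<Rightarrow> bool" where
  "represents M x f \<longleftrightarrow> Poly_Mapping.keys f \<subseteq> carrier M \<and> x = lin_ext M (\<lambda>y. y) f"

context
  fixes M :: "(complex, 'm, 'x) module_scheme" (structure)
  assumes M: "vspace M"
begin

text \<open>The elements of \<open>M\<close> themselves serve as basis of the formal combinations.
  Only the vector space structure of \<open>monoid_algebra\<close> matters here, hence the arbitrary
  multiplication and unit.\<close>

lemma represents_linear: "lin_ext M (\<lambda>y. y) \<in> linear_maps (monoid_algebra \<lparr>carrier = carrier M, monoid.mult = undefined, one = undefined\<rparr>) M"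
  by (rule lin_ext_linear[OF M]) simp

lemma represents_add: "represents M x f \<Longrightarrow> represents M y g \<Longrightarrow> represents M (x \<oplus> y) (f + g)"
  using lin_add[OF represents_linear, of f g] keys_plus_subset[of f "carrier M" g] by (simp add: represents_def)

lemma represents_smult: "represents M x f \<Longrightarrow> represents M (z \<odot> x) (pm_scale z f)"
  using lin_smult[OF represents_linear, of f z] keys_pm_scale[of z f] by (auto simp: represents_def)

lemma represents_atom: "x \<in> carrier M \<Longrightarrow> represents M x (Poly_Mapping.single x 1)"
  using M by (simp add: represents_def lin_ext_single)

lemma represents_eq: "represents M x f \<Longrightarrow> represents M y g \<Longrightarrow> f = g \<Longrightarrow> x = y"
  by (simp add: represents_def)

end

lemmas represents_intros = represents_add represents_smult represents_atom


section \<open>The bialgebra structure of $A(SL_q(2))$\<close>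

lemma algebra_mapI:
  assumes "calgebra B" "\<And>g. h g \<in> carrier B" "slq2_relations B q (h GA) (h GB) (h GC) (h GD)"
  shows "algebra_hom (slq2 q) B (algebra_map B h)" "algebra_map B h (slq2_gen q g) = h g"
  using algebra_map_hom[OF assms] algebra_map_gen[OF assms] by (simp_all add: same_algebra_hom[OF same_slq2])

abbreviation "slq2_a q \<equiv> slq2_gen q GA"
abbreviation "slq2_b q \<equiv> slq2_gen q GB"
abbreviation "slq2_c q \<equiv> slq2_gen q GC"
abbreviation "slq2_d q \<equiv> slq2_gen q GD"

lemma slq2_vspace [simp]: "vspace (slq2 q)"
  by (rule alg_vspace[OF calgebra_slq2])

lemma slq2_comult_gen_eq:
  "slq2_comult_gen q g = (case g of
     GA \<Rightarrow> pure (slq2 q) (slq2 q) (slq2_a q) (slq2_a q) \<oplus>\<^bsub>tensor (slq2 q) (slq2 q)\<^esub> pure (slq2 q) (slq2 q) (slq2_b q) (slq2_c q)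
   | GB \<Rightarrow> pure (slq2 q) (slq2 q) (slq2_a q) (slq2_b q) \<oplus>\<^bsub>tensor (slq2 q) (slq2 q)\<^esub> pure (slq2 q) (slq2 q) (slq2_b q) (slq2_d q)
   | GC \<Rightarrow> pure (slq2 q) (slq2 q) (slq2_c q) (slq2_a q) \<oplus>\<^bsub>tensor (slq2 q) (slq2 q)\<^esub> pure (slq2 q) (slq2 q) (slq2_d q) (slq2_c q)
   | GD \<Rightarrow> pure (slq2 q) (slq2 q) (slq2_c q) (slq2_b q) \<oplus>\<^bsub>tensor (slq2 q) (slq2 q)\<^esub> pure (slq2 q) (slq2 q) (slq2_d q) (slq2_d q))"
  by (simp add: slq2_comult_gen_def Let_def same_tensor[OF same_slq2] split: gen.split)

text \<open>Both sides are multiplied out and normalized by the relations in each tensor factor.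
  What remains is a comparison of coefficients of pure tensors, polynomial in q and its
  inverse.\<close>

lemma slq2_relations_tensor:
  assumes A: "calgebra H" and q: "q \<noteq> 0" and rels: "slq2_relations H q a b c d"
    and abcd: "a \<in> carrier H" "b \<in> carrier H" "c \<in> carrier H" "d \<in> carrier H"
  shows "slq2_relations (tensor H H) q
    (pure H H a a \<oplus>\<^bsub>tensor H H\<^esub> pure H H b c) (pure H H a b \<oplus>\<^bsub>tensor H H\<^esub> pure H H b d)
    (pure H H c a \<oplus>\<^bsub>tensor H H\<^esub> pure H H d c) (pure H H c b \<oplus>\<^bsub>tensor H H\<^esub> pure H H d d)"
proof -
  note AT = calgebra_tensor[OF A A]
  note V = alg_vspace[OF A] and VT = alg_vspace[OF AT]
  note closed = vs_closed[OF V] vs_closed[OF VT] alg_closed[OF A] alg_closed[OF AT] abcd pure_closed[OF V V]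
  have R: "a \<otimes>\<^bsub>H\<^esub> b = q \<odot>\<^bsub>H\<^esub> (b \<otimes>\<^bsub>H\<^esub> a)" "a \<otimes>\<^bsub>H\<^esub> c = q \<odot>\<^bsub>H\<^esub> (c \<otimes>\<^bsub>H\<^esub> a)"
    "b \<otimes>\<^bsub>H\<^esub> d = q \<odot>\<^bsub>H\<^esub> (d \<otimes>\<^bsub>H\<^esub> b)" "c \<otimes>\<^bsub>H\<^esub> b = b \<otimes>\<^bsub>H\<^esub> c"
    "c \<otimes>\<^bsub>H\<^esub> d = q \<odot>\<^bsub>H\<^esub> (d \<otimes>\<^bsub>H\<^esub> c)"
    "a \<otimes>\<^bsub>H\<^esub> d = \<one>\<^bsub>H\<^esub> \<oplus>\<^bsub>H\<^esub> q \<odot>\<^bsub>H\<^esub> (b \<otimes>\<^bsub>H\<^esub> c)"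
    "d \<otimes>\<^bsub>H\<^esub> a = \<one>\<^bsub>H\<^esub> \<oplus>\<^bsub>H\<^esub> inverse q \<odot>\<^bsub>H\<^esub> (b \<otimes>\<^bsub>H\<^esub> c)"
    using rels by (simp_all add: slq2_relations_def)
  note expand = alg_distrib[OF AT] tensor_mult_pure[OF A A] R pure_add_left[OF V V] pure_add_right[OF V V]
    pure_smult_left[OF V V] pure_smult_right[OF V V] tensor_one[OF A A] closed
  note rep = represents_intros[OF VT]
  define r where "r = inverse q"
  have qr: "q * r = 1" "q * (r * z) = z" for z using q by (simp_all add: r_def)
  \<comment> \<open>\<open>ev\<close> hides the indicator functions of the pure tensors, so that
    algebraic normalization treats their values as unknown numbers.\<close>
  define ev where "ev = (\<lambda>x. Poly_Mapping.lookup (Poly_Mapping.single (x :: ('a \<times> 'a \<Rightarrow>\<^sub>0 complex) set) (1 :: complex)))"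
  have ev: "Poly_Mapping.lookup (Poly_Mapping.single x 1) = ev x" for x by (simp add: ev_def)
  show ?thesis
    unfolding slq2_relations_def
    by (intro conjI; simp only: expand, rule represents_eq[OF VT], (rule rep | simp only: closed)+, rule poly_mapping_eqI,
        simp only: lookup_add lookup_pm_scale ev r_def[symmetric],
        simp only: algebra_simps qr)
qed

lemma slq2_comult_relations:
  assumes q: "q \<noteq> 0"
  shows "slq2_relations (tensor (slq2 q) (slq2 q)) q (slq2_comult_gen q GA) (slq2_comult_gen q GB)
    (slq2_comult_gen q GC) (slq2_comult_gen q GD)"
  unfolding slq2_comult_gen_eq gen.case
  by (rule slq2_relations_tensor[OF calgebra_slq2 q slq2_relations]) simp_all

lemma slq2_comult_gen_closed: "slq2_comult_gen q g \<in> carrier (tensor (slq2 q) (slq2 q))"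
  by (simp add: slq2_comult_gen_eq split: gen.split)

context
  fixes q :: complex
  assumes q: "q \<noteq> 0"
begin

lemma slq2_comult:
  "algebra_hom (slq2 q) (tensor (slq2 q) (slq2 q)) (comult (slq2 q))" "comult (slq2 q) (slq2_gen q g) = slq2_comult_gen q g"
proof -
  have "comult (slq2 q) = algebra_map (tensor (slq2 q) (slq2 q)) (slq2_comult_gen q)"
    by (simp add: slq2_def module.defs bialgebra.defs same_tensor[OF same_slq2, unfolded slq2_def module.defs bialgebra.defs])
  then show "algebra_hom (slq2 q) (tensor (slq2 q) (slq2 q)) (comult (slq2 q))" "comult (slq2 q) (slq2_gen q g) = slq2_comult_gen q g"
    using algebra_mapI[OF calgebra_tensor[OF calgebra_slq2 calgebra_slq2] slq2_comult_gen_closed slq2_comult_relations[OF q]] by simp_all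
qed

lemma slq2_counit:
  "algebra_hom (slq2 q) CC (counit (slq2 q))" "counit (slq2 q) (slq2_gen q g) = slq2_counit_gen g"
proof -
  have "counit (slq2 q) = algebra_map CC slq2_counit_gen"
    by (simp add: slq2_def module.defs bialgebra.defs)
  moreover have "slq2_relations CC q (slq2_counit_gen GA) (slq2_counit_gen GB) (slq2_counit_gen GC) (slq2_counit_gen GD)"
    by (simp add: slq2_relations_def slq2_counit_gen_def)
  ultimately show "algebra_hom (slq2 q) CC (counit (slq2 q))" "counit (slq2 q) (slq2_gen q g) = slq2_counit_gen g"
    using algebra_mapI[of CC slq2_counit_gen q] by simp_all
qed

lemma prebialgebra_slq2: "prebialgebra (slq2 q)"
  unfolding prebialgebra_def using calgebra_slq2 slq2_comult(1) slq2_counit(1) by blast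

end


section \<open>Representations by operators on sequences\<close>

definition op_algebra :: "(complex, (nat \<Rightarrow> complex) \<Rightarrow> nat \<Rightarrow> complex) module" where
  "op_algebra = \<lparr>carrier = {T. (\<forall>f g. T (\<lambda>n. f n + g n) = (\<lambda>n. T f n + T g n)) \<and> (\<forall>z f. T (\<lambda>n. z * f n) = (\<lambda>n. z * T f n))},
     monoid.mult = (\<circ>), one = id, ring.zero = (\<lambda>f n. 0), add = (\<lambda>S T f n. S f n + T f n),
     smult = (\<lambda>z T f n. z * T f n)\<rparr>"

lemma op_algebra_simps [simp]:
  "T \<in> carrier op_algebra \<longleftrightarrow> (\<forall>f g. T (\<lambda>n. f n + g n) = (\<lambda>n. T f n + T g n)) \<and> (\<forall>z f. T (\<lambda>n. z * f n) = (\<lambda>n. z * T f n))"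
  "(\<otimes>\<^bsub>op_algebra\<^esub>) = (\<circ>)" "\<one>\<^bsub>op_algebra\<^esub> = id" "\<zero>\<^bsub>op_algebra\<^esub> = (\<lambda>f n. 0)"
  "S \<oplus>\<^bsub>op_algebra\<^esub> T = (\<lambda>f n. S f n + T f n)" "z \<odot>\<^bsub>op_algebra\<^esub> T = (\<lambda>f n. z * T f n)"
  by (simp_all add: op_algebra_def)

lemma calgebra_op: "calgebra op_algebra"
proof (rule calgebraI)
  show "vspace op_algebra"
  proof (rule moduleI[OF CC_cring])
    show "abelian_group op_algebra"
    proof (rule abelian_groupI)
      show "\<exists>S\<in>carrier op_algebra. S \<oplus>\<^bsub>op_algebra\<^esub> T = \<zero>\<^bsub>op_algebra\<^esub>" if "T \<in> carrier op_algebra" for T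
        using that by (intro bexI[of _ "\<lambda>f n. - T f n"]) simp_all
    qed (simp_all add: algebra_simps)
  qed (simp_all add: algebra_simps)
  show "bilin op_algebra op_algebra op_algebra (\<otimes>\<^bsub>op_algebra\<^esub>)"
    by (intro bilinI linear_mapsI) (simp_all add: comp_def)
qed (simp_all add: fun_eq_iff)

text \<open>A representation with b c = 0: a and d are mutually inverse diagonal operators with
  entries q^n and q^(-n), \<open>s\<close> is the right shift, and the other off-diagonal generator
  is zero. Shifting the index by one produces the factor q in the commutation relations.\<close>

definition seq_op :: "complex \<Rightarrow> gen \<Rightarrow> gen \<Rightarrow> (nat \<Rightarrow> complex) \<Rightarrow> nat \<Rightarrow> complex" where
  "seq_op q s g f n = (if g = GA then q ^ n * f n else if g = GD then inverse q ^ n * f n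
     else if g = s \<and> n > 0 then f (n - 1) else 0)"

definition seq_rep :: "complex \<Rightarrow> gen \<Rightarrow> (gen list \<Rightarrow>\<^sub>0 complex) set \<Rightarrow> (nat \<Rightarrow> complex) \<Rightarrow> nat \<Rightarrow> complex" where
  "seq_rep q s = algebra_map op_algebra (seq_op q s)"

lemma seq_op_closed: "seq_op q s g \<in> carrier op_algebra"
  by (simp add: seq_op_def fun_eq_iff algebra_simps)

lemma seq_rep:
  assumes q: "q \<noteq> 0" and s: "s = GB \<or> s = GC"
  shows "algebra_hom (slq2 q) op_algebra (seq_rep q s)" "seq_rep q s (slq2_gen q g) = seq_op q s g"
proof -
  have pow: "q ^ n = q * q ^ (n - 1)" "inverse q ^ n * q = inverse q ^ (n - 1)" if "n > 0" for n
    using that q by (cases n; simp)+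
  have "slq2_relations op_algebra q (seq_op q s GA) (seq_op q s GB) (seq_op q s GC) (seq_op q s GD)"
    using s q by (auto simp: slq2_relations_def seq_op_def fun_eq_iff pow power_inverse field_simps)
  from algebra_mapI[OF calgebra_op seq_op_closed this]
  show "algebra_hom (slq2 q) op_algebra (seq_rep q s)" "seq_rep q s (slq2_gen q g) = seq_op q s g"
    unfolding seq_rep_def by simp_all
qed

definition delta_seq :: "nat \<Rightarrow> nat \<Rightarrow> complex" where
  "delta_seq m n = (if n = m then 1 else 0)"

text \<open>The factor may depend on the point mass but is never zero, so composition adds degrees
  and cannot produce zero.\<close>

definition shift_op :: "nat \<Rightarrow> ((nat \<Rightarrow> complex) \<Rightarrow> nat \<Rightarrow> complex) \<Rightarrow> bool" where
  "shift_op k T \<longleftrightarrow> T \<in> carrier op_algebra \<and> (\<forall>m. \<exists>z. z \<noteq> 0 \<and> T (delta_seq m) = (\<lambda>n. z * delta_seq (m + k) n))"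

lemma shift_op_comp:
  assumes "shift_op k S" "shift_op l T"
  shows "shift_op (k + l) (S \<circ> T)"
  unfolding shift_op_def
proof (intro conjI allI)
  show "S \<circ> T \<in> carrier op_algebra" using assms by (simp add: shift_op_def)
  fix m
  obtain z where z: "z \<noteq> 0" "T (delta_seq m) = (\<lambda>n. z * delta_seq (m + l) n)"
    using assms(2) unfolding shift_op_def by blast
  obtain w where w: "w \<noteq> 0" "S (delta_seq (m + l)) = (\<lambda>n. w * delta_seq (m + l + k) n)"
    using assms(1) unfolding shift_op_def by blast
  have "S (\<lambda>n. z * delta_seq (m + l) n) = (\<lambda>n. z * S (delta_seq (m + l)) n)"
    using assms(1) by (simp add: shift_op_def)
  then have "(S \<circ> T) (delta_seq m) = (\<lambda>n. (z * w) * delta_seq (m + (k + l)) n)"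
    using z w by (simp add: ac_simps)
  then show "\<exists>z. z \<noteq> 0 \<and> (S \<circ> T) (delta_seq m) = (\<lambda>n. z * delta_seq (m + (k + l)) n)"
    using z(1) w(1) by (intro exI[of _ "z * w"]) simp
qed

lemma shift_op_id: "shift_op 0 id"
  unfolding shift_op_def by (auto intro!: exI[of _ 1])

lemma shift_op_gen:
  assumes "q \<noteq> 0" "s = GB \<or> s = GC"
  shows "shift_op 0 (seq_op q s GA)" "shift_op 0 (seq_op q s GD)" "shift_op 1 (seq_op q s s)"
proof -
  have "seq_op q s GA (delta_seq m) = (\<lambda>n. q ^ m * delta_seq (m + 0) n)" "seq_op q s GD (delta_seq m) = (\<lambda>n. inverse q ^ m * delta_seq (m + 0) n)"
    "seq_op q s s (delta_seq m) = (\<lambda>n. 1 * delta_seq (m + 1) n)" for m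
    using assms by (auto simp: seq_op_def delta_seq_def fun_eq_iff)
  moreover have "q ^ m \<noteq> 0" "inverse q ^ m \<noteq> 0" "(1 :: complex) \<noteq> 0" for m using assms by simp_all
  ultimately show "shift_op 0 (seq_op q s GA)" "shift_op 0 (seq_op q s GD)" "shift_op 1 (seq_op q s s)"
    unfolding shift_op_def using seq_op_closed by blast+
qed

text \<open>The matrix coefficient between the point masses at 0 and at \<open>k\<close>. It detects
  exactly the degree \<open>k\<close> among elements acting as shifts.\<close>

definition coeff_functional :: "complex \<Rightarrow> gen \<Rightarrow> nat \<Rightarrow> (gen list \<Rightarrow>\<^sub>0 complex) set \<Rightarrow> complex" where
  "coeff_functional q s k x = seq_rep q s x (delta_seq 0) k"

context
  fixes q :: complex and s :: gen
  assumes q: "q \<noteq> 0" and s: "s = GB \<or> s = GC"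
begin

lemma coeff_functional_linear: "coeff_functional q s k \<in> linear_maps (slq2 q) CC"
proof (rule linear_mapsI)
  note L = algebra_homD(1)[OF seq_rep(1)[OF q s]]
  show "coeff_functional q s k (x \<oplus>\<^bsub>slq2 q\<^esub> y) = coeff_functional q s k x \<oplus>\<^bsub>CC\<^esub> coeff_functional q s k y"
    if "x \<in> carrier (slq2 q)" "y \<in> carrier (slq2 q)" for x y
    by (simp add: coeff_functional_def lin_add[OF L that])
  show "coeff_functional q s k (z \<odot>\<^bsub>slq2 q\<^esub> x) = z \<odot>\<^bsub>CC\<^esub> coeff_functional q s k x" if "x \<in> carrier (slq2 q)" for z x
    by (simp add: coeff_functional_def lin_smult[OF L that])
qed simp

text \<open>Elements with distinct degrees are linearly independent, and an element with a degree is
  nonzero. This takes the place of a monomial basis of the algebra.\<close>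

definition shift_degree :: "nat \<Rightarrow> (gen list \<Rightarrow>\<^sub>0 complex) set \<Rightarrow> bool" where
  "shift_degree k x \<longleftrightarrow> x \<in> carrier (slq2 q) \<and> shift_op k (seq_rep q s x)"

lemma shift_degree_mult: "shift_degree k x \<Longrightarrow> shift_degree l y \<Longrightarrow> shift_degree (k + l) (x \<otimes>\<^bsub>slq2 q\<^esub> y)"
  using shift_op_comp algebra_homD(3)[OF seq_rep(1)[OF q s], of x y] alg_closed[OF calgebra_slq2]
  by (simp add: shift_degree_def)

lemma shift_degree_pow: "shift_degree k x \<Longrightarrow> shift_degree (n * k) (x [^]\<^bsub>slq2 q\<^esub> (n :: nat))"
proof (induction n)
  case 0
  then show ?case
    using algebra_homD(2)[OF seq_rep(1)[OF q s]] shift_op_id alg_closed(2)[OF calgebra_slq2[of q]]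
    by (simp add: shift_degree_def alg_pow(1)[OF calgebra_slq2])
next
  case (Suc n)
  have "x \<in> carrier (slq2 q)" using Suc.prems by (simp add: shift_degree_def)
  then show ?case
    using shift_degree_mult[OF Suc.prems Suc.IH[OF Suc.prems]] alg_pow_Suc(2)[OF calgebra_slq2, of x q n] by simp
qed

lemma shift_degree_gen: "shift_degree 0 (slq2_a q)" "shift_degree 0 (slq2_d q)" "shift_degree 1 (slq2_gen q s)"
  using shift_op_gen[OF q s] by (simp_all add: shift_degree_def seq_rep(2)[OF q s])

lemma shift_degree_coeff:
  assumes "shift_degree k x"
  shows "coeff_functional q s k x \<noteq> 0" "n \<noteq> k \<Longrightarrow> coeff_functional q s n x = 0"
  using assms by (auto simp: shift_degree_def shift_op_def coeff_functional_def delta_seq_def dest!: spec[of _ 0])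

lemma coeff_functional_zero:
  assumes "seq_rep q s x = (\<lambda>f n. 0)"
  shows "coeff_functional q s n x = 0"
  by (simp add: coeff_functional_def assms)

end


section \<open>Gaussian binomial coefficients\<close>

text \<open>The recursion matches the normal order x^(n-k) y^k for y x = p x y: a further x has to
  pass y^k at the cost of p^k. Unlike a quotient of factorials it makes sense at a root of
  unity.\<close>

fun qbinom :: "complex \<Rightarrow> nat \<Rightarrow> nat \<Rightarrow> complex" where
  "qbinom p n 0 = 1"
| "qbinom p 0 (Suc k) = 0"
| "qbinom p (Suc n) (Suc k) = p ^ Suc k * qbinom p n (Suc k) + qbinom p n k"

lemma qbinom_zero: "k > n \<Longrightarrow> qbinom p n k = 0"
  by (induction p n k rule: qbinom.induct) auto

lemma qbinom_self [simp]: "qbinom p n n = 1"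
  by (induction n) (auto simp: qbinom_zero)

lemma qbinom_one: "qbinom 1 n k = of_nat (n choose k)"
  by (induction "1 :: complex" n k rule: qbinom.induct) auto

text \<open>The usual quotient formulas are kept free of division, because at a root of unity the
  factors may vanish. The second identity follows from the first by the recursion, and this
  implication also drives the induction for the first.\<close>

lemma qbinom_step: "(1 - p ^ Suc k) * qbinom p n (Suc k) = (1 - p ^ (n - k)) * qbinom p n k"
  and qbinom_absorb: "(1 - p ^ Suc k) * qbinom p (Suc n) (Suc k) = (1 - p ^ Suc n) * qbinom p n k"
proof -
  have absorb: "(1 - p ^ Suc k) * qbinom p (Suc n) (Suc k) = (1 - p ^ Suc n) * qbinom p n k"
    if "(1 - p ^ Suc k) * qbinom p n (Suc k) = (1 - p ^ (n - k)) * qbinom p n k" for n k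
  proof (cases "k \<le> n")
    case True
    have "(1 - p ^ Suc k) * qbinom p (Suc n) (Suc k)
      = p ^ Suc k * ((1 - p ^ Suc k) * qbinom p n (Suc k)) + (1 - p ^ Suc k) * qbinom p n k"
      by (simp add: algebra_simps)
    also have "\<dots> = (p ^ Suc k - p ^ Suc k * p ^ (n - k) + 1 - p ^ Suc k) * qbinom p n k"
      unfolding that by (simp add: algebra_simps)
    also have "p ^ Suc k * p ^ (n - k) = p ^ Suc n"
      using True by (simp flip: power_add)
    finally show ?thesis by simp
  \<comment> \<open>Beyond the top row both binomials vanish.\<close>
  qed (simp add: qbinom_zero)
  have step: "(1 - p ^ Suc k) * qbinom p n (Suc k) = (1 - p ^ (n - k)) * qbinom p n k" for n k
  proof (induction n arbitrary: k)
    case 0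
    then show ?case by (cases k) auto
  next
    case (Suc n)
    show ?case
    proof (cases k)
      case 0
      then show ?thesis using absorb[OF Suc.IH[of 0]] by simp
    next
      case (Suc k')
      show ?thesis
      proof (cases "k' \<le> n")
        case True
        have "(1 - p ^ (Suc n - k)) * qbinom p (Suc n) k
          = (1 - p ^ (n - k')) * p ^ k * qbinom p n k + (1 - p ^ (n - k')) * qbinom p n k'"
          by (simp add: Suc algebra_simps)
        also have "(1 - p ^ (n - k')) * qbinom p n k' = (1 - p ^ k) * qbinom p n k"
          using Suc.IH[of k'] by (simp add: Suc)
        also have "(1 - p ^ (n - k')) * p ^ k * qbinom p n k + (1 - p ^ k) * qbinom p n k = (1 - p ^ (n - k') * p ^ k) * qbinom p n k"
          by (simp add: algebra_simps)
        also have "p ^ (n - k') * p ^ k = p ^ Suc n"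
          using True Suc by (simp flip: power_add power_Suc)
        finally show ?thesis using absorb[OF Suc.IH[of k]] by simp
      qed (simp add: Suc qbinom_zero)
    qed
  qed
  show "(1 - p ^ Suc k) * qbinom p n (Suc k) = (1 - p ^ (n - k)) * qbinom p n k" by (rule step)
  show "(1 - p ^ Suc k) * qbinom p (Suc n) (Suc k) = (1 - p ^ Suc n) * qbinom p n k" by (rule absorb[OF step])
qed

text \<open>Along the row, neighbouring binomials differ by factors 1 - p^i with 0 < i \<le> n, none
  of which is zero.\<close>

lemma qbinom_nonzero:
  assumes "\<And>i. 0 < i \<Longrightarrow> i \<le> n \<Longrightarrow> p ^ i \<noteq> 1" "k \<le> n"
  shows "qbinom p n k \<noteq> 0"
  using assms(2)
proof (induction k)
  case (Suc k)
  then show ?case using qbinom_step[of p k n] assms(1)[of "n - k"] by auto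
qed simp

text \<open>The step from k = 0 to k = 1 carries the factor 1 - p^n = 0, and the zero propagates as
  long as the factors on the left can be cancelled.\<close>

lemma qbinom_root_of_unity:
  assumes "p ^ n = 1" "\<And>i. 0 < i \<Longrightarrow> i < n \<Longrightarrow> p ^ i \<noteq> 1" "0 < k" "k < n"
  shows "qbinom p n k = 0"
proof -
  have "qbinom p n (Suc k) = 0" if "Suc k < n" for k
    using that
  proof (induction k)
    case 0
    then show ?case using qbinom_step[of p 0 n] assms(1) assms(2)[of 1] by auto
  next
    case (Suc k)
    then show ?case using qbinom_step[of p "Suc k" n] assms(2)[of "Suc (Suc k)"] by auto
  qed
  then show ?thesis using assms(3,4) by (cases k) auto
qed

text \<open>The analogue of (-k-1 choose s) = (-1)^s (k+s choose s): as p^l = 1, the upper index l -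
  1 - k behaves like -k - 1. The product of the p^i is p^(s(s-1)/2) without a division in the
  exponent.\<close>

lemma qbinom_reflect:
  assumes p: "p ^ l = 1" "\<And>i. 0 < i \<Longrightarrow> i < l \<Longrightarrow> p ^ i \<noteq> 1" and s: "k + s < l"
  shows "p ^ (k * s) * p ^ (s * s) * qbinom p (l - 1 - k) s * (- 1) ^ s
    = (\<Prod>i<s. p ^ i) * qbinom p (k + s) s"
  using s
proof (induction s)
  case (Suc s)
  have "(1 - p ^ Suc s) * qbinom p (l - 1 - k) (Suc s) = (1 - p ^ (l - 1 - k - s)) * qbinom p (l - 1 - k) s"
    by (rule qbinom_step)
  then have "p ^ (k + Suc s) * ((1 - p ^ Suc s) * qbinom p (l - 1 - k) (Suc s))
    = (p ^ (k + Suc s) - p ^ (k + Suc s) * p ^ (l - 1 - k - s)) * qbinom p (l - 1 - k) s"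
    by (simp only: right_diff_distrib left_diff_distrib mult.assoc mult_1 mult_1_right)
  \<comment> \<open>The exponents add up to l; this is where the root of unity replaces the negative
    upper index.\<close>
  moreover have "p ^ (k + Suc s) * p ^ (l - 1 - k - s) = 1"
  proof -
    have "k + Suc s + (l - 1 - k - s) = l" using Suc.prems by simp
    then show ?thesis using p(1) by (simp only: power_add[symmetric])
  qed
  ultimately have 1: "p ^ (k + Suc s) * ((1 - p ^ Suc s) * qbinom p (l - 1 - k) (Suc s)) = - (1 - p ^ (k + Suc s)) * qbinom p (l - 1 - k) s"
    by (simp only: minus_diff_eq)
  have 2: "(1 - p ^ Suc s) * qbinom p (k + Suc s) (Suc s) = (1 - p ^ (k + Suc s)) * qbinom p (k + s) s"
    using qbinom_absorb[of p s "k + s"] by simp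
  have e: "p ^ (k * Suc s) * p ^ (Suc s * Suc s) = p ^ (k * s) * p ^ (s * s) * p ^ s * p ^ (k + Suc s)"
    by (simp add: algebra_simps flip: power_add)
  let ?sg = "\<lambda>s. (- 1 :: complex) ^ s"
  have "(1 - p ^ Suc s) * (p ^ (k * Suc s) * p ^ (Suc s * Suc s) * qbinom p (l - 1 - k) (Suc s) * ?sg (Suc s))
    = p ^ (k * s) * p ^ (s * s) * p ^ s * ?sg (Suc s) * (p ^ (k + Suc s) * ((1 - p ^ Suc s) * qbinom p (l - 1 - k) (Suc s)))"
    unfolding e by (simp only: ac_simps)
  also have "\<dots> = p ^ s * (1 - p ^ (k + Suc s)) * (p ^ (k * s) * p ^ (s * s) * qbinom p (l - 1 - k) s * ?sg s)"
    unfolding 1 power_Suc[of "- 1 :: complex" s]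
    by (simp only: ac_simps mult_minus_left mult_minus_right minus_minus mult_1)
  also have "\<dots> = p ^ s * (1 - p ^ (k + Suc s)) * ((\<Prod>i<s. p ^ i) * qbinom p (k + s) s)"
    using Suc by simp
  also have "\<dots> = (\<Prod>i<Suc s. p ^ i) * ((1 - p ^ (k + Suc s)) * qbinom p (k + s) s)"
    by simp
  also have "\<dots> = (1 - p ^ Suc s) * ((\<Prod>i<Suc s. p ^ i) * qbinom p (k + Suc s) (Suc s))"
    unfolding 2[symmetric] by (simp only: ac_simps)
  finally have "(1 - p ^ Suc s) * (p ^ (k * Suc s) * p ^ (Suc s * Suc s) * qbinom p (l - 1 - k) (Suc s) * ?sg (Suc s))
    = (1 - p ^ Suc s) * ((\<Prod>i<Suc s. p ^ i) * qbinom p (k + Suc s) (Suc s))" .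
  \<comment> \<open>The common factor can be cancelled because s + 1 is still below l.\<close>
  moreover have "1 - p ^ Suc s \<noteq> 0" using p(2)[of "Suc s"] Suc.prems by auto
  ultimately show ?case by (metis mult_left_cancel)
qed simp

text \<open>Both sides are the multinomial coefficient with parts k, s and N - s. The induction on s
  multiplies by 1 - p^(s+1) instead of using factorials.\<close>

lemma qbinom_trinomial:
  assumes p: "\<And>i. 0 < i \<Longrightarrow> i \<le> N + k \<Longrightarrow> p ^ i \<noteq> 1" and s: "s \<le> N"
  shows "qbinom p (k + s) s * qbinom p (N + k) (N - s) = qbinom p (N + k) N * qbinom p N s"
  using s
proof (induction s)
  case (Suc s)
  have 1: "(1 - p ^ Suc s) * qbinom p (k + Suc s) (Suc s) = (1 - p ^ (k + Suc s)) * qbinom p (k + s) s"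
    using qbinom_absorb[of p s "k + s"] by simp
  have 2: "(1 - p ^ (N - s)) * qbinom p (N + k) (N - s) = (1 - p ^ (k + Suc s)) * qbinom p (N + k) (N - Suc s)"
    using qbinom_step[of p "N - Suc s" "N + k"] Suc.prems by (simp add: Suc_diff_Suc ac_simps)
  have 3: "(1 - p ^ Suc s) * qbinom p N (Suc s) = (1 - p ^ (N - s)) * qbinom p N s"
    by (rule qbinom_step)
  have "(1 - p ^ Suc s) * (qbinom p (k + Suc s) (Suc s) * qbinom p (N + k) (N - Suc s))
    = (1 - p ^ (k + Suc s)) * qbinom p (N + k) (N - Suc s) * qbinom p (k + s) s"
    using 1 by (simp only: ac_simps) (metis mult.assoc mult.commute)
  also have "\<dots> = (1 - p ^ (N - s)) * (qbinom p (k + s) s * qbinom p (N + k) (N - s))"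
    unfolding 2[symmetric] by (simp only: ac_simps)
  also have "\<dots> = (1 - p ^ (N - s)) * (qbinom p (N + k) N * qbinom p N s)"
    using Suc by simp
  also have "\<dots> = qbinom p (N + k) N * ((1 - p ^ (N - s)) * qbinom p N s)"
    by (simp only: mult.left_commute)
  also have "\<dots> = (1 - p ^ Suc s) * (qbinom p (N + k) N * qbinom p N (Suc s))"
    unfolding 3[symmetric] by (simp only: mult.left_commute)
  finally show ?case using p[of "Suc s"] Suc.prems by auto
qed simp

section \<open>Powers of skew-commuting elements\<close>

text \<open>A coefficient that is the sum of a stay term \<open>f s\<close> and a shift term
  \<open>g (s - 1)\<close> splits the sum in two. The boundary conditions let both parts run over
  the shorter range.\<close>

lemma pascal_sum:
  assumes V: "vspace V" and G: "\<And>s. s \<le> Suc N \<Longrightarrow> G s \<in> carrier V" and f: "f (Suc N) = 0"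
    and c: "\<And>s. s \<le> Suc N \<Longrightarrow> c s = f s + (if s = 0 then 0 else g (s - 1))"
  shows "(\<Oplus>\<^bsub>V\<^esub>s\<in>{..Suc N}. c s \<odot>\<^bsub>V\<^esub> G s) = (\<Oplus>\<^bsub>V\<^esub>s\<in>{..N}. f s \<odot>\<^bsub>V\<^esub> G s \<oplus>\<^bsub>V\<^esub> g s \<odot>\<^bsub>V\<^esub> G (Suc s))"
proof -
  have G': "G s \<in> carrier V" "G (Suc s) \<in> carrier V" if "s \<le> N" for s
    using that G by simp_all
  have cl: "(\<Oplus>\<^bsub>V\<^esub>s\<in>{..N}. f s \<odot>\<^bsub>V\<^esub> G s) \<in> carrier V" "(\<Oplus>\<^bsub>V\<^esub>s\<in>{..N}. g s \<odot>\<^bsub>V\<^esub> G (Suc s)) \<in> carrier V"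
    by (rule vs_finsum_closed[OF V]; simp add: G' V)+
  have "(\<Oplus>\<^bsub>V\<^esub>s\<in>{..Suc N}. c s \<odot>\<^bsub>V\<^esub> G s)
    = (\<Oplus>\<^bsub>V\<^esub>s\<in>{..Suc N}. f s \<odot>\<^bsub>V\<^esub> G s \<oplus>\<^bsub>V\<^esub> (if s = 0 then 0 else g (s - 1)) \<odot>\<^bsub>V\<^esub> G s)"
    by (rule vs_finsum_cong[OF V refl]) (simp_all add: c G V vs_add_smult[OF V])
  also have "\<dots> = (\<Oplus>\<^bsub>V\<^esub>s\<in>{..Suc N}. f s \<odot>\<^bsub>V\<^esub> G s) \<oplus>\<^bsub>V\<^esub> (\<Oplus>\<^bsub>V\<^esub>s\<in>{..Suc N}. (if s = 0 then 0 else g (s - 1)) \<odot>\<^bsub>V\<^esub> G s)"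
    by (rule vs_finsum_add[OF V]) (simp_all add: G V)
  also have "(\<Oplus>\<^bsub>V\<^esub>s\<in>{..Suc N}. f s \<odot>\<^bsub>V\<^esub> G s) = (\<Oplus>\<^bsub>V\<^esub>s\<in>{..N}. f s \<odot>\<^bsub>V\<^esub> G s)"
    by (subst vs_finsum_Suc(1)[OF V]) (simp_all add: G V f cl(1) vs_zero[OF V])
  also have "(\<Oplus>\<^bsub>V\<^esub>s\<in>{..Suc N}. (if s = 0 then 0 else g (s - 1)) \<odot>\<^bsub>V\<^esub> G s) = (\<Oplus>\<^bsub>V\<^esub>s\<in>{..N}. g s \<odot>\<^bsub>V\<^esub> G (Suc s))"
    by (subst vs_finsum_Suc(2)[OF V]) (simp_all add: G V cl(2) vs_zero[OF V])
  also have "(\<Oplus>\<^bsub>V\<^esub>s\<in>{..N}. f s \<odot>\<^bsub>V\<^esub> G s) \<oplus>\<^bsub>V\<^esub> (\<Oplus>\<^bsub>V\<^esub>s\<in>{..N}. g s \<odot>\<^bsub>V\<^esub> G (Suc s))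
    = (\<Oplus>\<^bsub>V\<^esub>s\<in>{..N}. f s \<odot>\<^bsub>V\<^esub> G s \<oplus>\<^bsub>V\<^esub> g s \<odot>\<^bsub>V\<^esub> G (Suc s))"
    by (rule vs_finsum_add[OF V, symmetric]) (simp_all add: G V)
  finally show ?thesis .
qed

context
  fixes B :: "(complex, 'b, 'x) module_scheme" (structure)
  assumes B: "calgebra B"
begin

lemma skew_pow_left:
  assumes x: "x \<in> carrier B" and y: "y \<in> carrier B" and yx: "y \<otimes> x = z \<odot> (x \<otimes> y)"
  shows "y [^] (m :: nat) \<otimes> x = z ^ m \<odot> (x \<otimes> y [^] m)"
proof (induction m)
  case (Suc m)
  have "y [^] Suc m \<otimes> x = y [^] m \<otimes> (y \<otimes> x)"
    using x y by (simp add: alg_pow_Suc(1)[OF B] alg_assoc[OF B] alg_closed[OF B])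
  also have "\<dots> = z \<odot> ((y [^] m \<otimes> x) \<otimes> y)"
    using x y by (simp add: yx alg_smult[OF B] alg_assoc[OF B] alg_closed[OF B])
  also have "\<dots> = z ^ Suc m \<odot> (x \<otimes> y [^] Suc m)"
    using x y by (simp add: Suc alg_smult[OF B] alg_assoc[OF B] alg_closed[OF B] vs_smult_smult[OF alg_vspace[OF B]] alg_pow_Suc(1)[OF B])
  finally show ?case .
qed (use x alg_one[OF B] vs_zero(5)[OF alg_vspace[OF B]] in \<open>simp add: alg_pow(1)[OF B]\<close>)

lemma skew_pow:
  assumes x: "x \<in> carrier B" and y: "y \<in> carrier B" and yx: "y \<otimes> x = z \<odot> (x \<otimes> y)"
  shows "y [^] (m :: nat) \<otimes> x [^] (n :: nat) = z ^ (m * n) \<odot> (x [^] n \<otimes> y [^] m)"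
proof (induction n)
  case (Suc n)
  note V = alg_vspace[OF B]
  have "y [^] m \<otimes> x [^] Suc n = (y [^] m \<otimes> x [^] n) \<otimes> x"
    using x y by (simp add: alg_pow_Suc(1)[OF B] alg_assoc[OF B] alg_closed[OF B])
  also have "\<dots> = z ^ (m * n) \<odot> (x [^] n \<otimes> (y [^] m \<otimes> x))"
    using x y by (simp add: Suc alg_smult[OF B] alg_assoc[OF B] alg_closed[OF B])
  also have "\<dots> = (z ^ (m * n) * z ^ m) \<odot> (x [^] n \<otimes> (x \<otimes> y [^] m))"
    using x y by (simp add: skew_pow_left[OF x y yx] alg_smult[OF B] alg_closed[OF B] vs_smult_smult[OF V])
  also have "\<dots> = z ^ (m * Suc n) \<odot> (x [^] Suc n \<otimes> y [^] m)"
    using x y by (simp add: alg_pow_Suc(1)[OF B] alg_assoc[OF B] alg_closed[OF B] power_add mult.commute)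
  finally show ?case .
qed (use y alg_one[OF B] vs_zero(5)[OF alg_vspace[OF B]] in \<open>simp add: alg_pow(1)[OF B] alg_closed[OF B]\<close>)

text \<open>One more factor is multiplied on the right: a trailing x moves past y^s at the cost of
  p^s, a trailing y just lengthens the power, and the coefficients recombine by the recursion of
  \<open>qbinom\<close>.\<close>

lemma qbinomial_theorem:
  assumes x: "x \<in> carrier B" and y: "y \<in> carrier B" and yx: "y \<otimes> x = p \<odot> (x \<otimes> y)"
  shows "(x \<oplus> y) [^] N = (\<Oplus>s\<in>{..N}. qbinom p N s \<odot> (x [^] (N - s) \<otimes> y [^] s))"
proof (induction N)
  case 0
  then show ?case by (simp add: alg_pow(1)[OF B] alg_closed[OF B] alg_one[OF B] alg_vspace[OF B])
next
  case (Suc N)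
  note V = alg_vspace[OF B] and closed = alg_closed[OF B]
  let ?G = "\<lambda>s. x [^] (Suc N - s) \<otimes> y [^] s"
  have xy: "x \<oplus> y \<in> carrier B" using x y V by simp
  have "(x \<oplus> y) [^] Suc N = (\<Oplus>s\<in>{..N}. (qbinom p N s \<odot> (x [^] (N - s) \<otimes> y [^] s)) \<otimes> (x \<oplus> y))"
    unfolding alg_pow_Suc(1)[OF B xy] Suc
    by (rule alg_finsum(2)[OF B]) (use x y V closed xy in simp_all)
  also have "\<dots> = (\<Oplus>s\<in>{..N}. (p ^ s * qbinom p N s) \<odot> ?G s \<oplus> qbinom p N s \<odot> ?G (Suc s))"
  proof (rule vs_finsum_cong[OF V refl])
    fix s assume "s \<in> {..N}"
    then have s: "Suc N - s = Suc (N - s)" by auto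
    have "(x [^] (N - s) \<otimes> y [^] s) \<otimes> x = p ^ s \<odot> ?G s"
      using x y closed by (simp add: s alg_assoc[OF B] skew_pow_left[OF x y yx] alg_smult[OF B] alg_pow_Suc(1)[OF B])
    moreover have "(x [^] (N - s) \<otimes> y [^] s) \<otimes> y = ?G (Suc s)"
      using x y closed by (simp add: alg_assoc[OF B] alg_pow_Suc(1)[OF B])
    ultimately show "(qbinom p N s \<odot> (x [^] (N - s) \<otimes> y [^] s)) \<otimes> (x \<oplus> y)
      = (p ^ s * qbinom p N s) \<odot> ?G s \<oplus> qbinom p N s \<odot> ?G (Suc s)"
      using x y closed V by (simp add: alg_distrib[OF B] alg_smult[OF B] vs_smult_smult[OF V] mult.commute)
    show "(p ^ s * qbinom p N s) \<odot> ?G s \<oplus> qbinom p N s \<odot> ?G (Suc s) \<in> carrier B"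
      using x y closed V by simp
  qed
  also have "\<dots> = (\<Oplus>s\<in>{..Suc N}. qbinom p (Suc N) s \<odot> ?G s)"
  proof (rule pascal_sum[OF V, symmetric])
    show "qbinom p (Suc N) s = p ^ s * qbinom p N s + (if s = 0 then 0 else qbinom p N (s - 1))" for s
      by (cases s) auto
  qed (use x y closed qbinom_zero in simp_all)
  finally show ?case .
qed

text \<open>
  The expansion of a power of the quantum determinant \<open>a d - q b c = 1\<close> with \<open>a\<close>, \<open>b\<close> moved to the
  left and \<open>c\<close>, \<open>d\<close> to the right.
\<close>

lemma quantum_det_power:
  assumes q: "q \<noteq> 0" and rels: "slq2_relations B q a b c d"
    and abcd: "a \<in> carrier B" "b \<in> carrier B" "c \<in> carrier B" "d \<in> carrier B"
  shows "(\<Oplus>s\<in>{..N}. ((- q) ^ s * qbinom ((inverse q)\<^sup>2) N s) \<odot>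
      (a [^] (N - s) \<otimes> (b [^] s \<otimes> (c [^] s \<otimes> d [^] (N - s))))) = \<one>"
proof (induction N)
  case 0
  then show ?case by (simp add: alg_pow(1)[OF B] alg_closed[OF B] alg_one[OF B] alg_vspace[OF B])
next
  case (Suc N)
  note V = alg_vspace[OF B] and closed = alg_closed[OF B] abcd vs_closed[OF alg_vspace[OF B]]
  let ?p = "(inverse q)\<^sup>2"
  let ?G = "\<lambda>s. a [^] (Suc N - s) \<otimes> (b [^] s \<otimes> (c [^] s \<otimes> d [^] (Suc N - s)))"
  let ?C = "\<lambda>N s. (- q) ^ s * qbinom ?p N s"
  have ba: "b \<otimes> a = inverse q \<odot> (a \<otimes> b)" and dc: "c \<otimes> d = q \<odot> (d \<otimes> c)"
    and ad: "a \<otimes> d = \<one> \<oplus> q \<odot> (b \<otimes> c)"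
    using rels q closed by (simp_all add: slq2_relations_def vs_smult_smult[OF V] vs_zero(5)[OF V])
  have ab: "a \<otimes> b = q \<odot> (b \<otimes> a)" using rels by (simp add: slq2_relations_def)
  have det: "a \<otimes> d \<oplus> (- q) \<odot> (b \<otimes> c) = \<one>"
  proof -
    have "a \<otimes> d \<oplus> (- q) \<odot> (b \<otimes> c) = \<one> \<oplus> (q + - q) \<odot> (b \<otimes> c)"
      unfolding ad using closed by (simp only: vs_ac(1)[OF V] vs_add_smult[OF V])
    then show ?thesis using closed vs_zero[OF V] by simp
  qed
  have "(\<Oplus>s\<in>{..Suc N}. ?C (Suc N) s \<odot> ?G s) = (\<Oplus>s\<in>{..N}. (?p ^ s * ?C N s) \<odot> ?G s \<oplus> (- q * ?C N s) \<odot> ?G (Suc s))"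
  proof (rule pascal_sum[OF V])
    show "?C (Suc N) s = ?p ^ s * ?C N s + (if s = 0 then 0 else - q * ?C N (s - 1))" for s
      by (cases s) (simp_all add: algebra_simps)
  qed (simp_all add: closed qbinom_zero)
  also have "\<dots> = (\<Oplus>s\<in>{..N}. ?C N s \<odot> (a [^] (N - s) \<otimes> (b [^] s \<otimes> (c [^] s \<otimes> d [^] (N - s)))))"
  proof (rule vs_finsum_cong[OF V refl])
    fix s assume "s \<in> {..N}"
    then have s: "Suc N - s = Suc (N - s)" by auto
    let ?w = "c [^] s \<otimes> d [^] (N - s)"
    have w: "?w \<in> carrier B" by (simp add: closed)
    have cd: "c [^] s \<otimes> d [^] Suc (N - s) = q ^ s \<odot> (d \<otimes> ?w)"
    proof -
      have "c [^] s \<otimes> d [^] Suc (N - s) = (c [^] s \<otimes> d) \<otimes> d [^] (N - s)"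
        by (simp only: alg_pow_Suc(2)[OF B abcd(4)] alg_assoc[OF B] closed)
      then show ?thesis
        by (simp add: skew_pow_left[OF abcd(4,3) dc] closed alg_assoc[OF B] alg_smult[OF B])
    qed
    have ab': "a \<otimes> b [^] s = q ^ s \<odot> (b [^] s \<otimes> a)"
    proof -
      have "q ^ s \<odot> (b [^] s \<otimes> a) = (q ^ s * inverse q ^ s) \<odot> (a \<otimes> b [^] s)"
        unfolding skew_pow_left[OF abcd(1,2) ba] by (simp add: closed vs_smult_smult[OF V])
      then show ?thesis using q by (simp add: closed vs_zero(5)[OF V] flip: power_mult_distrib)
    qed
    \<comment> \<open>In the middle of the monomial a meets d once a has passed b^s and d has passed
      c^s, each at the cost of q^s. The neighbouring monomial with s + 1 has b c in the same
      place.\<close>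
    have "?G s = a [^] (N - s) \<otimes> ((a \<otimes> b [^] s) \<otimes> (c [^] s \<otimes> d [^] Suc (N - s)))"
      unfolding s by (simp add: alg_pow_Suc(1)[OF B abcd(1)] closed alg_assoc[OF B] del: power_Suc)
    also have "\<dots> = (q ^ s * q ^ s) \<odot> (a [^] (N - s) \<otimes> (b [^] s \<otimes> ((a \<otimes> d) \<otimes> ?w)))"
      unfolding ab' cd by (simp add: closed alg_smult[OF B] alg_assoc[OF B] vs_smult_smult[OF V])
    finally have 1: "?G s = (q ^ s * q ^ s) \<odot> (a [^] (N - s) \<otimes> (b [^] s \<otimes> ((a \<otimes> d) \<otimes> ?w)))" .
    have 2: "?G (Suc s) = a [^] (N - s) \<otimes> (b [^] s \<otimes> ((b \<otimes> c) \<otimes> ?w))"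
      by (simp only: diff_Suc_Suc alg_pow_Suc(1)[OF B abcd(2)] alg_pow_Suc(2)[OF B abcd(3)] closed alg_assoc[OF B])
    \<comment> \<open>The weight q^(-2s) from the recursion cancels the reordering factor q^(2s), so
      that the inserted element is a d - q b c = 1.\<close>
    have p: "?p ^ s * (q ^ s * q ^ s) = 1"
      using q by (simp add: power2_eq_square power_mult_distrib) (simp add: power_inverse field_simps)
    have "(?p ^ s * ?C N s) \<odot> ?G s \<oplus> (- q * ?C N s) \<odot> ?G (Suc s)
      = ?C N s \<odot> ((?p ^ s * (q ^ s * q ^ s)) \<odot> (a [^] (N - s) \<otimes> (b [^] s \<otimes> ((a \<otimes> d) \<otimes> ?w)))
          \<oplus> (- q) \<odot> (a [^] (N - s) \<otimes> (b [^] s \<otimes> ((b \<otimes> c) \<otimes> ?w))))"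
      unfolding 1 2 by (simp add: closed vs_smult_smult[OF V] vs_smult_add[OF V] ac_simps)
    also have "\<dots> = ?C N s \<odot> (a [^] (N - s) \<otimes> (b [^] s \<otimes> ((a \<otimes> d \<oplus> (- q) \<odot> (b \<otimes> c)) \<otimes> ?w)))"
      unfolding p by (simp only: closed vs_zero(5)[OF V] alg_distrib[OF B] alg_smult[OF B])
    also have "\<dots> = ?C N s \<odot> (a [^] (N - s) \<otimes> (b [^] s \<otimes> ?w))"
      unfolding det by (simp add: closed alg_one[OF B])
    finally show "(?p ^ s * ?C N s) \<odot> ?G s \<oplus> (- q * ?C N s) \<odot> ?G (Suc s) = ?C N s \<odot> (a [^] (N - s) \<otimes> (b [^] s \<otimes> ?w))" .
  qed (simp add: closed)
  also have "\<dots> = \<one>" by (rule Suc)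
  finally show ?case .
qed

end


section \<open>Coassociativity\<close>

text \<open>
  Coassociativity and the counit law are only needed in the form of their consequences for slices
  \<open>(id \<otimes> \<phi>) (\<Delta> x)\<close>.
\<close>

definition coslice :: "'h bialgebra \<Rightarrow> ('h \<Rightarrow> complex) \<Rightarrow> 'h \<Rightarrow> 'h" where
  "coslice H \<phi> x = slice_right H \<phi> (comult H x)"

context
  fixes H :: "'h bialgebra"
  assumes H: "prebialgebra H"
begin

lemma coslice_linear: "\<phi> \<in> linear_maps H CC \<Longrightarrow> coslice H \<phi> \<in> linear_maps H H"
  unfolding coslice_def
  using lin_comp[OF prebialgebraD(5)[OF H] slice_right_linear[OF prebialgebraD(2,2)[OF H]]] by simp

lemma slice_right_mult:
  assumes \<phi>: "\<phi> \<in> linear_maps H CC" and p: "p \<in> carrier H" and u: "u \<in> carrier H" and t: "t \<in> carrier (tensor H H)"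
  shows "slice_right H \<phi> (pure H H p u \<otimes>\<^bsub>tensor H H\<^esub> t) = p \<otimes>\<^bsub>H\<^esub> slice_right H (\<lambda>y. \<phi> (u \<otimes>\<^bsub>H\<^esub> y)) t"
proof -
  note D = prebialgebraD[OF H]
  note A = D(1) and V = D(2)
  note AT = calgebra_tensor[OF A A]
  have \<phi>u: "(\<lambda>y. \<phi> (u \<otimes>\<^bsub>H\<^esub> y)) \<in> linear_maps H CC" by (rule lin_comp[OF alg_lin(1)[OF A u] \<phi>])
  show ?thesis
    by (rule tensor_lin_eq[OF V V lin_comp[OF alg_lin(1)[OF AT pure_closed[OF V V p u]] slice_right_linear[OF V V \<phi>]]
          lin_comp[OF slice_right_linear[OF V V \<phi>u] alg_lin(1)[OF A p]] V _ t])
      (simp add: tensor_mult_pure[OF A A] slice_right_pure[OF V V \<phi>] slice_right_pure[OF V V \<phi>u] p u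
        alg_closed[OF A] alg_smult[OF A])
qed

text \<open>Left multiplication of the second tensor factor by u, followed by \<phi>, is slicing by
  the functional y \<mapsto> \<phi>(u y). So slices of a product are slices of \<open>x\<close> for
  modified functionals.\<close>

lemma coslice_mult:
  assumes \<phi>: "\<phi> \<in> linear_maps H CC" and carr: "g \<in> carrier H" "p \<in> carrier H" "u \<in> carrier H" "r \<in> carrier H" "v \<in> carrier H"
    and g: "comult H g = pure H H p u \<oplus>\<^bsub>tensor H H\<^esub> pure H H r v" and x: "x \<in> carrier H"
  shows "coslice H \<phi> (g \<otimes>\<^bsub>H\<^esub> x) = p \<otimes>\<^bsub>H\<^esub> coslice H (\<lambda>y. \<phi> (u \<otimes>\<^bsub>H\<^esub> y)) x \<oplus>\<^bsub>H\<^esub> r \<otimes>\<^bsub>H\<^esub> coslice H (\<lambda>y. \<phi> (v \<otimes>\<^bsub>H\<^esub> y)) x"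
proof -
  note D = prebialgebraD[OF H]
  note A = D(1) and V = D(2)
  note AT = calgebra_tensor[OF A A]
  have t: "comult H x \<in> carrier (tensor H H)" by (rule lin_closed[OF D(5) x])
  have P: "pure H H p u \<in> carrier (tensor H H)" "pure H H r v \<in> carrier (tensor H H)" using carr V by simp_all
  show ?thesis
    unfolding coslice_def algebra_homD(3)[OF D(3) carr(1) x] g alg_distrib(2)[OF AT P t]
    by (simp add: lin_add[OF slice_right_linear[OF V V \<phi>]] alg_closed[OF AT] P t slice_right_mult[OF \<phi>] carr)
qed

lemma coslice_tensor_mult:
  assumes \<phi>: "\<phi> \<in> linear_maps H CC" and carr: "s \<in> carrier H" "g \<in> carrier H" "p \<in> carrier H" "u \<in> carrier H" "r \<in> carrier H" "v \<in> carrier H"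
    and g: "comult H g = pure H H p u \<oplus>\<^bsub>tensor H H\<^esub> pure H H r v" and t: "t \<in> carrier (tensor H H)"
  shows "tensor_map H H id (coslice H \<phi>) (pure H H s g \<otimes>\<^bsub>tensor H H\<^esub> t)
    = pure H H s p \<otimes>\<^bsub>tensor H H\<^esub> tensor_map H H id (coslice H (\<lambda>y. \<phi> (u \<otimes>\<^bsub>H\<^esub> y))) t
      \<oplus>\<^bsub>tensor H H\<^esub> pure H H s r \<otimes>\<^bsub>tensor H H\<^esub> tensor_map H H id (coslice H (\<lambda>y. \<phi> (v \<otimes>\<^bsub>H\<^esub> y))) t"
proof -
  note D = prebialgebraD[OF H]
  note A = D(1) and V = D(2)
  note AT = calgebra_tensor[OF A A]
  note VT = alg_vspace[OF AT]
  have L: "coslice H (\<lambda>y. \<phi> (u \<otimes>\<^bsub>H\<^esub> y)) \<in> linear_maps H H" if "u \<in> carrier H" for u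
    by (rule coslice_linear[OF lin_comp[OF alg_lin(1)[OF A that] \<phi>]])
  note tm = tensor_map_linear[OF V V V V lin_id(2)] and tp = tensor_map_pure[OF V V V V lin_id(2)]
  have P: "pure H H s g \<in> carrier (tensor H H)" "pure H H s p \<in> carrier (tensor H H)" "pure H H s r \<in> carrier (tensor H H)"
    using carr V by simp_all
  show ?thesis
    by (rule tensor_lin_eq[OF V V lin_comp[OF alg_lin(1)[OF AT P(1)] tm[OF coslice_linear[OF \<phi>]]]
          lin_add_fun[OF lin_comp[OF tm[OF L[OF carr(4)]] alg_lin(1)[OF AT P(2)]] lin_comp[OF tm[OF L[OF carr(6)]] alg_lin(1)[OF AT P(3)]] VT] VT _ t])
      (simp add: tensor_mult_pure[OF A A] carr tp[OF coslice_linear[OF \<phi>]] tp[OF L[OF carr(4)]] tp[OF L[OF carr(6)]]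
        alg_closed[OF A] lin_closed[OF L] coslice_mult[OF \<phi> carr(2-6) g] pure_add_right[OF V V])
qed

text \<open>One step of the induction over words; \<open>p\<close>, \<open>r\<close> is a row of the fundamental matrix.\<close>

lemma coslice_comult_step:
  assumes \<phi>: "\<phi> \<in> linear_maps H CC" and x: "x \<in> carrier H"
    and carr: "a \<in> carrier H" "b \<in> carrier H" "c \<in> carrier H" "d \<in> carrier H" "g \<in> carrier H" "p \<in> carrier H" "r \<in> carrier H"
      "u \<in> carrier H" "v \<in> carrier H"
    and g: "comult H g = pure H H p u \<oplus>\<^bsub>tensor H H\<^esub> pure H H r v"
    and p: "comult H p = pure H H p a \<oplus>\<^bsub>tensor H H\<^esub> pure H H r c"
    and r: "comult H r = pure H H p b \<oplus>\<^bsub>tensor H H\<^esub> pure H H r d"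
    and u: "comult H u = pure H H a u \<oplus>\<^bsub>tensor H H\<^esub> pure H H b v"
    and v: "comult H v = pure H H c u \<oplus>\<^bsub>tensor H H\<^esub> pure H H d v"
    and IH: "\<And>\<phi>. \<phi> \<in> linear_maps H CC \<Longrightarrow> comult H (coslice H \<phi> x) = tensor_map H H id (coslice H \<phi>) (comult H x)"
  shows "comult H (coslice H \<phi> (g \<otimes>\<^bsub>H\<^esub> x)) = tensor_map H H id (coslice H \<phi>) (comult H (g \<otimes>\<^bsub>H\<^esub> x))"
proof -
  note D = prebialgebraD[OF H]
  note A = D(1) and V = D(2)
  note AT = calgebra_tensor[OF A A]
  note VT = alg_vspace[OF AT]
  let ?T = "tensor H H"
  let ?\<phi>u = "\<lambda>y. \<phi> (u \<otimes>\<^bsub>H\<^esub> y)" and ?\<phi>v = "\<lambda>y. \<phi> (v \<otimes>\<^bsub>H\<^esub> y)"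
  have \<phi>': "?\<phi>u \<in> linear_maps H CC" "?\<phi>v \<in> linear_maps H CC"
    by (rule lin_comp[OF alg_lin(1)[OF A] \<phi>], rule carr)+
  have t: "comult H x \<in> carrier ?T" by (rule lin_closed[OF D(5) x])
  let ?gu = "tensor_map H H id (coslice H ?\<phi>u) (comult H x)" and ?gv = "tensor_map H H id (coslice H ?\<phi>v) (comult H x)"
  have G: "?gu \<in> carrier ?T" "?gv \<in> carrier ?T"
    by (rule lin_closed[OF tensor_map_linear[OF V V V V lin_id(2) coslice_linear] t], rule \<phi>')+
  have c: "coslice H ?\<phi>u x \<in> carrier H" "coslice H ?\<phi>v x \<in> carrier H"
    by (rule lin_closed[OF coslice_linear x], rule \<phi>')+
  have P: "pure H H y z \<in> carrier ?T" if "y \<in> carrier H" "z \<in> carrier H" for y z using that V by simp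
  have "comult H (coslice H \<phi> (g \<otimes>\<^bsub>H\<^esub> x)) = comult H p \<otimes>\<^bsub>?T\<^esub> comult H (coslice H ?\<phi>u x) \<oplus>\<^bsub>?T\<^esub> comult H r \<otimes>\<^bsub>?T\<^esub> comult H (coslice H ?\<phi>v x)"
    unfolding coslice_mult[OF \<phi> carr(5,6,8,7,9) g x]
    by (simp add: lin_add[OF D(5)] algebra_homD(3)[OF D(3)] carr c alg_closed[OF A])
  also have "\<dots> = (pure H H p a \<oplus>\<^bsub>?T\<^esub> pure H H r c) \<otimes>\<^bsub>?T\<^esub> ?gu \<oplus>\<^bsub>?T\<^esub> (pure H H p b \<oplus>\<^bsub>?T\<^esub> pure H H r d) \<otimes>\<^bsub>?T\<^esub> ?gv"
    unfolding p r IH[OF \<phi>'(1)] IH[OF \<phi>'(2)] ..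
  \<comment> \<open>The four terms are regrouped by their first tensor factor: those with
    \<open>p\<close> assemble to the comultiplication of \<open>u\<close>, those with
    \<open>r\<close> to that of \<open>v\<close>.\<close>
  also have "\<dots> = (pure H H p a \<otimes>\<^bsub>?T\<^esub> ?gu \<oplus>\<^bsub>?T\<^esub> pure H H p b \<otimes>\<^bsub>?T\<^esub> ?gv) \<oplus>\<^bsub>?T\<^esub> (pure H H r c \<otimes>\<^bsub>?T\<^esub> ?gu \<oplus>\<^bsub>?T\<^esub> pure H H r d \<otimes>\<^bsub>?T\<^esub> ?gv)"
    using G carr by (simp add: alg_distrib[OF AT] P alg_closed[OF AT] VT vs_ac[OF VT])
  also have "\<dots> = tensor_map H H id (coslice H \<phi>) (pure H H p u \<otimes>\<^bsub>?T\<^esub> comult H x) \<oplus>\<^bsub>?T\<^esub> tensor_map H H id (coslice H \<phi>) (pure H H r v \<otimes>\<^bsub>?T\<^esub> comult H x)"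
    unfolding coslice_tensor_mult[OF \<phi> carr(6,8,1,8,2,9) u t] coslice_tensor_mult[OF \<phi> carr(7,9,3,8,4,9) v t] ..
  also have "\<dots> = tensor_map H H id (coslice H \<phi>) (comult H (g \<otimes>\<^bsub>H\<^esub> x))"
    unfolding algebra_homD(3)[OF D(3) carr(5) x] g
    using carr t by (simp add: alg_distrib[OF AT] P alg_closed[OF AT] lin_add[OF tensor_map_linear[OF V V V V lin_id(2) coslice_linear[OF \<phi>]]])
  finally show ?thesis .
qed

text \<open>The entry \<open>T i j\<close> is the slice of the comultiplication of
  \<open>e i\<close> by the functional dual to \<open>e j\<close>, so coassociativity for slices
  gives the comultiplication of the entry.\<close>

lemma comatrix_coslice:
  assumes I: "finite I" and e: "\<And>i. i \<in> I \<Longrightarrow> e i \<in> carrier H" and \<phi>: "\<And>i. i \<in> I \<Longrightarrow> \<phi> i \<in> linear_maps H CC"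
    and dual: "\<And>i j. i \<in> I \<Longrightarrow> j \<in> I \<Longrightarrow> \<phi> i (e j) = (if i = j then 1 else 0)"
    and T: "\<And>i j. i \<in> I \<Longrightarrow> j \<in> I \<Longrightarrow> T i j \<in> carrier H"
    and \<Delta>: "\<And>i. i \<in> I \<Longrightarrow> comult H (e i) = (\<Oplus>\<^bsub>tensor H H\<^esub>j\<in>I. pure H H (T i j) (e j))"
    and coassoc: "\<And>\<phi> x. \<phi> \<in> linear_maps H CC \<Longrightarrow> x \<in> carrier H \<Longrightarrow>
      comult H (coslice H \<phi> x) = tensor_map H H id (coslice H \<phi>) (comult H x)"
    and counit: "\<And>\<phi> x. \<phi> \<in> linear_maps H CC \<Longrightarrow> x \<in> carrier H \<Longrightarrow> counit H (coslice H \<phi> x) = \<phi> x"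
  shows "comatrix H I T"
proof -
  note V = prebialgebraD(2)[OF H] and VT = prebialgebraD(7)[OF H]
  have Tc: "T i j = coslice H (\<phi> j) (e i)" if "i \<in> I" "j \<in> I" for i j
  proof -
    have "slice_right H (\<phi> j) (\<Oplus>\<^bsub>tensor H H\<^esub>k\<in>I. pure H H (T i k) (e k)) = T i j"
      by (rule slice_right_sum[OF I e \<phi>[OF that(2)] _ V V T[OF that(1)] that(2)]) (use dual[OF that(2)] in auto)
    then show ?thesis using \<Delta>[OF that(1)] by (simp add: coslice_def)
  qed
  show ?thesis
    unfolding comatrix_def
  proof (intro conjI ballI I T)
    fix i j assume ij: "i \<in> I" "j \<in> I"
    note L = tensor_map_linear[OF V V V V lin_id(2) coslice_linear[OF \<phi>[OF ij(2)]]]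
    have "comult H (T i j) = tensor_map H H id (coslice H (\<phi> j)) (\<Oplus>\<^bsub>tensor H H\<^esub>k\<in>I. pure H H (T i k) (e k))"
      unfolding Tc[OF ij] coassoc[OF \<phi>[OF ij(2)] e[OF ij(1)]] \<Delta>[OF ij(1)] ..
    also have "\<dots> = (\<Oplus>\<^bsub>tensor H H\<^esub>k\<in>I. tensor_map H H id (coslice H (\<phi> j)) (pure H H (T i k) (e k)))"
      by (rule lin_finsum[OF L VT VT I]) (simp add: V T ij e)
    also have "\<dots> = (\<Oplus>\<^bsub>tensor H H\<^esub>k\<in>I. pure H H (T i k) (T k j))"
      by (rule vs_finsum_cong[OF VT refl])
        (simp_all add: tensor_map_pure[OF V V V V lin_id(2) coslice_linear[OF \<phi>[OF ij(2)]]] V T ij e Tc[OF _ ij(2), symmetric])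
    finally show "comult H (T i j) = (\<Oplus>\<^bsub>tensor H H\<^esub>k\<in>I. pure H H (T i k) (T k j))" .
    show "counit H (T i j) = (if i = j then 1 else 0)"
      unfolding Tc[OF ij] counit[OF \<phi>[OF ij(2)] e[OF ij(1)]] using dual[OF ij(2,1)] by auto
  qed
qed

end

text \<open>Induction over words with \<phi> generalized, since splitting off a generator replaces
  \<phi> by its translates under left multiplication.\<close>

lemma slq2_coassoc:
  assumes q: "q \<noteq> 0" and x: "x \<in> carrier (slq2 q)" and \<phi>: "\<phi> \<in> linear_maps (slq2 q) CC"
  shows "comult (slq2 q) (coslice (slq2 q) \<phi> x) = tensor_map (slq2 q) (slq2 q) id (coslice (slq2 q) \<phi>) (comult (slq2 q) x)"
  using x \<phi>
proof (induction arbitrary: \<phi> rule: slq2_induct)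
  let ?H = "slq2 q" let ?T = "tensor ?H ?H"
  note H = prebialgebra_slq2[OF q]
  note D = prebialgebraD[OF H]
  note A = D(1) and V = D(2) and VT = D(7)
  have L1: "(\<lambda>x. comult ?H (coslice ?H \<phi> x)) \<in> linear_maps ?H ?T" if "\<phi> \<in> linear_maps ?H CC" for \<phi>
    by (rule lin_comp[OF coslice_linear[OF H that] D(5)])
  have L2: "(\<lambda>x. tensor_map ?H ?H id (coslice ?H \<phi>) (comult ?H x)) \<in> linear_maps ?H ?T" if "\<phi> \<in> linear_maps ?H CC" for \<phi>
    by (rule lin_comp[OF D(5) tensor_map_linear[OF V V V V lin_id(2) coslice_linear[OF H that]]])
  {
    case zero
    show ?case
      by (rule trans[OF lin_zero[OF L1[OF zero] V VT] lin_zero[OF L2[OF zero] V VT, symmetric]])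
  next
    case one
    have 1: "comult ?H \<one>\<^bsub>?H\<^esub> = pure ?H ?H \<one>\<^bsub>?H\<^esub> \<one>\<^bsub>?H\<^esub>"
      using algebra_homD(2)[OF D(3)] by (simp add: tensor_one[OF A A])
    note o = alg_closed(2)[OF A]
    have c: "coslice ?H \<phi> \<one>\<^bsub>?H\<^esub> = \<phi> \<one>\<^bsub>?H\<^esub> \<odot>\<^bsub>?H\<^esub> \<one>\<^bsub>?H\<^esub>"
      by (simp add: coslice_def 1 slice_right_pure[OF V V one] o)
    have tm: "tensor_map ?H ?H id (coslice ?H \<phi>) (pure ?H ?H \<one>\<^bsub>?H\<^esub> \<one>\<^bsub>?H\<^esub>) = pure ?H ?H \<one>\<^bsub>?H\<^esub> (coslice ?H \<phi> \<one>\<^bsub>?H\<^esub>)"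
      by (simp only: tensor_map_pure[OF V V V V lin_id(2) coslice_linear[OF H one] o o] id_apply)
    show ?case
      by (simp only: c 1 lin_smult[OF D(5) o] tm pure_smult_right[OF V V o o])
  next
    case (gen g x)
    have "comult ?H (slq2_gen q g) = slq2_comult_gen q g" for g by (rule slq2_comult(2)[OF q])
    note C = this[of GA, unfolded slq2_comult_gen_eq gen.case] this[of GB, unfolded slq2_comult_gen_eq gen.case]
      this[of GC, unfolded slq2_comult_gen_eq gen.case] this[of GD, unfolded slq2_comult_gen_eq gen.case]
    note K = slq2_gen_closed'
    note step = coslice_comult_step[OF H gen(3,1) K[where g = GA] K[where g = GB] K[where g = GC] K[where g = GD] K K K K K]
    \<comment> \<open>A generator selects its row (p, r) and its column (u, v) of the fundamental
      matrix.\<close>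
    show ?case
    proof (cases g)
      case GA
      show ?thesis unfolding GA by (rule step[OF C(1) C(1) C(2) C(1) C(3) gen(2)])
    next
      case GB
      show ?thesis unfolding GB by (rule step[OF C(2) C(1) C(2) C(2) C(4) gen(2)])
    next
      case GC
      show ?thesis unfolding GC by (rule step[OF C(3) C(3) C(4) C(1) C(3) gen(2)])
    next
      case GD
      show ?thesis unfolding GD by (rule step[OF C(4) C(3) C(4) C(2) C(4) gen(2)])
    qed
  next
    case (add x y)
    show ?case
      unfolding lin_add[OF L1[OF add(5)] add(1,2)] lin_add[OF L2[OF add(5)] add(1,2)] add(3)[OF add(5)] add(4)[OF add(5)] ..
  next
    case (smult z x)
    show ?case
      unfolding lin_smult[OF L1[OF smult(3)] smult(1)] lin_smult[OF L2[OF smult(3)] smult(1)] smult(2)[OF smult(3)] ..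
  }
qed

text \<open>On a word the counit of the first row or column entry is 0 or 1, so exactly the
  translate of \<phi> by the split-off generator survives.\<close>

lemma slq2_counit_coslice:
  assumes q: "q \<noteq> 0" and x: "x \<in> carrier (slq2 q)" and \<phi>: "\<phi> \<in> linear_maps (slq2 q) CC"
  shows "counit (slq2 q) (coslice (slq2 q) \<phi> x) = \<phi> x"
  using x \<phi>
proof (induction arbitrary: \<phi> rule: slq2_induct)
  let ?H = "slq2 q"
  note H = prebialgebra_slq2[OF q]
  note D = prebialgebraD[OF H]
  note A = D(1) and V = D(2)
  have L1: "(\<lambda>x. counit ?H (coslice ?H \<phi> x)) \<in> linear_maps ?H CC" if "\<phi> \<in> linear_maps ?H CC" for \<phi>
    by (rule lin_comp[OF coslice_linear[OF H that] D(6)])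
  {
    case zero
    then show ?case using lin_zero[OF L1 V vspace_CC] lin_zero[OF zero V vspace_CC] by simp
  next
    case one
    have 1: "comult ?H \<one>\<^bsub>?H\<^esub> = pure ?H ?H \<one>\<^bsub>?H\<^esub> \<one>\<^bsub>?H\<^esub>"
      using algebra_homD(2)[OF D(3)] by (simp add: tensor_one[OF A A])
    have "coslice ?H \<phi> \<one>\<^bsub>?H\<^esub> = \<phi> \<one>\<^bsub>?H\<^esub> \<odot>\<^bsub>?H\<^esub> \<one>\<^bsub>?H\<^esub>"
      by (simp add: coslice_def 1 slice_right_pure[OF V V one] alg_closed[OF A])
    then show ?case using lin_smult[OF D(6) alg_closed(2)[OF A]] algebra_homD(2)[OF D(4)] by simp
  next
    case (gen g x)
    let ?gen = "slq2_gen q"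
    have "comult ?H (?gen g) = slq2_comult_gen q g" for g by (rule slq2_comult(2)[OF q])
    note C = this[of GA, unfolded slq2_comult_gen_eq gen.case] this[of GB, unfolded slq2_comult_gen_eq gen.case]
      this[of GC, unfolded slq2_comult_gen_eq gen.case] this[of GD, unfolded slq2_comult_gen_eq gen.case]
    have step: "counit ?H (coslice ?H \<phi> (?gen h \<otimes>\<^bsub>?H\<^esub> x))
      = slq2_counit_gen p * \<phi> (?gen u \<otimes>\<^bsub>?H\<^esub> x) + slq2_counit_gen r * \<phi> (?gen v \<otimes>\<^bsub>?H\<^esub> x)"
      if g: "comult ?H (?gen h) = pure ?H ?H (?gen p) (?gen u) \<oplus>\<^bsub>tensor ?H ?H\<^esub> pure ?H ?H (?gen r) (?gen v)" for h p u r v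
    proof -
      have \<phi>': "(\<lambda>y. \<phi> (?gen u \<otimes>\<^bsub>?H\<^esub> y)) \<in> linear_maps ?H CC" for u
        by (rule lin_comp[OF alg_lin(1)[OF A slq2_gen_closed'] gen(3)])
      have c: "coslice ?H (\<lambda>y. \<phi> (?gen u \<otimes>\<^bsub>?H\<^esub> y)) x \<in> carrier ?H" for u
        by (rule lin_closed[OF coslice_linear[OF H \<phi>'] gen(1)])
      have cu: "counit ?H (?gen k \<otimes>\<^bsub>?H\<^esub> coslice ?H (\<lambda>y. \<phi> (?gen u \<otimes>\<^bsub>?H\<^esub> y)) x) = slq2_counit_gen k * \<phi> (?gen u \<otimes>\<^bsub>?H\<^esub> x)" for k u
        using algebra_homD(3)[OF D(4) slq2_gen_closed' c] gen(2)[OF \<phi>'] slq2_counit(2)[OF q] by simp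
      have m: "?gen k \<otimes>\<^bsub>?H\<^esub> coslice ?H (\<lambda>y. \<phi> (?gen u \<otimes>\<^bsub>?H\<^esub> y)) x \<in> carrier ?H" for k u
        using c alg_closed(1)[OF A] by simp
      show ?thesis
        unfolding coslice_mult[OF H gen(3) slq2_gen_closed' slq2_gen_closed' slq2_gen_closed' slq2_gen_closed' slq2_gen_closed' g gen(1)]
        by (simp add: lin_add[OF D(6) m m] cu)
    qed
    show ?case
      using step[OF C(1)] step[OF C(2)] step[OF C(3)] step[OF C(4)]
      by (cases g) (simp_all add: slq2_counit_gen_def)
  next
    case (add x y)
    show ?case
      unfolding lin_add[OF L1[OF add(5)] add(1,2)] lin_add[OF add(5) add(1,2)] add(3)[OF add(5)] add(4)[OF add(5)] ..
  next
    case (smult z x)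
    show ?case
      unfolding lin_smult[OF L1[OF smult(3)] smult(1)] lin_smult[OF smult(3) smult(1)] smult(2)[OF smult(3)] ..
  }
qed

section \<open>Comultiplication of monomials\<close>

lemma vs_finsum_regroup:
  assumes V: "vspace V" and P: "finite P" and K: "finite K" and h: "h ` P \<subseteq> K" and G: "\<And>p. p \<in> P \<Longrightarrow> G p \<in> carrier V"
  shows "finsum V G P = (\<Oplus>\<^bsub>V\<^esub>j\<in>K. finsum V G {p \<in> P. h p = j})"
proof -
  interpret module CC V by (rule V)
  have "P = (\<Union>j\<in>K. {p \<in> P. h p = j})" using h by blast
  then have "finsum V G P = finsum V G (\<Union>j\<in>K. {p \<in> P. h p = j})" by (rule arg_cong)
  also have "\<dots> = (\<Oplus>\<^bsub>V\<^esub>j\<in>K. finsum V G {p \<in> P. h p = j})"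
    by (rule add.finprod_UN_disjoint[OF K]) (use P G in \<open>auto simp: pairwise_def disjnt_def\<close>)
  finally show ?thesis .
qed

lemma tensor_pow_pure:
  assumes A: "calgebra A" and B: "calgebra B" and "x \<in> carrier A" "y \<in> carrier B"
  shows "pure A B x y [^]\<^bsub>tensor A B\<^esub> (n :: nat) = pure A B (x [^]\<^bsub>A\<^esub> n) (y [^]\<^bsub>B\<^esub> n)"
proof (induction n)
  case 0
  show ?case by (simp only: alg_pow(1)[OF calgebra_tensor[OF A B]] alg_pow(1)[OF A] alg_pow(1)[OF B] tensor_one[OF A B])
next
  case (Suc n)
  have "pure A B x y \<in> carrier (tensor A B)"
    using assms by (simp add: alg_vspace[OF A] alg_vspace[OF B])
  then show ?case
    by (simp only: alg_pow_Suc(1)[OF calgebra_tensor[OF A B]] alg_pow_Suc(1)[OF A] alg_pow_Suc(1)[OF B] Suc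
        tensor_mult_pure[OF A B] assms alg_closed[OF A] alg_closed[OF B])
qed

definition monomial :: "(complex, 'h, 'x) module_scheme \<Rightarrow> 'h \<Rightarrow> 'h \<Rightarrow> nat \<Rightarrow> nat \<Rightarrow> 'h" where
  "monomial H x z m i = x [^]\<^bsub>H\<^esub> (m - i) \<otimes>\<^bsub>H\<^esub> z [^]\<^bsub>H\<^esub> i"

text \<open>In the expansion of the comultiplication of x^(m-i) z^i, y is chosen s times from the
  first power and w is chosen r times from the second. The power of R arises from reordering z^s
  x^(i-r) in the second tensor factor.\<close>

definition monomial_term :: "(complex, 'h, 'x) module_scheme \<Rightarrow> complex \<Rightarrow> 'h \<Rightarrow> 'h \<Rightarrow> 'h \<Rightarrow> 'h \<Rightarrow> nat \<Rightarrow> nat \<Rightarrow> nat \<times> nat \<Rightarrow> 'h" where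
  "monomial_term H R x y z w m i = (\<lambda>(s, r).
     (qbinom (R\<^sup>2) (m - i) s * qbinom (R\<^sup>2) i r * R ^ (s * (i - r))) \<odot>\<^bsub>H\<^esub>
       ((x [^]\<^bsub>H\<^esub> (m - i - s) \<otimes>\<^bsub>H\<^esub> y [^]\<^bsub>H\<^esub> s) \<otimes>\<^bsub>H\<^esub> (z [^]\<^bsub>H\<^esub> (i - r) \<otimes>\<^bsub>H\<^esub> w [^]\<^bsub>H\<^esub> r)))"

definition monomial_matrix :: "(complex, 'h, 'x) module_scheme \<Rightarrow> complex \<Rightarrow> 'h \<Rightarrow> 'h \<Rightarrow> 'h \<Rightarrow> 'h \<Rightarrow> nat \<Rightarrow> nat \<Rightarrow> nat \<Rightarrow> 'h" where
  "monomial_matrix H R x y z w m i j =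
     finsum H (monomial_term H R x y z w m i) {p \<in> {..m - i} \<times> {..i}. fst p + snd p = j}"

lemma monomial_matrix_closed:
  assumes "calgebra H" "x \<in> carrier H" "y \<in> carrier H" "z \<in> carrier H" "w \<in> carrier H"
  shows "monomial_term H R x y z w m i p \<in> carrier H" "monomial_matrix H R x y z w m i j \<in> carrier H"
    "monomial H x z m i \<in> carrier H"
  using assms alg_vspace[OF assms(1)] unfolding monomial_matrix_def monomial_def
  by (auto simp: monomial_term_def split_beta alg_closed[OF assms(1)] intro!: vs_finsum_closed)

text \<open>Each of the two powers is expanded by the binomial theorem, and the double sum is
  grouped by s + r, which is the exponent of z in the second tensor factor.\<close>

lemma comult_monomial:
  fixes H :: "'h bialgebra"
  assumes H: "prebialgebra H" and c: "x \<in> carrier H" "y \<in> carrier H" "z \<in> carrier H" "w \<in> carrier H"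
    and yx: "y \<otimes>\<^bsub>H\<^esub> x = R \<odot>\<^bsub>H\<^esub> (x \<otimes>\<^bsub>H\<^esub> y)" and zx: "z \<otimes>\<^bsub>H\<^esub> x = R \<odot>\<^bsub>H\<^esub> (x \<otimes>\<^bsub>H\<^esub> z)"
    and wz: "w \<otimes>\<^bsub>H\<^esub> z = R \<odot>\<^bsub>H\<^esub> (z \<otimes>\<^bsub>H\<^esub> w)"
    and \<Delta>x: "comult H x = pure H H x x \<oplus>\<^bsub>tensor H H\<^esub> pure H H y z"
    and \<Delta>z: "comult H z = pure H H z x \<oplus>\<^bsub>tensor H H\<^esub> pure H H w z" and i: "i \<le> m"
  shows "comult H (monomial H x z m i)
    = (\<Oplus>\<^bsub>tensor H H\<^esub>j\<in>{..m}. pure H H (monomial_matrix H R x y z w m i j) (monomial H x z m j))"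
proof -
  note D = prebialgebraD[OF H]
  note A = D(1) and V = D(2) and VT = D(7)
  note AT = calgebra_tensor[OF A A]
  note closed = alg_closed[OF A] c vs_closed(2)[OF V] vs_closed(2)[OF VT] vs_closed(3)[OF V] vs_closed(3)[OF VT] pure_closed[OF V V]
  let ?T = "tensor H H" and ?P = "pure H H" and ?p = "R\<^sup>2"
  \<comment> \<open>Both tensor factors contribute R, hence the binomial parameter R^2.\<close>
  have twist: "?P u v \<otimes>\<^bsub>?T\<^esub> ?P s t = ?p \<odot>\<^bsub>?T\<^esub> (?P s t \<otimes>\<^bsub>?T\<^esub> ?P u v)"
    if "u \<otimes>\<^bsub>H\<^esub> s = R \<odot>\<^bsub>H\<^esub> (s \<otimes>\<^bsub>H\<^esub> u)" "v \<otimes>\<^bsub>H\<^esub> t = R \<odot>\<^bsub>H\<^esub> (t \<otimes>\<^bsub>H\<^esub> v)"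
      "u \<in> carrier H" "v \<in> carrier H" "s \<in> carrier H" "t \<in> carrier H" for u v s t
    using that by (simp add: tensor_mult_pure[OF A A] pure_smult_left[OF V V] pure_smult_right[OF V V] closed
        vs_smult_smult[OF VT] power2_eq_square)
  define F where "F s = qbinom ?p (m - i) s \<odot>\<^bsub>?T\<^esub> ?P (x [^]\<^bsub>H\<^esub> (m - i - s) \<otimes>\<^bsub>H\<^esub> y [^]\<^bsub>H\<^esub> s) (x [^]\<^bsub>H\<^esub> (m - i - s) \<otimes>\<^bsub>H\<^esub> z [^]\<^bsub>H\<^esub> s)" for s
  define G where "G r = qbinom ?p i r \<odot>\<^bsub>?T\<^esub> ?P (z [^]\<^bsub>H\<^esub> (i - r) \<otimes>\<^bsub>H\<^esub> w [^]\<^bsub>H\<^esub> r) (x [^]\<^bsub>H\<^esub> (i - r) \<otimes>\<^bsub>H\<^esub> z [^]\<^bsub>H\<^esub> r)" for r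
  have Fc: "F s \<in> carrier ?T" and Gc: "G s \<in> carrier ?T" for s by (simp_all add: F_def G_def closed)
  have F: "comult H (x [^]\<^bsub>H\<^esub> (m - i)) = (\<Oplus>\<^bsub>?T\<^esub>s\<in>{..m - i}. F s)"
    unfolding algebra_hom_pow[OF D(3) A AT c(1)] \<Delta>x
      qbinomial_theorem[OF AT pure_closed[OF V V c(1,1)] pure_closed[OF V V c(2,3)] twist[OF yx zx c(2,3,1,1)]]
    by (rule vs_finsum_cong[OF VT refl]) (simp_all add: tensor_pow_pure[OF A A] tensor_mult_pure[OF A A] F_def closed)
  have G: "comult H (z [^]\<^bsub>H\<^esub> i) = (\<Oplus>\<^bsub>?T\<^esub>r\<in>{..i}. G r)"
    unfolding algebra_hom_pow[OF D(3) A AT c(3)] \<Delta>z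
      qbinomial_theorem[OF AT pure_closed[OF V V c(3,1)] pure_closed[OF V V c(4,3)] twist[OF wz zx c(4,3,3,1)]]
    by (rule vs_finsum_cong[OF VT refl]) (simp_all add: tensor_pow_pure[OF A A] tensor_mult_pure[OF A A] G_def closed)
  note tc = monomial_matrix_closed[OF A c]
  let ?t = "monomial_term H R x y z w m i" and ?e = "monomial H x z m"
  have "comult H (?e i) = (\<Oplus>\<^bsub>?T\<^esub>s\<in>{..m - i}. \<Oplus>\<^bsub>?T\<^esub>r\<in>{..i}. F s \<otimes>\<^bsub>?T\<^esub> G r)"
    unfolding monomial_def algebra_homD(3)[OF D(3) alg_closed(3)[OF A c(1)] alg_closed(3)[OF A c(3)]] F G
    by (rule bilin_finsum[OF alg_bilin[OF AT] VT VT VT]) (simp_all add: Fc Gc)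
  also have "\<dots> = finsum ?T (\<lambda>(s, r). F s \<otimes>\<^bsub>?T\<^esub> G r) ({..m - i} \<times> {..i})"
    by (rule vs_finsum_Times[OF VT]) (simp_all add: Fc Gc alg_closed[OF AT])
  also have "\<dots> = finsum ?T (\<lambda>p. ?P (?t p) (?e (fst p + snd p))) ({..m - i} \<times> {..i})"
  proof (rule vs_finsum_cong[OF VT refl])
    fix p assume "p \<in> {..m - i} \<times> {..i}"
    then obtain s r where p: "p = (s, r)" and s: "s \<le> m - i" and r: "r \<le> i" by auto
    \<comment> \<open>The remaining powers of x join up only because s \<le> m - i and r \<le> i, so
      that no subtraction is truncated.\<close>
    have e: "m - (s + r) = (m - i - s) + (i - r)" using s r i by simp
    have "(x [^]\<^bsub>H\<^esub> (m - i - s) \<otimes>\<^bsub>H\<^esub> z [^]\<^bsub>H\<^esub> s) \<otimes>\<^bsub>H\<^esub> (x [^]\<^bsub>H\<^esub> (i - r) \<otimes>\<^bsub>H\<^esub> z [^]\<^bsub>H\<^esub> r)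
      = x [^]\<^bsub>H\<^esub> (m - i - s) \<otimes>\<^bsub>H\<^esub> ((z [^]\<^bsub>H\<^esub> s \<otimes>\<^bsub>H\<^esub> x [^]\<^bsub>H\<^esub> (i - r)) \<otimes>\<^bsub>H\<^esub> z [^]\<^bsub>H\<^esub> r)"
      by (simp add: alg_assoc[OF A] closed)
    also have "\<dots> = R ^ (s * (i - r)) \<odot>\<^bsub>H\<^esub> ?e (s + r)"
      unfolding skew_pow[OF A c(1,3) zx] monomial_def e alg_pow_add[OF A c(1)] alg_pow_add[OF A c(3)]
      by (simp add: alg_assoc[OF A] alg_smult[OF A] closed)
    finally have *: "(x [^]\<^bsub>H\<^esub> (m - i - s) \<otimes>\<^bsub>H\<^esub> z [^]\<^bsub>H\<^esub> s) \<otimes>\<^bsub>H\<^esub> (x [^]\<^bsub>H\<^esub> (i - r) \<otimes>\<^bsub>H\<^esub> z [^]\<^bsub>H\<^esub> r) = R ^ (s * (i - r)) \<odot>\<^bsub>H\<^esub> ?e (s + r)" .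
    show "(case p of (s, r) \<Rightarrow> F s \<otimes>\<^bsub>?T\<^esub> G r) = ?P (?t p) (?e (fst p + snd p))"
      unfolding p prod.case fst_conv snd_conv F_def G_def monomial_term_def
      by (simp add: alg_smult[OF AT] tensor_mult_pure[OF A A] * pure_smult_left[OF V V] pure_smult_right[OF V V] closed tc(3)
          vs_smult_smult[OF VT] ac_simps del: diff_diff_left)
    show "?P (?t p) (?e (fst p + snd p)) \<in> carrier ?T" by (simp add: closed tc)
  qed
  also have "\<dots> = (\<Oplus>\<^bsub>?T\<^esub>j\<in>{..m}. finsum ?T (\<lambda>p. ?P (?t p) (?e (fst p + snd p))) {p \<in> {..m - i} \<times> {..i}. fst p + snd p = j})"
    by (rule vs_finsum_regroup[OF VT]) (use i in \<open>auto simp: closed tc\<close>)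
  also have "\<dots> = (\<Oplus>\<^bsub>?T\<^esub>j\<in>{..m}. ?P (monomial_matrix H R x y z w m i j) (?e j))"
  proof (rule vs_finsum_cong[OF VT refl])
    fix j
    let ?S = "{p \<in> {..m - i} \<times> {..i}. fst p + snd p = j}"
    have fin: "finite ?S" by (rule finite_subset[of _ "{..m - i} \<times> {..i}"]) auto
    have "?P (monomial_matrix H R x y z w m i j) (?e j) = finsum ?T (\<lambda>p. ?P (?t p) (?e j)) ?S"
      unfolding monomial_matrix_def by (rule lin_finsum[OF pure_lin_left[OF V V tc(3)] V VT fin tc(1)])
    also have "\<dots> = finsum ?T (\<lambda>p. ?P (?t p) (?e (fst p + snd p))) ?S"
      by (rule vs_finsum_cong[OF VT refl]) (simp_all add: closed tc)
    finally show "finsum ?T (\<lambda>p. ?P (?t p) (?e (fst p + snd p))) ?S = ?P (monomial_matrix H R x y z w m i j) (?e j)" by (rule sym)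
    show "?P (monomial_matrix H R x y z w m i j) (?e j) \<in> carrier ?T" by (simp add: closed tc)
  qed
  finally show ?thesis .
qed

section \<open>Comodules spanned by monomials\<close>

lemma same_regular_comodule: "same_module H (regular_comodule H)"
  by (simp add: same_module_def regular_comodule_def module.defs comodule.defs)

lemma same_lin_span:
  assumes same: "same_module U U'" and U: "vspace U"
  shows "lin_span U' = lin_span U"
proof -
  note U' = same_vspace[OF same U] and s = same_simps[OF same]
  have "submodule N CC U' \<longleftrightarrow> submodule N CC U" for N
  proof
    assume N: "submodule N CC U"
    note D = submoduleD_vs[OF N U]
    show "submodule N CC U'"
      by (rule submoduleI_vs[OF U']; unfold s; (rule D; assumption?)?)
  next
    assume N: "submodule N CC U'"
    note D = submoduleD_vs[OF N U', unfolded s]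
    show "submodule N CC U"
      by (rule submoduleI_vs[OF U]; (rule D; assumption?)?)
  qed
  then have "{N. submodule N CC U' \<and> S \<subseteq> N} = {N. submodule N CC U \<and> S \<subseteq> N}" for S by blast
  then show ?thesis unfolding lin_span_def[abs_def] by simp
qed

section \<open>Monomials separated by their degrees, and comparison of matrix entries\<close>

context
  fixes q :: complex and e :: "nat \<Rightarrow> (gen list \<Rightarrow>\<^sub>0 complex) set" and D :: "nat \<Rightarrow> nat" and m :: nat
  assumes q: "q \<noteq> 0" and deg: "\<And>k. k \<le> m \<Longrightarrow> shift_degree q GC (D k) (e k)" and D: "inj_on D {..m}"
begin

text \<open>The coefficient functional in the representation where c shifts, normalized at
  \<open>e k\<close>. Distinct degrees make these functionals dual to the monomials.\<close>

definition monomial_functional :: "nat \<Rightarrow> (gen list \<Rightarrow>\<^sub>0 complex) set \<Rightarrow> complex" where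
  "monomial_functional k x = inverse (coeff_functional q GC (D k) (e k)) * coeff_functional q GC (D k) x"

lemma monomial_functional:
  "monomial_functional k \<in> linear_maps (slq2 q) CC"
  "i \<le> m \<Longrightarrow> j \<le> m \<Longrightarrow> monomial_functional i (e j) = (if i = j then 1 else 0)"
proof -
  have "(\<lambda>x. inverse (coeff_functional q GC (D k) (e k)) \<odot>\<^bsub>CC\<^esub> coeff_functional q GC (D k) x) \<in> linear_maps (slq2 q) CC"
    by (rule lin_smult_fun[OF coeff_functional_linear[OF q] vspace_CC]) simp
  then show "monomial_functional k \<in> linear_maps (slq2 q) CC" by (simp add: monomial_functional_def[abs_def])
  assume ij: "i \<le> m" "j \<le> m"
  have "D i = D j \<longleftrightarrow> i = j" using inj_onD[OF D, of i j] ij by auto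
  then show "monomial_functional i (e j) = (if i = j then 1 else 0)"
    using shift_degree_coeff[OF q _ deg[OF ij(2)]] by (auto simp: monomial_functional_def)
qed

lemma has_matrix_monomials:
  assumes T: "\<And>i j. i \<le> m \<Longrightarrow> j \<le> m \<Longrightarrow> T i j \<in> carrier (slq2 q)"
    and \<Delta>: "\<And>i. i \<le> m \<Longrightarrow> comult (slq2 q) (e i) = (\<Oplus>\<^bsub>tensor (slq2 q) (slq2 q)\<^esub>j\<in>{..m}. pure (slq2 q) (slq2 q) (T i j) (e j))"
  shows "has_matrix (slq2 q) (restrict_comodule (slq2 q) (regular_comodule (slq2 q)) (lin_span (slq2 q) (e ` {..m}))) {..m} e T"
proof -
  let ?H = "slq2 q" and ?X = "regular_comodule (slq2 q)"
  note H = prebialgebra_slq2[OF q]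
  note B = prebialgebraD[OF H]
  note same = same_regular_comodule[of ?H]
  have e: "e i \<in> carrier ?H" if "i \<in> {..m}" for i
    using deg[of i] that q by (simp add: shift_degree_def)
  have co: "coact ?X = comult ?H" by (simp add: regular_comodule_def module.defs comodule.defs)
  have cm: "comatrix ?H {..m} T"
    by (rule comatrix_coslice[OF H finite_atMost e monomial_functional(1) monomial_functional(2) T \<Delta> slq2_coassoc[OF q] slq2_counit_coslice[OF q]])
      auto
  show ?thesis
    unfolding same_lin_span[OF same B(2), symmetric]
  proof (rule has_matrix_restrict(1)[OF B(2) same_vspace[OF same B(2)] _ finite_atMost _ _ _ cm])
    show "coact ?X \<in> linear_maps ?X (tensor ?H ?X)"
      using B(5) by (simp add: co same_linear_maps[OF same] same_tensor[OF same])
    show "e i \<in> carrier ?X" if "i \<in> {..m}" for i using e[OF that] by (simp add: same_simps[OF same])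
    show "monomial_functional i \<in> linear_maps ?X CC" for i using monomial_functional(1) by (simp add: same_linear_maps[OF same])
    show "monomial_functional i (e j) = (if i = j then 1 else 0)" if "i \<in> {..m}" "j \<in> {..m}" for i j
      using monomial_functional(2) that by simp
    show "coact ?X (e i) = (\<Oplus>\<^bsub>tensor ?H ?X\<^esub>j\<in>{..m}. pure ?H ?X (T i j) (e j))" if "i \<in> {..m}" for i
      using \<Delta>[of i] that by (simp add: co same_tensor[OF same])
  qed
qed

text \<open>The dual functional applied to the second tensor factor reads off a matrix entry from
  any expansion of the comultiplication, including one in which several summands carry the same
  basis vector.\<close>

lemma matrix_entry:
  assumes i: "i \<le> m" and j: "j \<le> m"
    and T: "\<And>k. k \<le> m \<Longrightarrow> t k \<in> carrier (slq2 q)"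
    and \<Delta>: "comult (slq2 q) (e i) = (\<Oplus>\<^bsub>tensor (slq2 q) (slq2 q)\<^esub>j\<in>{..m}. pure (slq2 q) (slq2 q) (t j) (e j))"
    and P: "finite P" "\<And>p. p \<in> P \<Longrightarrow> F p \<in> carrier (slq2 q)" "\<And>p. p \<in> P \<Longrightarrow> h p \<le> m"
    and \<Delta>': "comult (slq2 q) (e i) = (\<Oplus>\<^bsub>tensor (slq2 q) (slq2 q)\<^esub>p\<in>P. pure (slq2 q) (slq2 q) (F p) (e (h p)))"
  shows "t j = (\<Oplus>\<^bsub>slq2 q\<^esub>p\<in>P. (if h p = j then 1 else 0) \<odot>\<^bsub>slq2 q\<^esub> F p)"
proof -
  let ?H = "slq2 q"
  note B = prebialgebraD[OF prebialgebra_slq2[OF q]]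
  note V = B(2)
  have e: "e i \<in> carrier ?H" if "i \<le> m" for i
    using deg[of i] that q by (simp add: shift_degree_def)
  note L = slice_right_linear[OF V V monomial_functional(1)[of j]]
  have "t j = slice_right ?H (monomial_functional j) (comult ?H (e i))"
    unfolding \<Delta> by (rule slice_right_sum[OF finite_atMost _ monomial_functional(1) _ V V, symmetric])
      (use e T j monomial_functional(2) in auto)
  also have "\<dots> = (\<Oplus>\<^bsub>?H\<^esub>p\<in>P. slice_right ?H (monomial_functional j) (pure ?H ?H (F p) (e (h p))))"
    unfolding \<Delta>' by (rule lin_finsum[OF L B(7) V P(1)]) (use P e in simp)
  also have "\<dots> = (\<Oplus>\<^bsub>?H\<^esub>p\<in>P. (if h p = j then 1 else 0) \<odot>\<^bsub>?H\<^esub> F p)"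
  proof (rule vs_finsum_cong[OF V refl])
    fix p assume p: "p \<in> P"
    have "slice_right ?H (monomial_functional j) (pure ?H ?H (F p) (e (h p))) = monomial_functional j (e (h p)) \<odot>\<^bsub>?H\<^esub> F p"
      by (rule slice_right_pure[OF V V monomial_functional(1)]) (use P p e in auto)
    then show "slice_right ?H (monomial_functional j) (pure ?H ?H (F p) (e (h p))) = (if h p = j then 1 else 0) \<odot>\<^bsub>?H\<^esub> F p"
      using monomial_functional(2)[OF j P(3)[OF p]] by (simp add: eq_commute)
    show "(if h p = j then 1 else 0) \<odot>\<^bsub>?H\<^esub> F p \<in> carrier ?H" using P p by simp
  qed
  finally show ?thesis .
qed

lemma matrix_entry_unique:
  assumes "i \<le> m" "j \<le> m" "\<And>k. k \<le> m \<Longrightarrow> t k \<in> carrier (slq2 q)"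
    "comult (slq2 q) (e i) = (\<Oplus>\<^bsub>tensor (slq2 q) (slq2 q)\<^esub>j\<in>{..m}. pure (slq2 q) (slq2 q) (t j) (e j))"
    "finite P" "\<And>p. p \<in> P \<Longrightarrow> F p \<in> carrier (slq2 q)" "\<And>p. p \<in> P \<Longrightarrow> h p \<le> m"
    "comult (slq2 q) (e i) = (\<Oplus>\<^bsub>tensor (slq2 q) (slq2 q)\<^esub>p\<in>P. pure (slq2 q) (slq2 q) (F p) (e (h p)))"
  shows "(\<And>p. p \<in> P \<Longrightarrow> h p \<noteq> j) \<Longrightarrow> t j = \<zero>\<^bsub>slq2 q\<^esub>"
    and "p0 \<in> P \<Longrightarrow> h p0 = j \<Longrightarrow> (\<And>p. p \<in> P \<Longrightarrow> h p = j \<Longrightarrow> p = p0) \<Longrightarrow> t j = F p0"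
proof -
  note V = slq2_vspace[of q]
  have *: "t j = (\<Oplus>\<^bsub>slq2 q\<^esub>p\<in>P. (if h p = j then 1 else 0) \<odot>\<^bsub>slq2 q\<^esub> F p)"
    by (rule matrix_entry[where t = t and i = i and P = P and F = F and h = h, OF assms])
  show "t j = \<zero>\<^bsub>slq2 q\<^esub>" if "\<And>p. p \<in> P \<Longrightarrow> h p \<noteq> j"
    unfolding * by (rule vs_finsum_zero[OF V]) (simp add: that vs_zero(3)[OF V] assms(6))
  assume p0: "p0 \<in> P" "h p0 = j" "\<And>p. p \<in> P \<Longrightarrow> h p = j \<Longrightarrow> p = p0"
  have "t j = (\<Oplus>\<^bsub>slq2 q\<^esub>p\<in>P. (if p = p0 then 1 else 0) \<odot>\<^bsub>slq2 q\<^esub> F p)"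
    unfolding *
  proof (rule vs_finsum_cong[OF V refl])
    fix p assume p: "p \<in> P"
    have "h p = j \<longleftrightarrow> p = p0" using p0(2,3) p by blast
    then show "(if h p = j then 1 else 0) \<odot>\<^bsub>slq2 q\<^esub> F p = (if p = p0 then 1 else 0) \<odot>\<^bsub>slq2 q\<^esub> F p" by simp
    show "(if p = p0 then 1 else 0) \<odot>\<^bsub>slq2 q\<^esub> F p \<in> carrier (slq2 q)" using vs_closed(3)[OF V assms(6)[OF p]] .
  qed
  also have "\<dots> = F p0" by (rule finsum_delta_smult[OF V assms(5) p0(1) assms(6)])
  finally show "t j = F p0" .
qed

end

section \<open>The matrices of $Y_m$ and $W_n$\<close>

definition "Y_basis q = monomial (slq2 q) (slq2_a q) (slq2_c q)"
definition "Y_matrix q = monomial_matrix (slq2 q) (inverse q) (slq2_a q) (slq2_b q) (slq2_c q) (slq2_d q)"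
definition "W_basis q l = monomial (slq2 q) (slq2_a q [^]\<^bsub>slq2 q\<^esub> (l :: nat)) (slq2_c q [^]\<^bsub>slq2 q\<^esub> l)"
definition "W_matrix q l = monomial_matrix (slq2 q) 1 (slq2_a q [^]\<^bsub>slq2 q\<^esub> (l :: nat)) (slq2_b q [^]\<^bsub>slq2 q\<^esub> l)
  (slq2_c q [^]\<^bsub>slq2 q\<^esub> l) (slq2_d q [^]\<^bsub>slq2 q\<^esub> l)"

lemma matrix_closed [simp]:
  "Y_basis q m i \<in> carrier (slq2 q)" "Y_matrix q m i j \<in> carrier (slq2 q)"
  "W_basis q l m i \<in> carrier (slq2 q)" "W_matrix q l m i j \<in> carrier (slq2 q)"
  unfolding Y_basis_def Y_matrix_def W_basis_def W_matrix_def
  by (simp_all add: monomial_matrix_closed(2)[OF calgebra_slq2] monomial_def alg_closed[OF calgebra_slq2])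

lemma monomial_comodule_eq:
  "monomial_comodule q x z m = restrict_comodule (slq2 q) (regular_comodule (slq2 q)) (lin_span (slq2 q) (monomial (slq2 q) x z m ` {..m}))"
proof -
  have "{(x [^]\<^bsub>slq2 q\<^esub> (m - k)) \<otimes>\<^bsub>slq2 q\<^esub> (z [^]\<^bsub>slq2 q\<^esub> k) | k. k \<le> m} = monomial (slq2 q) x z m ` {..m}"
    by (simp only: monomial_def image_def atMost_iff Bex_def) (rule Collect_cong, blast)
  then show ?thesis by (simp only: monomial_comodule_def)
qed

text \<open>All middle binomials vanish at a primitive root of unity, so only the two extreme terms
  survive.\<close>

lemma root_of_unity_power:
  assumes B: "calgebra B" and x: "x \<in> carrier B" "y \<in> carrier B" and yx: "y \<otimes>\<^bsub>B\<^esub> x = p \<odot>\<^bsub>B\<^esub> (x \<otimes>\<^bsub>B\<^esub> y)"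
    and p: "0 < l" "p ^ l = 1" "\<And>i. 0 < i \<Longrightarrow> i < l \<Longrightarrow> p ^ i \<noteq> 1"
  shows "(x \<oplus>\<^bsub>B\<^esub> y) [^]\<^bsub>B\<^esub> l = x [^]\<^bsub>B\<^esub> l \<oplus>\<^bsub>B\<^esub> y [^]\<^bsub>B\<^esub> l"
proof -
  note V = alg_vspace[OF B]
  have "(x \<oplus>\<^bsub>B\<^esub> y) [^]\<^bsub>B\<^esub> l = (\<Oplus>\<^bsub>B\<^esub>s\<in>{..l}. qbinom p l s \<odot>\<^bsub>B\<^esub> (x [^]\<^bsub>B\<^esub> (l - s) \<otimes>\<^bsub>B\<^esub> y [^]\<^bsub>B\<^esub> s))"
    by (rule qbinomial_theorem[OF B x yx])
  also have "\<dots> = (\<Oplus>\<^bsub>B\<^esub>s\<in>{0, l}. qbinom p l s \<odot>\<^bsub>B\<^esub> (x [^]\<^bsub>B\<^esub> (l - s) \<otimes>\<^bsub>B\<^esub> y [^]\<^bsub>B\<^esub> s))"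
  proof (rule vs_finsum_neutral[OF V])
    fix s assume "s \<in> {..l}" "s \<notin> {0, l}"
    then have "qbinom p l s = 0" by (intro qbinom_root_of_unity p) auto
    then show "qbinom p l s \<odot>\<^bsub>B\<^esub> (x [^]\<^bsub>B\<^esub> (l - s) \<otimes>\<^bsub>B\<^esub> y [^]\<^bsub>B\<^esub> s) = \<zero>\<^bsub>B\<^esub>"
      by (simp add: vs_zero(3)[OF V] alg_closed[OF B] x)
  qed (use p in \<open>simp_all add: V alg_closed[OF B] x\<close>)
  also have "\<dots> = x [^]\<^bsub>B\<^esub> l \<oplus>\<^bsub>B\<^esub> y [^]\<^bsub>B\<^esub> l"
    using p by (simp add: V alg_closed[OF B] x vs_zero(5)[OF V] alg_one[OF B] alg_pow(1)[OF B])
  finally show ?thesis .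
qed

context
  fixes q :: complex
  assumes q: "q \<noteq> 0"
begin

lemma slq2_skew:
  "slq2_b q \<otimes>\<^bsub>slq2 q\<^esub> slq2_a q = inverse q \<odot>\<^bsub>slq2 q\<^esub> (slq2_a q \<otimes>\<^bsub>slq2 q\<^esub> slq2_b q)"
  "slq2_c q \<otimes>\<^bsub>slq2 q\<^esub> slq2_a q = inverse q \<odot>\<^bsub>slq2 q\<^esub> (slq2_a q \<otimes>\<^bsub>slq2 q\<^esub> slq2_c q)"
  "slq2_d q \<otimes>\<^bsub>slq2 q\<^esub> slq2_c q = inverse q \<odot>\<^bsub>slq2 q\<^esub> (slq2_c q \<otimes>\<^bsub>slq2 q\<^esub> slq2_d q)"
  using slq2_relations[of q] q alg_closed(1)[OF calgebra_slq2[of q]]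
  by (simp_all add: slq2_relations_def vs_smult_smult[OF slq2_vspace] vs_zero(5)[OF slq2_vspace])

lemma slq2_comult_row:
  "comult (slq2 q) (slq2_a q) = pure (slq2 q) (slq2 q) (slq2_a q) (slq2_a q) \<oplus>\<^bsub>tensor (slq2 q) (slq2 q)\<^esub> pure (slq2 q) (slq2 q) (slq2_b q) (slq2_c q)"
  "comult (slq2 q) (slq2_c q) = pure (slq2 q) (slq2 q) (slq2_c q) (slq2_a q) \<oplus>\<^bsub>tensor (slq2 q) (slq2 q)\<^esub> pure (slq2 q) (slq2 q) (slq2_d q) (slq2_c q)"
  by (simp_all only: slq2_comult(2)[OF q] slq2_comult_gen_eq gen.case)

lemma comult_Y_basis:
  "i \<le> m \<Longrightarrow> comult (slq2 q) (Y_basis q m i)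
    = (\<Oplus>\<^bsub>tensor (slq2 q) (slq2 q)\<^esub>j\<in>{..m}. pure (slq2 q) (slq2 q) (Y_matrix q m i j) (Y_basis q m j))"
  unfolding Y_basis_def Y_matrix_def
  by (rule comult_monomial[OF prebialgebra_slq2[OF q] slq2_gen_closed' slq2_gen_closed' slq2_gen_closed' slq2_gen_closed'
        slq2_skew slq2_comult_row])

lemma Y_basis_degree: "k \<le> m \<Longrightarrow> shift_degree q GC k (Y_basis q m k)"
proof -
  note s = disjI2[OF refl[of GC], of "GC = GB"]
  have "shift_degree q GC ((m - k) * 0 + k * 1) (Y_basis q m k)"
    unfolding Y_basis_def monomial_def by (intro shift_degree_mult[OF q s] shift_degree_pow[OF q s] shift_degree_gen[OF q s])
  then show ?thesis by simp
qed

lemma has_matrix_Y: "has_matrix (slq2 q) (comod_Y q m) {..m} (Y_basis q m) (Y_matrix q m)"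
  unfolding comod_Y_def monomial_comodule_eq Y_basis_def[symmetric]
  by (rule has_matrix_monomials[OF q, where D = "\<lambda>k. k"]) (simp_all add: Y_basis_degree comult_Y_basis)

end

context
  fixes q :: complex and l :: nat
  assumes q: "q \<noteq> 0" and l: "0 < l" and ql: "q ^ l = 1" and prim: "\<And>i. 0 < i \<Longrightarrow> i < l \<Longrightarrow> ((inverse q)\<^sup>2) ^ i \<noteq> 1"
begin

lemma inverse_q_power: "inverse q ^ (l * n) = 1"
  by (simp add: power_mult power_inverse ql)

text \<open>The two terms of the comultiplication commute up to q^(-2), a primitive l-th root of
  unity, so the l-th power is additive on them.\<close>

lemma slq2_power_comult:
  assumes g: "\<And>g. g \<in> {x, y, z, w} \<Longrightarrow> g \<in> carrier (slq2 q)"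
    and \<Delta>: "comult (slq2 q) x = pure (slq2 q) (slq2 q) y z \<oplus>\<^bsub>tensor (slq2 q) (slq2 q)\<^esub> pure (slq2 q) (slq2 q) w v"
    and v: "v \<in> carrier (slq2 q)"
    and wy: "w \<otimes>\<^bsub>slq2 q\<^esub> y = inverse q \<odot>\<^bsub>slq2 q\<^esub> (y \<otimes>\<^bsub>slq2 q\<^esub> w)"
    and vz: "v \<otimes>\<^bsub>slq2 q\<^esub> z = inverse q \<odot>\<^bsub>slq2 q\<^esub> (z \<otimes>\<^bsub>slq2 q\<^esub> v)"
  shows "comult (slq2 q) (x [^]\<^bsub>slq2 q\<^esub> l) = pure (slq2 q) (slq2 q) (y [^]\<^bsub>slq2 q\<^esub> l) (z [^]\<^bsub>slq2 q\<^esub> l)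
    \<oplus>\<^bsub>tensor (slq2 q) (slq2 q)\<^esub> pure (slq2 q) (slq2 q) (w [^]\<^bsub>slq2 q\<^esub> l) (v [^]\<^bsub>slq2 q\<^esub> l)"
proof -
  let ?H = "slq2 q" let ?T = "tensor ?H ?H" and ?P = "pure ?H ?H"
  note D = prebialgebraD[OF prebialgebra_slq2[OF q]]
  note A = D(1) and V = D(2) and VT = D(7)
  note AT = calgebra_tensor[OF A A]
  have c: "x \<in> carrier ?H" "y \<in> carrier ?H" "z \<in> carrier ?H" "w \<in> carrier ?H" using g by simp_all
  have "?P w v \<otimes>\<^bsub>?T\<^esub> ?P y z = ((inverse q)\<^sup>2) \<odot>\<^bsub>?T\<^esub> (?P y z \<otimes>\<^bsub>?T\<^esub> ?P w v)"
    using c v by (simp add: tensor_mult_pure[OF A A] wy vz pure_smult_left[OF V V] pure_smult_right[OF V V] alg_closed[OF A]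
        vs_closed[OF V] pure_closed[OF V V] vs_smult_smult[OF VT] power2_eq_square)
  moreover have "((inverse q)\<^sup>2) ^ l = 1"
    using inverse_q_power[of 2] by (simp add: power_mult mult.commute flip: power_mult)
  ultimately show ?thesis
    unfolding algebra_hom_pow[OF D(3) A AT c(1)] \<Delta> tensor_pow_pure[OF A A c(2,3), symmetric] tensor_pow_pure[OF A A c(4) v, symmetric]
    using c v by (intro root_of_unity_power[OF AT _ _ _ l _ prim]) (simp_all add: pure_closed[OF V V])
qed

text \<open>Reordering costs a power of q^(-1) whose exponent is a multiple of l, that is,
  nothing.\<close>

lemma skew_pow_root:
  assumes "x \<in> carrier (slq2 q)" "y \<in> carrier (slq2 q)" "y \<otimes>\<^bsub>slq2 q\<^esub> x = inverse q \<odot>\<^bsub>slq2 q\<^esub> (x \<otimes>\<^bsub>slq2 q\<^esub> y)"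
  shows "y [^]\<^bsub>slq2 q\<^esub> (l * m) \<otimes>\<^bsub>slq2 q\<^esub> x [^]\<^bsub>slq2 q\<^esub> (n :: nat) = x [^]\<^bsub>slq2 q\<^esub> n \<otimes>\<^bsub>slq2 q\<^esub> y [^]\<^bsub>slq2 q\<^esub> (l * m)"
  using skew_pow[OF calgebra_slq2 assms, of "l * m" n] inverse_q_power[of "m * n"] assms(1,2)
  by (simp add: mult.assoc vs_zero(5)[OF slq2_vspace] alg_closed[OF calgebra_slq2])

text \<open>Since l-th powers commute where the generators skew-commute, the general formula applies
  with R = 1 and ordinary binomials.\<close>

lemma comult_W_basis:
  assumes i: "i \<le> m"
  shows "comult (slq2 q) (W_basis q l m i)
    = (\<Oplus>\<^bsub>tensor (slq2 q) (slq2 q)\<^esub>j\<in>{..m}. pure (slq2 q) (slq2 q) (W_matrix q l m i j) (W_basis q l m j))"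
proof -
  note c = alg_closed(3)[OF calgebra_slq2 slq2_gen_closed']
  have skew: "y [^]\<^bsub>slq2 q\<^esub> l \<otimes>\<^bsub>slq2 q\<^esub> x [^]\<^bsub>slq2 q\<^esub> l = 1 \<odot>\<^bsub>slq2 q\<^esub> (x [^]\<^bsub>slq2 q\<^esub> l \<otimes>\<^bsub>slq2 q\<^esub> y [^]\<^bsub>slq2 q\<^esub> l)"
    if "x \<in> carrier (slq2 q)" "y \<in> carrier (slq2 q)" "y \<otimes>\<^bsub>slq2 q\<^esub> x = inverse q \<odot>\<^bsub>slq2 q\<^esub> (x \<otimes>\<^bsub>slq2 q\<^esub> y)" for x y
    using skew_pow_root[OF that, of 1 l] that(1,2) by (simp add: vs_zero(5)[OF slq2_vspace] alg_closed[OF calgebra_slq2])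
  show ?thesis
    unfolding W_basis_def W_matrix_def
    by (rule comult_monomial[OF prebialgebra_slq2[OF q] c c c c skew[OF slq2_gen_closed' slq2_gen_closed' slq2_skew(1)[OF q]]
          skew[OF slq2_gen_closed' slq2_gen_closed' slq2_skew(2)[OF q]] skew[OF slq2_gen_closed' slq2_gen_closed' slq2_skew(3)[OF q]]
          slq2_power_comult[OF _ slq2_comult_row(1)[OF q] slq2_gen_closed' slq2_skew(1,2)[OF q]]
          slq2_power_comult[OF _ slq2_comult_row(2)[OF q] slq2_gen_closed' slq2_skew(3,2)[OF q]] i])
      auto
qed

lemma W_basis_degree: "k \<le> n \<Longrightarrow> shift_degree q GC (l * k) (W_basis q l n k)"
proof -
  note s = disjI2[OF refl[of GC], of "GC = GB"]
  have "shift_degree q GC ((n - k) * (l * 0) + k * (l * 1)) (W_basis q l n k)"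
    unfolding W_basis_def monomial_def by (intro shift_degree_mult[OF q s] shift_degree_pow[OF q s] shift_degree_gen[OF q s])
  then show ?thesis by (simp add: mult.commute)
qed

lemma has_matrix_W: "has_matrix (slq2 q) (comod_W l q n) {..n} (W_basis q l n) (W_matrix q l n)"
  unfolding comod_W_def monomial_comodule_eq W_basis_def[symmetric]
  by (rule has_matrix_monomials[OF q, where D = "\<lambda>k. l * k"]) (use l in \<open>simp_all add: W_basis_degree comult_W_basis inj_on_def\<close>)

lemma W_basis_mult_Y_basis:
  assumes j: "j \<le> n" and k: "k \<le> r"
  shows "W_basis q l n j \<otimes>\<^bsub>slq2 q\<^esub> Y_basis q r k = Y_basis q (l * n + r) (l * j + k)"
proof -
  let ?H = "slq2 q" and ?a = "slq2_a q" and ?c = "slq2_c q"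
  note A = calgebra_slq2[of q]
  note closed = alg_closed[OF A] slq2_gen_closed'
  have e: "l * n + r - (l * j + k) = l * (n - j) + (r - k)"
    using mult_le_mono2[OF j, of l] k by (simp add: diff_mult_distrib2)
  have "W_basis q l n j \<otimes>\<^bsub>?H\<^esub> Y_basis q r k
    = ?a [^]\<^bsub>?H\<^esub> (l * (n - j)) \<otimes>\<^bsub>?H\<^esub> ((?c [^]\<^bsub>?H\<^esub> (l * j) \<otimes>\<^bsub>?H\<^esub> ?a [^]\<^bsub>?H\<^esub> (r - k)) \<otimes>\<^bsub>?H\<^esub> ?c [^]\<^bsub>?H\<^esub> k)"
    by (simp add: W_basis_def Y_basis_def monomial_def closed alg_assoc[OF A] alg_pow_pow[OF A])
  also have "\<dots> = Y_basis q (l * n + r) (l * j + k)"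
    unfolding skew_pow_root[OF slq2_gen_closed' slq2_gen_closed' slq2_skew(2)[OF q]] Y_basis_def monomial_def e
      alg_pow_add[OF A slq2_gen_closed']
    by (simp add: closed alg_assoc[OF A])
  finally show ?thesis .
qed

text \<open>Multiplicativity of the comultiplication gives a sum over pairs. Different pairs may
  yield the same index l j + k when r \<ge> l, so this is not yet an expansion with distinct basis
  vectors.\<close>

lemma comult_product:
  assumes j: "j \<le> n" and k: "k \<le> r"
  shows "comult (slq2 q) (Y_basis q (l * n + r) (l * j + k))
    = (\<Oplus>\<^bsub>tensor (slq2 q) (slq2 q)\<^esub>p\<in>{..n} \<times> {..r}. pure (slq2 q) (slq2 q) (W_matrix q l n j (fst p) \<otimes>\<^bsub>slq2 q\<^esub> Y_matrix q r k (snd p))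
        (Y_basis q (l * n + r) (l * fst p + snd p)))"
proof -
  let ?H = "slq2 q" let ?T = "tensor ?H ?H" and ?P = "pure ?H ?H"
  note D = prebialgebraD[OF prebialgebra_slq2[OF q]]
  note A = D(1) and V = D(2) and VT = D(7)
  note AT = calgebra_tensor[OF A A]
  note closed = alg_closed[OF A] pure_closed[OF V V] alg_closed[OF AT]
  have "comult ?H (Y_basis q (l * n + r) (l * j + k)) = (\<Oplus>\<^bsub>?T\<^esub>j'\<in>{..n}. ?P (W_matrix q l n j j') (W_basis q l n j'))
      \<otimes>\<^bsub>?T\<^esub> (\<Oplus>\<^bsub>?T\<^esub>k'\<in>{..r}. ?P (Y_matrix q r k k') (Y_basis q r k'))"
    unfolding W_basis_mult_Y_basis[OF j k, symmetric] algebra_homD(3)[OF D(3) matrix_closed(3,1)]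
      comult_W_basis[OF j] comult_Y_basis[OF q k] by (rule refl)
  also have "\<dots> = (\<Oplus>\<^bsub>?T\<^esub>j'\<in>{..n}. \<Oplus>\<^bsub>?T\<^esub>k'\<in>{..r}. ?P (W_matrix q l n j j') (W_basis q l n j') \<otimes>\<^bsub>?T\<^esub> ?P (Y_matrix q r k k') (Y_basis q r k'))"
    by (rule bilin_finsum[OF alg_bilin[OF AT] VT VT VT]) (simp_all add: closed)
  also have "\<dots> = finsum ?T (\<lambda>(j', k'). ?P (W_matrix q l n j j') (W_basis q l n j') \<otimes>\<^bsub>?T\<^esub> ?P (Y_matrix q r k k') (Y_basis q r k')) ({..n} \<times> {..r})"
    by (rule vs_finsum_Times[OF VT]) (simp_all add: closed)
  also have "\<dots> = (\<Oplus>\<^bsub>?T\<^esub>p\<in>{..n} \<times> {..r}. ?P (W_matrix q l n j (fst p) \<otimes>\<^bsub>?H\<^esub> Y_matrix q r k (snd p)) (Y_basis q (l * n + r) (l * fst p + snd p)))"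
    by (rule vs_finsum_cong[OF VT refl]) (simp_all add: split_beta tensor_mult_pure[OF A A] mem_Times_iff W_basis_mult_Y_basis closed)
  finally show ?thesis .
qed

text \<open>Comparison of the product expansion with the defining one: an index without a
  decomposition gives a zero entry, and an index with a single decomposition gives a product of
  entries.\<close>

lemma Y_matrix_block:
  assumes j: "j \<le> n" and k: "k \<le> r" and i: "i \<le> l * n + r"
  shows "(\<And>j' k'. j' \<le> n \<Longrightarrow> k' \<le> r \<Longrightarrow> l * j' + k' \<noteq> i) \<Longrightarrow> Y_matrix q (l * n + r) (l * j + k) i = \<zero>\<^bsub>slq2 q\<^esub>"
    and "j' \<le> n \<Longrightarrow> k' \<le> r \<Longrightarrow> l * j' + k' = i \<Longrightarrow> (\<And>j'' k''. j'' \<le> n \<Longrightarrow> k'' \<le> r \<Longrightarrow> l * j'' + k'' = i \<Longrightarrow> j'' = j' \<and> k'' = k') \<Longrightarrow>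
      Y_matrix q (l * n + r) (l * j + k) i = W_matrix q l n j j' \<otimes>\<^bsub>slq2 q\<^esub> Y_matrix q r k k'"
proof -
  have jk: "l * j + k \<le> l * n + r" if "j \<le> n" "k \<le> r" for j k using that by (simp add: add_mono)
  note * = matrix_entry_unique[where D = "\<lambda>k. k" and e = "Y_basis q (l * n + r)" and t = "Y_matrix q (l * n + r) (l * j + k)"
      and P = "{..n} \<times> {..r}" and h = "\<lambda>p. l * fst p + snd p" and F = "\<lambda>p. W_matrix q l n j (fst p) \<otimes>\<^bsub>slq2 q\<^esub> Y_matrix q r k (snd p)",
      OF q Y_basis_degree[OF q] inj_on_id2 jk[OF j k] i matrix_closed(2) comult_Y_basis[OF q jk[OF j k]] _ _ _ comult_product[OF j k]]
  show "Y_matrix q (l * n + r) (l * j + k) i = \<zero>\<^bsub>slq2 q\<^esub>" if "\<And>j' k'. j' \<le> n \<Longrightarrow> k' \<le> r \<Longrightarrow> l * j' + k' \<noteq> i"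
    by (rule *(1)) (simp_all add: that jk alg_closed[OF calgebra_slq2] mem_Times_iff)
  assume a: "j' \<le> n" "k' \<le> r" "l * j' + k' = i" "\<And>j'' k''. j'' \<le> n \<Longrightarrow> k'' \<le> r \<Longrightarrow> l * j'' + k'' = i \<Longrightarrow> j'' = j' \<and> k'' = k'"
  have u: "p = (j', k')" if "p \<in> {..n} \<times> {..r}" "l * fst p + snd p = i" for p
    using a(4)[of "fst p" "snd p"] that by (auto simp: prod_eq_iff)
  have "Y_matrix q (l * n + r) (l * j + k) i = W_matrix q l n j (fst (j', k')) \<otimes>\<^bsub>slq2 q\<^esub> Y_matrix q r k (snd (j', k'))"
    by (rule *(2)) (use a(1-3) jk u in \<open>simp_all add: alg_closed[OF calgebra_slq2] mem_Times_iff\<close>)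
  then show "Y_matrix q (l * n + r) (l * j + k) i = W_matrix q l n j j' \<otimes>\<^bsub>slq2 q\<^esub> Y_matrix q r k k'" by simp
qed

end

section \<open>Irreducibility\<close>

context
  fixes q :: complex and s :: gen
  assumes q: "q \<noteq> 0" and s: "s = GB \<or> s = GC"
begin

text \<open>The kernel of the shift representation, a two-sided ideal. Terms in it can be discarded
  when degrees are computed.\<close>

definition seq_null :: "(gen list \<Rightarrow>\<^sub>0 complex) set \<Rightarrow> bool" where
  "seq_null x \<longleftrightarrow> x \<in> carrier (slq2 q) \<and> seq_rep q s x = (\<lambda>f n. 0)"

lemma seq_null_gen: "g \<noteq> GA \<Longrightarrow> g \<noteq> GD \<Longrightarrow> g \<noteq> s \<Longrightarrow> seq_null (slq2_gen q g)"
  by (simp add: seq_null_def seq_rep(2)[OF q s] seq_op_def fun_eq_iff)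

lemma seq_null_mult:
  assumes "seq_null x" "y \<in> carrier (slq2 q)"
  shows "seq_null (x \<otimes>\<^bsub>slq2 q\<^esub> y)" "seq_null (y \<otimes>\<^bsub>slq2 q\<^esub> x)"
proof -
  note M = algebra_homD(3)[OF seq_rep(1)[OF q s]]
  have x: "x \<in> carrier (slq2 q)" "seq_rep q s x = (\<lambda>f n. 0)" using assms(1) by (simp_all add: seq_null_def)
  have "seq_rep q s y \<in> carrier op_algebra" by (rule lin_closed[OF algebra_homD(1)[OF seq_rep(1)[OF q s]] assms(2)])
  \<comment> \<open>Homogeneity with the scalar 0 shows that an operator maps the zero sequence to
    itself.\<close>
  then have "seq_rep q s y (\<lambda>n. 0 * f n) = (\<lambda>n. 0 * seq_rep q s y f n)" for f
    unfolding op_algebra_simps by blast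
  then have y: "seq_rep q s y (\<lambda>n. 0) = (\<lambda>n. 0)" by simp
  show "seq_null (x \<otimes>\<^bsub>slq2 q\<^esub> y)" "seq_null (y \<otimes>\<^bsub>slq2 q\<^esub> x)"
    using x assms(2) by (simp_all add: seq_null_def M alg_closed[OF calgebra_slq2] y comp_def)
qed

lemma seq_null_pow: "seq_null x \<Longrightarrow> 0 < n \<Longrightarrow> seq_null (x [^]\<^bsub>slq2 q\<^esub> (n :: nat))"
proof (induction n)
  case (Suc n)
  have "x \<in> carrier (slq2 q)" using Suc.prems by (simp add: seq_null_def)
  then show ?case
    unfolding alg_pow_Suc(2)[OF calgebra_slq2 \<open>x \<in> carrier (slq2 q)\<close>]
    by (intro seq_null_mult(1) Suc.prems(1) alg_closed(3)[OF calgebra_slq2])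
qed simp

lemma seq_null_smult: "seq_null x \<Longrightarrow> seq_null (z \<odot>\<^bsub>slq2 q\<^esub> x)"
  using lin_smult[OF algebra_homD(1)[OF seq_rep(1)[OF q s]], of x z] by (simp add: seq_null_def)

lemma seq_null_coeff: "seq_null x \<Longrightarrow> coeff_functional q s n x = 0"
  using coeff_functional_zero[OF q s] by (simp add: seq_null_def)

lemma seq_null_sum:
  assumes "finite P" "\<And>p. p \<in> P \<Longrightarrow> seq_null (F p)"
  shows "seq_null (finsum (slq2 q) F P)"
proof -
  note V = slq2_vspace[of q] and V' = alg_vspace[OF calgebra_op]
  have c: "F p \<in> carrier (slq2 q)" if "p \<in> P" for p using assms(2)[OF that] by (simp add: seq_null_def)
  have "seq_rep q s (finsum (slq2 q) F P) = finsum op_algebra (\<lambda>p. seq_rep q s (F p)) P"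
    by (rule lin_finsum[OF algebra_homD(1)[OF seq_rep(1)[OF q s]] V V' assms(1) c])
  also have "\<dots> = \<zero>\<^bsub>op_algebra\<^esub>" by (rule vs_finsum_zero[OF V']) (use assms(2) in \<open>simp add: seq_null_def\<close>)
  finally show ?thesis using vs_finsum_closed[OF V c] by (simp add: seq_null_def)
qed

lemma shift_degree_smult:
  assumes x: "shift_degree q s k x" and z: "z \<noteq> 0"
  shows "shift_degree q s k (z \<odot>\<^bsub>slq2 q\<^esub> x)"
proof -
  have c: "x \<in> carrier (slq2 q)" and "shift_op k (seq_rep q s x)" using x q by (simp_all add: shift_degree_def[OF q s])
  then have d: "\<exists>w. w \<noteq> 0 \<and> seq_rep q s x (delta_seq m) = (\<lambda>n. w * delta_seq (m + k) n)" for m by (simp add: shift_op_def)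
  have zx: "z \<odot>\<^bsub>slq2 q\<^esub> x \<in> carrier (slq2 q)" using c by simp
  have r: "seq_rep q s (z \<odot>\<^bsub>slq2 q\<^esub> x) = (\<lambda>f n. z * seq_rep q s x f n)"
    using lin_smult[OF algebra_homD(1)[OF seq_rep(1)[OF q s]] c] by simp
  have "\<exists>w. w \<noteq> 0 \<and> seq_rep q s (z \<odot>\<^bsub>slq2 q\<^esub> x) (delta_seq m) = (\<lambda>n. w * delta_seq (m + k) n)" for m
  proof -
    obtain w where w: "w \<noteq> 0" "seq_rep q s x (delta_seq m) = (\<lambda>n. w * delta_seq (m + k) n)" using d[of m] by blast
    show ?thesis unfolding r w(2) by (rule exI[of _ "z * w"]) (use w(1) z in \<open>simp add: mult.assoc\<close>)
  qed
  then show ?thesis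
    using zx lin_closed[OF algebra_homD(1)[OF seq_rep(1)[OF q s]] zx] by (simp only: shift_degree_def[OF q s] shift_op_def) blast
qed

lemma shift_degree_sum:
  assumes P: "finite P" "p0 \<in> P" and F0: "shift_degree q s k (F p0)" and F: "\<And>p. p \<in> P \<Longrightarrow> p \<noteq> p0 \<Longrightarrow> seq_null (F p)"
  shows "shift_degree q s k (finsum (slq2 q) F P)"
proof -
  note V = slq2_vspace[of q] and V' = alg_vspace[OF calgebra_op]
  note L = algebra_homD(1)[OF seq_rep(1)[OF q s]]
  have c: "F p \<in> carrier (slq2 q)" if "p \<in> P" for p
    using F[OF that] F0 by (cases "p = p0") (simp_all add: seq_null_def shift_degree_def[OF q s])
  have "seq_rep q s (finsum (slq2 q) F P) = finsum op_algebra (\<lambda>p. seq_rep q s (F p)) P"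
    by (rule lin_finsum[OF L V V' P(1) c])
  also have "\<dots> = seq_rep q s (F p0)"
  proof (rule vs_finsum_single[OF V' P])
    show "seq_rep q s (F p) = \<zero>\<^bsub>op_algebra\<^esub>" if "p \<in> P" "p \<noteq> p0" for p using F[OF that] by (simp add: seq_null_def)
    show "seq_rep q s (F p0) \<in> carrier op_algebra" by (rule lin_closed[OF L c[OF P(2)]])
  qed
  finally show ?thesis
    using F0 vs_finsum_closed[OF V c] by (simp add: shift_degree_def[OF q s])
qed

end

text \<open>Here y acts by zero, so only terms with s = 0 count. Above the diagonal there are none;
  on and below it exactly one is left, with i - j factors z.\<close>

lemma monomial_matrix_degree_GC:
  assumes q: "q \<noteq> 0" and R: "R \<noteq> 0" and y: "seq_null q GC y"
    and d: "shift_degree q GC 0 x" "shift_degree q GC 0 w" "shift_degree q GC d z" and im: "i \<le> m"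
  shows "i < j \<Longrightarrow> seq_null q GC (monomial_matrix (slq2 q) R x y z w m i j)"
    and "j \<le> i \<Longrightarrow> qbinom (R\<^sup>2) i j \<noteq> 0 \<Longrightarrow> shift_degree q GC (d * (i - j)) (monomial_matrix (slq2 q) R x y z w m i j)"
proof -
  note S = disjI2[OF refl[of GC], of "GC = GB"]
  note A = calgebra_slq2[of q]
  have c: "x \<in> carrier (slq2 q)" "y \<in> carrier (slq2 q)" "z \<in> carrier (slq2 q)" "w \<in> carrier (slq2 q)"
    using d y by (simp_all add: shift_degree_def[OF q S] seq_null_def[OF q S])
  note closed = alg_closed[OF A] c
  let ?P = "{p \<in> {..m - i} \<times> {..i}. fst p + snd p = j}"
  have fin: "finite ?P" by (rule finite_subset[of _ "{..m - i} \<times> {..i}"]) auto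
  have null: "seq_null q GC (monomial_term (slq2 q) R x y z w m i (s, r))" if "0 < s" for s r
    unfolding monomial_term_def prod.case
    by (intro seq_null_smult[OF q S] seq_null_mult[OF q S] seq_null_pow[OF q S y that]) (simp_all add: closed)
  show "seq_null q GC (monomial_matrix (slq2 q) R x y z w m i j)" if "i < j"
    unfolding monomial_matrix_def
  proof (rule seq_null_sum[OF q S fin])
    fix p assume "p \<in> ?P"
    then have "0 < fst p" using that by auto
    then show "seq_null q GC (monomial_term (slq2 q) R x y z w m i p)" using null[of "fst p" "snd p"] by simp
  qed
  assume j: "j \<le> i" and nz: "qbinom (R\<^sup>2) i j \<noteq> 0"
  show "shift_degree q GC (d * (i - j)) (monomial_matrix (slq2 q) R x y z w m i j)"
    unfolding monomial_matrix_def
  proof (rule shift_degree_sum[OF q S fin, of "(0, j)"])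
    show "(0, j) \<in> ?P" using j by simp
    have "shift_degree q GC (((m - i - 0) * 0 + 0 * 0) + ((i - j) * d + j * 0)) ((x [^]\<^bsub>slq2 q\<^esub> (m - i - 0) \<otimes>\<^bsub>slq2 q\<^esub> x [^]\<^bsub>slq2 q\<^esub> (0 :: nat)) \<otimes>\<^bsub>slq2 q\<^esub> (z [^]\<^bsub>slq2 q\<^esub> (i - j) \<otimes>\<^bsub>slq2 q\<^esub> w [^]\<^bsub>slq2 q\<^esub> j))"
      by (intro shift_degree_mult[OF q S] shift_degree_pow[OF q S] d)
    then have "shift_degree q GC (d * (i - j)) ((x [^]\<^bsub>slq2 q\<^esub> (m - i - 0) \<otimes>\<^bsub>slq2 q\<^esub> y [^]\<^bsub>slq2 q\<^esub> (0 :: nat)) \<otimes>\<^bsub>slq2 q\<^esub> (z [^]\<^bsub>slq2 q\<^esub> (i - j) \<otimes>\<^bsub>slq2 q\<^esub> w [^]\<^bsub>slq2 q\<^esub> j))"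
      by (simp add: alg_pow(1)[OF A] mult.commute)
    then show "shift_degree q GC (d * (i - j)) (monomial_term (slq2 q) R x y z w m i (0, j))"
      unfolding monomial_term_def prod.case by (rule shift_degree_smult[OF q S]) (use nz R in simp)
    fix p assume p: "p \<in> ?P" "p \<noteq> (0, j)"
    then have "0 < fst p" by (cases p) auto
    then show "seq_null q GC (monomial_term (slq2 q) R x y z w m i p)" using null[of "fst p" "snd p"] by simp
  qed
qed

text \<open>The first row has no factors z and w at all, so its entries are single monomials in x
  and y.\<close>

lemma monomial_matrix_degree_GB:
  assumes q: "q \<noteq> 0" and R: "R \<noteq> 0" and z: "z \<in> carrier (slq2 q)" and w: "w \<in> carrier (slq2 q)"
    and d: "shift_degree q GB 0 x" "shift_degree q GB d y" and j: "j \<le> m" and nz: "qbinom (R\<^sup>2) m j \<noteq> 0"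
  shows "shift_degree q GB (d * j) (monomial_matrix (slq2 q) R x y z w m 0 j)"
proof -
  note S = disjI1[OF refl[of GB], of "GB = GC"]
  note A = calgebra_slq2[of q]
  have c: "x \<in> carrier (slq2 q)" "y \<in> carrier (slq2 q)"
    using d by (simp_all add: shift_degree_def[OF q S])
  note closed = alg_closed[OF A] c z w
  have P: "{p \<in> {..m - 0} \<times> {..0}. fst p + snd p = j} = {(j, 0)}" using j by auto
  have e: "monomial_matrix (slq2 q) R x y z w m 0 j = monomial_term (slq2 q) R x y z w m 0 (j, 0)"
    unfolding monomial_matrix_def P by (simp add: monomial_term_def closed)
  have "shift_degree q GB ((m - j) * 0 + j * d) (x [^]\<^bsub>slq2 q\<^esub> (m - j) \<otimes>\<^bsub>slq2 q\<^esub> y [^]\<^bsub>slq2 q\<^esub> j)"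
    by (intro shift_degree_mult[OF q S] shift_degree_pow[OF q S] d)
  then have "shift_degree q GB (d * j) ((x [^]\<^bsub>slq2 q\<^esub> (m - 0 - j) \<otimes>\<^bsub>slq2 q\<^esub> y [^]\<^bsub>slq2 q\<^esub> j) \<otimes>\<^bsub>slq2 q\<^esub> (z [^]\<^bsub>slq2 q\<^esub> (0 - 0 :: nat) \<otimes>\<^bsub>slq2 q\<^esub> w [^]\<^bsub>slq2 q\<^esub> (0 :: nat)))"
    by (simp add: alg_pow(1)[OF A] alg_one[OF A] closed mult.commute)
  then show ?thesis
    unfolding e monomial_term_def prod.case by (rule shift_degree_smult[OF q S]) (use nz R in simp)
qed

definition WY_matrix :: "complex \<Rightarrow> nat \<Rightarrow> nat \<Rightarrow> nat \<Rightarrow> nat \<times> nat \<Rightarrow> nat \<times> nat \<Rightarrow> (gen list \<Rightarrow>\<^sub>0 complex) set" where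
  "WY_matrix q l n m = (\<lambda>(i, k) (j, k'). W_matrix q l n i j \<otimes>\<^bsub>slq2 q\<^esub> Y_matrix q m k k')"

context
  fixes q :: complex and l :: nat
  assumes q: "q \<noteq> 0" and l: "0 < l" and prim: "\<And>i. 0 < i \<Longrightarrow> i < l \<Longrightarrow> ((inverse q)\<^sup>2) ^ i \<noteq> 1"
begin

text \<open>Ordinary binomials are nonzero, and so are the Gaussian ones because k < l. The
  Kronecker product is therefore triangular in the representation where c shifts, with a definite
  degree at each remaining entry.\<close>

lemma WY_matrix_GC:
  assumes i: "i \<le> n" and k: "k \<le> m" and m: "m < l"
  shows "j \<le> i \<and> k' \<le> k \<Longrightarrow> shift_degree q GC (l * (i - j) + (k - k')) (WY_matrix q l n m (i, k) (j, k'))"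
    and "\<not> (j \<le> i \<and> k' \<le> k) \<Longrightarrow> seq_null q GC (WY_matrix q l n m (i, k) (j, k'))"
proof -
  note S = disjI2[OF refl[of GC], of "GC = GB"]
  note gen = shift_degree_gen[OF q S] and pow = shift_degree_pow[OF q S]
  have null: "seq_null q GC (slq2_b q)" by (rule seq_null_gen[OF q S]) simp_all
  have P: "shift_degree q GC 0 (slq2_a q [^]\<^bsub>slq2 q\<^esub> l)" "shift_degree q GC 0 (slq2_d q [^]\<^bsub>slq2 q\<^esub> l)" "shift_degree q GC l (slq2_c q [^]\<^bsub>slq2 q\<^esub> l)"
    using pow[OF gen(1), of l] pow[OF gen(2), of l] pow[OF gen(3), of l] by simp_all
  have iq: "inverse q \<noteq> 0" using q by simp
  note W = monomial_matrix_degree_GC[OF q one_neq_zero seq_null_pow[OF q S null l] P i, folded W_matrix_def]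
  note Y = monomial_matrix_degree_GC[OF q iq null gen k, folded Y_matrix_def]
  show "shift_degree q GC (l * (i - j) + (k - k')) (WY_matrix q l n m (i, k) (j, k'))" if "j \<le> i \<and> k' \<le> k"
  proof -
    have "qbinom (1\<^sup>2) i j \<noteq> 0" using that by (simp add: qbinom_one)
    moreover have "qbinom ((inverse q)\<^sup>2) k k' \<noteq> 0" using that prim k m by (intro qbinom_nonzero) auto
    ultimately show ?thesis
      using shift_degree_mult[OF q S W(2)[of j] Y(2)[of k']] that by (simp add: WY_matrix_def)
  qed
  assume n: "\<not> (j \<le> i \<and> k' \<le> k)"
  show "seq_null q GC (WY_matrix q l n m (i, k) (j, k'))"
  proof (cases "i < j")
    case True
    show ?thesis unfolding WY_matrix_def prod.case by (rule seq_null_mult(1)[OF q S W(1)[OF True] matrix_closed(2)])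
  next
    case False
    then have "k < k'" using n by simp
    show ?thesis unfolding WY_matrix_def prod.case by (rule seq_null_mult(2)[OF q S Y(1)[OF \<open>k < k'\<close>] matrix_closed(4)])
  qed
qed

lemma WY_matrix_GB:
  assumes j: "j \<le> n" and k: "k \<le> m" and m: "m < l"
  shows "shift_degree q GB (l * j + k) (WY_matrix q l n m (0, 0) (j, k))"
proof -
  note S = disjI1[OF refl[of GB], of "GB = GC"]
  note gen = shift_degree_gen[OF q S] and pow = shift_degree_pow[OF q S]
  note c = alg_closed(3)[OF calgebra_slq2 slq2_gen_closed']
  have P: "shift_degree q GB 0 (slq2_a q [^]\<^bsub>slq2 q\<^esub> l)" "shift_degree q GB l (slq2_b q [^]\<^bsub>slq2 q\<^esub> l)"
    using pow[OF gen(1), of l] pow[OF gen(3), of l] by simp_all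
  have iq: "inverse q \<noteq> 0" using q by simp
  have "qbinom (1\<^sup>2) n j \<noteq> 0" using j by (simp add: qbinom_one)
  then have W: "shift_degree q GB (l * j) (W_matrix q l n 0 j)"
    unfolding W_matrix_def by (intro monomial_matrix_degree_GB[OF q one_neq_zero c c P j])
  have "qbinom ((inverse q)\<^sup>2) m k \<noteq> 0" using prim k m by (intro qbinom_nonzero) auto
  then have Y: "shift_degree q GB (1 * k) (Y_matrix q m 0 k)"
    unfolding Y_matrix_def by (intro monomial_matrix_degree_GB[OF q iq slq2_gen_closed' slq2_gen_closed' gen(1,3) k])
  show ?thesis using shift_degree_mult[OF q S W Y] by (simp add: WY_matrix_def)
qed

text \<open>The degrees l i + k of the labels are pairwise distinct because k < l. The
  representation in which c shifts lowers any vector to the label (0, 0), and the one in which b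
  shifts raises that label to any other.\<close>

lemma irreducible_WY:
  assumes m: "m < l" and U: "has_matrix (slq2 q) U ({..n} \<times> {..m}) e (WY_matrix q l n m)"
  shows "irreducible_comodule (slq2 q) U"
proof (rule has_matrix_irreducible[OF prebialgebra_slq2[OF q] U, of "(0, 0)"])
  let ?I = "{..n} \<times> {..m}" and ?h = "\<lambda>p. l * fst p + snd p"
  note SC = disjI2[OF refl[of GC], of "GC = GB"] and SB = disjI1[OF refl[of GB], of "GB = GC"]
  \<comment> \<open>Quotient and remainder by l recover the pair, as the second component stays
    below l.\<close>
  have inj: "p = p'" if "?h p = ?h p'" "p \<in> ?I" "p' \<in> ?I" for p p'
  proof -
    have "snd p < l" "snd p' < l" using that m by (auto simp: mem_Times_iff)
    then have "fst p = ?h p div l" "fst p' = ?h p' div l" "snd p = ?h p mod l" "snd p' = ?h p' mod l" by simp_all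
    then show ?thesis using that(1) by (metis prod.collapse)
  qed
  show "(0, 0) \<in> ?I" by simp
  {
    fix x :: "nat \<times> nat \<Rightarrow> complex" assume ex: "\<exists>i\<in>?I. x i \<noteq> 0"
    \<comment> \<open>The functional is taken at the largest degree occurring in the vector: only
      there can the step down to (0, 0) use up the full degree.\<close>
    let ?S = "{p \<in> ?I. x p \<noteq> 0}"
    have "finite (?h ` ?S)" "?h ` ?S \<noteq> {}" using ex by auto
    then have "Max (?h ` ?S) \<in> ?h ` ?S" by (rule Max_in)
    then obtain p0 where p0: "p0 \<in> ?S" "Max (?h ` ?S) = ?h p0" by blast
    have max: "?h p \<le> ?h p0" if "p \<in> ?S" for p
      unfolding p0(2)[symmetric] by (rule Max_ge[OF \<open>finite (?h ` ?S)\<close> imageI[OF that]])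
    let ?\<chi> = "coeff_functional q GC (?h p0)"
    have 0: "shift_degree q GC (?h p) (WY_matrix q l n m p (0, 0))" if "p \<in> ?I" for p
      using WY_matrix_GC(1)[of "fst p" n "snd p" m 0 0] that m by auto
    have other: "x p * ?\<chi> (WY_matrix q l n m p (0, 0)) = 0" if "p \<in> ?I" "p \<noteq> p0" for p
    proof -
      have "?h p0 \<noteq> ?h p" using inj[of p p0] that p0 by auto
      then show ?thesis using shift_degree_coeff(2)[OF q SC 0[OF that(1)]] by simp
    qed
    have "(\<Sum>p\<in>?I. x p * ?\<chi> (WY_matrix q l n m p (0, 0))) = x p0 * ?\<chi> (WY_matrix q l n m p0 (0, 0))"
      using sum.remove[of ?I p0 "\<lambda>p. x p * ?\<chi> (WY_matrix q l n m p (0, 0))"] p0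
        sum.neutral[of "?I - {p0}" "\<lambda>p. x p * ?\<chi> (WY_matrix q l n m p (0, 0))"] other by simp
    moreover have "x p0 * ?\<chi> (WY_matrix q l n m p0 (0, 0)) \<noteq> 0"
      using p0 shift_degree_coeff(1)[OF q SC 0, of p0] by simp
    moreover have "(\<Sum>p\<in>?I. x p * ?\<chi> (WY_matrix q l n m p j)) = 0" if j: "j \<in> ?I" "j \<noteq> (0, 0)" for j
    proof (rule sum.neutral, rule ballI)
      fix p assume p: "p \<in> ?I"
      have fs: "fst p \<le> n" "snd p \<le> m" using p by auto
      show "x p * ?\<chi> (WY_matrix q l n m p j) = 0"
      proof (cases "x p \<noteq> 0 \<and> fst j \<le> fst p \<and> snd j \<le> snd p")
        case True
        \<comment> \<open>A label j other than (0, 0) uses up less than the full degree of p, which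
          is itself at most the maximum, so the functional does not see this entry.\<close>
        have "l * (fst p - fst j) + (snd p - snd j) < ?h p"
        proof (cases "fst j = 0")
          case False
          have "l * (fst p - fst j) + l * fst j = l * fst p" using True by (simp flip: add_mult_distrib2)
          moreover have "0 < l * fst j" using False l by simp
          ultimately show ?thesis by linarith
        qed (use True j in \<open>auto simp: prod_eq_iff\<close>)
        also have "?h p \<le> ?h p0" using max[of p] True p by auto
        finally have "?h p0 \<noteq> l * (fst p - fst j) + (snd p - snd j)" by simp
        then show ?thesis
          using shift_degree_coeff(2)[OF q SC WY_matrix_GC(1)[OF fs m, of "fst j" "snd j"]] True by simp
      next
        case False
        show ?thesis
        proof (cases "x p = 0")
          case False
          with \<open>\<not> (x p \<noteq> 0 \<and> fst j \<le> fst p \<and> snd j \<le> snd p)\<close> have "\<not> (fst j \<le> fst p \<and> snd j \<le> snd p)" by simp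
          from seq_null_coeff[OF q SC WY_matrix_GC(2)[OF fs m this]] show ?thesis by simp
        qed simp
      qed
    qed
    ultimately show "\<exists>\<chi>\<in>linear_maps (slq2 q) CC. (\<Sum>p\<in>?I. x p * \<chi> (WY_matrix q l n m p (0, 0))) \<noteq> 0 \<and>
        (\<forall>j\<in>?I. j \<noteq> (0, 0) \<longrightarrow> (\<Sum>p\<in>?I. x p * \<chi> (WY_matrix q l n m p j)) = 0)"
      by (intro bexI[of _ ?\<chi>] conjI ballI impI coeff_functional_linear[OF q SC]) simp_all
  }
  fix i assume i: "i \<in> ?I"
  \<comment> \<open>The entries of the first row have pairwise distinct degrees, so a single
    coefficient functional isolates the desired one.\<close>
  have d: "shift_degree q GB (?h p) (WY_matrix q l n m (0, 0) p)" if "p \<in> ?I" for p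
    using WY_matrix_GB[of "fst p" n "snd p" m] that m by auto
  show "\<exists>\<chi>\<in>linear_maps (slq2 q) CC. \<chi> (WY_matrix q l n m (0, 0) i) \<noteq> 0 \<and> (\<forall>j\<in>?I. j \<noteq> i \<longrightarrow> \<chi> (WY_matrix q l n m (0, 0) j) = 0)"
  proof (intro bexI[of _ "coeff_functional q GB (?h i)"] conjI ballI impI coeff_functional_linear[OF q SB])
    show "coeff_functional q GB (?h i) (WY_matrix q l n m (0, 0) i) \<noteq> 0" by (rule shift_degree_coeff(1)[OF q SB d[OF i]])
    fix j assume j: "j \<in> ?I" "j \<noteq> i"
    then have "?h i \<noteq> ?h j" using inj[of i j] i by auto
    then show "coeff_functional q GB (?h i) (WY_matrix q l n m (0, 0) j) = 0" by (rule shift_degree_coeff(2)[OF q SB d[OF j(1)]])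
  qed
qed

end

section \<open>Subcomodules and quotients of $Y_m$\<close>

text \<open>The product is q^(-s(s-1)), and s^2 - s(s-1) = s.\<close>

lemma gauss_power: "(\<Prod>i<s. ((inverse q)\<^sup>2) ^ i) * q ^ (s * s) = q ^ s" if "q \<noteq> (0 :: complex)"
proof (induction s)
  case (Suc s)
  have iv: "inverse q ^ s * q ^ s = 1" using that by (simp flip: power_mult_distrib)
  have e: "Suc s * Suc s = s * s + (s + s + 1)" by simp
  have "(\<Prod>i<Suc s. ((inverse q)\<^sup>2) ^ i) * q ^ (Suc s * Suc s)
    = ((\<Prod>i<s. ((inverse q)\<^sup>2) ^ i) * q ^ (s * s)) * ((inverse q ^ s * q ^ s) * (inverse q ^ s * q ^ s) * q)"
    unfolding e by (simp only: prod.lessThan_Suc power2_eq_square power_mult_distrib power_add power_one_right ac_simps)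
  then show ?case unfolding iv Suc by (simp only: power_Suc mult_1 mult_1_right mult.commute)
qed simp

context
  fixes q :: complex and l :: nat
  assumes q: "q \<noteq> 0" and l: "0 < l" and ql: "q ^ l = 1" and prim: "\<And>i. 0 < i \<Longrightarrow> i < l \<Longrightarrow> ((inverse q)\<^sup>2) ^ i \<noteq> 1"
begin

text \<open>The scalar by which an entry of the first column of the middle block differs from a
  basis monomial; it is nonzero as long as N + k < l.\<close>

abbreviation (input) col_factor :: "nat \<Rightarrow> nat \<Rightarrow> complex" where
  "col_factor N k \<equiv> qbinom ((inverse q)\<^sup>2) (N + k) N * q ^ (k * N)"

text \<open>The left side is the scalar in \<open>monomial_term\<close> times the factor from moving
  c^k to the left past a^(N-s). Reflection replaces the binomial with upper index l - 1 - k, and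
  trinomial revision separates a factor independent of s from the coefficients of the determinant
  power.\<close>

lemma column_coefficient:
  assumes k: "N + k < l" and s: "s \<le> N"
  shows "qbinom ((inverse q)\<^sup>2) (l - 1 - k) s * qbinom ((inverse q)\<^sup>2) (N + k) (N - s) * inverse q ^ (s * (k + s)) * q ^ ((N - s) * k)
    = col_factor N k * ((- q) ^ s * qbinom ((inverse q)\<^sup>2) N s)"
proof -
  let ?p = "(inverse q)\<^sup>2"
  let ?A = "qbinom ?p (l - 1 - k) s" and ?B = "qbinom ?p (k + s) s" and ?C = "qbinom ?p (N + k) (N - s)"
  let ?u = "inverse q ^ (s * (k + s))" and ?v = "q ^ (s * (k + s))"
  have uv: "?u * ?v = 1" using q by (simp flip: power_mult_distrib)
  have sg: "(- 1) ^ s * (- 1) ^ s = (1 :: complex)" by (simp flip: power_mult_distrib)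
  have v: "?v = q ^ (s * k) * q ^ (s * s)" by (simp only: add_mult_distrib2 power_add)
  have pn: "?p ^ n = inverse q ^ n * inverse q ^ n" for n by (simp only: power2_eq_square power_mult_distrib)
  have "?p ^ l = 1" unfolding pn by (simp add: power_inverse ql)
  moreover have "k + s < l" using k s by simp
  ultimately have "?p ^ (k * s) * ?p ^ (s * s) * ?A * (- 1) ^ s = (\<Prod>i<s. ?p ^ i) * ?B"
    using qbinom_reflect[of ?p l k s, OF _ prim] by blast
  moreover have "?p ^ (k * s) * ?p ^ (s * s) = ?p ^ (s * (k + s))" by (simp only: add_mult_distrib2 power_add mult.commute)
  ultimately have *: "?u * ?u * ?A * (- 1) ^ s = (\<Prod>i<s. ?p ^ i) * ?B" by (simp only: pn)
  \<comment> \<open>Factors equal to 1 are inserted so that the left side of the reflection formula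
    appears.\<close>
  have "?A * ?u = ?A * ?u * (?u * ?v) * ((- 1) ^ s * (- 1) ^ s)" by (simp only: uv sg mult_1_right)
  also have "\<dots> = (- 1) ^ s * ?v * (?u * ?u * ?A * (- 1) ^ s)" by (simp only: ac_simps)
  also have "\<dots> = (- 1) ^ s * ((\<Prod>i<s. ?p ^ i) * q ^ (s * s)) * q ^ (s * k) * ?B"
    unfolding * v by (simp only: ac_simps)
  also have "\<dots> = (- q) ^ s * q ^ (s * k) * ?B"
    unfolding gauss_power[OF q] power_minus[of q s] by (rule refl)
  finally have AB: "?A * ?u = (- q) ^ s * q ^ (s * k) * ?B" .
  have "s * k + (N - s) * k = k * N" using s by (metis add_mult_distrib le_add_diff_inverse mult.commute)
  then have "q ^ (s * k) * q ^ ((N - s) * k) = q ^ (k * N)" by (simp only: power_add[symmetric])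
  moreover have BC: "?B * ?C = qbinom ?p (N + k) N * qbinom ?p N s"
    by (rule qbinom_trinomial[OF prim s]) (use k in simp_all)
  ultimately show ?thesis
  proof -
    assume e: "q ^ (s * k) * q ^ ((N - s) * k) = q ^ (k * N)"
    have "?A * ?C * ?u * q ^ ((N - s) * k) = (?A * ?u) * ?C * q ^ ((N - s) * k)" by (simp only: ac_simps)
    also have "\<dots> = (- q) ^ s * (q ^ (s * k) * q ^ ((N - s) * k)) * (?B * ?C)" unfolding AB by (simp only: ac_simps)
    also have "\<dots> = col_factor N k * ((- q) ^ s * qbinom ?p N s)" unfolding e BC by (simp only: ac_simps)
    finally show ?thesis .
  qed
qed

text \<open>After reordering, a^(n-k) c^k with n = l - 2 - m0 stands in front of every term. The sum
  behind it is the expansion of the N-th power of the determinant for N = m0 + 1 and equals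
  1.\<close>

lemma Y_matrix_column:
  assumes m: "m0 + 2 \<le> l" and k: "k \<le> l - 2 - m0"
  shows "Y_matrix q (l + m0) (m0 + 1 + k) (m0 + 1) = col_factor (m0 + 1) k \<odot>\<^bsub>slq2 q\<^esub> Y_basis q (l - 2 - m0) k"
proof -
  let ?H = "slq2 q" and ?a = "slq2_a q" and ?b = "slq2_b q" and ?c = "slq2_c q" and ?d = "slq2_d q"
  let ?p = "(inverse q)\<^sup>2" and ?N = "m0 + 1" and ?n = "l - 2 - m0"
  note A = calgebra_slq2[of q] and V = slq2_vspace[of q]
  note closed = alg_closed[OF A] slq2_gen_closed' matrix_closed vs_closed[OF V]
  have Nk: "?N + k < l" using m k by simp
  have e: "l + m0 - (?N + k) = l - 1 - k" by simp
  let ?P = "{p \<in> {..l + m0 - (?N + k)} \<times> {..?N + k}. fst p + snd p = ?N}"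
  let ?t = "monomial_term ?H (inverse q) ?a ?b ?c ?d (l + m0) (?N + k)"
  let ?G = "\<lambda>s. ?a [^]\<^bsub>?H\<^esub> (?N - s) \<otimes>\<^bsub>?H\<^esub> (?b [^]\<^bsub>?H\<^esub> s \<otimes>\<^bsub>?H\<^esub> (?c [^]\<^bsub>?H\<^esub> s \<otimes>\<^bsub>?H\<^esub> ?d [^]\<^bsub>?H\<^esub> (?N - s)))"
  let ?g = "\<lambda>s. (- q) ^ s * qbinom ?p ?N s"
  \<comment> \<open>Because N + k < l, the range of the first component does not cut off the
    antidiagonal.\<close>
  have P: "?P = (\<lambda>s. (s, ?N - s)) ` {..?N}"
    using Nk by (auto simp: image_iff)
  have tc: "?t p \<in> carrier ?H" for p by (rule monomial_matrix_closed(1)[OF A]) simp_all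
  have bc: "?b \<otimes>\<^bsub>?H\<^esub> ?c = 1 \<odot>\<^bsub>?H\<^esub> (?c \<otimes>\<^bsub>?H\<^esub> ?b)" and ac: "?a \<otimes>\<^bsub>?H\<^esub> ?c = q \<odot>\<^bsub>?H\<^esub> (?c \<otimes>\<^bsub>?H\<^esub> ?a)"
    using slq2_relations[of q] by (simp_all add: slq2_relations_def vs_zero(5)[OF V] closed)
  have tm: "?t (s, ?N - s) = col_factor ?N k \<odot>\<^bsub>?H\<^esub> (Y_basis q ?n k \<otimes>\<^bsub>?H\<^esub> (?g s \<odot>\<^bsub>?H\<^esub> ?G s))" if s: "s \<le> ?N" for s
  proof -
    \<comment> \<open>The exponent of a splits into n - k, which belongs to the basis monomial, and
      N - s, which belongs to the determinant power.\<close>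
    have i: "?N + k - (?N - s) = k + s" "l - 1 - k - s = (?n - k) + (?N - s)" using s k m by simp_all
    have "(?a [^]\<^bsub>?H\<^esub> (l - 1 - k - s) \<otimes>\<^bsub>?H\<^esub> ?b [^]\<^bsub>?H\<^esub> s) \<otimes>\<^bsub>?H\<^esub> (?c [^]\<^bsub>?H\<^esub> (k + s) \<otimes>\<^bsub>?H\<^esub> ?d [^]\<^bsub>?H\<^esub> (?N - s))
      = ?a [^]\<^bsub>?H\<^esub> (?n - k) \<otimes>\<^bsub>?H\<^esub> (?a [^]\<^bsub>?H\<^esub> (?N - s) \<otimes>\<^bsub>?H\<^esub> ((?b [^]\<^bsub>?H\<^esub> s \<otimes>\<^bsub>?H\<^esub> ?c [^]\<^bsub>?H\<^esub> k) \<otimes>\<^bsub>?H\<^esub> (?c [^]\<^bsub>?H\<^esub> s \<otimes>\<^bsub>?H\<^esub> ?d [^]\<^bsub>?H\<^esub> (?N - s))))"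
      unfolding i alg_pow_add[OF A slq2_gen_closed'] by (simp only: alg_assoc[OF A] closed)
    also have "\<dots> = ?a [^]\<^bsub>?H\<^esub> (?n - k) \<otimes>\<^bsub>?H\<^esub> ((?a [^]\<^bsub>?H\<^esub> (?N - s) \<otimes>\<^bsub>?H\<^esub> ?c [^]\<^bsub>?H\<^esub> k) \<otimes>\<^bsub>?H\<^esub> (?b [^]\<^bsub>?H\<^esub> s \<otimes>\<^bsub>?H\<^esub> (?c [^]\<^bsub>?H\<^esub> s \<otimes>\<^bsub>?H\<^esub> ?d [^]\<^bsub>?H\<^esub> (?N - s))))"
      unfolding skew_pow[OF A slq2_gen_closed' slq2_gen_closed' bc] power_one
      by (simp only: alg_assoc[OF A] closed vs_zero(5)[OF V])
    also have "\<dots> = q ^ ((?N - s) * k) \<odot>\<^bsub>?H\<^esub> (Y_basis q ?n k \<otimes>\<^bsub>?H\<^esub> ?G s)"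
      unfolding skew_pow[OF A slq2_gen_closed' slq2_gen_closed' ac, where m = "?N - s" and n = k] Y_basis_def monomial_def
      by (simp only: alg_assoc[OF A] closed alg_smult[OF A])
    finally show ?thesis
      unfolding monomial_term_def prod.case e i(1)
      by (simp only: alg_smult[OF A] closed vs_smult_smult[OF V] column_coefficient[OF Nk s])
  qed
  have "Y_matrix q (l + m0) (?N + k) ?N = finsum ?H ?t ((\<lambda>s. (s, ?N - s)) ` {..?N})"
    unfolding Y_matrix_def monomial_matrix_def P by (rule refl)
  also have "\<dots> = (\<Oplus>\<^bsub>?H\<^esub>s\<in>{..?N}. ?t (s, ?N - s))"
    by (rule vs_finsum_reindex[OF V]) (simp add: inj_on_def, rule tc)
  also have "\<dots> = (\<Oplus>\<^bsub>?H\<^esub>s\<in>{..?N}. col_factor ?N k \<odot>\<^bsub>?H\<^esub> (Y_basis q ?n k \<otimes>\<^bsub>?H\<^esub> (?g s \<odot>\<^bsub>?H\<^esub> ?G s)))"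
    by (rule vs_finsum_cong[OF V refl tm]) (simp_all add: closed)
  also have "\<dots> = col_factor ?N k \<odot>\<^bsub>?H\<^esub> (\<Oplus>\<^bsub>?H\<^esub>s\<in>{..?N}. Y_basis q ?n k \<otimes>\<^bsub>?H\<^esub> (?g s \<odot>\<^bsub>?H\<^esub> ?G s))"
    by (rule vs_finsum_smult[OF V]) (simp add: closed)
  also have "(\<Oplus>\<^bsub>?H\<^esub>s\<in>{..?N}. Y_basis q ?n k \<otimes>\<^bsub>?H\<^esub> (?g s \<odot>\<^bsub>?H\<^esub> ?G s)) = Y_basis q ?n k \<otimes>\<^bsub>?H\<^esub> (\<Oplus>\<^bsub>?H\<^esub>s\<in>{..?N}. ?g s \<odot>\<^bsub>?H\<^esub> ?G s)"
    by (rule alg_finsum(1)[OF A, symmetric]) (simp_all add: closed)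
  also have "(\<Oplus>\<^bsub>?H\<^esub>s\<in>{..?N}. ?g s \<odot>\<^bsub>?H\<^esub> ?G s) = \<one>\<^bsub>?H\<^esub>"
    by (rule quantum_det_power[OF A q slq2_relations]) simp_all
  finally show ?thesis by (simp add: alg_one[OF A])
qed

text \<open>The comultiplication of an entry of the first column is expanded twice, by the matrix
  law in the large comodule and by the coaction on the proportional basis vector. Comparing
  coefficients of the independent basis monomials determines the remaining columns of the
  block.\<close>

lemma Y_matrix_lower_block:
  assumes m: "m0 + 2 \<le> l" and k: "k \<le> l - 2 - m0" and k': "k' \<le> l - 2 - m0"
  shows "col_factor (m0 + 1) k' \<odot>\<^bsub>slq2 q\<^esub> Y_matrix q (l + m0) (m0 + 1 + k) (m0 + 1 + k')
    = col_factor (m0 + 1) k \<odot>\<^bsub>slq2 q\<^esub> Y_matrix q (l - 2 - m0) k k'"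
proof -
  let ?H = "slq2 q" let ?T = "tensor ?H ?H" and ?P = "pure ?H ?H"
  let ?N = "m0 + 1" and ?n = "l - 2 - m0" and ?f = "col_factor (m0 + 1)"
  note B = prebialgebraD[OF prebialgebra_slq2[OF q]]
  note V = B(2) and VT = B(7)
  note closed = matrix_closed vs_closed[OF V] pure_closed[OF V V] vs_closed[OF VT]
  let ?M = "Y_matrix q (l + m0)"
  \<comment> \<open>Outside the middle rows the first column vanishes: by the factorization with n =
    1 and r = m0, the target m0 + 1 has a remainder that does not occur.\<close>
  have zero: "?M i ?N = \<zero>\<^bsub>?H\<^esub>" if i: "i \<le> l + m0" "i \<notin> (\<lambda>k. ?N + k) ` {..?n}" for i
  proof -
    have i': "i \<le> m0 \<or> l \<le> i"
    proof (rule ccontr)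
      assume "\<not> ?thesis"
      then have "i = ?N + (i - ?N)" "i - ?N \<le> ?n" by auto
      then show False using i(2) by blast
    qed
    \<comment> \<open>The rows outside the middle are those of the two blocks with quotient 0 or 1
      and remainder at most m0.\<close>
    define j k where "j = (if i \<le> m0 then 0 else 1 :: nat)" and "k = (if i \<le> m0 then i else i - l)"
    have jk: "j \<le> 1" "k \<le> m0" "i = l * j + k" using i' i(1) by (auto simp: j_def k_def)
    have "Y_matrix q (l * 1 + m0) (l * j + k) ?N = \<zero>\<^bsub>?H\<^esub>"
    proof (rule Y_matrix_block(1)[OF q l ql prim jk(1,2)])
      fix j' k' :: nat assume "j' \<le> 1" "k' \<le> m0"
      then show "l * j' + k' \<noteq> ?N" using m by (cases j') auto
    qed (use l in simp_all)
    then show ?thesis using jk(3) by simp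
  qed
  note cm = comatrixD[OF has_matrixD(2)[OF has_matrix_Y[OF q, of "l + m0"]]]
  have "comult ?H (?M (?N + k) ?N) = (\<Oplus>\<^bsub>?T\<^esub>i\<in>{..l + m0}. ?P (?M (?N + k) i) (?M i ?N))"
    by (rule cm(3)) (use m k in simp_all)
  also have "\<dots> = (\<Oplus>\<^bsub>?T\<^esub>i\<in>(\<lambda>k. ?N + k) ` {..?n}. ?P (?M (?N + k) i) (?M i ?N))"
  proof (rule vs_finsum_neutral[OF VT])
    show "(\<lambda>k. ?N + k) ` {..?n} \<subseteq> {..l + m0}" using m by auto
    fix i assume i: "i \<in> {..l + m0}" "i \<notin> (\<lambda>k. ?N + k) ` {..?n}"
    then have "?M i ?N = \<zero>\<^bsub>?H\<^esub>" by (intro zero) simp_all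
    then show "?P (?M (?N + k) i) (?M i ?N) = \<zero>\<^bsub>?T\<^esub>" by (simp only: pure_zero_right[OF V V] closed)
  qed (simp_all only: closed finite_atMost)
  also have "\<dots> = (\<Oplus>\<^bsub>?T\<^esub>i\<in>{..?n}. ?P (?M (?N + k) (?N + i)) (?M (?N + i) ?N))"
    by (rule vs_finsum_reindex[OF VT]) (simp_all add: closed inj_on_def)
  also have "\<dots> = (\<Oplus>\<^bsub>?T\<^esub>i\<in>{..?n}. ?P (?f i \<odot>\<^bsub>?H\<^esub> ?M (?N + k) (?N + i)) (Y_basis q ?n i))"
    by (rule vs_finsum_cong[OF VT refl])
      (simp_all only: atMost_iff Y_matrix_column[OF m] pure_smult_right[OF V V] pure_smult_left[OF V V] closed)
  finally have 1: "comult ?H (?M (?N + k) ?N) = (\<Oplus>\<^bsub>?T\<^esub>i\<in>{..?n}. ?P (?f i \<odot>\<^bsub>?H\<^esub> ?M (?N + k) (?N + i)) (Y_basis q ?n i))" .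
  have "comult ?H (?M (?N + k) ?N) = ?f k \<odot>\<^bsub>?T\<^esub> (\<Oplus>\<^bsub>?T\<^esub>i\<in>{..?n}. ?P (Y_matrix q ?n k i) (Y_basis q ?n i))"
    unfolding Y_matrix_column[OF m k] lin_smult[OF B(5) matrix_closed(1)] comult_Y_basis[OF q k] by (rule refl)
  also have "\<dots> = (\<Oplus>\<^bsub>?T\<^esub>i\<in>{..?n}. ?f k \<odot>\<^bsub>?T\<^esub> ?P (Y_matrix q ?n k i) (Y_basis q ?n i))"
    by (rule vs_finsum_smult[OF VT, symmetric]) (simp add: closed)
  also have "\<dots> = (\<Oplus>\<^bsub>?T\<^esub>i\<in>{..?n}. ?P (?f k \<odot>\<^bsub>?H\<^esub> Y_matrix q ?n k i) (Y_basis q ?n i))"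
    by (rule vs_finsum_cong[OF VT refl]) (simp_all only: pure_smult_left[OF V V] closed)
  finally have 2: "comult ?H (?M (?N + k) ?N) = (\<Oplus>\<^bsub>?T\<^esub>i\<in>{..?n}. ?P (?f k \<odot>\<^bsub>?H\<^esub> Y_matrix q ?n k i) (Y_basis q ?n i))" .
  have d: "shift_degree q GC k (Y_basis q ?n k)" if "k \<le> ?n" for k by (rule Y_basis_degree[OF q that])
  \<comment> \<open>The functional dual to the basis monomial with index \<open>k'\<close> reads its
    coefficient off either expansion.\<close>
  have slice: "slice_right ?H (monomial_functional q (Y_basis q ?n) (\<lambda>k. k) k') (\<Oplus>\<^bsub>?T\<^esub>i\<in>{..?n}. ?P (x i) (Y_basis q ?n i)) = x k'"
    if "\<And>i. x i \<in> carrier ?H" for x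
    by (rule slice_right_sum[OF finite_atMost _ _ _ V V])
      (use that k' monomial_functional[OF q d inj_on_id2] in auto)
  show ?thesis
    using slice[of "\<lambda>i. ?f i \<odot>\<^bsub>?H\<^esub> ?M (?N + k) (?N + i)"] slice[of "\<lambda>i. ?f k \<odot>\<^bsub>?H\<^esub> Y_matrix q ?n k i"] 1 2
    by (simp add: closed)
qed

end

lemma primitive_root:
  assumes "odd l" and l: "l \<ge> 3" and qe: "q = exp (2 * of_real pi * \<i> / of_nat l)"
  shows "q \<noteq> 0" "q ^ l = 1" "\<And>i. 0 < i \<Longrightarrow> i < l \<Longrightarrow> ((inverse q)\<^sup>2) ^ i \<noteq> 1"
proof -
  have q: "q = cis (2 * pi / real l)" by (simp add: qe cis_conv_exp mult_ac)
  have pow: "q ^ k = cis (2 * pi * real k / real l)" for k by (simp add: q DeMoivre mult_ac)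
  show q0: "q \<noteq> 0" by (simp add: qe)
  show ql: "q ^ l = 1" unfolding pow using l by simp
  have roots: "inj_on (\<lambda>k. cis (2 * pi * real k / real l)) {..<l}"
    using bij_betw_roots_unity[of l] l by (simp add: bij_betw_def)
  show "((inverse q)\<^sup>2) ^ i \<noteq> 1" if i: "0 < i" "i < l" for i
  proof
    assume "((inverse q)\<^sup>2) ^ i = 1"
    then have "q ^ (2 * i) = 1" by (simp add: power_mult power_inverse flip: power_mult)
    \<comment> \<open>The exponent is reduced below l, where the powers of q are known to be
      distinct.\<close>
    moreover have "q ^ (2 * i) = q ^ (2 * i mod l)"
      using mult_div_mod_eq[of l "2 * i"] ql by (metis mult_1 power_add power_mult power_one)
    ultimately have "q ^ (2 * i mod l) = q ^ 0" by simp
    then have "2 * i mod l = 0" using inj_onD[OF roots, of "2 * i mod l" 0] l unfolding pow by simp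
    then have "l dvd 2 * i" by (simp add: dvd_eq_mod_eq_0)
    \<comment> \<open>Oddness of l is used here: it makes l coprime to 2.\<close>
    then have "l dvd i" using \<open>odd l\<close> by (simp add: coprime_dvd_mult_right_iff)
    then show False using i by (simp add: nat_dvd_not_less)
  qed
qed

section \<open>Decomposition of the index range by quotient and remainder modulo l\<close>

context
  fixes q :: complex and l :: nat
  assumes q: "q \<noteq> 0" and l: "0 < l" and ql: "q ^ l = 1" and prim: "\<And>i. 0 < i \<Longrightarrow> i < l \<Longrightarrow> ((inverse q)\<^sup>2) ^ i \<noteq> 1"
begin

abbreviation (input) block :: "nat \<Rightarrow> nat \<Rightarrow> nat set" where
  "block n m \<equiv> (\<lambda>(j, k). l * j + k) ` ({..n} \<times> {..m})"

lemma division_unique: "k < l \<Longrightarrow> k' < l \<Longrightarrow> l * j + k = l * j' + k' \<Longrightarrow> j = j' \<and> k = (k' :: nat)"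
  by (metis add.commute div_mult_self1_is_m div_mult_self2 div_less add_0 mod_mult_self2 mod_less l less_numeral_extra(3))

lemma block_subset: "block n m \<subseteq> {..l * n + m}"
  by (auto intro!: add_mono)

lemma Y_matrix_block_zero:
  assumes m: "m < l" and i: "i \<in> block n m" "j \<in> {..l * n + m} - block n m"
  shows "Y_matrix q (l * n + m) i j = \<zero>\<^bsub>slq2 q\<^esub>"
proof -
  obtain a b where ab: "i = l * a + b" "a \<le> n" "b \<le> m" using i(1) by auto
  show ?thesis
    unfolding ab(1) by (rule Y_matrix_block(1)[OF q l ql prim ab(2,3)]) (use i(2) in auto)
qed

text \<open>For m < l the decomposition of a block index is unique, so every entry factors and a
  mere relabelling by pairs suffices.\<close>

lemma has_matrix_block:
  assumes m: "m < l" and U: "has_matrix (slq2 q) U (block n m) e (Y_matrix q (l * n + m))"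
  obtains f where "has_matrix (slq2 q) U ({..n} \<times> {..m}) f (WY_matrix q l n m)"
proof -
  have "has_matrix (slq2 q) U ({..n} \<times> {..m}) (\<lambda>p. 1 \<odot>\<^bsub>U\<^esub> e ((\<lambda>(j, k). l * j + k) p)) (WY_matrix q l n m)"
  proof (rule has_matrix_change[OF prebialgebra_slq2[OF q] U])
    show "bij_betw (\<lambda>(j, k). l * j + k) ({..n} \<times> {..m}) (block n m)"
      unfolding bij_betw_def
    proof (intro conjI refl inj_onI)
      fix p p' assume "p \<in> {..n} \<times> {..m}" "p' \<in> {..n} \<times> {..m}" "(case p of (j, k) \<Rightarrow> l * j + k) = (case p' of (j, k) \<Rightarrow> l * j + k)"
      then show "p = p'" using division_unique[of "snd p" "snd p'" "fst p" "fst p'"] m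
        by (simp add: split_beta mem_Times_iff prod_eq_iff)
    qed
    fix p p' assume "p \<in> {..n} \<times> {..m}" "p' \<in> {..n} \<times> {..m}"
    then obtain a b a' b' where p: "p = (a, b)" "p' = (a', b')" "a \<le> n" "b \<le> m" "a' \<le> n" "b' \<le> m" by auto
    show "WY_matrix q l n m p p' \<in> carrier (slq2 q)"
      unfolding p WY_matrix_def prod.case by (rule alg_closed(1)[OF calgebra_slq2 matrix_closed(4,2)])
    have "Y_matrix q (l * n + m) (l * a + b) (l * a' + b') = W_matrix q l n a a' \<otimes>\<^bsub>slq2 q\<^esub> Y_matrix q m b b'"
    proof (rule Y_matrix_block(2)[OF q l ql prim])
      fix j k assume "j \<le> n" "k \<le> m" "l * j + k = l * a' + b'"
      then show "j = a' \<and> k = b'" using division_unique[of k b' j a'] p m by simp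
    qed (use p in \<open>simp_all add: add_mono\<close>)
    then show "1 \<odot>\<^bsub>slq2 q\<^esub> Y_matrix q (l * n + m) (case p of (j, k) \<Rightarrow> l * j + k) (case p' of (j, k) \<Rightarrow> l * j + k)
      = 1 \<odot>\<^bsub>slq2 q\<^esub> WY_matrix q l n m p p'"
      unfolding p WY_matrix_def prod.case by (rule arg_cong)
  qed simp
  then show thesis by (rule that)
qed

lemma has_matrix_tensor_WY:
  "has_matrix (slq2 q) (tensor_comodule (slq2 q) (comod_W l q n) (comod_Y q m)) ({..n} \<times> {..m})
    (\<lambda>(j, k). pure (comod_W l q n) (comod_Y q m) (W_basis q l n j) (Y_basis q m k)) (WY_matrix q l n m)"
  unfolding WY_matrix_def
  by (rule has_matrix_tensor[OF prebialgebra_slq2[OF q] has_matrix_W[OF q l ql prim] has_matrix_Y[OF q]])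

lemma WY_iso:
  "has_matrix (slq2 q) U ({..n} \<times> {..m}) f (WY_matrix q l n m) \<Longrightarrow>
    comodule_iso (slq2 q) U (tensor_comodule (slq2 q) (comod_W l q n) (comod_Y q m))"
  by (rule has_matrix_iso[OF prebialgebra_slq2[OF q] _ has_matrix_tensor_WY])

text \<open>In these two cases the pairs exhaust the whole index range: either there is a single
  quotient, or every remainder is allowed.\<close>

lemma Y_full_block:
  assumes m: "m < l" and full: "n = 0 \<or> m = l - 1"
  shows "irreducible_comodule (slq2 q) (comod_Y q (l * n + m))"
    and "comodule_iso (slq2 q) (comod_Y q (l * n + m)) (tensor_comodule (slq2 q) (comod_W l q n) (comod_Y q m))"
proof -
  have "block n m = {..l * n + m}"
  proof (intro subset_antisym block_subset subsetI)
    fix i assume "i \<in> {..l * n + m}"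
    then have i: "i \<le> l * n + m" by simp
    have "i div l \<le> n" using div_le_mono[OF i, of l] m by simp
    moreover have "i mod l \<le> m"
    proof (cases "n = 0")
      case True
      then show ?thesis using i m by simp
    next
      case False
      then show ?thesis using full mod_less_divisor[OF l, of i] by auto
    qed
    ultimately show "i \<in> block n m" by (intro image_eqI[of _ _ "(i div l, i mod l)"]) auto
  qed
  then obtain f where f: "has_matrix (slq2 q) (comod_Y q (l * n + m)) ({..n} \<times> {..m}) f (WY_matrix q l n m)"
    using has_matrix_block[OF m] has_matrix_Y[OF q, of "l * n + m"] by metis
  show "irreducible_comodule (slq2 q) (comod_Y q (l * n + m))" by (rule irreducible_WY[OF q l prim m f])
  show "comodule_iso (slq2 q) (comod_Y q (l * n + m)) (tensor_comodule (slq2 q) (comod_W l q n) (comod_Y q m))" by (rule WY_iso[OF f])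
qed

text \<open>The indices missing from the block are those with remainder above m, and their quotients
  are at most n - 1. They carry the quotient comodule, whose irreducibility gives the
  maximality.\<close>

lemma Y_partial_block:
  assumes m: "m + 2 \<le> l" and n: "0 < n"
  shows "\<exists>N. maximal_subcomodule (slq2 q) (comod_Y q (l * n + m)) N \<and>
    comodule_iso (slq2 q) (restrict_comodule (slq2 q) (comod_Y q (l * n + m)) N) (tensor_comodule (slq2 q) (comod_W l q n) (comod_Y q m)) \<and>
    irreducible_comodule (slq2 q) (quotient_comodule (slq2 q) (comod_Y q (l * n + m)) N) \<and>
    comodule_iso (slq2 q) (quotient_comodule (slq2 q) (comod_Y q (l * n + m)) N)
      (tensor_comodule (slq2 q) (comod_W l q (n - 1)) (comod_Y q (l - 2 - m)))"
proof -
  let ?H = "slq2 q" and ?U = "comod_Y q (l * n + m)" and ?e = "Y_basis q (l * n + m)"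
  let ?I = "{..l * n + m}" and ?J = "block n m" and ?p = "l - 2 - m" and ?K = "{..n - 1} \<times> {..l - 2 - m}"
  let ?T = "Y_matrix q (l * n + m)"
  note H = prebialgebra_slq2[OF q] and V = slq2_vspace[of q]
  have ml: "m < l" using m by simp
  note Y = has_matrix_Y[OF q, of "l * n + m"] and J = block_subset[of n m]
  have T0: "?T i j = \<zero>\<^bsub>?H\<^esub>" if "i \<in> ?J" "j \<in> ?I - ?J" for i j by (rule Y_matrix_block_zero[OF ml that])
  define N where "N = lin_span ?U (?e ` ?J)"
  obtain f where f: "has_matrix ?H (restrict_comodule ?H ?U N) ({..n} \<times> {..m}) f (WY_matrix q l n m)"
    by (rule has_matrix_block[OF ml subcomodule_span(1)[OF H Y J T0]]) (simp_all add: N_def)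
  let ?h = "\<lambda>(j, k). l * j + (m + 1 + k)"
  \<comment> \<open>Rescaling by the inverse column factors turns the middle block into the matrix
    of V with index l - 2 - m. The factor does not depend on the first component, since the W part
    needs no correction.\<close>
  let ?s = "\<lambda>p :: nat \<times> nat. inverse (qbinom ((inverse q)\<^sup>2) (m + 1 + snd p) (m + 1) * q ^ (snd p * (m + 1)))"
  \<comment> \<open>One l is moved from the quotient part to the remainder part, so that the second
    factor of the product decomposition contains the middle block.\<close>
  have n': "l * n + m = l * (n - 1) + (l + m)" using n by (cases n) simp_all
  have h: "bij_betw ?h ?K (?I - ?J)"
    unfolding bij_betw_def
  proof (intro conjI subset_antisym subsetI)
    show "inj_on ?h ?K"
    proof (rule inj_onI)
      fix p p' assume "p \<in> ?K" "p' \<in> ?K" "?h p = ?h p'"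
      then show "p = p'" using division_unique[of "m + 1 + snd p" "m + 1 + snd p'" "fst p" "fst p'"] m
        by (auto simp: split_beta mem_Times_iff prod_eq_iff)
    qed
    fix i
    {
      assume "i \<in> ?h ` ?K"
      then obtain j k where jk: "i = l * j + (m + 1 + k)" "j \<le> n - 1" "k \<le> ?p" by auto
      have "l * j + (m + 1 + k) \<le> l * (n - 1) + (l + m)" using mult_le_mono2[OF jk(2), of l] jk(3) m by linarith
      moreover have "i \<notin> ?J"
      proof
        assume "i \<in> ?J"
        then obtain j' k' where "i = l * j' + k'" "k' \<le> m" by auto
        moreover have "m + 1 + k < l" using jk(3) m by arith
        ultimately show False using division_unique[of k' "m + 1 + k" j' j] jk(1) m by simp
      qed
      ultimately show "i \<in> ?I - ?J" unfolding n' jk(1) by simp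
    }
    assume i: "i \<in> ?I - ?J"
    have e: "i = l * (i div l) + i mod l" by simp
    have "i div l \<le> n" using div_le_mono[of i "l * n + m" l] i ml by simp
    then have k: "m < i mod l" using i e by (metis (no_types, lifting) DiffD2 SigmaI atMost_iff case_prod_conv image_eqI not_less)
    \<comment> \<open>The top quotient n occurs only with remainders up to m, as the index is at
      most l n + m.\<close>
    have "i div l \<noteq> n"
    proof
      assume "i div l = n"
      then show False using e i k by auto
    qed
    then have "(i div l, i mod l - (m + 1)) \<in> ?K" using \<open>i div l \<le> n\<close> mod_less_divisor[OF l, of i] by auto
    moreover have mod: "m + 1 + (i mod l - (m + 1)) = i mod l" using k by simp
    have "i = ?h (i div l, i mod l - (m + 1))" unfolding prod.case mod by (rule e)
    ultimately show "i \<in> ?h ` ?K" by (rule rev_image_eqI)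
  qed
  \<comment> \<open>Converts the cross-multiplied proportionality of
    \<open>Y_matrix_lower_block\<close> into the form with inverse scalars.\<close>
  have smult_cross: "inverse x \<odot>\<^bsub>?H\<^esub> u = inverse y \<odot>\<^bsub>?H\<^esub> v"
    if uv: "y \<odot>\<^bsub>?H\<^esub> u = x \<odot>\<^bsub>?H\<^esub> v" and "x \<noteq> 0" "y \<noteq> 0" "u \<in> carrier ?H" "v \<in> carrier ?H" for x y u v
  proof -
    have "inverse x \<odot>\<^bsub>?H\<^esub> u = (inverse x * inverse y) \<odot>\<^bsub>?H\<^esub> (y \<odot>\<^bsub>?H\<^esub> u)" using that(3,4) by (simp add: vs_smult_smult[OF V] mult.assoc)
    also have "\<dots> = inverse y \<odot>\<^bsub>?H\<^esub> v" unfolding uv using that(2,5) by (simp add: vs_smult_smult[OF V] mult.commute[of "inverse x"] mult.assoc)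
    finally show ?thesis .
  qed
  have cf: "qbinom ((inverse q)\<^sup>2) (m + 1 + k) (m + 1) * q ^ (k * (m + 1)) \<noteq> 0" if "k \<le> ?p" for k
  proof -
    have "qbinom ((inverse q)\<^sup>2) (m + 1 + k) (m + 1) \<noteq> 0" by (rule qbinom_nonzero) (use prim that m in auto)
    then show ?thesis using q by simp
  qed
  have g: "has_matrix ?H (quotient_comodule ?H ?U N) ?K
      (\<lambda>p. ?s p \<odot>\<^bsub>quotient_comodule ?H ?U N\<^esub> (N +>\<^bsub>?U\<^esub> ?e (?h p))) (WY_matrix q l (n - 1) ?p)"
  proof (rule has_matrix_change[OF H has_matrix_quotient(1)[OF H Y J T0, folded N_def] h])
    fix p p' assume p: "p \<in> ?K" "p' \<in> ?K"
    obtain a b a' b' where ab: "p = (a, b)" "p' = (a', b')" "a \<le> n - 1" "b \<le> ?p" "a' \<le> n - 1" "b' \<le> ?p" using p by auto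
    show "?s p \<noteq> 0" using cf[OF ab(4)] unfolding ab(1) snd_conv by simp
    let ?M = "Y_matrix q (l + m)" and ?c = "\<lambda>k. qbinom ((inverse q)\<^sup>2) (m + 1 + k) (m + 1) * q ^ (k * (m + 1))"
    show "WY_matrix q l (n - 1) ?p p p' \<in> carrier ?H"
      unfolding ab WY_matrix_def prod.case by (rule alg_closed(1)[OF calgebra_slq2 matrix_closed(4,2)])
    have "Y_matrix q (l * (n - 1) + (l + m)) (l * a + (m + 1 + b)) (l * a' + (m + 1 + b'))
      = W_matrix q l (n - 1) a a' \<otimes>\<^bsub>?H\<^esub> ?M (m + 1 + b) (m + 1 + b')"
    proof (rule Y_matrix_block(2)[OF q l ql prim])
      fix j k assume k: "k \<le> l + m" "l * j + k = l * a' + (m + 1 + b')"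
      \<comment> \<open>As k may run up to l + m, a second decomposition has to be excluded: its
        remainder k - l would be at most m, while the target has remainder m + 1 + b'.\<close>
      have "k < l"
      proof (rule ccontr)
        assume "\<not> k < l"
        then have "l * Suc j + (k - l) = l * a' + (m + 1 + b')" "k - l < l" using k m by simp_all
        then have "k - l = m + 1 + b'" using division_unique[of "k - l" "m + 1 + b'" "Suc j" a'] ab(6) m by simp
        then show False using k(1) by simp
      qed
      then show "j = a' \<and> k = m + 1 + b'" using division_unique[of k "m + 1 + b'" j a'] k(2) ab(6) m by simp
    next
      show "l * a' + (m + 1 + b') \<le> l * (n - 1) + (l + m)" using mult_le_mono2[OF ab(5), of l] ab(6) m by linarith
    qed (use ab m in simp_all)
    then have 1: "?T (l * a + (m + 1 + b)) (l * a' + (m + 1 + b')) = W_matrix q l (n - 1) a a' \<otimes>\<^bsub>?H\<^esub> ?M (m + 1 + b) (m + 1 + b')"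
      unfolding n' .
    have 2: "inverse (?c b) \<odot>\<^bsub>?H\<^esub> ?M (m + 1 + b) (m + 1 + b') = inverse (?c b') \<odot>\<^bsub>?H\<^esub> Y_matrix q ?p b b'"
      by (rule smult_cross[OF Y_matrix_lower_block[OF q l ql prim m ab(4,6)] cf[OF ab(4)] cf[OF ab(6)] matrix_closed(2,2)])
    show "?s p \<odot>\<^bsub>?H\<^esub> ?T (?h p) (?h p') = ?s p' \<odot>\<^bsub>?H\<^esub> WY_matrix q l (n - 1) ?p p p'"
      unfolding ab(1,2) prod.case snd_conv WY_matrix_def 1
      by (simp only: alg_smult(1)[OF calgebra_slq2 matrix_closed(4) matrix_closed(2), symmetric] 2)
  qed
  have p: "?p < l" using m by simp
  have irr: "irreducible_comodule ?H (quotient_comodule ?H ?U N)" by (rule irreducible_WY[OF q l prim p g])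
  have "?J \<noteq> ?I"
  proof
    assume "?J = ?I"
    moreover have "?h (0, 0) \<in> ?h ` ?K" by (rule imageI) simp
    ultimately show False using h by (auto simp: bij_betw_def)
  qed
  then have "maximal_subcomodule ?H ?U N"
    using irr unfolding N_def by (intro maximal_subcomodule_quotient[OF H Y _ T0] psubsetI J)
  then show ?thesis using WY_iso[OF f] WY_iso[OF g] irr by blast
qed

end

theorem proposition3p1:
  fixes l :: nat and q :: complex
  assumes "odd l" and "l \<ge> 3" and "q = exp (2 * of_real pi * \<i> / of_nat l)"
  shows
    "(\<forall>m0. m0 \<le> l - 1 \<longrightarrow> irreducible_comodule (slq2 q) (comod_V q m0)) \<and>
     (\<forall>m1. m1 > 0 \<longrightarrow>
        irreducible_comodule (slq2 q) (comod_Y q (l - 1 + l * m1)) \<and>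
        comodule_iso (slq2 q) (comod_Y q (l - 1 + l * m1))
          (tensor_comodule (slq2 q) (comod_W l q m1) (comod_V q (l - 1)))) \<and>
     (\<forall>m0 m1. m0 \<le> l - 2 \<and> m1 \<ge> 1 \<longrightarrow>
        (\<exists>N. maximal_subcomodule (slq2 q) (comod_Y q (m0 + l * m1)) N \<and>
           comodule_iso (slq2 q) (restrict_comodule (slq2 q) (comod_Y q (m0 + l * m1)) N)
             (tensor_comodule (slq2 q) (comod_W l q m1) (comod_V q m0)) \<and>
           irreducible_comodule (slq2 q) (quotient_comodule (slq2 q) (comod_Y q (m0 + l * m1)) N) \<and>
           comodule_iso (slq2 q) (quotient_comodule (slq2 q) (comod_Y q (m0 + l * m1)) N)
             (tensor_comodule (slq2 q) (comod_W l q (m1 - 1)) (comod_V q (l - 2 - m0)))))"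
proof -
  note q = primitive_root[OF assms]
  have l: "0 < l" using assms(2) by simp
  show ?thesis
  proof (intro conjI allI impI)
    fix m0 assume "m0 \<le> l - 1"
    \<comment> \<open>This is the full block with n = 0, where the index m0 is its own
      remainder.\<close>
    then show "irreducible_comodule (slq2 q) (comod_V q m0)"
      using Y_full_block(1)[OF q(1) l q(2,3), of m0 0] l by simp
  next
    fix m1 :: nat assume "m1 > 0"
    show "irreducible_comodule (slq2 q) (comod_Y q (l - 1 + l * m1))"
      "comodule_iso (slq2 q) (comod_Y q (l - 1 + l * m1)) (tensor_comodule (slq2 q) (comod_W l q m1) (comod_V q (l - 1)))"
      using Y_full_block[OF q(1) l q(2,3), of "l - 1" m1] l by (simp_all add: add.commute)
  next
    fix m0 m1 :: nat assume "m0 \<le> l - 2 \<and> m1 \<ge> 1"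
    then have m: "m0 + 2 \<le> l" "0 < m1" using assms(2) by auto
    show "\<exists>N. maximal_subcomodule (slq2 q) (comod_Y q (m0 + l * m1)) N \<and>
           comodule_iso (slq2 q) (restrict_comodule (slq2 q) (comod_Y q (m0 + l * m1)) N)
             (tensor_comodule (slq2 q) (comod_W l q m1) (comod_V q m0)) \<and>
           irreducible_comodule (slq2 q) (quotient_comodule (slq2 q) (comod_Y q (m0 + l * m1)) N) \<and>
           comodule_iso (slq2 q) (quotient_comodule (slq2 q) (comod_Y q (m0 + l * m1)) N)
             (tensor_comodule (slq2 q) (comod_W l q (m1 - 1)) (comod_V q (l - 2 - m0)))"
      using Y_partial_block[OF q(1) l q(2,3) m] by (simp only: add.commute)
  qed
qed

end
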